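(* Let $\Gamma$ be an ordered group. Let $\Lambda\subseteq\Gamma$ be any subset and let $FR$ be a $\Gamma$-filtered ring. The category $\operatorname{Glid}_\Lambda FR$ of glider representations is a Grothendieck deflation quasi-abelian category.
   Context: Rings are unital. An ordered group $(\Gamma,\le)$ is a group with a (partial) order such that $\alpha\le\beta$ and $\gamma\le\delta$ imply $\alpha\gamma\le\beta\delta$; its unit is $e$. A $\Gamma$-filtered ring $FR$ is a ring $R$ with additive subgroups $\{F_\gamma R\}_{\gamma\in\Gamma}$ such that $1_R\in F_eR$, $F_\alpha R\subseteq F_\beta R$ if $\alpha\le\beta$, and $(F_\alpha R)(F_\beta R)\subseteq F_{\alpha\beta}R$. The preadditive category $\overline{\mathcal F}_\Lambda R$ has object set $\Lambda\sqcup\{\infty\}$; for $\alpha,\beta\in\Lambda$, $\operatorname{Hom}(\alpha,\beta)=F_{\beta\alpha^{-1}}R$ if $\alpha\le\beta$ and $0$ otherwise; $\operatorname{Hom}(\alpha,\infty)=R$ for all $\alpha\in\Lambda\sqcup\{\infty\}$; $\operatorname{Hom}(\infty,\alpha)=0$ for $\alpha\in\Lambda$; composition is multiplication in $R$. If $\alpha\le\beta$ or $\beta=\infty$, write $1_{\alpha,\beta}$ for $1_R\in\operatorname{Hom}(\alpha,\beta)$. $\operatorname{Mod}$ denotes additive covariant functors to abelian groups. $\operatorname{Preglid}_\Lambda FR\subseteq\operatorname{Mod}\overline{\mathcal F}_\Lambda R$ is the full subcategory of those $M$ for which all $M(1_{\alpha,\beta})$ are monomorphisms. With $\Sigma$ the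 class of its morphisms $f$ such that $f_\lambda$ is an isomorphism for all $\lambda\in\Lambda$ (no condition on $f_\infty$), $\operatorname{Glid}_\Lambda FR=(\operatorname{Preglid}_\Lambda FR)[\Sigma^{-1}]$. A deflation quasi-abelian category is an additive category with kernels and cokernels in which cokernels (morphisms that are cokernels of some morphism) are stable under pullback; its conflations are all kernel-cokernel pairs. In a category $\mathcal C$ with all small filtered direct limits, an object $C$ is finitely presentable if $\varinjlim\operatorname{Hom}(C,D)\to\operatorname{Hom}(C,\varinjlim D)$ is an isomorphism for all filtered diagrams $D$; $\mathcal C$ is locally presentable if it has all small filtered direct limits and every object is a filtered direct limit of finitely presentable objects. A (deflation) quasi-abelian category is a Grothendieck (deflation) quasi-abelian category if it is locally presentable and has exact filtered direct limits (filtered direct limits of conflations are conflations). *)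

theory Defs
  imports "HOL-Algebra.AbelCoset" "HOL-Library.FuncSet"
begin

unbundle cardinal_syntax

section \<open>Universes\<close>

text \<open>
  HOL has no type of all small sets. A type \<^typ>\<open>'u\<close> of regular uncountable cardinality plays
  the role of a universe: a set is small if its cardinality is strictly below that of
  \<^typ>\<open>'u\<close>, and small abelian groups are represented on small subsets of \<^typ>\<open>'u\<close>.
  If the cardinality of \<^typ>\<open>'u\<close> is inaccessible, these are, up to isomorphism, exactly the
  small sets and small abelian groups of a Grothendieck universe. The weaker requirement is
  satisfied for example by \<^typ>\<open>nat suc\<close>.
\<close>

definition universe :: "'u itself \<Rightarrow> bool" where
  "universe _ \<longleftrightarrow> |UNIV :: nat set| <o |UNIV :: 'u set| \<and> regularCard |UNIV :: 'u set|"

definition small :: "'u itself \<Rightarrow> 'a set \<Rightarrow> bool" where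
  "small _ A \<longleftrightarrow> |A| <o |UNIV :: 'u set|"


section \<open>Categories\<close>

text \<open>
  Hom-sets of distinct pairs of objects need not be disjoint, so composition takes the objects
  as arguments: \<^term>\<open>cmp C a b c g f\<close> is the composite of \<open>f : a \<rightarrow> b\<close> and \<open>g : b \<rightarrow> c\<close>.
\<close>

record ('o, 'm) category =
  obj :: "'o set"
  Hom :: "'o \<Rightarrow> 'o \<Rightarrow> 'm set"
  ident :: "'o \<Rightarrow> 'm"
  cmp :: "'o \<Rightarrow> 'o \<Rightarrow> 'o \<Rightarrow> 'm \<Rightarrow> 'm \<Rightarrow> 'm"

definition is_category :: "('o, 'm) category \<Rightarrow> bool" where
  "is_category C \<longleftrightarrow>
    (\<forall>a\<in>obj C. ident C a \<in> Hom C a a) \<and>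
    (\<forall>a\<in>obj C. \<forall>b\<in>obj C. \<forall>c\<in>obj C. \<forall>f\<in>Hom C a b. \<forall>g\<in>Hom C b c.
      cmp C a b c g f \<in> Hom C a c) \<and>
    (\<forall>a\<in>obj C. \<forall>b\<in>obj C. \<forall>f\<in>Hom C a b.
      cmp C a a b f (ident C a) = f \<and> cmp C a b b (ident C b) f = f) \<and>
    (\<forall>a\<in>obj C. \<forall>b\<in>obj C. \<forall>c\<in>obj C. \<forall>d\<in>obj C.
      \<forall>f\<in>Hom C a b. \<forall>g\<in>Hom C b c. \<forall>h\<in>Hom C c d.
      cmp C a c d h (cmp C a b c g f) = cmp C a b d (cmp C b c d h g) f)"

definition full_subcategory :: "('o, 'm) category \<Rightarrow> 'o set \<Rightarrow> ('o, 'm) category" where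
  "full_subcategory C X = C\<lparr>obj := X\<rparr>"

record ('o, 'm, 'p, 'n) functor_data =
  fobj :: "'o \<Rightarrow> 'p"
  farr :: "'o \<Rightarrow> 'o \<Rightarrow> 'm \<Rightarrow> 'n"

definition is_functor ::
  "('o, 'm) category \<Rightarrow> ('p, 'n) category \<Rightarrow> ('o, 'm, 'p, 'n) functor_data \<Rightarrow> bool" where
  "is_functor C D F \<longleftrightarrow>
    (\<forall>a\<in>obj C. fobj F a \<in> obj D) \<and>
    (\<forall>a\<in>obj C. \<forall>b\<in>obj C. \<forall>f\<in>Hom C a b. farr F a b f \<in> Hom D (fobj F a) (fobj F b)) \<and>
    (\<forall>a\<in>obj C. farr F a a (ident C a) = ident D (fobj F a)) \<and>
    (\<forall>a\<in>obj C. \<forall>b\<in>obj C. \<forall>c\<in>obj C. \<forall>f\<in>Hom C a b. \<forall>g\<in>Hom C b c.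
      farr F a c (cmp C a b c g f) =
      cmp D (fobj F a) (fobj F b) (fobj F c) (farr F b c g) (farr F a b f))"

text \<open>Transformations are extensional, so that equal components mean equal transformations.\<close>

definition nat_trans ::
  "('o, 'm) category \<Rightarrow> ('p, 'n) category \<Rightarrow>
    ('o, 'm, 'p, 'n) functor_data \<Rightarrow> ('o, 'm, 'p, 'n) functor_data \<Rightarrow> ('o \<Rightarrow> 'n) set" where
  "nat_trans C D F G =
    {\<eta>. \<eta> \<in> (\<Pi>\<^sub>E a\<in>obj C. Hom D (fobj F a) (fobj G a)) \<and>
      (\<forall>a\<in>obj C. \<forall>b\<in>obj C. \<forall>f\<in>Hom C a b.
        cmp D (fobj F a) (fobj F b) (fobj G b) (\<eta> b) (farr F a b f) =
        cmp D (fobj F a) (fobj G a) (fobj G b) (farr G a b f) (\<eta> a))}"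

definition functor_category ::
  "('o, 'm) category \<Rightarrow> ('p, 'n) category \<Rightarrow>
    (('o, 'm, 'p, 'n) functor_data, 'o \<Rightarrow> 'n) category" where
  "functor_category C D =
    \<lparr>obj = {F. is_functor C D F},
     Hom = nat_trans C D,
     ident = (\<lambda>F. \<lambda>a\<in>obj C. ident D (fobj F a)),
     cmp = (\<lambda>F G H \<theta> \<eta>. \<lambda>a\<in>obj C. cmp D (fobj F a) (fobj G a) (fobj H a) (\<theta> a) (\<eta> a))\<rparr>"


section \<open>Localization\<close>

text \<open>
  The category of fractions of \<open>C\<close> at a class \<open>S\<close> of morphisms (\<^term>\<open>S a b\<close> being the
  members of \<open>S\<close> from \<open>a\<close> to \<open>b\<close>): morphisms are classes of
  zigzags, i.e. of paths of morphisms of \<open>C\<close> and formal inverses of members of \<open>S\<close>.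
  A path lists its steps in the order in which they are traversed; \<open>Bwd x y s\<close> is the formal
  inverse of \<open>s : x \<rightarrow> y\<close> and so leads from \<open>y\<close> to \<open>x\<close>.
\<close>

datatype ('o, 'm) step = Fwd 'o 'o 'm | Bwd 'o 'o 'm

fun is_zigzag ::
  "('o, 'm) category \<Rightarrow> ('o \<Rightarrow> 'o \<Rightarrow> 'm set) \<Rightarrow> 'o \<Rightarrow> ('o, 'm) step list \<Rightarrow> 'o \<Rightarrow> bool" where
  "is_zigzag C S a [] b \<longleftrightarrow> a \<in> obj C \<and> a = b"
| "is_zigzag C S a (Fwd x y f # p) b \<longleftrightarrow>
    x = a \<and> x \<in> obj C \<and> y \<in> obj C \<and> f \<in> Hom C x y \<and> is_zigzag C S y p b"
| "is_zigzag C S a (Bwd x y s # p) b \<longleftrightarrow>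
    y = a \<and> x \<in> obj C \<and> y \<in> obj C \<and> s \<in> S x y \<and> is_zigzag C S x p b"

inductive zigzag_eq ::
  "('o, 'm) category \<Rightarrow> ('o \<Rightarrow> 'o \<Rightarrow> 'm set) \<Rightarrow>
    'o \<Rightarrow> 'o \<Rightarrow> ('o, 'm) step list \<Rightarrow> ('o, 'm) step list \<Rightarrow> bool"
  for C S where
  refl: "is_zigzag C S a p b \<Longrightarrow> zigzag_eq C S a b p p"
| sym: "zigzag_eq C S a b p q \<Longrightarrow> zigzag_eq C S a b q p"
| trans: "zigzag_eq C S a b p q \<Longrightarrow> zigzag_eq C S a b q r \<Longrightarrow> zigzag_eq C S a b p r"
| append: "zigzag_eq C S a b p p' \<Longrightarrow> zigzag_eq C S b c q q' \<Longrightarrow>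
    zigzag_eq C S a c (p @ q) (p' @ q')"
| ident: "a \<in> obj C \<Longrightarrow> zigzag_eq C S a a [Fwd a a (ident C a)] []"
| cmp: "a \<in> obj C \<Longrightarrow> b \<in> obj C \<Longrightarrow> c \<in> obj C \<Longrightarrow> f \<in> Hom C a b \<Longrightarrow> g \<in> Hom C b c \<Longrightarrow>
    zigzag_eq C S a c [Fwd a b f, Fwd b c g] [Fwd a c (cmp C a b c g f)]"
| fwd_bwd: "a \<in> obj C \<Longrightarrow> b \<in> obj C \<Longrightarrow> s \<in> S a b \<Longrightarrow>
    zigzag_eq C S a a [Fwd a b s, Bwd a b s] []"
| bwd_fwd: "a \<in> obj C \<Longrightarrow> b \<in> obj C \<Longrightarrow> s \<in> S a b \<Longrightarrow>
    zigzag_eq C S b b [Bwd a b s, Fwd a b s] []"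

definition localization ::
  "('o, 'm) category \<Rightarrow> ('o \<Rightarrow> 'o \<Rightarrow> 'm set) \<Rightarrow> ('o, ('o, 'm) step list set) category" where
  "localization C S =
    \<lparr>obj = obj C,
     Hom = (\<lambda>a b. {p. is_zigzag C S a p b} // {(p, q). zigzag_eq C S a b p q}),
     ident = (\<lambda>a. {p. zigzag_eq C S a a [] p}),
     cmp = (\<lambda>a b c Q P. {r. \<exists>p\<in>P. \<exists>q\<in>Q. zigzag_eq C S a c (p @ q) r})\<rparr>"


section \<open>Additive categories, kernels and cokernels\<close>

definition preadditive ::
  "('o, 'm) category \<Rightarrow> ('o \<Rightarrow> 'o \<Rightarrow> 'm \<Rightarrow> 'm \<Rightarrow> 'm) \<Rightarrow> bool" where
  "preadditive C hadd \<longleftrightarrow> is_category C \<and>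
    (\<forall>a\<in>obj C. \<forall>b\<in>obj C.
      \<exists>z. comm_group \<lparr>carrier = Hom C a b, monoid.mult = hadd a b, one = z\<rparr>) \<and>
    (\<forall>a\<in>obj C. \<forall>b\<in>obj C. \<forall>c\<in>obj C. \<forall>f\<in>Hom C a b. \<forall>f'\<in>Hom C a b.
      \<forall>g\<in>Hom C b c. \<forall>g'\<in>Hom C b c.
      cmp C a b c g (hadd a b f f') = hadd a c (cmp C a b c g f) (cmp C a b c g f') \<and>
      cmp C a b c (hadd b c g g') f = hadd a c (cmp C a b c g f) (cmp C a b c g' f))"

definition additive_functor ::
  "('o, 'm) category \<Rightarrow> ('o \<Rightarrow> 'o \<Rightarrow> 'm \<Rightarrow> 'm \<Rightarrow> 'm) \<Rightarrow>
    ('p, 'n) category \<Rightarrow> ('p \<Rightarrow> 'p \<Rightarrow> 'n \<Rightarrow> 'n \<Rightarrow> 'n) \<Rightarrow>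
    ('o, 'm, 'p, 'n) functor_data \<Rightarrow> bool" where
  "additive_functor C hadd D hadd' F \<longleftrightarrow> is_functor C D F \<and>
    (\<forall>a\<in>obj C. \<forall>b\<in>obj C. \<forall>f\<in>Hom C a b. \<forall>g\<in>Hom C a b.
      farr F a b (hadd a b f g) =
      hadd' (fobj F a) (fobj F b) (farr F a b f) (farr F a b g))"

definition zero_object :: "('o, 'm) category \<Rightarrow> 'o \<Rightarrow> bool" where
  "zero_object C z \<longleftrightarrow> z \<in> obj C \<and>
    (\<forall>a\<in>obj C. (\<exists>!f. f \<in> Hom C a z) \<and> (\<exists>!f. f \<in> Hom C z a))"

definition biproduct ::
  "('o, 'm) category \<Rightarrow> ('o \<Rightarrow> 'o \<Rightarrow> 'm \<Rightarrow> 'm \<Rightarrow> 'm) \<Rightarrow> 'o \<Rightarrow> 'o \<Rightarrow> 'o \<Rightarrow> bool" where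
  "biproduct C hadd a b p \<longleftrightarrow> p \<in> obj C \<and>
    (\<exists>i\<in>Hom C a p. \<exists>j\<in>Hom C b p. \<exists>q\<in>Hom C p a. \<exists>r\<in>Hom C p b.
      cmp C a p a q i = ident C a \<and> cmp C b p b r j = ident C b \<and>
      hadd p p (cmp C p a p i q) (cmp C p b p j r) = ident C p)"

text \<open>The preadditive structure of an additive category is determined by the category.\<close>

definition additive_category :: "('o, 'm) category \<Rightarrow> bool" where
  "additive_category C \<longleftrightarrow> (\<exists>hadd. preadditive C hadd \<and> (\<exists>z. zero_object C z) \<and>
    (\<forall>a\<in>obj C. \<forall>b\<in>obj C. \<exists>p. biproduct C hadd a b p))"

definition zero_morphism :: "('o, 'm) category \<Rightarrow> 'o \<Rightarrow> 'o \<Rightarrow> 'm \<Rightarrow> bool" where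
  "zero_morphism C a b f \<longleftrightarrow>
    (\<exists>z. zero_object C z \<and> (\<exists>g\<in>Hom C a z. \<exists>h\<in>Hom C z b. f = cmp C a z b h g))"

text \<open>\<open>k : n \<rightarrow> a\<close> is a kernel of \<open>f : a \<rightarrow> b\<close>.\<close>

definition is_kernel :: "('o, 'm) category \<Rightarrow> 'o \<Rightarrow> 'o \<Rightarrow> 'o \<Rightarrow> 'm \<Rightarrow> 'm \<Rightarrow> bool" where
  "is_kernel C n a b k f \<longleftrightarrow>
    n \<in> obj C \<and> a \<in> obj C \<and> b \<in> obj C \<and> k \<in> Hom C n a \<and> f \<in> Hom C a b \<and>
    zero_morphism C n b (cmp C n a b f k) \<and>
    (\<forall>x\<in>obj C. \<forall>h\<in>Hom C x a. zero_morphism C x b (cmp C x a b f h) \<longrightarrow>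
      (\<exists>!u. u \<in> Hom C x n \<and> cmp C x n a k u = h))"

text \<open>\<open>c : b \<rightarrow> q\<close> is a cokernel of \<open>f : a \<rightarrow> b\<close>.\<close>

definition is_cokernel :: "('o, 'm) category \<Rightarrow> 'o \<Rightarrow> 'o \<Rightarrow> 'o \<Rightarrow> 'm \<Rightarrow> 'm \<Rightarrow> bool" where
  "is_cokernel C a b q f c \<longleftrightarrow>
    a \<in> obj C \<and> b \<in> obj C \<and> q \<in> obj C \<and> f \<in> Hom C a b \<and> c \<in> Hom C b q \<and>
    zero_morphism C a q (cmp C a b q c f) \<and>
    (\<forall>x\<in>obj C. \<forall>h\<in>Hom C b x. zero_morphism C a x (cmp C a b x h f) \<longrightarrow>
      (\<exists>!u. u \<in> Hom C q x \<and> cmp C b q x u c = h))"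

definition cokernel_map :: "('o, 'm) category \<Rightarrow> 'o \<Rightarrow> 'o \<Rightarrow> 'm \<Rightarrow> bool" where
  "cokernel_map C b q c \<longleftrightarrow> (\<exists>a f. is_cokernel C a b q f c)"

text \<open>
  The square formed by \<open>q : p \<rightarrow> a\<close>, \<open>r : p \<rightarrow> b\<close>, \<open>f : a \<rightarrow> c\<close> and \<open>g : b \<rightarrow> c\<close> is cartesian.
\<close>

definition is_pullback ::
  "('o, 'm) category \<Rightarrow> 'o \<Rightarrow> 'o \<Rightarrow> 'o \<Rightarrow> 'o \<Rightarrow> 'm \<Rightarrow> 'm \<Rightarrow> 'm \<Rightarrow> 'm \<Rightarrow> bool" where
  "is_pullback C p a b c q r f g \<longleftrightarrow>
    p \<in> obj C \<and> a \<in> obj C \<and> b \<in> obj C \<and> c \<in> obj C \<and>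
    q \<in> Hom C p a \<and> r \<in> Hom C p b \<and> f \<in> Hom C a c \<and> g \<in> Hom C b c \<and>
    cmp C p a c f q = cmp C p b c g r \<and>
    (\<forall>x\<in>obj C. \<forall>s\<in>Hom C x a. \<forall>t\<in>Hom C x b. cmp C x a c f s = cmp C x b c g t \<longrightarrow>
      (\<exists>!u. u \<in> Hom C x p \<and> cmp C x p a q u = s \<and> cmp C x p b r u = t))"

definition deflation_quasi_abelian :: "('o, 'm) category \<Rightarrow> bool" where
  "deflation_quasi_abelian C \<longleftrightarrow> additive_category C \<and>
    (\<forall>a\<in>obj C. \<forall>b\<in>obj C. \<forall>f\<in>Hom C a b. \<exists>n k. is_kernel C n a b k f) \<and>
    (\<forall>a\<in>obj C. \<forall>b\<in>obj C. \<forall>f\<in>Hom C a b. \<exists>q c. is_cokernel C a b q f c) \<and>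
    (\<forall>p a b c q r f g. is_pullback C p a b c q r f g \<and> cokernel_map C a c f \<longrightarrow>
      cokernel_map C p b r)"

definition conflation :: "('o, 'm) category \<Rightarrow> 'o \<Rightarrow> 'o \<Rightarrow> 'o \<Rightarrow> 'm \<Rightarrow> 'm \<Rightarrow> bool" where
  "conflation C a b c f g \<longleftrightarrow> is_kernel C a b c f g \<and> is_cokernel C a b c f g"


section \<open>Filtered direct limits and Grothendieck categories\<close>

definition filtered :: "('o, 'm) category \<Rightarrow> bool" where
  "filtered J \<longleftrightarrow> is_category J \<and> obj J \<noteq> {} \<and>
    (\<forall>i\<in>obj J. \<forall>j\<in>obj J. \<exists>k\<in>obj J. Hom J i k \<noteq> {} \<and> Hom J j k \<noteq> {}) \<and>
    (\<forall>i\<in>obj J. \<forall>j\<in>obj J. \<forall>u\<in>Hom J i j. \<forall>v\<in>Hom J i j.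
      \<exists>k\<in>obj J. \<exists>w\<in>Hom J j k. cmp J i j k w u = cmp J i j k w v)"

definition small_filtered :: "('u, 'u) category \<Rightarrow> bool" where
  "small_filtered J \<longleftrightarrow> filtered J \<and> small TYPE('u) (obj J) \<and>
    (\<forall>i\<in>obj J. \<forall>j\<in>obj J. small TYPE('u) (Hom J i j))"

definition is_cocone ::
  "('i, 'k) category \<Rightarrow> ('o, 'm) category \<Rightarrow> ('i, 'k, 'o, 'm) functor_data \<Rightarrow>
    'o \<Rightarrow> ('i \<Rightarrow> 'm) \<Rightarrow> bool" where
  "is_cocone J C D x \<kappa> \<longleftrightarrow> x \<in> obj C \<and>
    (\<forall>i\<in>obj J. \<kappa> i \<in> Hom C (fobj D i) x) \<and>
    (\<forall>i\<in>obj J. \<forall>j\<in>obj J. \<forall>u\<in>Hom J i j.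
      cmp C (fobj D i) (fobj D j) x (\<kappa> j) (farr D i j u) = \<kappa> i)"

definition is_colimit ::
  "('i, 'k) category \<Rightarrow> ('o, 'm) category \<Rightarrow> ('i, 'k, 'o, 'm) functor_data \<Rightarrow>
    'o \<Rightarrow> ('i \<Rightarrow> 'm) \<Rightarrow> bool" where
  "is_colimit J C D l \<iota> \<longleftrightarrow> is_functor J C D \<and> is_cocone J C D l \<iota> \<and>
    (\<forall>x \<kappa>. is_cocone J C D x \<kappa> \<longrightarrow>
      (\<exists>!h. h \<in> Hom C l x \<and> (\<forall>i\<in>obj J. cmp C (fobj D i) l x h (\<iota> i) = \<kappa> i)))"

definition has_filtered_colimits :: "'u itself \<Rightarrow> ('o, 'm) category \<Rightarrow> bool" where
  "has_filtered_colimits _ C \<longleftrightarrow>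
    (\<forall>(J :: ('u, 'u) category) D. small_filtered J \<and> is_functor J C D \<longrightarrow>
      (\<exists>l \<iota>. is_colimit J C D l \<iota>))"

text \<open>
  The direct limit of the sets \<^term>\<open>Hom C x (fobj D i)\<close> over a filtered category \<open>J\<close> is
  the quotient of their disjoint union by the relation of becoming equal at a later index.
\<close>

definition hom_union ::
  "('i, 'k) category \<Rightarrow> ('o, 'm) category \<Rightarrow> ('i, 'k, 'o, 'm) functor_data \<Rightarrow>
    'o \<Rightarrow> ('i \<times> 'm) set" where
  "hom_union J C D x = (SIGMA i:obj J. Hom C x (fobj D i))"

definition hom_rel ::
  "('i, 'k) category \<Rightarrow> ('o, 'm) category \<Rightarrow> ('i, 'k, 'o, 'm) functor_data \<Rightarrow>
    'o \<Rightarrow> ('i \<times> 'm) rel" where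
  "hom_rel J C D x =
    {((i, f), (j, g)). (i, f) \<in> hom_union J C D x \<and> (j, g) \<in> hom_union J C D x \<and>
      (\<exists>k\<in>obj J. \<exists>u\<in>Hom J i k. \<exists>v\<in>Hom J j k.
        cmp C x (fobj D i) (fobj D k) (farr D i k u) f =
        cmp C x (fobj D j) (fobj D k) (farr D j k v) g)}"

text \<open>
  The value of the canonical map \<open>lim Hom(x, D) \<rightarrow> Hom(x, lim D)\<close> at a class \<open>K\<close>; all
  representatives of \<open>K\<close> give the same value.
\<close>

definition canonical_map ::
  "('o, 'm) category \<Rightarrow> ('i, 'k, 'o, 'm) functor_data \<Rightarrow> 'o \<Rightarrow> 'o \<Rightarrow> ('i \<Rightarrow> 'm) \<Rightarrow>
    ('i \<times> 'm) set \<Rightarrow> 'm" where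
  "canonical_map C D x l \<iota> K = the_elem ((\<lambda>(i, f). cmp C x (fobj D i) l (\<iota> i) f) ` K)"

definition finitely_presentable :: "'u itself \<Rightarrow> ('o, 'm) category \<Rightarrow> 'o \<Rightarrow> bool" where
  "finitely_presentable _ C x \<longleftrightarrow> x \<in> obj C \<and>
    (\<forall>(J :: ('u, 'u) category) D l \<iota>. small_filtered J \<and> is_colimit J C D l \<iota> \<longrightarrow>
      bij_betw (canonical_map C D x l \<iota>) (hom_union J C D x // hom_rel J C D x) (Hom C x l))"

definition locally_presentable :: "'u itself \<Rightarrow> ('o, 'm) category \<Rightarrow> bool" where
  "locally_presentable U C \<longleftrightarrow> has_filtered_colimits U C \<and>
    (\<forall>x\<in>obj C. \<exists>(J :: ('u, 'u) category) D \<iota>. small_filtered J \<and>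
      (\<forall>i\<in>obj J. finitely_presentable U C (fobj D i)) \<and> is_colimit J C D x \<iota>)"

definition exact_filtered_colimits :: "'u itself \<Rightarrow> ('o, 'm) category \<Rightarrow> bool" where
  "exact_filtered_colimits _ C \<longleftrightarrow>
    (\<forall>(J :: ('u, 'u) category) A B E f g a \<alpha> b \<beta> e \<epsilon> f' g'.
      small_filtered J \<and>
      is_colimit J C A a \<alpha> \<and> is_colimit J C B b \<beta> \<and> is_colimit J C E e \<epsilon> \<and>
      f \<in> nat_trans J C A B \<and> g \<in> nat_trans J C B E \<and>
      (\<forall>j\<in>obj J. conflation C (fobj A j) (fobj B j) (fobj E j) (f j) (g j)) \<and>
      f' \<in> Hom C a b \<and> g' \<in> Hom C b e \<and>
      (\<forall>j\<in>obj J.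
        cmp C (fobj A j) a b f' (\<alpha> j) = cmp C (fobj A j) (fobj B j) b (\<beta> j) (f j) \<and>
        cmp C (fobj B j) b e g' (\<beta> j) = cmp C (fobj B j) (fobj E j) e (\<epsilon> j) (g j)) \<longrightarrow>
      conflation C a b e f' g')"

definition grothendieck_deflation_quasi_abelian :: "'u itself \<Rightarrow> ('o, 'm) category \<Rightarrow> bool" where
  "grothendieck_deflation_quasi_abelian U C \<longleftrightarrow>
    deflation_quasi_abelian C \<and> locally_presentable U C \<and> exact_filtered_colimits U C"


section \<open>Ordered groups and filtered rings\<close>

locale ordered_group = group G for G (structure) and leq :: "'g rel" +
  constrains G :: "'g monoid"
  assumes partial_order: "partial_order_on (carrier G) leq"
    and mult_mono: "(\<alpha>, \<beta>) \<in> leq \<Longrightarrow> (\<gamma>, \<delta>) \<in> leq \<Longrightarrow> (\<alpha> \<otimes> \<gamma>, \<beta> \<otimes> \<delta>) \<in> leq"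

locale filtered_ring = ordered_group G leq + R: ring R
  for G (structure) and leq and R (structure) and F :: "'g \<Rightarrow> 'r set" +
  constrains G :: "'g monoid" and R :: "'r ring"
  assumes subgroups: "\<alpha> \<in> carrier G \<Longrightarrow> additive_subgroup (F \<alpha>) R"
    and one_mem: "\<one>\<^bsub>R\<^esub> \<in> F \<one>\<^bsub>G\<^esub>"
    and mono: "(\<alpha>, \<beta>) \<in> leq \<Longrightarrow> F \<alpha> \<subseteq> F \<beta>"
    and mult_mem: "\<alpha> \<in> carrier G \<Longrightarrow> \<beta> \<in> carrier G \<Longrightarrow> r \<in> F \<alpha> \<Longrightarrow> s \<in> F \<beta> \<Longrightarrow>
      r \<otimes>\<^bsub>R\<^esub> s \<in> F (\<alpha> \<otimes>\<^bsub>G\<^esub> \<beta>)"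


section \<open>Glider representations\<close>

text \<open>Objects of the following category are \<open>Some \<alpha>\<close> for \<open>\<alpha> \<in> \<Lambda>\<close>, and \<open>None\<close> for \<open>\<infinity>\<close>.\<close>

fun Fbar_Hom ::
  "'g monoid \<Rightarrow> 'g rel \<Rightarrow> 'r ring \<Rightarrow> ('g \<Rightarrow> 'r set) \<Rightarrow> 'g option \<Rightarrow> 'g option \<Rightarrow> 'r set" where
  "Fbar_Hom G leq R F (Some \<alpha>) (Some \<beta>) =
    (if (\<alpha>, \<beta>) \<in> leq then F (\<beta> \<otimes>\<^bsub>G\<^esub> inv\<^bsub>G\<^esub> \<alpha>) else {\<zero>\<^bsub>R\<^esub>})"
| "Fbar_Hom G leq R F a None = carrier R"
| "Fbar_Hom G leq R F None (Some \<beta>) = {\<zero>\<^bsub>R\<^esub>}"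

definition Fbar ::
  "'g monoid \<Rightarrow> 'g rel \<Rightarrow> 'g set \<Rightarrow> 'r ring \<Rightarrow> ('g \<Rightarrow> 'r set) \<Rightarrow> ('g option, 'r) category" where
  "Fbar G leq \<Lambda> R F =
    \<lparr>obj = insert None (Some ` \<Lambda>),
     Hom = Fbar_Hom G leq R F,
     ident = (\<lambda>a. \<one>\<^bsub>R\<^esub>),
     cmp = (\<lambda>a b c g f. g \<otimes>\<^bsub>R\<^esub> f)\<rparr>"

definition Ab :: "('u monoid, 'u \<Rightarrow> 'u) category" where
  "Ab =
    \<lparr>obj = {A. comm_group A \<and> small TYPE('u) (carrier A)},
     Hom = (\<lambda>A B. hom A B \<inter> extensional (carrier A)),
     ident = (\<lambda>A. \<lambda>x\<in>carrier A. x),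
     cmp = (\<lambda>A B C g f. compose (carrier A) g f)\<rparr>"

definition Ab_add :: "'u monoid \<Rightarrow> 'u monoid \<Rightarrow> ('u \<Rightarrow> 'u) \<Rightarrow> ('u \<Rightarrow> 'u) \<Rightarrow> 'u \<Rightarrow> 'u" where
  "Ab_add A B f g = (\<lambda>x\<in>carrier A. f x \<otimes>\<^bsub>B\<^esub> g x)"

type_synonym ('g, 'r, 'u) module_functor = "('g option, 'r, 'u monoid, 'u \<Rightarrow> 'u) functor_data"

definition Mod_Fbar ::
  "'g monoid \<Rightarrow> 'g rel \<Rightarrow> 'g set \<Rightarrow> 'r ring \<Rightarrow> ('g \<Rightarrow> 'r set) \<Rightarrow>
    (('g, 'r, 'u) module_functor, 'g option \<Rightarrow> 'u \<Rightarrow> 'u) category" where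
  "Mod_Fbar G leq \<Lambda> R F =
    full_subcategory (functor_category (Fbar G leq \<Lambda> R F) Ab)
      {M. additive_functor (Fbar G leq \<Lambda> R F) (\<lambda>a b r s. r \<oplus>\<^bsub>R\<^esub> s) Ab Ab_add M}"

definition Preglid ::
  "'g monoid \<Rightarrow> 'g rel \<Rightarrow> 'g set \<Rightarrow> 'r ring \<Rightarrow> ('g \<Rightarrow> 'r set) \<Rightarrow>
    (('g, 'r, 'u) module_functor, 'g option \<Rightarrow> 'u \<Rightarrow> 'u) category" where
  "Preglid G leq \<Lambda> R F =
    full_subcategory (Mod_Fbar G leq \<Lambda> R F)
      {M \<in> obj (Mod_Fbar G leq \<Lambda> R F).
        (\<forall>\<alpha>\<in>\<Lambda>. \<forall>\<beta>\<in>\<Lambda>. (\<alpha>, \<beta>) \<in> leq \<longrightarrow>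
          farr M (Some \<alpha>) (Some \<beta>) \<one>\<^bsub>R\<^esub> \<in> mon (fobj M (Some \<alpha>)) (fobj M (Some \<beta>))) \<and>
        (\<forall>a\<in>insert None (Some ` \<Lambda>).
          farr M a None \<one>\<^bsub>R\<^esub> \<in> mon (fobj M a) (fobj M None))}"

definition Glid_Sigma ::
  "'g monoid \<Rightarrow> 'g rel \<Rightarrow> 'g set \<Rightarrow> 'r ring \<Rightarrow> ('g \<Rightarrow> 'r set) \<Rightarrow>
    ('g, 'r, 'u) module_functor \<Rightarrow> ('g, 'r, 'u) module_functor \<Rightarrow>
    ('g option \<Rightarrow> 'u \<Rightarrow> 'u) set" where
  "Glid_Sigma G leq \<Lambda> R F M N =
    {f \<in> Hom (Preglid G leq \<Lambda> R F) M N.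
      \<forall>\<alpha>\<in>\<Lambda>. f (Some \<alpha>) \<in> iso (fobj M (Some \<alpha>)) (fobj N (Some \<alpha>))}"

definition Glid ::
  "'u itself \<Rightarrow> 'g monoid \<Rightarrow> 'g rel \<Rightarrow> 'g set \<Rightarrow> 'r ring \<Rightarrow> ('g \<Rightarrow> 'r set) \<Rightarrow>
    (('g, 'r, 'u) module_functor,
     (('g, 'r, 'u) module_functor, 'g option \<Rightarrow> 'u \<Rightarrow> 'u) step list set) category" where
  "Glid _ G leq \<Lambda> R F = localization (Preglid G leq \<Lambda> R F) (Glid_Sigma G leq \<Lambda> R F)"

end

theory Submission
  imports Defs
begin

text \<open>
  An object of \<open>Preglid\<close> is an \<open>R\<close>-module (its value at \<open>\<infinity>\<close>) together with subgroups indexed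
  by \<open>\<Lambda>\<close>, and the class \<open>\<Sigma>\<close> consists of the morphisms that are bijective on these subgroups.
  Restriction to the subgroups forgets the component of a morphism at \<open>\<infinity>\<close>; up to precomposition with
  members of \<open>\<Sigma>\<close> it is full (take the graph of a morphism) and faithful (take an equalizer). Hence
  \<open>Glid\<close> is isomorphic to the category whose morphisms are defined on the subgroups only.

  In that category kernels are pointwise and the cokernel maps are exactly the pointwise
  surjections, so they are stable under pullback. Filtered colimits are pointwise as well, hence exact;
  the point is that a pointwise colimit still embeds into some \<open>R\<close>-module. Every object is the
  filtered colimit of the objects presented by its finite sets of elements and relations.
\<close>

section \<open>Cardinal bounds below a regular uncountable universe\<close>

section \<open>Small sets\<close>

text \<open>The obstacle is that the total modules of a diagram of gliders are not connected by
  maps, so they can neither be glued nor divided out. A new total module is therefore made of formal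
  combinations of elements of parts, and two combinations are identified when all admissible
  morphisms into gliders give them equal values. Such a quotient is automatically an
  \<open>R\<close>-module containing its parts, and it is universal among gliders; where a given
  glider is itself a test object, its identity shows that its elements stay distinct. Quantifying
  over all gliders costs no size, as only the set of combinations has to be small. A universe is
  merely regular and uncountable: small sets are closed under small disjoint unions, lists and
  finite subsets, but in general not under power sets. Hence the elements of a quotient are codes of
  representatives rather than classes. Negatives are never data: minus one lies in \<open>F\<close>
  at the unit, so closure under scalars includes closure under inverses. The localized and the
  concrete category share their objects, so an isomorphism is available for the transfer.\<close>

lemma universe_infinite: "universe TYPE('u) \<Longrightarrow> infinite (UNIV :: 'u set)"
  unfolding universe_def
  by (metis card_of_ordLeq_finite infinite_UNIV_nat ordLess_imp_ordLeq)

lemma universe_stable: "universe TYPE('u) \<Longrightarrow> stable |UNIV :: 'u set|"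
  using universe_infinite[where ?'u = 'u] regularCard_stable[of "|UNIV :: 'u set|"]
  unfolding universe_def by (simp add: card_of_card_order_on Field_card_of)

lemma small_subset: "small TYPE('u) A \<Longrightarrow> B \<subseteq> A \<Longrightarrow> small TYPE('u) B"
  unfolding small_def by (meson card_of_mono1 ordLeq_ordLess_trans)

lemma small_image: "small TYPE('u) A \<Longrightarrow> small TYPE('u) (f ` A)"
  unfolding small_def by (meson card_of_image ordLeq_ordLess_trans)

lemma small_finite: "universe TYPE('u) \<Longrightarrow> finite A \<Longrightarrow> small TYPE('u) A"
  unfolding small_def using universe_infinite[where ?'u = 'u]
    finite_ordLess_infinite[of "|A|" "|UNIV :: 'u set|"]
  by (simp add: card_of_well_order_on Field_card_of)

lemma small_nat: "universe TYPE('u) \<Longrightarrow> small TYPE('u) (UNIV :: nat set)"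
  unfolding small_def universe_def by blast

lemma small_encode:
  assumes "small TYPE('u) A"
  obtains e :: "'a \<Rightarrow> 'u" where "inj_on e A"
  using assms unfolding small_def
  by (metis card_of_ordLeq ordLess_imp_ordLeq)

text \<open>This is where regularity of the universe enters: for infinite cardinals it amounts to
  \<open>stable\<close>, the bound on small disjoint unions of small sets.\<close>

lemma small_Sigma:
  assumes "universe TYPE('u)" "small TYPE('u) A" "\<And>a. a \<in> A \<Longrightarrow> small TYPE('u) (B a)"
  shows "small TYPE('u) (Sigma A B)"
  using stable_elim[OF universe_stable[OF assms(1)], of A B] assms unfolding small_def by blast

lemma small_lists_length:
  assumes "universe TYPE('u)" "small TYPE('u) A"
  shows "small TYPE('u) {xs \<in> lists A. length xs = n}"
proof (induction n)
  case 0
  have "{xs \<in> lists A. length xs = 0} = {[]}" by auto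
  show ?case unfolding \<open>_ = {[]}\<close> by (rule small_finite[OF assms(1)]) simp
next
  case (Suc n)
  have "{xs \<in> lists A. length xs = Suc n} \<subseteq> (\<lambda>(x, xs). x # xs) ` (A \<times> {xs \<in> lists A. length xs = n})"
    by (auto simp: length_Suc_conv image_iff)
  moreover have "small TYPE('u) (A \<times> {xs \<in> lists A. length xs = n})"
    by (rule small_Sigma[OF assms Suc.IH])
  ultimately show ?case using small_image small_subset by blast
qed

text \<open>Lists are split by length. The union over all lengths stays small because the universe
  is uncountable.\<close>

lemma small_lists:
  assumes "universe TYPE('u)" "small TYPE('u) A"
  shows "small TYPE('u) (lists A)"
proof -
  have "lists A = snd ` (SIGMA n:UNIV. {xs \<in> lists A. length xs = n})"
    by force
  moreover have "small TYPE('u) (SIGMA n:UNIV. {xs \<in> lists A. length xs = n})"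
    by (rule small_Sigma[OF assms(1) small_nat[OF assms(1)] small_lists_length[OF assms]])
  ultimately show ?thesis using small_image[of "SIGMA n:UNIV. {xs \<in> lists A. length xs = n}" snd] by simp
qed

text \<open>Finite subsets are images of lists. The full power set is out of reach: with
  \<open>nat suc\<close> as universe, the power set of \<open>nat\<close> is not small.\<close>

lemma small_Fpow:
  assumes "universe TYPE('u)" "small TYPE('u) A"
  shows "small TYPE('u) (Fpow A)"
proof -
  have "Fpow A \<subseteq> set ` lists A"
    unfolding Fpow_def lists_eq_set using finite_list by fastforce
  then show ?thesis by (meson assms small_image small_lists small_subset)
qed


section \<open>Direct limits of hom-sets, and transport along isomorphisms that fix the
  objects\<close>

section \<open>Isomorphic categories\<close>

lemma cat_ident: "is_category C \<Longrightarrow> a \<in> obj C \<Longrightarrow> ident C a \<in> Hom C a a"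
  unfolding is_category_def by blast

lemma cat_cmp: "is_category C \<Longrightarrow> a \<in> obj C \<Longrightarrow> b \<in> obj C \<Longrightarrow> c \<in> obj C \<Longrightarrow>
    f \<in> Hom C a b \<Longrightarrow> g \<in> Hom C b c \<Longrightarrow> cmp C a b c g f \<in> Hom C a c"
  unfolding is_category_def by blast

lemma cat_ident_right: "is_category C \<Longrightarrow> a \<in> obj C \<Longrightarrow> b \<in> obj C \<Longrightarrow>
    f \<in> Hom C a b \<Longrightarrow> cmp C a a b f (ident C a) = f"
  unfolding is_category_def by blast

lemma cat_ident_left: "is_category C \<Longrightarrow> a \<in> obj C \<Longrightarrow> b \<in> obj C \<Longrightarrow>
    f \<in> Hom C a b \<Longrightarrow> cmp C a b b (ident C b) f = f"
  unfolding is_category_def by blast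

lemma cat_assoc: "is_category C \<Longrightarrow> a \<in> obj C \<Longrightarrow> b \<in> obj C \<Longrightarrow> c \<in> obj C \<Longrightarrow> d \<in> obj C \<Longrightarrow>
    f \<in> Hom C a b \<Longrightarrow> g \<in> Hom C b c \<Longrightarrow> h \<in> Hom C c d \<Longrightarrow>
    cmp C a c d h (cmp C a b c g f) = cmp C a b d (cmp C b c d h g) f"
  unfolding is_category_def by blast

lemma functor_obj: "is_functor C D T \<Longrightarrow> a \<in> obj C \<Longrightarrow> fobj T a \<in> obj D"
  unfolding is_functor_def by blast

lemma functor_arr: "is_functor C D T \<Longrightarrow> a \<in> obj C \<Longrightarrow> b \<in> obj C \<Longrightarrow> f \<in> Hom C a b \<Longrightarrow>
    farr T a b f \<in> Hom D (fobj T a) (fobj T b)"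
  unfolding is_functor_def by blast

lemma functor_ident: "is_functor C D T \<Longrightarrow> a \<in> obj C \<Longrightarrow> farr T a a (ident C a) = ident D (fobj T a)"
  unfolding is_functor_def by blast

lemma functor_cmp: "is_functor C D T \<Longrightarrow> a \<in> obj C \<Longrightarrow> b \<in> obj C \<Longrightarrow> c \<in> obj C \<Longrightarrow>
    f \<in> Hom C a b \<Longrightarrow> g \<in> Hom C b c \<Longrightarrow>
    farr T a c (cmp C a b c g f) = cmp D (fobj T a) (fobj T b) (fobj T c) (farr T b c g) (farr T a b f)"
  unfolding is_functor_def by blast

lemma cocone_obj: "is_cocone J C D x \<kappa> \<Longrightarrow> x \<in> obj C"
  unfolding is_cocone_def by blast

lemma cocone_leg: "is_cocone J C D x \<kappa> \<Longrightarrow> i \<in> obj J \<Longrightarrow> \<kappa> i \<in> Hom C (fobj D i) x"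
  unfolding is_cocone_def by blast

lemma cocone_cmp: "is_cocone J C D x \<kappa> \<Longrightarrow> i \<in> obj J \<Longrightarrow> j \<in> obj J \<Longrightarrow> u \<in> Hom J i j \<Longrightarrow>
    cmp C (fobj D i) (fobj D j) x (\<kappa> j) (farr D i j u) = \<kappa> i"
  unfolding is_cocone_def by blast

lemma colimit_functor: "is_colimit J C D l \<iota> \<Longrightarrow> is_functor J C D"
  unfolding is_colimit_def by blast

lemma colimit_cocone: "is_colimit J C D l \<iota> \<Longrightarrow> is_cocone J C D l \<iota>"
  unfolding is_colimit_def by blast

lemma nat_trans_component: "\<eta> \<in> nat_trans C D S T \<Longrightarrow> a \<in> obj C \<Longrightarrow> \<eta> a \<in> Hom D (fobj S a) (fobj T a)"
  unfolding nat_trans_def by auto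

text \<open>An upper bound of \<open>k\<close> and \<open>k'\<close> turns the two legs into
  parallel morphisms out of \<open>i\<close>, and a further morphism makes these equal.\<close>

lemma filtered_span:
  assumes "filtered J" "i \<in> obj J" "k \<in> obj J" "k' \<in> obj J" "u \<in> Hom J i k" "u' \<in> Hom J i k'"
  obtains m w w' where "m \<in> obj J" "w \<in> Hom J k m" "w' \<in> Hom J k' m"
    "cmp J i k m w u = cmp J i k' m w' u'"
proof -
  have cat: "is_category J" using assms unfolding filtered_def by blast
  obtain n a a' where n: "n \<in> obj J" "a \<in> Hom J k n" "a' \<in> Hom J k' n"
    using assms unfolding filtered_def by blast
  have "cmp J i k n a u \<in> Hom J i n" "cmp J i k' n a' u' \<in> Hom J i n"
    using cat n assms unfolding is_category_def by blast+
  then obtain m b where m: "m \<in> obj J" "b \<in> Hom J n m"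
    "cmp J i n m b (cmp J i k n a u) = cmp J i n m b (cmp J i k' n a' u')"
    using assms n unfolding filtered_def by blast
  show ?thesis
  proof
    show "m \<in> obj J" by fact
    show "cmp J k n m b a \<in> Hom J k m" "cmp J k' n m b a' \<in> Hom J k' m"
      using cat n m assms unfolding is_category_def by blast+
    have "cmp J i n m b (cmp J i k n a u) = cmp J i k m (cmp J k n m b a) u"
      using cat n m assms unfolding is_category_def by blast
    moreover have "cmp J i n m b (cmp J i k' n a' u') = cmp J i k' m (cmp J k' n m b a') u'"
      using cat n m assms unfolding is_category_def by blast
    ultimately show "cmp J i k m (cmp J k n m b a) u = cmp J i k' m (cmp J k' n m b a') u'"
      using m by simp
  qed
qed

text \<open>Only transitivity needs more than the category structure: the two stages at which
  neighbours become equal both receive a morphism from the middle index, so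
  \<open>filtered_span\<close> merges them.\<close>

lemma equiv_hom_rel:
  assumes J: "filtered J" and C: "is_category C" and D: "is_functor J C D" and x: "x \<in> obj C"
  shows "equiv (hom_union J C D x) (hom_rel J C D x)"
proof (rule equivI)
  have catJ: "is_category J" using J unfolding filtered_def by blast
  show "hom_rel J C D x \<subseteq> hom_union J C D x \<times> hom_union J C D x"
    unfolding hom_rel_def by blast
  show "refl_on (hom_union J C D x) (hom_rel J C D x)"
  proof (rule refl_onI)
    fix y assume "y \<in> hom_union J C D x"
    then obtain i f where y: "y = (i, f)" "i \<in> obj J" "f \<in> Hom C x (fobj D i)"
      unfolding hom_union_def by blast
    then show "(y, y) \<in> hom_rel J C D x"
      using catJ unfolding hom_rel_def hom_union_def is_category_def by blast
  qed
  show "sym (hom_rel J C D x)"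
    unfolding hom_rel_def by (rule symI) (clarsimp, metis)
  show "trans (hom_rel J C D x)"
  proof (rule transI)
    fix a b c assume ab: "(a, b) \<in> hom_rel J C D x" and bc: "(b, c) \<in> hom_rel J C D x"
    obtain i f where a: "a = (i, f)" by fastforce
    obtain j g where b: "b = (j, g)" by fastforce
    obtain l h where c: "c = (l, h)" by fastforce
    have mem: "i \<in> obj J" "f \<in> Hom C x (fobj D i)" "j \<in> obj J" "g \<in> Hom C x (fobj D j)"
       "l \<in> obj J" "h \<in> Hom C x (fobj D l)"
      using ab bc unfolding a b c hom_rel_def hom_union_def by blast+
    obtain k u v where k: "k \<in> obj J" "u \<in> Hom J i k" "v \<in> Hom J j k"
      "cmp C x (fobj D i) (fobj D k) (farr D i k u) f = cmp C x (fobj D j) (fobj D k) (farr D j k v) g"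
      using ab unfolding a b hom_rel_def by blast
    obtain k' u' v' where k': "k' \<in> obj J" "u' \<in> Hom J j k'" "v' \<in> Hom J l k'"
      "cmp C x (fobj D j) (fobj D k') (farr D j k' u') g = cmp C x (fobj D l) (fobj D k') (farr D l k' v') h"
      using bc unfolding b c hom_rel_def by blast
    obtain m w w' where m: "m \<in> obj J" "w \<in> Hom J k m" "w' \<in> Hom J k' m"
      "cmp J j k m w v = cmp J j k' m w' u'"
      using filtered_span[OF J mem(3) k(1) k'(1) k(3) k'(2)] .
    have *: "cmp C x (fobj D p) (fobj D m) (farr D p m (cmp J p q m r s)) t =
        cmp C x (fobj D q) (fobj D m) (farr D q m r) (cmp C x (fobj D p) (fobj D q) (farr D p q s) t)"
      if "p \<in> obj J" "q \<in> obj J" "r \<in> Hom J q m" "s \<in> Hom J p q" "t \<in> Hom C x (fobj D p)" for p q r s t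
    proof -
      have "fobj D p \<in> obj C" "fobj D q \<in> obj C" "fobj D m \<in> obj C"
        "farr D q m r \<in> Hom C (fobj D q) (fobj D m)" "farr D p q s \<in> Hom C (fobj D p) (fobj D q)"
        using D that m unfolding is_functor_def by blast+
      moreover have "farr D p m (cmp J p q m r s) = cmp C (fobj D p) (fobj D q) (fobj D m) (farr D q m r) (farr D p q s)"
        using D that m unfolding is_functor_def by blast
      ultimately show ?thesis using C x that unfolding is_category_def by metis
    qed
    have "cmp J i k m w u \<in> Hom J i m" "cmp J l k' m w' v' \<in> Hom J l m"
      using catJ m k k' mem unfolding is_category_def by blast+
    moreover have "cmp C x (fobj D i) (fobj D m) (farr D i m (cmp J i k m w u)) f =
       cmp C x (fobj D l) (fobj D m) (farr D l m (cmp J l k' m w' v')) h"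
      using *[OF mem(1) k(1) m(2) k(2) mem(2)] *[OF mem(5) k'(1) m(3) k'(3) mem(6)]
        *[OF mem(3) k(1) m(2) k(3) mem(4)] *[OF mem(3) k'(1) m(3) k'(2) mem(4)] k k' m by simp
    ultimately show "(a, c) \<in> hom_rel J C D x"
      using mem m unfolding a c hom_rel_def hom_union_def by blast
  qed
qed

text \<open>Removes the quotient from finite presentability: the value is constant on classes, so
  surjectivity and injectivity can be read on representatives. Later arguments use only this
  form.\<close>

lemma bij_betw_canonical_map_iff:
  assumes J: "filtered J" and C: "is_category C" and l: "is_colimit J C D l \<iota>" and x: "x \<in> obj C"
  shows "bij_betw (canonical_map C D x l \<iota>) (hom_union J C D x // hom_rel J C D x) (Hom C x l) \<longleftrightarrow>
    (\<forall>f\<in>Hom C x l. \<exists>i\<in>obj J. \<exists>g\<in>Hom C x (fobj D i). cmp C x (fobj D i) l (\<iota> i) g = f) \<and>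
    (\<forall>i\<in>obj J. \<forall>j\<in>obj J. \<forall>f\<in>Hom C x (fobj D i). \<forall>g\<in>Hom C x (fobj D j).
      cmp C x (fobj D i) l (\<iota> i) f = cmp C x (fobj D j) l (\<iota> j) g \<longrightarrow>
      (\<exists>k\<in>obj J. \<exists>u\<in>Hom J i k. \<exists>v\<in>Hom J j k.
        cmp C x (fobj D i) (fobj D k) (farr D i k u) f =
        cmp C x (fobj D j) (fobj D k) (farr D j k v) g))" (is "?B \<longleftrightarrow> ?S \<and> ?I")
proof -
  let ?A = "hom_union J C D x" and ?r = "hom_rel J C D x"
  let ?m = "\<lambda>(i, f). cmp C x (fobj D i) l (\<iota> i) f"
  have D: "is_functor J C D" and co: "is_cocone J C D l \<iota>" using l unfolding is_colimit_def by blast+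
  have eq: "equiv ?A ?r" using equiv_hom_rel[OF J C D x] .
  have *: "?m (i, f) = cmp C x (fobj D k) l (\<iota> k) (cmp C x (fobj D i) (fobj D k) (farr D i k u) f)"
    if "i \<in> obj J" "k \<in> obj J" "u \<in> Hom J i k" "f \<in> Hom C x (fobj D i)" for i k u f
  proof -
    have "fobj D i \<in> obj C" "fobj D k \<in> obj C" "l \<in> obj C" "\<iota> k \<in> Hom C (fobj D k) l"
      "farr D i k u \<in> Hom C (fobj D i) (fobj D k)"
      using D co that unfolding is_functor_def is_cocone_def by blast+
    moreover have "cmp C (fobj D i) (fobj D k) l (\<iota> k) (farr D i k u) = \<iota> i"
      using co that unfolding is_cocone_def by blast
    ultimately show ?thesis using cat_assoc[OF C x, of "fobj D i" "fobj D k" l] that by simp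
  qed
  have cong: "?m y = ?m z" if yz: "(y, z) \<in> ?r" for y z
  proof -
    obtain i f where y: "y = (i, f)" by fastforce
    obtain j g where z: "z = (j, g)" by fastforce
    have mem: "i \<in> obj J" "f \<in> Hom C x (fobj D i)" "j \<in> obj J" "g \<in> Hom C x (fobj D j)"
      using that unfolding y z hom_rel_def hom_union_def by blast+
    obtain k u v where k: "k \<in> obj J" "u \<in> Hom J i k" "v \<in> Hom J j k"
      "cmp C x (fobj D i) (fobj D k) (farr D i k u) f = cmp C x (fobj D j) (fobj D k) (farr D j k v) g"
      using yz unfolding y z hom_rel_def by blast
    show ?thesis
      unfolding y z using *[OF mem(1) k(1,2) mem(2)] *[OF mem(3) k(1,3) mem(4)] k(4) by simp
  qed
  have val: "canonical_map C D x l \<iota> (?r `` {y}) = ?m y" if "y \<in> ?A" for y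
  proof -
    \<comment> \<open>\<open>the_elem\<close> in \<open>canonical_map\<close> returns the common
      value because the image of a class is a singleton.\<close>
    have "?m ` (?r `` {y}) = {?m y}"
    proof
      show "?m ` (?r `` {y}) \<subseteq> {?m y}" using cong by fastforce
      show "{?m y} \<subseteq> ?m ` (?r `` {y})" using equiv_class_self[OF eq that] by blast
    qed
    then show ?thesis unfolding canonical_map_def by simp
  qed
  have inj: "inj_on (canonical_map C D x l \<iota>) (?A // ?r) \<longleftrightarrow> (\<forall>y\<in>?A. \<forall>z\<in>?A. ?m y = ?m z \<longrightarrow> (y, z) \<in> ?r)"
    unfolding inj_on_def quotient_def using val eq
    by (auto simp del: split_paired_All simp: eq_equiv_class_iff)
  have m_mem: "?m y \<in> Hom C x l" if "y \<in> ?A" for y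
    using that C D co x unfolding hom_union_def is_category_def is_functor_def is_cocone_def by auto
  have img: "canonical_map C D x l \<iota> ` (?A // ?r) = ?m ` ?A"
    using val unfolding quotient_def by (simp add: image_UN image_comp) force
  have "?S \<longleftrightarrow> ?m ` ?A = Hom C x l"
  proof
    assume ?S then show "?m ` ?A = Hom C x l" using m_mem unfolding hom_union_def by force
  next
    assume "?m ` ?A = Hom C x l"
    then show ?S unfolding hom_union_def by (auto simp: image_iff set_eq_iff) metis
  qed
  moreover have "?I \<longleftrightarrow> (\<forall>y\<in>?A. \<forall>z\<in>?A. ?m y = ?m z \<longrightarrow> (y, z) \<in> ?r)"
    unfolding hom_union_def hom_rel_def by fastforce
  ultimately show ?thesis unfolding bij_betw_def inj img by blast
qed


text \<open>Functor data are total functions, and a round trip through an isomorphism and its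
  inverse restores a diagram only on the objects and morphisms of \<open>J\<close>. Colimits do not
  see the rest.\<close>

lemma is_colimit_cong:
  assumes "is_colimit J C E l \<iota>" "is_category J" "\<And>i. i \<in> obj J \<Longrightarrow> fobj E' i = fobj E i"
    "\<And>i j u. i \<in> obj J \<Longrightarrow> j \<in> obj J \<Longrightarrow> u \<in> Hom J i j \<Longrightarrow> farr E' i j u = farr E i j u"
    "\<And>i. i \<in> obj J \<Longrightarrow> \<iota>' i = \<iota> i"
  shows "is_colimit J C E' l \<iota>'"
proof -
  have "is_functor J C E'"
    using assms(1) assms(3,4) cat_ident[OF assms(2)] cat_cmp[OF assms(2)]
    unfolding is_colimit_def is_functor_def by simp
  moreover have "is_cocone J C E' x \<kappa> \<longleftrightarrow> is_cocone J C E x \<kappa>" for x \<kappa>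
    using assms unfolding is_cocone_def by simp
  moreover have "is_cocone J C E l \<iota>' \<longleftrightarrow> is_cocone J C E l \<iota>"
    using assms unfolding is_cocone_def by simp
  ultimately show ?thesis using assms(1,3,5) unfolding is_colimit_def by simp
qed

text \<open>Objects are shared and only hom-sets are translated, so every notion transfers with the
  same objects and without a choice of isomorphic copies.\<close>

locale category_isomorphism =
  fixes C :: "('o, 'm) category" and D :: "('o, 'n) category" and \<phi> :: "'o \<Rightarrow> 'o \<Rightarrow> 'm \<Rightarrow> 'n"
  assumes cat_C: "is_category C" and cat_D: "is_category D" and obj_eq: "obj D = obj C"
    and bij: "a \<in> obj C \<Longrightarrow> b \<in> obj C \<Longrightarrow> bij_betw (\<phi> a b) (Hom C a b) (Hom D a b)"
    and map_ident: "a \<in> obj C \<Longrightarrow> \<phi> a a (ident C a) = ident D a"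
    and map_cmp: "a \<in> obj C \<Longrightarrow> b \<in> obj C \<Longrightarrow> c \<in> obj C \<Longrightarrow> f \<in> Hom C a b \<Longrightarrow> g \<in> Hom C b c \<Longrightarrow>
      \<phi> a c (cmp C a b c g f) = cmp D a b c (\<phi> b c g) (\<phi> a b f)"
begin

lemma map_mem: "a \<in> obj C \<Longrightarrow> b \<in> obj C \<Longrightarrow> f \<in> Hom C a b \<Longrightarrow> \<phi> a b f \<in> Hom D a b"
  using bij by (meson bij_betw_apply)

lemma map_eq_iff: "a \<in> obj C \<Longrightarrow> b \<in> obj C \<Longrightarrow> f \<in> Hom C a b \<Longrightarrow> g \<in> Hom C a b \<Longrightarrow>
    \<phi> a b f = \<phi> a b g \<longleftrightarrow> f = g"
  using bij by (meson bij_betw_imp_inj_on inj_on_eq_iff)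

lemma Hom_D: "a \<in> obj C \<Longrightarrow> b \<in> obj C \<Longrightarrow> Hom D a b = \<phi> a b ` Hom C a b"
  using bij bij_betw_imp_surj_on by metis

definition \<psi> :: "'o \<Rightarrow> 'o \<Rightarrow> 'n \<Rightarrow> 'm" where
  "\<psi> a b = inv_into (Hom C a b) (\<phi> a b)"

lemma \<psi>_mem: "a \<in> obj C \<Longrightarrow> b \<in> obj C \<Longrightarrow> f \<in> Hom D a b \<Longrightarrow> \<psi> a b f \<in> Hom C a b"
  unfolding \<psi>_def by (simp add: Hom_D inv_into_into)

lemma map_\<psi>: "a \<in> obj C \<Longrightarrow> b \<in> obj C \<Longrightarrow> f \<in> Hom D a b \<Longrightarrow> \<phi> a b (\<psi> a b f) = f"
  unfolding \<psi>_def by (simp add: Hom_D f_inv_into_f)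

lemma \<psi>_map: "a \<in> obj C \<Longrightarrow> b \<in> obj C \<Longrightarrow> f \<in> Hom C a b \<Longrightarrow> \<psi> a b (\<phi> a b f) = f"
  unfolding \<psi>_def using bij bij_betw_imp_inj_on inv_into_f_f by metis

lemma C_cmp: "a \<in> obj C \<Longrightarrow> b \<in> obj C \<Longrightarrow> c \<in> obj C \<Longrightarrow>
    f \<in> Hom C a b \<Longrightarrow> g \<in> Hom C b c \<Longrightarrow> cmp C a b c g f \<in> Hom C a c"
  using cat_cmp[OF cat_C] .

lemma inverse: "category_isomorphism D C \<psi>"
proof
  show "bij_betw (\<psi> a b) (Hom D a b) (Hom C a b)" if "a \<in> obj D" "b \<in> obj D" for a b
    unfolding \<psi>_def using that bij bij_betw_inv_into by (metis obj_eq)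
  show "\<psi> a a (ident D a) = ident C a" if "a \<in> obj D" for a
    using that \<psi>_map cat_ident[OF cat_C] map_ident obj_eq by metis
  show "\<psi> a c (cmp D a b c g f) = cmp C a b c (\<psi> b c g) (\<psi> a b f)"
    if *: "a \<in> obj D" "b \<in> obj D" "c \<in> obj D" "f \<in> Hom D a b" "g \<in> Hom D b c" for a b c f g
  proof -
    have m: "\<psi> a b f \<in> Hom C a b" "\<psi> b c g \<in> Hom C b c"
      using * \<psi>_mem unfolding obj_eq by blast+
    have "\<phi> a c (cmp C a b c (\<psi> b c g) (\<psi> a b f)) = cmp D a b c (\<phi> b c (\<psi> b c g)) (\<phi> a b (\<psi> a b f))"
      using map_cmp * m unfolding obj_eq by blast
    also have "\<dots> = cmp D a b c g f" using map_\<psi> * unfolding obj_eq by force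
    finally have "\<phi> a c (cmp C a b c (\<psi> b c g) (\<psi> a b f)) = cmp D a b c g f" .
    moreover have "cmp C a b c (\<psi> b c g) (\<psi> a b f) \<in> Hom C a c"
      using C_cmp * m unfolding obj_eq by blast
    ultimately show ?thesis using \<psi>_map * unfolding obj_eq by metis
  qed
qed (use cat_C cat_D obj_eq in auto)

text \<open>Zero objects, kernels, cokernels, pullbacks and colimits all ask for a unique morphism
  with some property; this equivalence is the one point at which their universal properties are
  transported.\<close>

lemma ex1_Hom:
  assumes "a \<in> obj C" "b \<in> obj C" "\<And>u. u \<in> Hom C a b \<Longrightarrow> P u \<longleftrightarrow> Q (\<phi> a b u)"
  shows "(\<exists>!u. u \<in> Hom D a b \<and> Q u) \<longleftrightarrow> (\<exists>!u. u \<in> Hom C a b \<and> P u)"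
  proof -
  have "(\<exists>!u. u \<in> \<phi> a b ` Hom C a b \<and> Q u) \<longleftrightarrow> (\<exists>!u. u \<in> Hom C a b \<and> Q (\<phi> a b u))"
  proof -
    have "(\<exists>!u. u \<in> \<phi> a b ` Hom C a b \<and> Q u) \<longleftrightarrow>
        (\<exists>u\<in>Hom C a b. Q (\<phi> a b u) \<and> (\<forall>v\<in>Hom C a b. Q (\<phi> a b v) \<longrightarrow> \<phi> a b v = \<phi> a b u))"
      unfolding Ex1_def by blast
    also have "\<dots> \<longleftrightarrow> (\<exists>u\<in>Hom C a b. Q (\<phi> a b u) \<and> (\<forall>v\<in>Hom C a b. Q (\<phi> a b v) \<longrightarrow> v = u))"
      using map_eq_iff[OF assms(1,2)] by (intro bex_cong refl conj_cong ball_cong imp_cong) auto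
    also have "\<dots> \<longleftrightarrow> (\<exists>!u. u \<in> Hom C a b \<and> Q (\<phi> a b u))" unfolding Ex1_def by blast
    finally show ?thesis .
  qed
  moreover have "(\<lambda>u. u \<in> Hom C a b \<and> Q (\<phi> a b u)) = (\<lambda>u. u \<in> Hom C a b \<and> P u)"
    using assms(3) by auto
  ultimately show ?thesis unfolding Hom_D[OF assms(1,2)] by simp
qed

lemma ball_Hom:
  assumes "a \<in> obj C" "b \<in> obj C"
  shows "(\<forall>u\<in>Hom D a b. Q u) \<longleftrightarrow> (\<forall>u\<in>Hom C a b. Q (\<phi> a b u))"
  using assms Hom_D by simp

lemma bex_Hom:
  assumes "a \<in> obj C" "b \<in> obj C"
  shows "(\<exists>u\<in>Hom D a b. Q u) \<longleftrightarrow> (\<exists>u\<in>Hom C a b. Q (\<phi> a b u))"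
  using assms Hom_D by simp

lemma zero_object_iff: "zero_object D z \<longleftrightarrow> zero_object C z"
proof -
  have *: "(\<exists>!f. f \<in> Hom D a b) \<longleftrightarrow> (\<exists>!f. f \<in> Hom C a b)" if "a \<in> obj C" "b \<in> obj C" for a b
    using ex1_Hom[OF that, of "\<lambda>_. True" "\<lambda>_. True"] by simp
  show ?thesis unfolding zero_object_def obj_eq by (intro conj_cong ball_cong *) simp_all
qed

lemma zero_morphism_iff:
  assumes "a \<in> obj C" "b \<in> obj C" "f \<in> Hom C a b"
  shows "zero_morphism D a b (\<phi> a b f) \<longleftrightarrow> zero_morphism C a b f"
proof -
  have "(\<exists>g\<in>Hom D a z. \<exists>h\<in>Hom D z b. \<phi> a b f = cmp D a z b h g) \<longleftrightarrow>
      (\<exists>g\<in>Hom C a z. \<exists>h\<in>Hom C z b. f = cmp C a z b h g)" if "zero_object C z" for z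
  proof -
    have z: "z \<in> obj C" using that unfolding zero_object_def by blast
    show ?thesis
      using assms z by (simp add: bex_Hom map_eq_iff C_cmp flip: map_cmp)
  qed
  then show ?thesis unfolding zero_morphism_def zero_object_iff by blast
qed

lemma is_kernel_iff:
  assumes "n \<in> obj C" "a \<in> obj C" "b \<in> obj C" "k \<in> Hom C n a" "f \<in> Hom C a b"
  shows "is_kernel D n a b (\<phi> n a k) (\<phi> a b f) \<longleftrightarrow> is_kernel C n a b k f"
proof -
  have "(\<exists>!u. u \<in> Hom D x n \<and> cmp D x n a (\<phi> n a k) u = \<phi> x a h) \<longleftrightarrow>
      (\<exists>!u. u \<in> Hom C x n \<and> cmp C x n a k u = h)" if "x \<in> obj C" "h \<in> Hom C x a" for x h
    by (rule ex1_Hom) (use that assms in \<open>simp_all add: map_eq_iff C_cmp flip: map_cmp\<close>)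
  then show ?thesis
    unfolding is_kernel_def obj_eq using assms
    by (simp add: map_mem ball_Hom zero_morphism_iff C_cmp flip: map_cmp)
qed

lemma is_cokernel_iff:
  assumes "a \<in> obj C" "b \<in> obj C" "q \<in> obj C" "f \<in> Hom C a b" "c \<in> Hom C b q"
  shows "is_cokernel D a b q (\<phi> a b f) (\<phi> b q c) \<longleftrightarrow> is_cokernel C a b q f c"
proof -
  have "(\<exists>!u. u \<in> Hom D q x \<and> cmp D b q x u (\<phi> b q c) = \<phi> b x h) \<longleftrightarrow>
      (\<exists>!u. u \<in> Hom C q x \<and> cmp C b q x u c = h)" if "x \<in> obj C" "h \<in> Hom C b x" for x h
    by (rule ex1_Hom) (use that assms in \<open>simp_all add: map_eq_iff C_cmp flip: map_cmp\<close>)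
  then show ?thesis
    unfolding is_cokernel_def obj_eq using assms
    by (simp add: map_mem ball_Hom zero_morphism_iff C_cmp flip: map_cmp)
qed

lemma cokernel_map_iff:
  assumes "b \<in> obj C" "q \<in> obj C" "c \<in> Hom C b q"
  shows "cokernel_map D b q (\<phi> b q c) \<longleftrightarrow> cokernel_map C b q c"
proof
  assume "cokernel_map D b q (\<phi> b q c)"
  then obtain a f where *: "is_cokernel D a b q f (\<phi> b q c)" unfolding cokernel_map_def by blast
  then have "a \<in> obj C" "f \<in> Hom D a b" unfolding is_cokernel_def obj_eq by blast+
  then have "is_cokernel C a b q (\<psi> a b f) c"
    using * is_cokernel_iff[of a b q "\<psi> a b f" c] assms by (simp add: \<psi>_mem map_\<psi>)
  then show "cokernel_map C b q c" unfolding cokernel_map_def by blast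
next
  assume "cokernel_map C b q c"
  then obtain a f where *: "is_cokernel C a b q f c" unfolding cokernel_map_def by blast
  then have "a \<in> obj C" "f \<in> Hom C a b" unfolding is_cokernel_def by blast+
  then show "cokernel_map D b q (\<phi> b q c)"
    using * is_cokernel_iff[of a b q f c] assms unfolding cokernel_map_def by blast
qed

lemma is_pullback_map:
  assumes "is_pullback C p a b c q r f g"
  shows "is_pullback D p a b c (\<phi> p a q) (\<phi> p b r) (\<phi> a c f) (\<phi> b c g)"
proof -
  have mem: "p \<in> obj C" "a \<in> obj C" "b \<in> obj C" "c \<in> obj C"
    "q \<in> Hom C p a" "r \<in> Hom C p b" "f \<in> Hom C a c" "g \<in> Hom C b c"
    and sq: "cmp C p a c f q = cmp C p b c g r"
    and univ: "\<And>x s t. x \<in> obj C \<Longrightarrow> s \<in> Hom C x a \<Longrightarrow> t \<in> Hom C x b \<Longrightarrow>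
      cmp C x a c f s = cmp C x b c g t \<Longrightarrow>
      (\<exists>!u. u \<in> Hom C x p \<and> cmp C x p a q u = s \<and> cmp C x p b r u = t)"
    using assms unfolding is_pullback_def by blast+
  have "(\<exists>!u. u \<in> Hom D x p \<and> cmp D x p a (\<phi> p a q) u = \<phi> x a s \<and> cmp D x p b (\<phi> p b r) u = \<phi> x b t) \<longleftrightarrow>
      (\<exists>!u. u \<in> Hom C x p \<and> cmp C x p a q u = s \<and> cmp C x p b r u = t)"
    if "x \<in> obj C" "s \<in> Hom C x a" "t \<in> Hom C x b" for x s t
    by (rule ex1_Hom) (use that mem in \<open>simp_all add: map_eq_iff C_cmp flip: map_cmp\<close>)
  then show ?thesis
    unfolding is_pullback_def obj_eq using mem sq univ
    by (simp add: map_mem ball_Hom map_eq_iff C_cmp flip: map_cmp)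
qed

text \<open>The addition is conjugated by the bijections between hom-sets. This is enough because an
  additive category only asserts that some addition exists.\<close>

lemma preadditive_map:
  assumes "preadditive C hadd"
  shows "preadditive D (\<lambda>a b f g. \<phi> a b (hadd a b (\<psi> a b f) (\<psi> a b g)))" (is "preadditive D ?h")
proof -
  obtain e where e: "\<And>a b. a \<in> obj C \<Longrightarrow> b \<in> obj C \<Longrightarrow>
      comm_group \<lparr>carrier = Hom C a b, monoid.mult = hadd a b, one = e a b\<rparr>"
    using assms unfolding preadditive_def by metis
  have closed: "hadd a b f g \<in> Hom C a b"
    if "a \<in> obj C" "b \<in> obj C" "f \<in> Hom C a b" "g \<in> Hom C a b" for a b f g
  proof -
    interpret comm_group "\<lparr>carrier = Hom C a b, monoid.mult = hadd a b, one = e a b\<rparr>"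
      using e that by blast
    show ?thesis using m_closed that by simp
  qed
  have grp: "comm_group \<lparr>carrier = Hom D a b, monoid.mult = ?h a b, one = \<phi> a b (e a b)\<rparr>"
    if ab: "a \<in> obj C" "b \<in> obj C" for a b
  proof -
    interpret comm_group "\<lparr>carrier = Hom C a b, monoid.mult = hadd a b, one = e a b\<rparr>"
      using e that by blast
    show ?thesis
    proof (rule comm_groupI; simp)
      show "\<phi> a b (hadd a b (\<psi> a b x) (\<psi> a b y)) \<in> Hom D a b" if "x \<in> Hom D a b" "y \<in> Hom D a b" for x y
        using that ab by (simp add: map_mem closed \<psi>_mem)
      show "\<phi> a b (e a b) \<in> Hom D a b" using map_mem[OF ab] one_closed by simp
      show "\<phi> a b (hadd a b (\<psi> a b (\<phi> a b (hadd a b (\<psi> a b x) (\<psi> a b y)))) (\<psi> a b z)) =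
          \<phi> a b (hadd a b (\<psi> a b x) (\<psi> a b (\<phi> a b (hadd a b (\<psi> a b y) (\<psi> a b z)))))"
        if "x \<in> Hom D a b" "y \<in> Hom D a b" "z \<in> Hom D a b" for x y z
        using that ab m_assoc[of "\<psi> a b x" "\<psi> a b y" "\<psi> a b z"] by (simp add: closed \<psi>_mem \<psi>_map)
      show "\<phi> a b (hadd a b (\<psi> a b x) (\<psi> a b y)) = \<phi> a b (hadd a b (\<psi> a b y) (\<psi> a b x))"
        if "x \<in> Hom D a b" "y \<in> Hom D a b" for x y
        using that ab m_comm[of "\<psi> a b x" "\<psi> a b y"] by (simp add: \<psi>_mem)
      show "\<phi> a b (hadd a b (\<psi> a b (\<phi> a b (e a b))) (\<psi> a b x)) = x" if "x \<in> Hom D a b" for x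
        using that ab l_one[of "\<psi> a b x"] one_closed by (simp add: \<psi>_mem \<psi>_map map_\<psi>)
      show "\<exists>y\<in>Hom D a b. \<phi> a b (hadd a b (\<psi> a b y) (\<psi> a b x)) = \<phi> a b (e a b)" if x: "x \<in> Hom D a b" for x
      proof -
        obtain y where "y \<in> Hom C a b" "hadd a b y (\<psi> a b x) = e a b"
          using l_inv_ex[of "\<psi> a b x"] x ab by (auto simp: \<psi>_mem)
        then show ?thesis using ab by (intro bexI[of _ "\<phi> a b y"]) (simp_all add: \<psi>_map map_mem)
      qed
    qed
  qed
  have distr: "cmp C a b c g (hadd a b f f') = hadd a c (cmp C a b c g f) (cmp C a b c g f')"
      "cmp C a b c (hadd b c g g') f = hadd a c (cmp C a b c g f) (cmp C a b c g' f)"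
    if "a \<in> obj C" "b \<in> obj C" "c \<in> obj C" "f \<in> Hom C a b" "f' \<in> Hom C a b" "g \<in> Hom C b c" "g' \<in> Hom C b c"
    for a b c f f' g g'
    using assms that unfolding preadditive_def by blast+
  show ?thesis
    unfolding preadditive_def obj_eq
    using grp by (auto simp: cat_D ball_Hom \<psi>_map closed distr C_cmp simp flip: map_cmp)
qed

lemma additive_category_map:
  assumes "additive_category C"
  shows "additive_category D"
proof -
  obtain hadd where h: "preadditive C hadd" "\<exists>z. zero_object C z"
     "\<And>a b. a \<in> obj C \<Longrightarrow> b \<in> obj C \<Longrightarrow> \<exists>p. biproduct C hadd a b p"
    using assms unfolding additive_category_def by blast
  have closed: "hadd a b f g \<in> Hom C a b"
    if ab: "a \<in> obj C" "b \<in> obj C" "f \<in> Hom C a b" "g \<in> Hom C a b" for a b f g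
  proof -
    obtain e where "comm_group \<lparr>carrier = Hom C a b, monoid.mult = hadd a b, one = e\<rparr>"
      using h(1) ab unfolding preadditive_def by blast
    then interpret comm_group "\<lparr>carrier = Hom C a b, monoid.mult = hadd a b, one = e\<rparr>" .
    show ?thesis using m_closed that by simp
  qed
  have "biproduct D (\<lambda>a b f g. \<phi> a b (hadd a b (\<psi> a b f) (\<psi> a b g))) a b p"
    if ab: "a \<in> obj C" "b \<in> obj C" and bip: "biproduct C hadd a b p" for a b p
  proof -
    have p: "p \<in> obj C" using bip unfolding biproduct_def by blast
    have id: "ident C x \<in> Hom C x x" if "x \<in> obj C" for x using cat_ident[OF cat_C that] .
    show ?thesis
      using bip unfolding biproduct_def obj_eq using ab p
      by (simp add: bex_Hom \<psi>_map closed C_cmp id map_eq_iff flip: map_cmp map_ident)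
  qed
  then show ?thesis
    unfolding additive_category_def zero_object_iff obj_eq using preadditive_map[OF h(1)] h by blast
qed


text \<open>Data in \<open>D\<close> are carried to \<open>C\<close> by \<open>\<psi>\<close>, the
  problem is solved there, and the answer is carried back by \<open>\<phi>\<close>. For this the
  inverse is interpreted as an isomorphism in its own right.\<close>

lemma deflation_quasi_abelian_map:
  assumes dqa: "deflation_quasi_abelian C"
  shows "deflation_quasi_abelian D"
  unfolding deflation_quasi_abelian_def
proof (intro conjI ballI allI impI)
  interpret inv: category_isomorphism D C \<psi> by (rule inverse)
  show "additive_category D"
    using dqa additive_category_map unfolding deflation_quasi_abelian_def by blast
  show "\<exists>n k. is_kernel D n a b k f" if *: "a \<in> obj D" "b \<in> obj D" "f \<in> Hom D a b" for a b f
  proof -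
    have "\<psi> a b f \<in> Hom C a b" using * \<psi>_mem obj_eq by blast
    then obtain n k where k: "is_kernel C n a b k (\<psi> a b f)"
      using dqa * unfolding deflation_quasi_abelian_def obj_eq by blast
    then have "n \<in> obj C" "k \<in> Hom C n a" unfolding is_kernel_def by blast+
    then have "is_kernel D n a b (\<phi> n a k) (\<phi> a b (\<psi> a b f))"
      using is_kernel_iff[of n a b k "\<psi> a b f"] k * \<psi>_mem obj_eq by blast
    then show ?thesis using * map_\<psi> obj_eq by metis
  qed
  show "\<exists>q c. is_cokernel D a b q f c" if *: "a \<in> obj D" "b \<in> obj D" "f \<in> Hom D a b" for a b f
  proof -
    have "\<psi> a b f \<in> Hom C a b" using * \<psi>_mem obj_eq by blast
    then obtain q c where c: "is_cokernel C a b q (\<psi> a b f) c"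
      using dqa * unfolding deflation_quasi_abelian_def obj_eq by blast
    then have "q \<in> obj C" "c \<in> Hom C b q" unfolding is_cokernel_def by blast+
    then have "is_cokernel D a b q (\<phi> a b (\<psi> a b f)) (\<phi> b q c)"
      using is_cokernel_iff[of a b q "\<psi> a b f" c] c * \<psi>_mem obj_eq by blast
    then show ?thesis using * map_\<psi> obj_eq by metis
  qed
  show "cokernel_map D p b r" if *: "is_pullback D p a b c q r f g \<and> cokernel_map D a c f" for p a b c q r f g
  proof -
    have mem: "p \<in> obj D" "a \<in> obj D" "b \<in> obj D" "c \<in> obj D" "r \<in> Hom D p b" "f \<in> Hom D a c"
      using * unfolding is_pullback_def by blast+
    have "is_pullback C p a b c (\<psi> p a q) (\<psi> p b r) (\<psi> a c f) (\<psi> b c g)"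
      using * inv.is_pullback_map by blast
    moreover have "cokernel_map C a c (\<psi> a c f)"
      using * inv.cokernel_map_iff mem by blast
    ultimately have "cokernel_map C p b (\<psi> p b r)"
      using dqa unfolding deflation_quasi_abelian_def by blast
    then show ?thesis using inv.cokernel_map_iff mem by blast
  qed
qed

definition map_functor :: "('i, 'k, 'o, 'm) functor_data \<Rightarrow> ('i, 'k, 'o, 'n) functor_data" where
  "map_functor E = \<lparr>fobj = fobj E, farr = (\<lambda>i j u. \<phi> (fobj E i) (fobj E j) (farr E i j u))\<rparr>"

lemma fobj_map_functor [simp]: "fobj (map_functor E) = fobj E"
  unfolding map_functor_def by simp

lemma farr_map_functor [simp]: "farr (map_functor E) i j u = \<phi> (fobj E i) (fobj E j) (farr E i j u)"
  unfolding map_functor_def by simp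

lemma is_functor_map:
  assumes "is_functor J C E"
  shows "is_functor J D (map_functor E)"
  using assms unfolding is_functor_def obj_eq by (simp add: map_mem map_ident map_cmp)

lemma is_cocone_map:
  assumes "is_functor J C E" "is_cocone J C E x \<kappa>"
  shows "is_cocone J D (map_functor E) x (\<lambda>i. \<phi> (fobj E i) x (\<kappa> i))"
  using assms unfolding is_functor_def is_cocone_def obj_eq by (simp add: map_mem flip: map_cmp)

text \<open>A competing cocone lives in \<open>D\<close>; it is pulled back along
  \<open>\<psi>\<close> to a cocone in \<open>C\<close>, whose unique factorization is then
  transported by \<open>ex1_Hom\<close>.\<close>

lemma is_colimit_map:
  assumes "is_colimit J C E l \<iota>"
  shows "is_colimit J D (map_functor E) l (\<lambda>i. \<phi> (fobj E i) l (\<iota> i))"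
  unfolding is_colimit_def
proof (intro conjI allI impI)
  interpret inv: category_isomorphism D C \<psi> by (rule inverse)
  have E: "is_functor J C E" and co: "is_cocone J C E l \<iota>"
    and univ: "\<And>x \<kappa>. is_cocone J C E x \<kappa> \<Longrightarrow>
      (\<exists>!h. h \<in> Hom C l x \<and> (\<forall>i\<in>obj J. cmp C (fobj E i) l x h (\<iota> i) = \<kappa> i))"
    using assms unfolding is_colimit_def by blast+
  show "is_functor J D (map_functor E)" using is_functor_map E .
  show "is_cocone J D (map_functor E) l (\<lambda>i. \<phi> (fobj E i) l (\<iota> i))" using is_cocone_map E co .
  fix x \<kappa> assume \<kappa>: "is_cocone J D (map_functor E) x \<kappa>"
  have Eobj: "fobj E i \<in> obj C" if "i \<in> obj J" for i using E that unfolding is_functor_def by blast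
  have Earr: "farr E i j u \<in> Hom C (fobj E i) (fobj E j)" if "i \<in> obj J" "j \<in> obj J" "u \<in> Hom J i j" for i j u
    using E that unfolding is_functor_def by blast
  have x: "x \<in> obj C" and \<kappa>mem: "\<And>i. i \<in> obj J \<Longrightarrow> \<kappa> i \<in> Hom D (fobj E i) x"
    using \<kappa> unfolding is_cocone_def obj_eq by simp_all
  have l: "l \<in> obj C" and \<iota>: "\<And>i. i \<in> obj J \<Longrightarrow> \<iota> i \<in> Hom C (fobj E i) l"
    using co unfolding is_cocone_def by blast+
  have "is_cocone J C E x (\<lambda>i. \<psi> (fobj E i) x (\<kappa> i))"
    unfolding is_cocone_def
  proof (intro conjI ballI)
    show "\<psi> (fobj E i) x (\<kappa> i) \<in> Hom C (fobj E i) x" if "i \<in> obj J" for i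
      using that Eobj x \<kappa>mem by (simp add: \<psi>_mem)
    show "cmp C (fobj E i) (fobj E j) x (\<psi> (fobj E j) x (\<kappa> j)) (farr E i j u) = \<psi> (fobj E i) x (\<kappa> i)"
      if ij: "i \<in> obj J" "j \<in> obj J" "u \<in> Hom J i j" for i j u
    proof -
      have "cmp D (fobj E i) (fobj E j) x (\<kappa> j) (\<phi> (fobj E i) (fobj E j) (farr E i j u)) = \<kappa> i"
        using \<kappa> ij unfolding is_cocone_def by simp
      moreover have "\<psi> (fobj E i) (fobj E j) (\<phi> (fobj E i) (fobj E j) (farr E i j u)) = farr E i j u"
        using \<psi>_map Eobj Earr ij by blast
      ultimately show ?thesis
        using inv.map_cmp[of "fobj E i" "fobj E j" x "\<phi> (fobj E i) (fobj E j) (farr E i j u)" "\<kappa> j"]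
          Eobj Earr x ij \<kappa>mem by (simp add: obj_eq map_mem)
    qed
  qed (rule x)
  then have *: "\<exists>!h. h \<in> Hom C l x \<and> (\<forall>i\<in>obj J. cmp C (fobj E i) l x h (\<iota> i) = \<psi> (fobj E i) x (\<kappa> i))"
    using univ by simp
  have "(\<exists>!h. h \<in> Hom D l x \<and> (\<forall>i\<in>obj J. cmp D (fobj E i) l x h (\<phi> (fobj E i) l (\<iota> i)) = \<kappa> i)) \<longleftrightarrow>
     (\<exists>!h. h \<in> Hom C l x \<and> (\<forall>i\<in>obj J. cmp C (fobj E i) l x h (\<iota> i) = \<psi> (fobj E i) x (\<kappa> i)))"
  proof (rule ex1_Hom[OF l x], rule ball_cong)
    fix h i assume h: "h \<in> Hom C l x" and i: "i \<in> obj J"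
    have "cmp C (fobj E i) l x h (\<iota> i) = \<psi> (fobj E i) x (\<kappa> i) \<longleftrightarrow>
        \<phi> (fobj E i) x (cmp C (fobj E i) l x h (\<iota> i)) = \<phi> (fobj E i) x (\<psi> (fobj E i) x (\<kappa> i))"
      using h i Eobj \<iota> \<kappa>mem l x by (simp add: map_eq_iff C_cmp \<psi>_mem)
    then show "cmp C (fobj E i) l x h (\<iota> i) = \<psi> (fobj E i) x (\<kappa> i) \<longleftrightarrow>
        cmp D (fobj E i) l x (\<phi> l x h) (\<phi> (fobj E i) l (\<iota> i)) = \<kappa> i"
      using h i Eobj \<iota> \<kappa>mem l x by (simp add: map_cmp map_\<psi>)
  qed simp
  then show "\<exists>!h. h \<in> Hom D l x \<and> (\<forall>i\<in>obj J. cmp D (fobj (map_functor E) i) l x h (\<phi> (fobj E i) l (\<iota> i)) = \<kappa> i)"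
    using * by simp
qed

text \<open>Lets a colimit found in \<open>C\<close> for the translated diagram count, after
  translation back, as a colimit of the original diagram in \<open>D\<close>.\<close>

lemma map_functor_inverse:
  assumes "is_functor J D E" "is_category J" "is_colimit J D (map_functor (category_isomorphism.map_functor \<psi> E)) l \<iota>"
  shows "is_colimit J D E l \<iota>"
  using assms(3,2)
proof (rule is_colimit_cong)
  interpret inv: category_isomorphism D C \<psi> by (rule inverse)
  show "fobj E i = fobj (map_functor (inv.map_functor E)) i" for i by simp
  show "farr E i j u = farr (map_functor (inv.map_functor E)) i j u"
    if "i \<in> obj J" "j \<in> obj J" "u \<in> Hom J i j" for i j u
  proof -
    have "fobj E i \<in> obj C" "fobj E j \<in> obj C" "farr E i j u \<in> Hom D (fobj E i) (fobj E j)"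
      using assms that unfolding is_functor_def obj_eq by blast+
    then show ?thesis by (simp add: map_\<psi>)
  qed
qed simp

lemma has_filtered_colimits_map:
  assumes "has_filtered_colimits TYPE('u) C"
  shows "has_filtered_colimits TYPE('u) D"
  unfolding has_filtered_colimits_def
proof (intro allI impI)
  interpret inv: category_isomorphism D C \<psi> by (rule inverse)
  fix J :: "('u, 'u) category" and E
  assume *: "small_filtered J \<and> is_functor J D E"
  obtain l \<iota> where "is_colimit J C (inv.map_functor E) l \<iota>"
    using assms * inv.is_functor_map unfolding has_filtered_colimits_def by blast
  then have "is_colimit J D (map_functor (inv.map_functor E)) l (\<lambda>i. \<phi> (fobj E i) l (\<iota> i))"
    using is_colimit_map by fastforce
  then have "is_colimit J D E l (\<lambda>i. \<phi> (fobj E i) l (\<iota> i))"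
    using map_functor_inverse * unfolding small_filtered_def filtered_def by blast
  then show "\<exists>l \<iota>. is_colimit J D E l \<iota>" by blast
qed

text \<open>The diagrams to be tested live in \<open>D\<close>. They are pulled back to
  \<open>C\<close> together with their colimits, and both clauses of
  \<open>bij_betw_canonical_map_iff\<close> are translated on representatives.\<close>

lemma finitely_presentable_map:
  assumes fp: "finitely_presentable TYPE('u) C x"
  shows "finitely_presentable TYPE('u) D x"
  unfolding finitely_presentable_def
proof (intro conjI allI impI)
  interpret inv: category_isomorphism D C \<psi> by (rule inverse)
  have x: "x \<in> obj C" using fp unfolding finitely_presentable_def by blast
  then show "x \<in> obj D" by (simp add: obj_eq)
  fix J :: "('u, 'u) category" and E l \<iota>
  assume *: "small_filtered J \<and> is_colimit J D E l \<iota>"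
  then have J: "filtered J" and E: "is_functor J D E" and co: "is_cocone J D E l \<iota>"
    and col: "is_colimit J D E l \<iota>"
    unfolding small_filtered_def is_colimit_def by blast+
  let ?E = "inv.map_functor E" and ?\<iota> = "\<lambda>i. \<psi> (fobj E i) l (\<iota> i)"
  have l: "l \<in> obj C" and \<iota>: "\<And>i. i \<in> obj J \<Longrightarrow> \<iota> i \<in> Hom D (fobj E i) l"
    using co unfolding is_cocone_def obj_eq by blast+
  have Eobj: "fobj E i \<in> obj C" if "i \<in> obj J" for i using E that unfolding is_functor_def obj_eq by blast
  have Earr: "farr E i j u \<in> Hom D (fobj E i) (fobj E j)" if "i \<in> obj J" "j \<in> obj J" "u \<in> Hom J i j" for i j u
    using E that unfolding is_functor_def by blast
  have col': "is_colimit J C ?E l ?\<iota>"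
    using inv.is_colimit_map col by blast
  then have "bij_betw (canonical_map C ?E x l ?\<iota>) (hom_union J C ?E x // hom_rel J C ?E x) (Hom C x l)"
    using fp * unfolding finitely_presentable_def by blast
  then have S: "\<forall>f\<in>Hom C x l. \<exists>i\<in>obj J. \<exists>g\<in>Hom C x (fobj E i). cmp C x (fobj E i) l (?\<iota> i) g = f"
    and I: "\<And>i j f g. i \<in> obj J \<Longrightarrow> j \<in> obj J \<Longrightarrow> f \<in> Hom C x (fobj E i) \<Longrightarrow> g \<in> Hom C x (fobj E j) \<Longrightarrow>
      cmp C x (fobj E i) l (?\<iota> i) f = cmp C x (fobj E j) l (?\<iota> j) g \<Longrightarrow>
      (\<exists>k\<in>obj J. \<exists>u\<in>Hom J i k. \<exists>v\<in>Hom J j k.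
        cmp C x (fobj E i) (fobj E k) (\<psi> (fobj E i) (fobj E k) (farr E i k u)) f =
        cmp C x (fobj E j) (fobj E k) (\<psi> (fobj E j) (fobj E k) (farr E j k v)) g)"
    unfolding bij_betw_canonical_map_iff[OF J cat_C col' x] by auto
  have \<iota>_cmp: "\<phi> x l (cmp C x (fobj E i) l (?\<iota> i) g) = cmp D x (fobj E i) l (\<iota> i) (\<phi> x (fobj E i) g)"
    if "i \<in> obj J" "g \<in> Hom C x (fobj E i)" for i g
    using that x l \<iota> Eobj by (simp add: map_cmp \<psi>_mem map_\<psi>)
  have E_cmp: "\<phi> x (fobj E k) (cmp C x (fobj E i) (fobj E k) (\<psi> (fobj E i) (fobj E k) (farr E i k u)) f) =
      cmp D x (fobj E i) (fobj E k) (farr E i k u) (\<phi> x (fobj E i) f)"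
    if "i \<in> obj J" "k \<in> obj J" "u \<in> Hom J i k" "f \<in> Hom C x (fobj E i)" for i k u f
    using that x Eobj Earr by (simp add: map_cmp \<psi>_mem map_\<psi>)
  show "bij_betw (canonical_map D E x l \<iota>) (hom_union J D E x // hom_rel J D E x) (Hom D x l)"
    unfolding bij_betw_canonical_map_iff[OF J cat_D col \<open>x \<in> obj D\<close>]
  proof (intro conjI ballI impI)
    fix f assume "f \<in> Hom D x l"
    then obtain f' where f': "f = \<phi> x l f'" "f' \<in> Hom C x l" using Hom_D x l by blast
    obtain i g where "i \<in> obj J" "g \<in> Hom C x (fobj E i)" "cmp C x (fobj E i) l (?\<iota> i) g = f'"
      using S f'(2) by blast
    then show "\<exists>i\<in>obj J. \<exists>g\<in>Hom D x (fobj E i). cmp D x (fobj E i) l (\<iota> i) g = f"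
      using \<iota>_cmp[of i g] f' map_mem x Eobj by metis
  next
    fix i j f g assume ij: "i \<in> obj J" "j \<in> obj J" and fg: "f \<in> Hom D x (fobj E i)" "g \<in> Hom D x (fobj E j)"
      and eq: "cmp D x (fobj E i) l (\<iota> i) f = cmp D x (fobj E j) l (\<iota> j) g"
    obtain f' where f': "f = \<phi> x (fobj E i) f'" "f' \<in> Hom C x (fobj E i)" using Hom_D x Eobj ij fg by blast
    obtain g' where g': "g = \<phi> x (fobj E j) g'" "g' \<in> Hom C x (fobj E j)" using Hom_D x Eobj ij fg by blast
    have "cmp C x (fobj E i) l (?\<iota> i) f' \<in> Hom C x l" "cmp C x (fobj E j) l (?\<iota> j) g' \<in> Hom C x l"
      using ij f' g' x l Eobj \<iota> by (simp_all add: C_cmp \<psi>_mem)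
    then have "cmp C x (fobj E i) l (?\<iota> i) f' = cmp C x (fobj E j) l (?\<iota> j) g'"
      using eq \<iota>_cmp ij f' g' map_eq_iff x l by metis
    then obtain k u v where k: "k \<in> obj J" "u \<in> Hom J i k" "v \<in> Hom J j k"
      "cmp C x (fobj E i) (fobj E k) (\<psi> (fobj E i) (fobj E k) (farr E i k u)) f' =
        cmp C x (fobj E j) (fobj E k) (\<psi> (fobj E j) (fobj E k) (farr E j k v)) g'"
      using I ij f' g' by blast
    then have "cmp D x (fobj E i) (fobj E k) (farr E i k u) f = cmp D x (fobj E j) (fobj E k) (farr E j k v) g"
      using E_cmp ij f' g' by metis
    then show "\<exists>k\<in>obj J. \<exists>u\<in>Hom J i k. \<exists>v\<in>Hom J j k.
        cmp D x (fobj E i) (fobj E k) (farr E i k u) f = cmp D x (fobj E j) (fobj E k) (farr E j k v) g"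
      using k by blast
  qed
qed

lemma locally_presentable_map:
  assumes lp: "locally_presentable TYPE('u) C"
  shows "locally_presentable TYPE('u) D"
  unfolding locally_presentable_def
proof (intro conjI ballI)
  show "has_filtered_colimits TYPE('u) D"
    using lp has_filtered_colimits_map unfolding locally_presentable_def by blast
  fix x assume "x \<in> obj D"
  then obtain J :: "('u, 'u) category" and E \<iota> where *: "small_filtered J"
    "\<forall>i\<in>obj J. finitely_presentable TYPE('u) C (fobj E i)" "is_colimit J C E x \<iota>"
    using lp unfolding locally_presentable_def obj_eq by blast
  then have "\<forall>i\<in>obj J. finitely_presentable TYPE('u) D (fobj (map_functor E) i)"
    using finitely_presentable_map[where ?'u = 'u] by simp
  then show "\<exists>(J :: ('u, 'u) category) D' \<iota>. small_filtered J \<and>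
      (\<forall>i\<in>obj J. finitely_presentable TYPE('u) D (fobj D' i)) \<and> is_colimit J D D' x \<iota>"
    using * is_colimit_map by blast
qed

lemma conflation_iff:
  assumes "a \<in> obj C" "b \<in> obj C" "c \<in> obj C" "f \<in> Hom C a b" "g \<in> Hom C b c"
  shows "conflation D a b c (\<phi> a b f) (\<phi> b c g) \<longleftrightarrow> conflation C a b c f g"
  unfolding conflation_def using assms is_kernel_iff is_cokernel_iff by simp

lemma exact_filtered_colimits_map:
  assumes ex: "exact_filtered_colimits TYPE('u) C"
  shows "exact_filtered_colimits TYPE('u) D"
  unfolding exact_filtered_colimits_def
proof (intro allI impI)
  interpret inv: category_isomorphism D C \<psi> by (rule inverse)
  fix J :: "('u, 'u) category" and A B E f g a \<alpha> b \<beta> e \<epsilon> f' g'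
  assume *: "small_filtered J \<and>
      is_colimit J D A a \<alpha> \<and> is_colimit J D B b \<beta> \<and> is_colimit J D E e \<epsilon> \<and>
      f \<in> nat_trans J D A B \<and> g \<in> nat_trans J D B E \<and>
      (\<forall>j\<in>obj J. conflation D (fobj A j) (fobj B j) (fobj E j) (f j) (g j)) \<and>
      f' \<in> Hom D a b \<and> g' \<in> Hom D b e \<and>
      (\<forall>j\<in>obj J.
        cmp D (fobj A j) a b f' (\<alpha> j) = cmp D (fobj A j) (fobj B j) b (\<beta> j) (f j) \<and>
        cmp D (fobj B j) b e g' (\<beta> j) = cmp D (fobj B j) (fobj E j) e (\<epsilon> j) (g j))"
  \<comment> \<open>The families are restricted to \<open>obj J\<close> because members of
    \<open>nat_trans\<close> are extensional.\<close>
  let ?f = "\<lambda>j\<in>obj J. \<psi> (fobj A j) (fobj B j) (f j)" and ?g = "\<lambda>j\<in>obj J. \<psi> (fobj B j) (fobj E j) (g j)"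
  have nat: "(\<lambda>j\<in>obj J. \<psi> (fobj X j) (fobj Y j) (h j)) \<in> nat_trans J C (inv.map_functor X) (inv.map_functor Y)"
    if h: "h \<in> nat_trans J D X Y" and X: "is_functor J D X" and Y: "is_functor J D Y" for h X Y
  proof -
    have o: "fobj X j \<in> obj D" "fobj Y j \<in> obj D" "h j \<in> Hom D (fobj X j) (fobj Y j)" if "j \<in> obj J" for j
      using h X Y that unfolding is_functor_def nat_trans_def by (auto simp: PiE_iff)
    have r: "farr X i j u \<in> Hom D (fobj X i) (fobj X j)" "farr Y i j u \<in> Hom D (fobj Y i) (fobj Y j)"
      "cmp D (fobj X i) (fobj X j) (fobj Y j) (h j) (farr X i j u) =
        cmp D (fobj X i) (fobj Y i) (fobj Y j) (farr Y i j u) (h i)"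
      if "i \<in> obj J" "j \<in> obj J" "u \<in> Hom J i j" for i j u
      using h X Y that unfolding is_functor_def nat_trans_def by auto
    show ?thesis
      unfolding nat_trans_def using o r by (auto simp: inv.map_mem simp flip: inv.map_cmp)
  qed
  have fun_of: "is_functor J D A" "is_functor J D B" "is_functor J D E"
    using * unfolding is_colimit_def by blast+
  have objs: "fobj A j \<in> obj D" "fobj B j \<in> obj D" "fobj E j \<in> obj D" if "j \<in> obj J" for j
    using fun_of that functor_obj by metis+
  have colim: "is_colimit J D A a \<alpha>" "is_colimit J D B b \<beta>" "is_colimit J D E e \<epsilon>"
    using * by blast+
  note cc = colim[THEN colimit_cocone]
  note lim = cc[THEN cocone_obj] and legs = cc[THEN cocone_leg]
  have fg: "f j \<in> Hom D (fobj A j) (fobj B j)" "g j \<in> Hom D (fobj B j) (fobj E j)" if "j \<in> obj J" for j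
    using * that nat_trans_component by metis+
  have "conflation C (fobj A j) (fobj B j) (fobj E j) (?f j) (?g j)" if "j \<in> obj J" for j
    using inv.conflation_iff[OF objs[OF that] fg[OF that]] * that by simp
  moreover have "cmp C (fobj A j) a b (\<psi> a b f') (\<psi> (fobj A j) a (\<alpha> j)) =
        cmp C (fobj A j) (fobj B j) b (\<psi> (fobj B j) b (\<beta> j)) (?f j) \<and>
      cmp C (fobj B j) b e (\<psi> b e g') (\<psi> (fobj B j) b (\<beta> j)) =
        cmp C (fobj B j) (fobj E j) e (\<psi> (fobj E j) e (\<epsilon> j)) (?g j)" if "j \<in> obj J" for j
    using * that objs legs lim fg by (simp flip: inv.map_cmp)
  moreover have "?f \<in> nat_trans J C (inv.map_functor A) (inv.map_functor B)"
    "?g \<in> nat_trans J C (inv.map_functor B) (inv.map_functor E)"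
    using nat * fun_of by blast+
  moreover have "is_colimit J C (inv.map_functor A) a (\<lambda>j. \<psi> (fobj A j) a (\<alpha> j))"
      "is_colimit J C (inv.map_functor B) b (\<lambda>j. \<psi> (fobj B j) b (\<beta> j))"
      "is_colimit J C (inv.map_functor E) e (\<lambda>j. \<psi> (fobj E j) e (\<epsilon> j))"
    using * inv.is_colimit_map by blast+
  moreover have "\<psi> a b f' \<in> Hom C a b" "\<psi> b e g' \<in> Hom C b e"
    using * lim inv.map_mem by blast+
  ultimately have "conflation C a b e (\<psi> a b f') (\<psi> b e g')"
    using * ex[unfolded exact_filtered_colimits_def, rule_format, of J "inv.map_functor A" a
        "\<lambda>j. \<psi> (fobj A j) a (\<alpha> j)" "inv.map_functor B" b "\<lambda>j. \<psi> (fobj B j) b (\<beta> j)"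
        "inv.map_functor E" e "\<lambda>j. \<psi> (fobj E j) e (\<epsilon> j)" ?f ?g "\<psi> a b f'" "\<psi> b e g'"] by simp
  then show "conflation D a b e f' g'"
    using inv.conflation_iff lim * by blast
qed

lemma grothendieck_deflation_quasi_abelian_map:
  "grothendieck_deflation_quasi_abelian TYPE('u) C \<Longrightarrow> grothendieck_deflation_quasi_abelian TYPE('u) D"
  unfolding grothendieck_deflation_quasi_abelian_def
  using deflation_quasi_abelian_map locally_presentable_map exact_filtered_colimits_map by blast

end

section \<open>Calculus of right fractions\<close>

section \<open>Localization at the morphisms inverted by a functor\<close>

definition is_iso_in :: "('o, 'm) category \<Rightarrow> 'o \<Rightarrow> 'o \<Rightarrow> 'm \<Rightarrow> bool" where
  "is_iso_in C a b f \<longleftrightarrow>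
    (\<exists>g\<in>Hom C b a. cmp C a b a g f = ident C a \<and> cmp C b a b f g = ident C b)"

lemma is_zigzag_obj: "is_zigzag C S a p b \<Longrightarrow> a \<in> obj C \<and> b \<in> obj C"
  by (induction C S a p b rule: is_zigzag.induct) auto

lemma is_zigzag_append: "is_zigzag C S a p b \<Longrightarrow> is_zigzag C S b q c \<Longrightarrow> is_zigzag C S a (p @ q) c"
  by (induction C S a p b rule: is_zigzag.induct) auto

text \<open>
  A functor that is the identity on objects and that is full and faithful up to precomposition
  with members of the class \<open>S\<close> of morphisms it inverts.
\<close>

locale localizing_functor =
  fixes C :: "('o, 'm) category" and D :: "('o, 'n) category"
    and \<phi> :: "'o \<Rightarrow> 'o \<Rightarrow> 'm \<Rightarrow> 'n" and S :: "'o \<Rightarrow> 'o \<Rightarrow> 'm set"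
  assumes cat_C: "is_category C" and cat_D: "is_category D" and obj_eq: "obj D = obj C"
    and map_mem: "a \<in> obj C \<Longrightarrow> b \<in> obj C \<Longrightarrow> f \<in> Hom C a b \<Longrightarrow> \<phi> a b f \<in> Hom D a b"
    and map_ident: "a \<in> obj C \<Longrightarrow> \<phi> a a (ident C a) = ident D a"
    and map_cmp: "a \<in> obj C \<Longrightarrow> b \<in> obj C \<Longrightarrow> c \<in> obj C \<Longrightarrow> f \<in> Hom C a b \<Longrightarrow> g \<in> Hom C b c \<Longrightarrow>
      \<phi> a c (cmp C a b c g f) = cmp D a b c (\<phi> b c g) (\<phi> a b f)"
    and S_iff: "a \<in> obj C \<Longrightarrow> b \<in> obj C \<Longrightarrow> f \<in> S a b \<longleftrightarrow> f \<in> Hom C a b \<and> is_iso_in D a b (\<phi> a b f)"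
    and full: "a \<in> obj C \<Longrightarrow> b \<in> obj C \<Longrightarrow> h \<in> Hom D a b \<Longrightarrow>
      \<exists>p\<in>obj C. \<exists>s\<in>S p a. \<exists>f\<in>Hom C p b. cmp D p a b h (\<phi> p a s) = \<phi> p b f"
    and faithful: "a \<in> obj C \<Longrightarrow> b \<in> obj C \<Longrightarrow> f \<in> Hom C a b \<Longrightarrow> g \<in> Hom C a b \<Longrightarrow>
      \<phi> a b f = \<phi> a b g \<Longrightarrow> \<exists>p\<in>obj C. \<exists>s\<in>S p a. cmp C p a b f s = cmp C p a b g s"
begin

lemmas zz_refl = zigzag_eq.refl[where C = C and S = S]
  and zz_sym = zigzag_eq.sym[where C = C and S = S]
  and zz_trans = zigzag_eq.trans[where C = C and S = S]
  and zz_append = zigzag_eq.append[where C = C and S = S]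
  and zz_cmp = zigzag_eq.cmp[where C = C and S = S]
  and zz_fwd_bwd = zigzag_eq.fwd_bwd[where C = C and S = S]
  and zz_bwd_fwd = zigzag_eq.bwd_fwd[where C = C and S = S]

declare zz_trans [trans]

lemmas C_cmp = cat_cmp[OF cat_C] and C_assoc = cat_assoc[OF cat_C] and C_ident = cat_ident[OF cat_C]
lemmas D_cmp = cat_cmp[OF cat_D, unfolded obj_eq] and D_assoc = cat_assoc[OF cat_D, unfolded obj_eq]
  and D_ident = cat_ident[OF cat_D, unfolded obj_eq]
  and D_ident_left = cat_ident_left[OF cat_D, unfolded obj_eq]
  and D_ident_right = cat_ident_right[OF cat_D, unfolded obj_eq]

lemma S_Hom: "a \<in> obj C \<Longrightarrow> b \<in> obj C \<Longrightarrow> s \<in> S a b \<Longrightarrow> s \<in> Hom C a b"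
  using S_iff by blast

definition inverse :: "'o \<Rightarrow> 'o \<Rightarrow> 'm \<Rightarrow> 'n" where
  "inverse a b s = (SOME g. g \<in> Hom D b a \<and> cmp D a b a g (\<phi> a b s) = ident D a \<and>
    cmp D b a b (\<phi> a b s) g = ident D b)"

lemma inverse:
  assumes "a \<in> obj C" "b \<in> obj C" "s \<in> S a b"
  shows "inverse a b s \<in> Hom D b a" "cmp D a b a (inverse a b s) (\<phi> a b s) = ident D a"
    "cmp D b a b (\<phi> a b s) (inverse a b s) = ident D b"
proof -
  have "\<exists>g. g \<in> Hom D b a \<and> cmp D a b a g (\<phi> a b s) = ident D a \<and> cmp D b a b (\<phi> a b s) g = ident D b"
    using assms S_iff unfolding is_iso_in_def by blast
  from someI_ex[OF this] show "inverse a b s \<in> Hom D b a" "cmp D a b a (inverse a b s) (\<phi> a b s) = ident D a"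
    "cmp D b a b (\<phi> a b s) (inverse a b s) = ident D b"
    unfolding inverse_def by blast+
qed

lemma S_ident: "a \<in> obj C \<Longrightarrow> ident C a \<in> S a a"
  using S_iff C_ident D_ident D_ident_left map_ident unfolding is_iso_in_def by metis

lemma S_cmp:
  assumes "a \<in> obj C" "b \<in> obj C" "c \<in> obj C" "s \<in> S a b" "t \<in> S b c"
  shows "cmp C a b c t s \<in> S a c"
proof -
  let ?s = "inverse a b s" and ?t = "inverse b c t"
  note i = inverse[OF assms(1,2,4)] inverse[OF assms(2,3,5)]
  note h = S_Hom[OF assms(1,2,4)] S_Hom[OF assms(2,3,5)]
  note m = map_mem[OF assms(1,2) h(1)] map_mem[OF assms(2,3) h(2)]
  have "cmp D a c a (cmp D c b a ?s ?t) (cmp D a b c (\<phi> b c t) (\<phi> a b s)) =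
      cmp D a b a ?s (cmp D a b b (cmp D b c b ?t (\<phi> b c t)) (\<phi> a b s))"
    using assms(1-3) i(1,4) m D_assoc D_cmp by metis
  also have "\<dots> = ident D a" using i(2,5) D_ident_left[OF assms(1,2) m(1)] by simp
  finally have 1: "cmp D a c a (cmp D c b a ?s ?t) (cmp D a b c (\<phi> b c t) (\<phi> a b s)) = ident D a" .
  have "cmp D c a c (cmp D a b c (\<phi> b c t) (\<phi> a b s)) (cmp D c b a ?s ?t) =
      cmp D c b c (\<phi> b c t) (cmp D c b b (cmp D b a b (\<phi> a b s) ?s) ?t)"
    using assms(1-3) i(1,4) m D_assoc D_cmp by metis
  also have "\<dots> = ident D c" using i(3,6) D_ident_left[OF assms(3,2) i(4)] by simp
  finally have 2: "cmp D c a c (cmp D a b c (\<phi> b c t) (\<phi> a b s)) (cmp D c b a ?s ?t) = ident D c" .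
  have "cmp D c b a ?s ?t \<in> Hom D c a" using D_cmp[OF assms(3,2,1) i(4,1)] .
  then show ?thesis
    using S_iff[OF assms(1,3)] C_cmp[OF assms(1-3) h] 1 2 map_cmp[OF assms(1-3) h]
    unfolding is_iso_in_def by metis
qed

text \<open>The functor out of the localization that \<open>\<phi>\<close> induces, before passing
  to classes. The first step of a path is traversed first, so it becomes the innermost factor of the
  composite.\<close>

fun eval_zigzag :: "'o \<Rightarrow> ('o, 'm) step list \<Rightarrow> 'n" where
  "eval_zigzag b [] = ident D b"
| "eval_zigzag b (Fwd x y f # p) = cmp D x y b (eval_zigzag b p) (\<phi> x y f)"
| "eval_zigzag b (Bwd x y s # p) = cmp D y x b (eval_zigzag b p) (inverse x y s)"

lemma eval_zigzag_mem: "is_zigzag C S a p b \<Longrightarrow> eval_zigzag b p \<in> Hom D a b"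
proof (induction p arbitrary: a)
  case Nil
  then show ?case by (auto intro: D_ident)
next
  case (Cons st p)
  show ?case
  proof (cases st)
    case (Fwd x y f)
    then show ?thesis using Cons is_zigzag_obj[of C S y p b] by (auto intro!: D_cmp map_mem)
  next
    case (Bwd x y s)
    then show ?thesis using Cons is_zigzag_obj[of C S x p b] by (auto intro!: D_cmp inverse)
  qed
qed

lemma eval_zigzag_append:
  "is_zigzag C S a p b \<Longrightarrow> is_zigzag C S b q c \<Longrightarrow>
    eval_zigzag c (p @ q) = cmp D a b c (eval_zigzag c q) (eval_zigzag b p)"
proof (induction p arbitrary: a)
  case Nil
  then show ?case using D_ident_right eval_zigzag_mem is_zigzag_obj by fastforce
next
  case (Cons st p)
  have c: "c \<in> obj C" "b \<in> obj C" using Cons(3) is_zigzag_obj by fast+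
  have q: "eval_zigzag c q \<in> Hom D b c" using Cons(3) eval_zigzag_mem by blast
  show ?case
  proof (cases st)
    case (Fwd x y f)
    then have *: "x = a" "a \<in> obj C" "y \<in> obj C" "f \<in> Hom C a y" "is_zigzag C S y p b" using Cons(2) by auto
    then show ?thesis
      unfolding Fwd using Cons(1)[OF *(5) Cons(3)] c q eval_zigzag_mem[OF *(5)] map_mem[OF *(2-4)]
      by (simp add: D_assoc)
  next
    case (Bwd x y s)
    then have *: "y = a" "x \<in> obj C" "a \<in> obj C" "s \<in> S x a" "is_zigzag C S x p b" using Cons(2) by auto
    then show ?thesis
      unfolding Bwd using Cons(1)[OF *(5) Cons(3)] c q eval_zigzag_mem[OF *(5)] inverse[OF *(2-4)]
      by (simp add: D_assoc)
  qed
qed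

lemma zigzag_eq_is_zigzag: "zigzag_eq C S a b p q \<Longrightarrow> is_zigzag C S a p b \<and> is_zigzag C S a q b"
  by (induction rule: zigzag_eq.induct)
    (auto intro: is_zigzag_append C_ident C_cmp S_Hom)

text \<open>Each generating relation holds in \<open>D\<close> because \<open>\<phi>\<close> is
  functorial and sends \<open>S\<close> to isomorphisms. Hence the value is well defined on classes
  of zigzags.\<close>

lemma zigzag_eq_eval: "zigzag_eq C S a b p q \<Longrightarrow> eval_zigzag b p = eval_zigzag b q"
proof (induction rule: zigzag_eq.induct)
  case (append a b p p' c q q')
  then show ?case using eval_zigzag_append zigzag_eq_is_zigzag by metis
next
  case (ident a)
  then show ?case using map_ident D_ident_left D_ident by simp
next
  case (cmp a b c f g)
  then show ?case using map_cmp D_ident_left map_mem D_cmp by simp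
next
  case (fwd_bwd a b s)
  then show ?case using inverse D_ident_left by simp
next
  case (bwd_fwd a b s)
  then show ?case using inverse D_ident_left map_mem S_Hom by simp
qed auto

lemma zigzag_eq_left: "zigzag_eq C S a b p p' \<Longrightarrow> is_zigzag C S b q c \<Longrightarrow> zigzag_eq C S a c (p @ q) (p' @ q)"
  by (intro zz_append zz_refl)

lemma zigzag_eq_right: "is_zigzag C S a p b \<Longrightarrow> zigzag_eq C S b c q q' \<Longrightarrow> zigzag_eq C S a c (p @ q) (p @ q')"
  by (intro zz_append zz_refl)

text \<open>Insert \<open>s\<close> followed by its formal inverse after \<open>t\<close>: then
  \<open>t\<close> and \<open>s\<close> merge into the composite, which cancels against its own
  formal inverse. The factor \<open>t\<close> may be any morphism whose composite with
  \<open>s\<close> lies in \<open>S\<close>.\<close>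

lemma zigzag_eq_Bwd:
  assumes o: "a \<in> obj C" "m \<in> obj C" "n \<in> obj C" and s: "s \<in> S m a" and t: "t \<in> Hom C n m"
    and st: "cmp C n m a s t \<in> S n a"
  shows "zigzag_eq C S a m [Bwd n a (cmp C n m a s t), Fwd n m t] [Bwd m a s]"
proof -
  let ?st = "cmp C n m a s t"
  have sH: "s \<in> Hom C m a" using S_Hom o s by blast
  have "zigzag_eq C S a m ([Bwd n a ?st, Fwd n m t] @ []) ([Bwd n a ?st, Fwd n m t] @ [Fwd m a s, Bwd m a s])"
    by (rule zigzag_eq_right[where b = m], use o t st in simp)
      (rule zz_sym[OF zz_fwd_bwd[OF o(2,1) s]])
  also have "zigzag_eq C S a m \<dots> ([Bwd n a ?st] @ ([Fwd n a ?st] @ [Bwd m a s]))"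
    using zigzag_eq_right[OF _ zigzag_eq_left[OF zz_cmp[OF o(3,2,1) t sH]], of a "[Bwd n a ?st]" "[Bwd m a s]" m]
      o s st by simp
  also have "zigzag_eq C S a m \<dots> ([] @ [Bwd m a s])"
    using zigzag_eq_left[OF zz_bwd_fwd[OF o(3,1) st], of "[Bwd m a s]" m] o s by simp
  finally show ?thesis by simp
qed

text \<open>Expansion of a fraction by \<open>t\<close>, obtained from \<open>zigzag_eq_Bwd\<close>
  by appending the numerator. It serves to bring two fractions to a common denominator.\<close>

lemma zigzag_eq_fraction:
  assumes o: "a \<in> obj C" "b \<in> obj C" "m \<in> obj C" "n \<in> obj C" and s: "s \<in> S m a" and t: "t \<in> Hom C n m"
    and f: "f \<in> Hom C m b" and st: "cmp C n m a s t \<in> S n a"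
  shows "zigzag_eq C S a b [Bwd m a s, Fwd m b f] [Bwd n a (cmp C n m a s t), Fwd n b (cmp C n m b f t)]"
proof -
  let ?st = "cmp C n m a s t"
  have "zigzag_eq C S a b ([Bwd m a s] @ [Fwd m b f]) ([Bwd n a ?st, Fwd n m t] @ [Fwd m b f])"
    by (rule zigzag_eq_left[OF zz_sym[OF zigzag_eq_Bwd[OF o(1,3,4) s t st]]]) (use o f in simp)
  also have "zigzag_eq C S a b \<dots> ([Bwd n a ?st] @ [Fwd n b (cmp C n m b f t)])"
    using zigzag_eq_right[OF _ zz_cmp[OF o(4,3,2) t f], of a "[Bwd n a ?st]"] o st by simp
  finally show ?thesis by simp
qed

text \<open>The right Ore condition. The composite of \<open>g\<close> with the inverse of
  \<open>s\<close> exists in \<open>D\<close>; fullness up to \<open>S\<close> realizes it by some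
  \<open>g'\<close> over some \<open>t\<close>. The resulting square commutes only after
  \<open>\<phi>\<close>, and faithfulness up to \<open>S\<close> repairs this by one more
  precomposition.\<close>

lemma ore:
  assumes o: "x \<in> obj C" "y \<in> obj C" "m \<in> obj C" and g: "g \<in> Hom C x y" and s: "s \<in> S m y"
  obtains q t g' where "q \<in> obj C" "t \<in> S q x" "g' \<in> Hom C q m" "cmp C q m y s g' = cmp C q x y g t"
proof -
  note i = inverse[OF o(3,2) s] and sH = S_Hom[OF o(3,2) s]
  have "cmp D x y m (inverse m y s) (\<phi> x y g) \<in> Hom D x m"
    using D_cmp o i map_mem g by blast
  then obtain p t g' where p: "p \<in> obj C" "t \<in> S p x" "g' \<in> Hom C p m"
    "cmp D p x m (cmp D x y m (inverse m y s) (\<phi> x y g)) (\<phi> p x t) = \<phi> p m g'"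
    using full[OF o(1,3)] by blast
  have tH: "t \<in> Hom C p x" using S_Hom p o by blast
  have mem: "\<phi> p x t \<in> Hom D p x" "\<phi> x y g \<in> Hom D x y" "\<phi> m y s \<in> Hom D m y"
    using map_mem o p g sH tH by blast+
  have "cmp D p m y (\<phi> m y s) (\<phi> p m g') = cmp D p y y (cmp D y m y (\<phi> m y s) (inverse m y s)) (cmp D p x y (\<phi> x y g) (\<phi> p x t))"
    unfolding p(4)[symmetric] using D_assoc D_cmp o p(1) i(1) mem by metis
  also have "\<dots> = cmp D p x y (\<phi> x y g) (\<phi> p x t)"
    unfolding i(3) using D_ident_left D_cmp o p(1) mem by metis
  finally have "\<phi> p y (cmp C p m y s g') = \<phi> p y (cmp C p x y g t)"
    using map_cmp o p sH g tH by simp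
  moreover have "cmp C p m y s g' \<in> Hom C p y" "cmp C p x y g t \<in> Hom C p y"
    using C_cmp o p sH g tH by blast+
  ultimately obtain q v where q: "q \<in> obj C" "v \<in> S q p"
    "cmp C q p y (cmp C p m y s g') v = cmp C q p y (cmp C p x y g t) v"
    using faithful p(1) o(2) by blast
  have vH: "v \<in> Hom C q p" using S_Hom q p by blast
  show ?thesis
  proof (rule that[OF q(1)])
    show "cmp C q p x t v \<in> S q x" using S_cmp q p o by blast
    show "cmp C q p m g' v \<in> Hom C q m" using C_cmp q p o vH by blast
    show "cmp C q m y s (cmp C q p m g' v) = cmp C q x y g (cmp C q p x t v)"
      using q(3) C_assoc q(1) p(1,3) o vH sH g tH by simp
  qed
qed

text \<open>Induction from the end of the path. A leading forward step is moved past the denominator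
  of the remaining fraction by \<open>ore\<close>; a leading backward step is absorbed into that
  denominator, as \<open>S\<close> is closed under composition.\<close>

lemma zigzag_fraction:
  assumes "is_zigzag C S a p b"
  shows "\<exists>m\<in>obj C. \<exists>s\<in>S m a. \<exists>f\<in>Hom C m b. zigzag_eq C S a b p [Bwd m a s, Fwd m b f]"
  using assms
proof (induction p arbitrary: a)
  case Nil
  then have "a \<in> obj C" "a = b" by auto
  then have "zigzag_eq C S a b [] [Bwd a a (ident C a), Fwd a b (ident C a)]"
    using zz_sym[OF zz_bwd_fwd[of a a "ident C a"]] S_ident by simp
  then show ?case using S_ident C_ident \<open>a \<in> obj C\<close> \<open>a = b\<close> by blast
next
  case (Cons st p)
  have b: "b \<in> obj C" using is_zigzag_obj[OF Cons(2)] by blast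
  show ?case
  proof (cases st)
    case (Fwd x y g)
    then have x: "x = a" "a \<in> obj C" "y \<in> obj C" "g \<in> Hom C a y" "is_zigzag C S y p b" using Cons(2) by auto
    obtain m s f where m: "m \<in> obj C" "s \<in> S m y" "f \<in> Hom C m b" "zigzag_eq C S y b p [Bwd m y s, Fwd m b f]"
      using Cons(1)[OF x(5)] by blast
    obtain q t g' where q: "q \<in> obj C" "t \<in> S q a" "g' \<in> Hom C q m" "cmp C q m y s g' = cmp C q a y g t"
      using ore[OF x(2,3) m(1) x(4) m(2)] .
    have tH: "t \<in> Hom C q a" and sH: "s \<in> Hom C m y" using S_Hom q m x by blast+
    have "zigzag_eq C S a b ([Fwd a y g] @ p) ([Fwd a y g] @ [Bwd m y s, Fwd m b f])"
      using zigzag_eq_right[OF _ m(4), of a "[Fwd a y g]"] x by simp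
    \<comment> \<open>Inserting the formal inverse of \<open>t\<close> followed by \<open>t\<close>
      lets the Ore square replace \<open>g\<close> after \<open>t\<close> by \<open>s\<close> after
      \<open>g'\<close>; then \<open>s\<close> cancels against its formal inverse.\<close>
    also have "zigzag_eq C S a b ([] @ [Fwd a y g, Bwd m y s, Fwd m b f]) ([Bwd q a t, Fwd q a t] @ [Fwd a y g, Bwd m y s, Fwd m b f])"
      by (rule zigzag_eq_left[OF zz_sym[OF zz_bwd_fwd[OF q(1) x(2) q(2)]]])
        (use x m b in simp)
    then have "zigzag_eq C S a b ([Fwd a y g] @ [Bwd m y s, Fwd m b f]) ([Bwd q a t] @ [Fwd q a t, Fwd a y g] @ [Bwd m y s, Fwd m b f])"
      by simp
    also have "zigzag_eq C S a b \<dots> ([Bwd q a t] @ [Fwd q y (cmp C q a y g t)] @ [Bwd m y s, Fwd m b f])"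
      by (rule zigzag_eq_right[OF _ zigzag_eq_left[OF zz_cmp[OF q(1) x(2,3) tH x(4)]]])
        (use x m b q in simp_all)
    also have "zigzag_eq C S a b \<dots> ([Bwd q a t] @ [Fwd q m g', Fwd m y s] @ [Bwd m y s, Fwd m b f])"
      unfolding q(4)[symmetric]
      by (rule zigzag_eq_right[OF _ zigzag_eq_left[OF zz_sym[OF zz_cmp[OF q(1) m(1) x(3) q(3) sH]]]])
        (use x m b q in simp_all)
    also have "\<dots> = [Bwd q a t, Fwd q m g'] @ ([Fwd m y s, Bwd m y s] @ [Fwd m b f])" by simp
    also have "zigzag_eq C S a b \<dots> ([Bwd q a t, Fwd q m g'] @ ([] @ [Fwd m b f]))"
      by (rule zigzag_eq_right[OF _ zigzag_eq_left[OF zz_fwd_bwd[OF m(1) x(3) m(2)]]])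
        (use x m b q in simp_all)
    also have "\<dots> = [Bwd q a t] @ [Fwd q m g', Fwd m b f]" by simp
    also have "zigzag_eq C S a b \<dots> ([Bwd q a t] @ [Fwd q b (cmp C q m b f g')])"
      by (rule zigzag_eq_right[OF _ zz_cmp[OF q(1) m(1) b q(3) m(3)]])
        (use x m b q in simp_all)
    finally show ?thesis
      unfolding Fwd x(1) using q C_cmp[OF q(1) m(1) b q(3) m(3)] by auto
  next
    case (Bwd x y s)
    then have x: "y = a" "x \<in> obj C" "a \<in> obj C" "s \<in> S x a" "is_zigzag C S x p b" using Cons(2) by auto
    obtain m s' f where m: "m \<in> obj C" "s' \<in> S m x" "f \<in> Hom C m b" "zigzag_eq C S x b p [Bwd m x s', Fwd m b f]"
      using Cons(1)[OF x(5)] by blast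
    have s'H: "s' \<in> Hom C m x" using S_Hom m x by blast
    have c: "cmp C m x a s s' \<in> S m a" using S_cmp m x by blast
    have "zigzag_eq C S a b ([Bwd x a s] @ p) ([Bwd x a s] @ [Bwd m x s', Fwd m b f])"
      using zigzag_eq_right[OF _ m(4), of a "[Bwd x a s]"] x by simp
    also have "zigzag_eq C S a b \<dots> ([Bwd m a (cmp C m x a s s'), Fwd m x s'] @ [Bwd m x s', Fwd m b f])"
      by (rule zigzag_eq_left[OF zz_sym[OF zigzag_eq_Bwd[OF x(3,2) m(1) x(4) s'H c]]])
        (use x m b in simp)
    also have "\<dots> = [Bwd m a (cmp C m x a s s')] @ ([Fwd m x s', Bwd m x s'] @ [Fwd m b f])" by simp
    also have "zigzag_eq C S a b \<dots> ([Bwd m a (cmp C m x a s s')] @ ([] @ [Fwd m b f]))"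
      by (rule zigzag_eq_right[OF _ zigzag_eq_left[OF zz_fwd_bwd[OF m(1) x(2) m(2)]]])
        (use x m b c in simp_all)
    finally show ?thesis
      unfolding Bwd x(1) using m c by auto
  qed
qed

text \<open>Both zigzags are fractions, and \<open>ore\<close> gives them a common denominator.
  Cancelling it in \<open>D\<close> shows that the numerators agree after \<open>\<phi>\<close>; by
  faithfulness up to \<open>S\<close> a further expansion by \<open>v\<close> makes them equal in
  \<open>C\<close>.\<close>

lemma eval_zigzag_inj:
  assumes p: "is_zigzag C S a p b" and q: "is_zigzag C S a q b" and eq: "eval_zigzag b p = eval_zigzag b q"
  shows "zigzag_eq C S a b p q"
proof -
  have o: "a \<in> obj C" "b \<in> obj C" using is_zigzag_obj[OF p] by blast+
  obtain m s f where m: "m \<in> obj C" "s \<in> S m a" "f \<in> Hom C m b" "zigzag_eq C S a b p [Bwd m a s, Fwd m b f]"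
    using zigzag_fraction[OF p] by blast
  obtain m' s' f' where m': "m' \<in> obj C" "s' \<in> S m' a" "f' \<in> Hom C m' b" "zigzag_eq C S a b q [Bwd m' a s', Fwd m' b f']"
    using zigzag_fraction[OF q] by blast
  have sH: "s \<in> Hom C m a" and s'H: "s' \<in> Hom C m' a" using S_Hom m m' o by blast+
  obtain r t t' where r: "r \<in> obj C" "t \<in> S r m" "t' \<in> Hom C r m'" "cmp C r m' a s' t' = cmp C r m a s t"
    using ore[OF m(1) o(1) m'(1) sH m'(2)] .
  have tH: "t \<in> Hom C r m" using S_Hom r m by blast
  have mem: "\<phi> m a s \<in> Hom D m a" "\<phi> m b f \<in> Hom D m b" "\<phi> m' a s' \<in> Hom D m' a" "\<phi> m' b f' \<in> Hom D m' b"
     "\<phi> r m t \<in> Hom D r m" "\<phi> r m' t' \<in> Hom D r m'"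
    using map_mem o m m' r sH s'H tH by blast+
  note i = inverse[OF m(1) o(1) m(2)] and i' = inverse[OF m'(1) o(1) m'(2)]
  have "cmp D a m b (\<phi> m b f) (inverse m a s) = cmp D a m' b (\<phi> m' b f') (inverse m' a s')"
    using eq zigzag_eq_eval[OF m(4)] zigzag_eq_eval[OF m'(4)] D_ident_left o m(1) m'(1) mem by simp
  then have "cmp D r a b (cmp D a m b (\<phi> m b f) (inverse m a s)) (cmp D r m a (\<phi> m a s) (\<phi> r m t)) =
      cmp D r a b (cmp D a m' b (\<phi> m' b f') (inverse m' a s')) (cmp D r m' a (\<phi> m' a s') (\<phi> r m' t'))"
    using r(4) map_cmp[OF r(1) m(1) o(1) tH sH] map_cmp[OF r(1) m'(1) o(1) r(3) s'H] by simp
  moreover have "cmp D r a b (cmp D a m b (\<phi> m b f) (inverse m a s)) (cmp D r m a (\<phi> m a s) (\<phi> r m t)) =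
      cmp D r m b (\<phi> m b f) (cmp D r m m (cmp D m a m (inverse m a s) (\<phi> m a s)) (\<phi> r m t))"
    using D_assoc D_cmp o m(1) r(1) i(1) mem by metis
  moreover have "cmp D r a b (cmp D a m' b (\<phi> m' b f') (inverse m' a s')) (cmp D r m' a (\<phi> m' a s') (\<phi> r m' t')) =
      cmp D r m' b (\<phi> m' b f') (cmp D r m' m' (cmp D m' a m' (inverse m' a s') (\<phi> m' a s')) (\<phi> r m' t'))"
    using D_assoc D_cmp o m'(1) r(1) i'(1) mem by metis
  ultimately have "cmp D r m b (\<phi> m b f) (\<phi> r m t) = cmp D r m' b (\<phi> m' b f') (\<phi> r m' t')"
    unfolding i(2) i'(2) using D_ident_left m(1) m'(1) r(1) mem by simp
  then have "\<phi> r b (cmp C r m b f t) = \<phi> r b (cmp C r m' b f' t')"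
    using map_cmp m(1,3) m'(1,3) r(1,3) tH o by simp
  moreover have ft: "cmp C r m b f t \<in> Hom C r b" "cmp C r m' b f' t' \<in> Hom C r b"
    using C_cmp m m' r tH o by blast+
  ultimately obtain n v where n: "n \<in> obj C" "v \<in> S n r"
    "cmp C n r b (cmp C r m b f t) v = cmp C n r b (cmp C r m' b f' t') v"
    using faithful[OF r(1) o(2)] by blast
  have vH: "v \<in> Hom C n r" using S_Hom n r by blast
  have stS: "cmp C r m a s t \<in> S r a" using S_cmp r m o by blast
  have stvS: "cmp C n r a (cmp C r m a s t) v \<in> S n a" using S_cmp n r o stS by blast
  have "zigzag_eq C S a b p [Bwd m a s, Fwd m b f]" by (rule m(4))
  also have "zigzag_eq C S a b \<dots> [Bwd r a (cmp C r m a s t), Fwd r b (cmp C r m b f t)]"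
    by (rule zigzag_eq_fraction[OF o m(1) r(1) m(2) tH m(3) stS])
  also have "zigzag_eq C S a b \<dots> [Bwd n a (cmp C n r a (cmp C r m a s t) v), Fwd n b (cmp C n r b (cmp C r m b f t) v)]"
    by (rule zigzag_eq_fraction[OF o r(1) n(1) stS vH ft(1) stvS])
  finally have 1: "zigzag_eq C S a b p [Bwd n a (cmp C n r a (cmp C r m a s t) v), Fwd n b (cmp C n r b (cmp C r m b f t) v)]" .
  have "zigzag_eq C S a b q [Bwd m' a s', Fwd m' b f']" by (rule m'(4))
  also have "zigzag_eq C S a b \<dots> [Bwd r a (cmp C r m a s t), Fwd r b (cmp C r m' b f' t')]"
    using zigzag_eq_fraction[OF o m'(1) r(1) m'(2) r(3) m'(3)] stS unfolding r(4) by blast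
  also have "zigzag_eq C S a b \<dots> [Bwd n a (cmp C n r a (cmp C r m a s t) v), Fwd n b (cmp C n r b (cmp C r m b f t) v)]"
    unfolding n(3) by (rule zigzag_eq_fraction[OF o r(1) n(1) stS vH ft(2) stvS])
  finally show ?thesis using 1 zz_sym zz_trans by blast
qed

abbreviation "zclass a b p \<equiv> {q. zigzag_eq C S a b p q}"

lemma zclass_eq_iff:
  assumes "is_zigzag C S a p b"
  shows "zclass a b p = zclass a b q \<longleftrightarrow> zigzag_eq C S a b p q"
proof
  assume "zclass a b p = zclass a b q"
  then have "p \<in> zclass a b q" using zz_refl[OF assms] by blast
  then show "zigzag_eq C S a b p q" using zz_sym by blast
next
  assume pq: "zigzag_eq C S a b p q"
  show "zclass a b p = zclass a b q"
    using zz_trans[OF pq] zz_trans[OF zz_sym[OF pq]] by blast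
qed

lemma Hom_localization: "Hom (localization C S) a b = zclass a b ` {p. is_zigzag C S a p b}"
  unfolding localization_def quotient_def by auto

lemma ident_localization: "ident (localization C S) a = zclass a a []"
  unfolding localization_def by simp

lemma cmp_localization:
  assumes "is_zigzag C S a p b" "is_zigzag C S b q c"
  shows "cmp (localization C S) a b c (zclass b c q) (zclass a b p) = zclass a c (p @ q)"
proof -
  have "(\<exists>p'\<in>zclass a b p. \<exists>q'\<in>zclass b c q. zigzag_eq C S a c (p' @ q') r) \<longleftrightarrow> zigzag_eq C S a c (p @ q) r" for r
  proof
    assume "\<exists>p'\<in>zclass a b p. \<exists>q'\<in>zclass b c q. zigzag_eq C S a c (p' @ q') r"
    then obtain p' q' where pq: "zigzag_eq C S a b p p'" "zigzag_eq C S b c q q'" "zigzag_eq C S a c (p' @ q') r"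
      by blast
    show "zigzag_eq C S a c (p @ q) r" by (rule zz_trans[OF zz_append[OF pq(1,2)] pq(3)])
  next
    assume "zigzag_eq C S a c (p @ q) r"
    then show "\<exists>p'\<in>zclass a b p. \<exists>q'\<in>zclass b c q. zigzag_eq C S a c (p' @ q') r"
      using zz_refl[OF assms(1)] zz_refl[OF assms(2)] by blast
  qed
  then show ?thesis unfolding localization_def by simp
qed

lemma is_category_localization: "is_category (localization C S)"
proof -
  have obj: "obj (localization C S) = obj C" unfolding localization_def by simp
  show ?thesis
    unfolding is_category_def obj
  proof (intro conjI ballI)
    fix a assume "a \<in> obj C"
    then show "ident (localization C S) a \<in> Hom (localization C S) a a"
      unfolding Hom_localization ident_localization by (intro imageI) simp
  next
    fix a b c f g assume "f \<in> Hom (localization C S) a b" "g \<in> Hom (localization C S) b c"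
    then obtain p q where "f = zclass a b p" "is_zigzag C S a p b" "g = zclass b c q" "is_zigzag C S b q c"
      unfolding Hom_localization by blast
    then show "cmp (localization C S) a b c g f \<in> Hom (localization C S) a c"
      unfolding Hom_localization
      by (simp add: cmp_localization) (intro imageI CollectI is_zigzag_append)
  next
    fix a b f assume "f \<in> Hom (localization C S) a b"
    then obtain p where p: "f = zclass a b p" "is_zigzag C S a p b"
      unfolding Hom_localization by blast
    then show "cmp (localization C S) a a b f (ident (localization C S) a) = f"
        "cmp (localization C S) a b b (ident (localization C S) b) f = f"
      unfolding ident_localization using cmp_localization[of a "[]" a p b] cmp_localization[of a p b "[]" b]
      by (simp_all add: is_zigzag_obj)
  next
    fix a b c d f g h assume "f \<in> Hom (localization C S) a b" "g \<in> Hom (localization C S) b c"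
      "h \<in> Hom (localization C S) c d"
    then obtain p q r where "f = zclass a b p" "is_zigzag C S a p b" "g = zclass b c q" "is_zigzag C S b q c"
      "h = zclass c d r" "is_zigzag C S c r d"
      unfolding Hom_localization by blast
    then show "cmp (localization C S) a c d h (cmp (localization C S) a b c g f) =
        cmp (localization C S) a b d (cmp (localization C S) b c d h g) f"
      by (simp add: cmp_localization is_zigzag_append)
  qed
qed

text \<open>Injectivity on hom-sets is \<open>eval_zigzag_inj\<close>. For surjectivity, fullness up
  to \<open>S\<close> exhibits \<open>h\<close> as the value of the fraction with denominator
  \<open>s\<close> and numerator \<open>f\<close>.\<close>

theorem localization_isomorphism:
  "category_isomorphism (localization C S) D (\<lambda>a b K. eval_zigzag b (SOME p. p \<in> K))"
proof -
  have val: "eval_zigzag b (SOME q. q \<in> zclass a b p) = eval_zigzag b p" if "is_zigzag C S a p b" for a b p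
  proof -
    have "(SOME q. q \<in> zclass a b p) \<in> zclass a b p"
      using zz_refl[OF that] by (intro someI[of "\<lambda>q. q \<in> zclass a b p" p]) simp
    then have "zigzag_eq C S a b p (SOME q. q \<in> zclass a b p)" by (rule CollectD)
    then show ?thesis by (rule zigzag_eq_eval[symmetric])
  qed
  have obj: "obj (localization C S) = obj C" unfolding localization_def by simp
  show ?thesis
  proof
    show "bij_betw (\<lambda>K. eval_zigzag b (SOME p. p \<in> K)) (Hom (localization C S) a b) (Hom D a b)"
      if ab: "a \<in> obj (localization C S)" "b \<in> obj (localization C S)" for a b
    proof (rule bij_betwI')
      fix K L assume "K \<in> Hom (localization C S) a b" "L \<in> Hom (localization C S) a b"
      then obtain p q where pq: "K = zclass a b p" "L = zclass a b q" "is_zigzag C S a p b" "is_zigzag C S a q b"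
        unfolding Hom_localization by blast
      show "(eval_zigzag b (SOME p. p \<in> K) = eval_zigzag b (SOME p. p \<in> L)) = (K = L)"
        unfolding pq(1,2) val[OF pq(3)] val[OF pq(4)] zclass_eq_iff[OF pq(3)]
        using eval_zigzag_inj pq zigzag_eq_eval by blast
    next
      fix K assume "K \<in> Hom (localization C S) a b"
      then show "eval_zigzag b (SOME p. p \<in> K) \<in> Hom D a b"
        unfolding Hom_localization using val eval_zigzag_mem by fastforce
    next
      fix h assume h: "h \<in> Hom D a b"
      have o: "a \<in> obj C" "b \<in> obj C" using ab obj by blast+
      obtain p s f where p: "p \<in> obj C" "s \<in> S p a" "f \<in> Hom C p b" "cmp D p a b h (\<phi> p a s) = \<phi> p b f"
        using full[OF o h] by blast
      note i = inverse[OF p(1) o(1) p(2)]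
      have sD: "\<phi> p a s \<in> Hom D p a" using map_mem S_Hom p o by blast
      have z: "is_zigzag C S a [Bwd p a s, Fwd p b f] b" using p o by simp
      have "eval_zigzag b [Bwd p a s, Fwd p b f] = cmp D a p b (\<phi> p b f) (inverse p a s)"
        using D_ident_left map_mem p o by simp
      also have "\<dots> = cmp D a a b h (cmp D a p a (\<phi> p a s) (inverse p a s))"
        unfolding p(4)[symmetric] using D_assoc o p(1) i(1) sD h by simp
      also have "\<dots> = h" unfolding i(3) using D_ident_right o h by simp
      finally show "\<exists>K\<in>Hom (localization C S) a b. h = eval_zigzag b (SOME p. p \<in> K)"
        unfolding Hom_localization using val[OF z] z by (metis imageI mem_Collect_eq)
    qed
    show "eval_zigzag a (SOME p. p \<in> ident (localization C S) a) = ident D a"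
      if "a \<in> obj (localization C S)" for a
      unfolding ident_localization using val[of a "[]" a] that obj by simp
    show "eval_zigzag c (SOME p. p \<in> cmp (localization C S) a b c g f) =
        cmp D a b c (eval_zigzag c (SOME p. p \<in> g)) (eval_zigzag b (SOME p. p \<in> f))"
      if fg: "f \<in> Hom (localization C S) a b" "g \<in> Hom (localization C S) b c" for a b c f g
    proof -
      obtain p where p: "f = zclass a b p" "is_zigzag C S a p b" using fg unfolding Hom_localization by blast
      obtain q where q: "g = zclass b c q" "is_zigzag C S b q c" using fg unfolding Hom_localization by blast
      show ?thesis
        unfolding p(1) q(1) cmp_localization[OF p(2) q(2)] val[OF p(2)] val[OF q(2)]
          val[OF is_zigzag_append[OF p(2) q(2)]] eval_zigzag_append[OF p(2) q(2)] ..
    qed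
  qed (simp_all add: is_category_localization cat_D obj obj_eq)
qed

end

section \<open>Categories of small abelian groups and of functors\<close>

section \<open>Functor categories\<close>

lemma is_category_full_subcategory: "is_category C \<Longrightarrow> X \<subseteq> obj C \<Longrightarrow> is_category (full_subcategory C X)"
  unfolding is_category_def full_subcategory_def by (simp add: subset_eq)

lemma is_category_Ab: "is_category (Ab :: ('u monoid, 'u \<Rightarrow> 'u) category)"
  unfolding is_category_def Ab_def
proof (simp, intro conjI allI impI ballI)
  show "(\<lambda>x\<in>carrier a. x) \<in> hom a a" if "comm_group a \<and> small TYPE('u) (carrier a)" for a :: "'u monoid"
  proof -
    interpret comm_group a using that by blast
    show ?thesis by (auto simp: hom_def)
  qed
  show "compose (carrier a) g f \<in> hom a c"
    if "comm_group a \<and> small TYPE('u) (carrier a)" "f \<in> hom a b \<inter> extensional (carrier a)"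
      "g \<in> hom b c \<inter> extensional (carrier b)" for a b c :: "'u monoid" and f g
  proof -
    interpret comm_group a using that by blast
    show ?thesis using that by (auto simp: hom_def compose_def Pi_iff)
  qed
  show "compose (carrier a) f (\<lambda>x\<in>carrier a. x) = f"
    if "f \<in> hom a b \<inter> extensional (carrier a)" for a b :: "'u monoid" and f
    using that by (intro ext) (auto simp: compose_def extensional_def)
  show "compose (carrier a) (\<lambda>x\<in>carrier b. x) f = f"
    if "f \<in> hom a b \<inter> extensional (carrier a)" for a b :: "'u monoid" and f
    using that by (intro ext) (auto simp: compose_def extensional_def hom_def)
  show "compose (carrier a) h (compose (carrier a) g f) = compose (carrier a) (compose (carrier b) h g) f"
    if "f \<in> hom a b \<inter> extensional (carrier a)" for a b :: "'u monoid" and f g h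
    using that by (intro ext) (auto simp: compose_def hom_def)
qed

lemma is_category_functor_category:
  assumes D: "is_category D"
  shows "is_category (functor_category C D)"
proof -
  have mem: "\<theta> a \<in> Hom D (fobj S a) (fobj T a)" if "\<theta> \<in> nat_trans C D S T" "a \<in> obj C" for \<theta> S T a
    using nat_trans_component that .
  have ext: "\<theta> a = undefined" if "\<theta> \<in> nat_trans C D S T" "a \<notin> obj C" for \<theta> S T a
    using that unfolding nat_trans_def by (auto simp: PiE_def extensional_def)
  have nat: "cmp D (fobj S a) (fobj S b) (fobj T b) (\<theta> b) (farr S a b f) =
      cmp D (fobj S a) (fobj T a) (fobj T b) (farr T a b f) (\<theta> a)"
    if "\<theta> \<in> nat_trans C D S T" "a \<in> obj C" "b \<in> obj C" "f \<in> Hom C a b" for \<theta> S T a b f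
    using that unfolding nat_trans_def by blast
  note o = functor_obj[of C D] and r = functor_arr[of C D]
  show ?thesis
    unfolding is_category_def functor_category_def
  proof (simp, intro conjI allI impI ballI)
    show "(\<lambda>a\<in>obj C. ident D (fobj S a)) \<in> nat_trans C D S S" if S: "is_functor C D S" for S
      unfolding nat_trans_def using o[OF S] r[OF S] cat_ident[OF D] cat_ident_left[OF D] cat_ident_right[OF D]
      by auto
    show "(\<lambda>a\<in>obj C. cmp D (fobj S a) (fobj T a) (fobj P a) (\<theta> a) (\<eta> a)) \<in> nat_trans C D S P"
      if fu: "is_functor C D S" "is_functor C D T" "is_functor C D P"
        and t: "\<eta> \<in> nat_trans C D S T" "\<theta> \<in> nat_trans C D T P" for S T P \<eta> \<theta>
      unfolding nat_trans_def
    proof (intro CollectI conjI ballI)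
      show "(\<lambda>a\<in>obj C. cmp D (fobj S a) (fobj T a) (fobj P a) (\<theta> a) (\<eta> a)) \<in>
          (\<Pi>\<^sub>E a\<in>obj C. Hom D (fobj S a) (fobj P a))"
        using cat_cmp[OF D] o fu mem t by auto
      fix a b f assume ab: "a \<in> obj C" "b \<in> obj C" "f \<in> Hom C a b"
      note oo = o[OF fu(1) ab(1)] o[OF fu(2) ab(1)] o[OF fu(3) ab(1)] o[OF fu(1) ab(2)] o[OF fu(2) ab(2)] o[OF fu(3) ab(2)]
      note rr = r[OF fu(1) ab] r[OF fu(2) ab] r[OF fu(3) ab]
      note mm = mem[OF t(1) ab(1)] mem[OF t(1) ab(2)] mem[OF t(2) ab(1)] mem[OF t(2) ab(2)]
      show "cmp D (fobj S a) (fobj S b) (fobj P b)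
           ((\<lambda>a\<in>obj C. cmp D (fobj S a) (fobj T a) (fobj P a) (\<theta> a) (\<eta> a)) b) (farr S a b f) =
          cmp D (fobj S a) (fobj P a) (fobj P b) (farr P a b f)
           ((\<lambda>a\<in>obj C. cmp D (fobj S a) (fobj T a) (fobj P a) (\<theta> a) (\<eta> a)) a)"
        using ab cat_assoc[OF D oo(1,4,5,6) rr(1) mm(2,4)] cat_assoc[OF D oo(1,2,5,6) mm(1) rr(2) mm(4)]
          cat_assoc[OF D oo(1,2,3,6) mm(1,3) rr(3)] nat[OF t(1) ab] nat[OF t(2) ab] by simp
    qed
    show "(\<lambda>a\<in>obj C. cmp D (fobj S a) (fobj S a) (fobj T a) (\<eta> a) (if a \<in> obj C then ident D (fobj S a) else undefined)) = \<eta>"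
      if fu: "is_functor C D S" "is_functor C D T" and t: "\<eta> \<in> nat_trans C D S T" for S T \<eta>
      using cat_ident_right[OF D o[OF fu(1)] o[OF fu(2)]] mem[OF t] ext[OF t] by (intro HOL.ext) auto
    show "(\<lambda>a\<in>obj C. cmp D (fobj S a) (fobj T a) (fobj T a) (if a \<in> obj C then ident D (fobj T a) else undefined) (\<eta> a)) = \<eta>"
      if fu: "is_functor C D S" "is_functor C D T" and t: "\<eta> \<in> nat_trans C D S T" for S T \<eta>
      using cat_ident_left[OF D o[OF fu(1)] o[OF fu(2)]] mem[OF t] ext[OF t] by (intro HOL.ext) auto
  qed (auto intro!: restrict_ext cat_assoc[OF D] o mem)
qed


section \<open>Functors on \<open>Fbar\<close> as modules with a family of subgroups\<close>

section \<open>Gliders as filtered modules\<close>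

locale gliders = filtered_ring G leq R F
  for G :: "'g monoid" (structure) and leq and R :: "'r ring" (structure) and F +
  fixes \<Lambda> :: "'g set" and U :: "'u itself"
  assumes universe: "universe TYPE('u)"
    and Lambda: "\<Lambda> \<subseteq> carrier G"
    and small_Lambda: "small TYPE('u) \<Lambda>"
    and small_R: "small TYPE('u) (carrier R)"
begin

text \<open>The hom-sets of \<open>Fbar\<close> inside \<Lambda>, except that they become empty
  unless \<alpha> \<le> \<beta>: the zero morphism present there would impose no condition on a
  family of subgroups.\<close>

definition scal :: "'g \<Rightarrow> 'g \<Rightarrow> 'r set" where
  "scal \<alpha> \<beta> = {r. (\<alpha>, \<beta>) \<in> leq \<and> r \<in> F (\<beta> \<otimes>\<^bsub>G\<^esub> inv\<^bsub>G\<^esub> \<alpha>)}"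

lemma quot_mem: "\<alpha> \<in> \<Lambda> \<Longrightarrow> \<beta> \<in> \<Lambda> \<Longrightarrow> \<beta> \<otimes>\<^bsub>G\<^esub> inv\<^bsub>G\<^esub> \<alpha> \<in> carrier G"
  using Lambda by blast

lemma F_sub: "\<gamma> \<in> carrier G \<Longrightarrow> r \<in> F \<gamma> \<Longrightarrow> r \<in> carrier R"
  using additive_subgroup.a_subset[OF subgroups] by blast

lemma F_add: "\<gamma> \<in> carrier G \<Longrightarrow> r \<in> F \<gamma> \<Longrightarrow> s \<in> F \<gamma> \<Longrightarrow> r \<oplus>\<^bsub>R\<^esub> s \<in> F \<gamma>"
  using additive_subgroup.a_closed[OF subgroups] by blast

lemma F_zero: "\<gamma> \<in> carrier G \<Longrightarrow> \<zero>\<^bsub>R\<^esub> \<in> F \<gamma>"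
  using additive_subgroup.zero_closed[OF subgroups] by blast

lemma F_minus: "\<gamma> \<in> carrier G \<Longrightarrow> r \<in> F \<gamma> \<Longrightarrow> \<ominus>\<^bsub>R\<^esub> r \<in> F \<gamma>"
  using additive_subgroup.a_inv_closed[OF subgroups] by blast

lemma leq_refl: "\<alpha> \<in> \<Lambda> \<Longrightarrow> (\<alpha>, \<alpha>) \<in> leq"
  using partial_order Lambda unfolding partial_order_on_def preorder_on_def refl_on_def by blast

lemma leq_trans: "(\<alpha>, \<beta>) \<in> leq \<Longrightarrow> (\<beta>, \<gamma>) \<in> leq \<Longrightarrow> (\<alpha>, \<gamma>) \<in> leq"
  using partial_order unfolding partial_order_on_def preorder_on_def trans_def by blast

lemma scal_R: "\<alpha> \<in> \<Lambda> \<Longrightarrow> \<beta> \<in> \<Lambda> \<Longrightarrow> r \<in> scal \<alpha> \<beta> \<Longrightarrow> r \<in> carrier R"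
  unfolding scal_def using F_sub quot_mem by blast

text \<open>Translation by the inverse of \<open>\<alpha>\<close> turns \<alpha> \<le> \<beta> into
  a comparison with the unit of the group, and at the unit the filtration contains one.\<close>

lemma scal_one:
  assumes "\<alpha> \<in> \<Lambda>" "\<beta> \<in> \<Lambda>" "(\<alpha>, \<beta>) \<in> leq"
  shows "\<one>\<^bsub>R\<^esub> \<in> scal \<alpha> \<beta>"
proof -
  have a: "\<alpha> \<in> carrier G" using assms Lambda by blast
  have "inv\<^bsub>G\<^esub> \<alpha> \<in> carrier G" using a by simp
  then have "(inv\<^bsub>G\<^esub> \<alpha>, inv\<^bsub>G\<^esub> \<alpha>) \<in> leq"
    using partial_order unfolding partial_order_on_def preorder_on_def refl_on_def by blast
  then have "(\<alpha> \<otimes>\<^bsub>G\<^esub> inv\<^bsub>G\<^esub> \<alpha>, \<beta> \<otimes>\<^bsub>G\<^esub> inv\<^bsub>G\<^esub> \<alpha>) \<in> leq" using mult_mono assms by blast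
  then have "(\<one>\<^bsub>G\<^esub>, \<beta> \<otimes>\<^bsub>G\<^esub> inv\<^bsub>G\<^esub> \<alpha>) \<in> leq" using a by simp
  then show ?thesis using mono one_mem assms unfolding scal_def by blast
qed

text \<open>Makes negation a scalar. Closure of parts under inverses and compatibility of morphisms
  with inverses then follow from compatibility with scalars.\<close>

lemma scal_minus_one: "\<alpha> \<in> \<Lambda> \<Longrightarrow> \<beta> \<in> \<Lambda> \<Longrightarrow> (\<alpha>, \<beta>) \<in> leq \<Longrightarrow> \<ominus>\<^bsub>R\<^esub> \<one>\<^bsub>R\<^esub> \<in> scal \<alpha> \<beta>"
  using scal_one unfolding scal_def using F_minus quot_mem by blast

lemma scal_mult:
  assumes "\<alpha> \<in> \<Lambda>" "\<beta> \<in> \<Lambda>" "\<gamma> \<in> \<Lambda>" "r \<in> scal \<alpha> \<beta>" "s \<in> scal \<beta> \<gamma>"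
  shows "s \<otimes>\<^bsub>R\<^esub> r \<in> scal \<alpha> \<gamma>"
proof -
  have c: "\<alpha> \<in> carrier G" "\<beta> \<in> carrier G" "\<gamma> \<in> carrier G" using assms Lambda by blast+
  have "s \<otimes>\<^bsub>R\<^esub> r \<in> F ((\<gamma> \<otimes>\<^bsub>G\<^esub> inv\<^bsub>G\<^esub> \<beta>) \<otimes>\<^bsub>G\<^esub> (\<beta> \<otimes>\<^bsub>G\<^esub> inv\<^bsub>G\<^esub> \<alpha>))"
    using mult_mem quot_mem assms unfolding scal_def by blast
  also have "(\<gamma> \<otimes>\<^bsub>G\<^esub> inv\<^bsub>G\<^esub> \<beta>) \<otimes>\<^bsub>G\<^esub> (\<beta> \<otimes>\<^bsub>G\<^esub> inv\<^bsub>G\<^esub> \<alpha>) = \<gamma> \<otimes>\<^bsub>G\<^esub> (inv\<^bsub>G\<^esub> \<beta> \<otimes>\<^bsub>G\<^esub> (\<beta> \<otimes>\<^bsub>G\<^esub> inv\<^bsub>G\<^esub> \<alpha>))"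
    using c by (simp add: m_assoc)
  also have "inv\<^bsub>G\<^esub> \<beta> \<otimes>\<^bsub>G\<^esub> (\<beta> \<otimes>\<^bsub>G\<^esub> inv\<^bsub>G\<^esub> \<alpha>) = inv\<^bsub>G\<^esub> \<alpha>"
    using c by (simp flip: m_assoc)
  finally show ?thesis using assms leq_trans unfolding scal_def by blast
qed

text \<open>
  An object of \<open>Preglid\<close> amounts to an \<open>R\<close>-module \<open>\<Omega>\<close> (its value at \<open>\<infinity>\<close>) together with
  the images \<open>V \<mu>\<close> in \<open>\<Omega>\<close> of its values at the \<open>\<mu> \<in> \<Lambda>\<close>.
\<close>

definition is_glider :: "'u monoid \<Rightarrow> ('r \<Rightarrow> 'u \<Rightarrow> 'u) \<Rightarrow> ('g \<Rightarrow> 'u set) \<Rightarrow> bool" where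
  "is_glider \<Omega> a V \<longleftrightarrow> comm_group \<Omega> \<and> small TYPE('u) (carrier \<Omega>) \<and>
    (\<forall>r\<in>carrier R. \<forall>x\<in>carrier \<Omega>. a r x \<in> carrier \<Omega>) \<and>
    (\<forall>r\<in>carrier R. \<forall>x\<in>carrier \<Omega>. \<forall>y\<in>carrier \<Omega>. a r (x \<otimes>\<^bsub>\<Omega>\<^esub> y) = a r x \<otimes>\<^bsub>\<Omega>\<^esub> a r y) \<and>
    (\<forall>r\<in>carrier R. \<forall>s\<in>carrier R. \<forall>x\<in>carrier \<Omega>. a (r \<oplus>\<^bsub>R\<^esub> s) x = a r x \<otimes>\<^bsub>\<Omega>\<^esub> a s x) \<and>
    (\<forall>r\<in>carrier R. \<forall>s\<in>carrier R. \<forall>x\<in>carrier \<Omega>. a (r \<otimes>\<^bsub>R\<^esub> s) x = a r (a s x)) \<and>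
    (\<forall>x\<in>carrier \<Omega>. a \<one>\<^bsub>R\<^esub> x = x) \<and>
    (\<forall>\<mu>\<in>\<Lambda>. subgroup (V \<mu>) \<Omega>) \<and>
    (\<forall>\<alpha>\<in>\<Lambda>. \<forall>\<beta>\<in>\<Lambda>. \<forall>r\<in>scal \<alpha> \<beta>. \<forall>x\<in>V \<alpha>. a r x \<in> V \<beta>)"

abbreviation PG :: "(('g, 'r, 'u) module_functor, 'g option \<Rightarrow> 'u \<Rightarrow> 'u) category" where
  "PG \<equiv> Preglid G leq \<Lambda> R F"

abbreviation Obj :: "('g, 'r, 'u) module_functor set" where
  "Obj \<equiv> obj PG"

abbreviation Fb :: "('g option, 'r) category" where
  "Fb \<equiv> Fbar G leq \<Lambda> R F"

definition total :: "('g, 'r, 'u) module_functor \<Rightarrow> 'u monoid" where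
  "total M = fobj M None"

definition act :: "('g, 'r, 'u) module_functor \<Rightarrow> 'r \<Rightarrow> 'u \<Rightarrow> 'u" where
  "act M = farr M None None"

definition inc :: "('g, 'r, 'u) module_functor \<Rightarrow> 'g \<Rightarrow> 'u \<Rightarrow> 'u" where
  "inc M \<mu> = farr M (Some \<mu>) None \<one>\<^bsub>R\<^esub>"

definition part :: "('g, 'r, 'u) module_functor \<Rightarrow> 'g \<Rightarrow> 'u set" where
  "part M \<mu> = inc M \<mu> ` carrier (fobj M (Some \<mu>))"

lemma Obj_iff: "M \<in> Obj \<longleftrightarrow> is_functor Fb Ab M \<and>
    (\<forall>a\<in>obj Fb. \<forall>b\<in>obj Fb. \<forall>r\<in>Hom Fb a b. \<forall>s\<in>Hom Fb a b.
      farr M a b (r \<oplus>\<^bsub>R\<^esub> s) = Ab_add (fobj M a) (fobj M b) (farr M a b r) (farr M a b s)) \<and>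
    (\<forall>\<alpha>\<in>\<Lambda>. \<forall>\<beta>\<in>\<Lambda>. (\<alpha>, \<beta>) \<in> leq \<longrightarrow>
      farr M (Some \<alpha>) (Some \<beta>) \<one>\<^bsub>R\<^esub> \<in> mon (fobj M (Some \<alpha>)) (fobj M (Some \<beta>))) \<and>
    (\<forall>a\<in>obj Fb. farr M a None \<one>\<^bsub>R\<^esub> \<in> mon (fobj M a) (fobj M None))"
  unfolding Preglid_def Mod_Fbar_def full_subcategory_def additive_functor_def Fbar_def by auto

lemma obj_Fb: "obj Fb = insert None (Some ` \<Lambda>)"
  and Hom_Fb: "Hom Fb = Fbar_Hom G leq R F"
  and cmp_Fb: "cmp Fb a b c s r = s \<otimes>\<^bsub>R\<^esub> r"
  and ident_Fb: "ident Fb a = \<one>\<^bsub>R\<^esub>"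
  unfolding Fbar_def by simp_all

lemma Hom_Fb_None: "Hom Fb a None = carrier R"
  unfolding Hom_Fb by (cases a) auto

lemma Hom_Fb_Some: "r \<in> scal \<alpha> \<beta> \<Longrightarrow> r \<in> Hom Fb (Some \<alpha>) (Some \<beta>)"
  unfolding Hom_Fb scal_def by auto

lemma Hom_Fb_R: "a \<in> obj Fb \<Longrightarrow> b \<in> obj Fb \<Longrightarrow> r \<in> Hom Fb a b \<Longrightarrow> r \<in> carrier R"
  unfolding obj_Fb Hom_Fb by (auto split: if_splits intro: F_sub[OF quot_mem])

context
  fixes M :: "('g, 'r, 'u) module_functor"
  assumes M: "M \<in> Obj"
begin

lemma Obj_group: "a \<in> obj Fb \<Longrightarrow> comm_group (fobj M a)"
  and Obj_small: "a \<in> obj Fb \<Longrightarrow> small TYPE('u) (carrier (fobj M a))"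
  using M[unfolded Obj_iff] functor_obj[of Fb Ab M a] unfolding Ab_def by auto

lemma Obj_hom: "a \<in> obj Fb \<Longrightarrow> b \<in> obj Fb \<Longrightarrow> r \<in> Hom Fb a b \<Longrightarrow> farr M a b r \<in> hom (fobj M a) (fobj M b)"
  and Obj_ext: "a \<in> obj Fb \<Longrightarrow> b \<in> obj Fb \<Longrightarrow> r \<in> Hom Fb a b \<Longrightarrow> farr M a b r \<in> extensional (carrier (fobj M a))"
  using M[unfolded Obj_iff] functor_arr[of Fb Ab M a b r] unfolding Ab_def by auto

lemma Obj_cmp: "a \<in> obj Fb \<Longrightarrow> b \<in> obj Fb \<Longrightarrow> c \<in> obj Fb \<Longrightarrow> r \<in> Hom Fb a b \<Longrightarrow> s \<in> Hom Fb b c \<Longrightarrow>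
    x \<in> carrier (fobj M a) \<Longrightarrow> farr M a c (s \<otimes>\<^bsub>R\<^esub> r) x = farr M b c s (farr M a b r x)"
  using M[unfolded Obj_iff] functor_cmp[of Fb Ab M a b c r s] unfolding Ab_def cmp_Fb by (simp add: compose_def)

lemma Obj_add: "a \<in> obj Fb \<Longrightarrow> b \<in> obj Fb \<Longrightarrow> r \<in> Hom Fb a b \<Longrightarrow> s \<in> Hom Fb a b \<Longrightarrow>
    x \<in> carrier (fobj M a) \<Longrightarrow> farr M a b (r \<oplus>\<^bsub>R\<^esub> s) x = farr M a b r x \<otimes>\<^bsub>fobj M b\<^esub> farr M a b s x"
  using M[unfolded Obj_iff] unfolding Ab_add_def by simp

lemma Obj_ident: "a \<in> obj Fb \<Longrightarrow> x \<in> carrier (fobj M a) \<Longrightarrow> farr M a a \<one>\<^bsub>R\<^esub> x = x"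
  using M[unfolded Obj_iff] functor_ident[of Fb Ab M a] unfolding Ab_def ident_Fb by simp

lemma inc_hom: "\<mu> \<in> \<Lambda> \<Longrightarrow> inc M \<mu> \<in> hom (fobj M (Some \<mu>)) (total M)"
  and inc_inj: "\<mu> \<in> \<Lambda> \<Longrightarrow> inj_on (inc M \<mu>) (carrier (fobj M (Some \<mu>)))"
  using M[unfolded Obj_iff] unfolding inc_def total_def mon_def obj_Fb by auto

lemma inc_act: "\<alpha> \<in> \<Lambda> \<Longrightarrow> r \<in> carrier R \<Longrightarrow> x \<in> carrier (fobj M (Some \<alpha>)) \<Longrightarrow>
    act M r (inc M \<alpha> x) = farr M (Some \<alpha>) None r x"
  unfolding act_def inc_def
  using Obj_cmp[of "Some \<alpha>" None None "\<one>\<^bsub>R\<^esub>" r x] R.r_one by (simp add: obj_Fb Hom_Fb_None)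

lemma inc_farr: "\<alpha> \<in> \<Lambda> \<Longrightarrow> \<beta> \<in> \<Lambda> \<Longrightarrow> r \<in> Hom Fb (Some \<alpha>) (Some \<beta>) \<Longrightarrow> x \<in> carrier (fobj M (Some \<alpha>)) \<Longrightarrow>
    inc M \<beta> (farr M (Some \<alpha>) (Some \<beta>) r x) = act M r (inc M \<alpha> x)"
  using inc_act[of \<alpha> r x] unfolding inc_def
  using Obj_cmp[of "Some \<alpha>" "Some \<beta>" None r "\<one>\<^bsub>R\<^esub>" x] Hom_Fb_R[of "Some \<alpha>" "Some \<beta>" r]
  by (simp add: obj_Fb Hom_Fb_None)

lemma glider_of_Obj: "is_glider (total M) (act M) (part M)"
  unfolding is_glider_def
proof (intro conjI ballI)
  have None: "None \<in> obj Fb" by (simp add: obj_Fb)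
  show "comm_group (total M)" "small TYPE('u) (carrier (total M))"
    using Obj_group[OF None] Obj_small[OF None] unfolding total_def by blast+
  show "act M r x \<in> carrier (total M)" if "r \<in> carrier R" "x \<in> carrier (total M)" for r x
    using hom_in_carrier[OF Obj_hom[OF None None, of r]] that unfolding total_def act_def Hom_Fb_None by blast
  show "act M r (x \<otimes>\<^bsub>total M\<^esub> y) = act M r x \<otimes>\<^bsub>total M\<^esub> act M r y"
    if "r \<in> carrier R" "x \<in> carrier (total M)" "y \<in> carrier (total M)" for r x y
    using hom_mult[OF Obj_hom[OF None None, of r]] that unfolding total_def act_def Hom_Fb_None by blast
  show "act M (r \<oplus>\<^bsub>R\<^esub> s) x = act M r x \<otimes>\<^bsub>total M\<^esub> act M s x"
    if "r \<in> carrier R" "s \<in> carrier R" "x \<in> carrier (total M)" for r s x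
    using Obj_add[OF None None] that unfolding total_def act_def Hom_Fb_None by blast
  show "act M (r \<otimes>\<^bsub>R\<^esub> s) x = act M r (act M s x)"
    if "r \<in> carrier R" "s \<in> carrier R" "x \<in> carrier (total M)" for r s x
    using Obj_cmp[OF None None None] that unfolding total_def act_def Hom_Fb_None by blast
  show "act M \<one>\<^bsub>R\<^esub> x = x" if "x \<in> carrier (total M)" for x
    using Obj_ident[OF None] that unfolding total_def act_def by blast
  show "subgroup (part M \<mu>) (total M)" if "\<mu> \<in> \<Lambda>" for \<mu>
  proof -
    have "group_hom (fobj M (Some \<mu>)) (total M) (inc M \<mu>)"
      using inc_hom[OF that] Obj_group[of "Some \<mu>"] Obj_group[OF None] that comm_group.axioms(2)
      unfolding group_hom_def group_hom_axioms_def total_def obj_Fb by blast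
    then show ?thesis unfolding part_def by (rule group_hom.img_is_subgroup)
  qed
  show "act M r x \<in> part M \<beta>" if ab: "\<alpha> \<in> \<Lambda>" "\<beta> \<in> \<Lambda>" and r: "r \<in> scal \<alpha> \<beta>" and x: "x \<in> part M \<alpha>" for \<alpha> \<beta> r x
  proof -
    obtain y where y: "x = inc M \<alpha> y" "y \<in> carrier (fobj M (Some \<alpha>))" using x unfolding part_def by blast
    have "farr M (Some \<alpha>) (Some \<beta>) r y \<in> carrier (fobj M (Some \<beta>))"
      using hom_in_carrier[OF Obj_hom[of "Some \<alpha>" "Some \<beta>" r]] Hom_Fb_Some[OF r] ab y unfolding obj_Fb by blast
    then show ?thesis using inc_farr[of \<alpha> \<beta> r y] ab y Hom_Fb_Some[OF r] unfolding part_def by force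
  qed
qed

end

text \<open>The functor takes the subgroups themselves as values and restrictions of the action as
  maps, so the scalar one acts by literal inclusions and the monomorphism conditions are
  immediate.\<close>

lemma Obj_of_glider:
  assumes gl: "is_glider \<Omega> a V"
  obtains M where "M \<in> Obj" "total M = \<Omega>"
    "\<And>r x. r \<in> carrier R \<Longrightarrow> x \<in> carrier \<Omega> \<Longrightarrow> act M r x = a r x"
    "\<And>\<mu>. \<mu> \<in> \<Lambda> \<Longrightarrow> part M \<mu> = V \<mu>"
proof -
  let ?V = "\<lambda>x. case x of None \<Rightarrow> carrier \<Omega> | Some \<mu> \<Rightarrow> V \<mu>"
  let ?O = "\<lambda>x. \<Omega>\<lparr>carrier := ?V x\<rparr>"
  let ?M = "\<lparr>fobj = ?O, farr = (\<lambda>x y r. restrict (a r) (?V x))\<rparr> :: ('g, 'r, 'u) module_functor"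
  have g: "comm_group \<Omega>" "small TYPE('u) (carrier \<Omega>)"
    and closed: "\<And>r x. r \<in> carrier R \<Longrightarrow> x \<in> carrier \<Omega> \<Longrightarrow> a r x \<in> carrier \<Omega>"
    and mult: "\<And>r x y. r \<in> carrier R \<Longrightarrow> x \<in> carrier \<Omega> \<Longrightarrow> y \<in> carrier \<Omega> \<Longrightarrow>
      a r (x \<otimes>\<^bsub>\<Omega>\<^esub> y) = a r x \<otimes>\<^bsub>\<Omega>\<^esub> a r y"
    and add: "\<And>r s x. r \<in> carrier R \<Longrightarrow> s \<in> carrier R \<Longrightarrow> x \<in> carrier \<Omega> \<Longrightarrow> a (r \<oplus>\<^bsub>R\<^esub> s) x = a r x \<otimes>\<^bsub>\<Omega>\<^esub> a s x"
    and assoc: "\<And>r s x. r \<in> carrier R \<Longrightarrow> s \<in> carrier R \<Longrightarrow> x \<in> carrier \<Omega> \<Longrightarrow> a (r \<otimes>\<^bsub>R\<^esub> s) x = a r (a s x)"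
    and one: "\<And>x. x \<in> carrier \<Omega> \<Longrightarrow> a \<one>\<^bsub>R\<^esub> x = x"
    and sub: "\<And>\<mu>. \<mu> \<in> \<Lambda> \<Longrightarrow> subgroup (V \<mu>) \<Omega>"
    and scal: "\<And>\<alpha> \<beta> r x. \<alpha> \<in> \<Lambda> \<Longrightarrow> \<beta> \<in> \<Lambda> \<Longrightarrow> r \<in> scal \<alpha> \<beta> \<Longrightarrow> x \<in> V \<alpha> \<Longrightarrow> a r x \<in> V \<beta>"
    using gl unfolding is_glider_def by blast+
  interpret \<Omega>: comm_group \<Omega> by (rule g)
  have zero: "a \<zero>\<^bsub>R\<^esub> x = \<one>\<^bsub>\<Omega>\<^esub>" if "x \<in> carrier \<Omega>" for x
  proof -
    have "a \<zero>\<^bsub>R\<^esub> x \<otimes>\<^bsub>\<Omega>\<^esub> a \<zero>\<^bsub>R\<^esub> x = a \<zero>\<^bsub>R\<^esub> x" using add[of "\<zero>\<^bsub>R\<^esub>" "\<zero>\<^bsub>R\<^esub>" x] that by simp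
    then show ?thesis using closed[of "\<zero>\<^bsub>R\<^esub>" x] that by (metis R.zero_closed \<Omega>.l_cancel_one')
  qed
  have subV: "subgroup (?V x) \<Omega>" if "x \<in> obj Fb" for x
    using that sub \<Omega>.subgroup_self unfolding obj_Fb by auto
  have V_sub: "?V x \<subseteq> carrier \<Omega>" if "x \<in> obj Fb" for x
    using subgroup.subset[OF subV[OF that]] .
  have mem: "a r z \<in> ?V y" if xy: "x \<in> obj Fb" "y \<in> obj Fb" "r \<in> Hom Fb x y" "z \<in> ?V x" for x y r z
  proof (cases y)
    case None
    have "z \<in> carrier \<Omega>" using V_sub[OF xy(1)] xy(4) by blast
    then show ?thesis using None closed[OF Hom_Fb_R[OF xy(1-3)]] by simp
  next
    case (Some \<beta>)
    \<comment> \<open>The trivial hom-sets of \<open>Fbar\<close> are not covered by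
      \<open>scal\<close>. Their only member is zero, which sends everything to the unit and hence
      into any subgroup.\<close>
    show ?thesis
    proof (cases "r = \<zero>\<^bsub>R\<^esub>")
      case True
      have "z \<in> carrier \<Omega>" using V_sub[OF xy(1)] xy(4) by blast
      then show ?thesis using True zero subgroup.one_closed[OF subV[OF xy(2)]] by simp
    next
      case False
      then obtain \<alpha> where "x = Some \<alpha>" "(\<alpha>, \<beta>) \<in> leq" "r \<in> F (\<beta> \<otimes>\<^bsub>G\<^esub> inv\<^bsub>G\<^esub> \<alpha>)"
        using xy(3) unfolding Some Hom_Fb by (cases x) (auto split: if_splits)
      then show ?thesis using scal[of \<alpha> \<beta> r z] xy unfolding Some obj_Fb scal_def by auto
    qed
  qed
  have comm: "comm_group (?O x)" if "x \<in> obj Fb" for x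
  proof -
    have "group (?O x)" using \<Omega>.subgroup_imp_group[OF subV[OF that]] .
    then show ?thesis using V_sub[OF that] \<Omega>.m_comm by (intro group.group_comm_groupI) auto
  qed
  have hom: "restrict (a r) (?V x) \<in> hom (?O x) (?O y)"
    if "x \<in> obj Fb" "y \<in> obj Fb" "r \<in> Hom Fb x y" for x y r
  proof (rule homI)
    show "restrict (a r) (?V x) z \<in> carrier (?O y)" if "z \<in> carrier (?O x)" for z
      using mem \<open>x \<in> obj Fb\<close> \<open>y \<in> obj Fb\<close> \<open>r \<in> Hom Fb x y\<close> that by simp
    show "restrict (a r) (?V x) (z \<otimes>\<^bsub>?O x\<^esub> w) = restrict (a r) (?V x) z \<otimes>\<^bsub>?O y\<^esub> restrict (a r) (?V x) w"
      if "z \<in> carrier (?O x)" "w \<in> carrier (?O x)" for z w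
    proof -
      have "z \<in> ?V x" "w \<in> ?V x" using that by simp_all
      moreover from this have "z \<otimes>\<^bsub>\<Omega>\<^esub> w \<in> ?V x" using subgroup.m_closed[OF subV[OF \<open>x \<in> obj Fb\<close>]] by blast
      moreover have "r \<in> carrier R" using Hom_Fb_R \<open>x \<in> obj Fb\<close> \<open>y \<in> obj Fb\<close> \<open>r \<in> Hom Fb x y\<close> by blast
      ultimately show ?thesis using mult V_sub[OF \<open>x \<in> obj Fb\<close>] by auto
    qed
  qed
  have fun_M: "is_functor Fb Ab ?M"
    unfolding is_functor_def
  proof (intro conjI ballI)
    show "fobj ?M x \<in> obj Ab" if "x \<in> obj Fb" for x
      using comm[OF that] small_subset[OF g(2) V_sub[OF that]] unfolding Ab_def by simp
    show "farr ?M x y r \<in> Hom Ab (fobj ?M x) (fobj ?M y)" if "x \<in> obj Fb" "y \<in> obj Fb" "r \<in> Hom Fb x y" for x y r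
      using hom[OF that] unfolding Ab_def by simp
    show "farr ?M x x (ident Fb x) = ident Ab (fobj ?M x)" if "x \<in> obj Fb" for x
    proof (rule ext)
      fix w
      show "farr ?M x x (ident Fb x) w = ident Ab (fobj ?M x) w"
        using one[of w] V_sub[OF that] unfolding Ab_def ident_Fb by auto
    qed
    show "farr ?M x z (cmp Fb x y z s r) = cmp Ab (fobj ?M x) (fobj ?M y) (fobj ?M z) (farr ?M y z s) (farr ?M x y r)"
      if *: "x \<in> obj Fb" "y \<in> obj Fb" "z \<in> obj Fb" "r \<in> Hom Fb x y" "s \<in> Hom Fb y z" for x y z r s
    proof (rule ext)
      fix w
      have "r \<in> carrier R" "s \<in> carrier R" using Hom_Fb_R * by blast+
      then show "farr ?M x z (cmp Fb x y z s r) w = cmp Ab (fobj ?M x) (fobj ?M y) (fobj ?M z) (farr ?M y z s) (farr ?M x y r) w"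
        using mem[OF *(1,2,4), of w] assoc[of s r w] V_sub[OF *(1)]
        unfolding Ab_def cmp_Fb by (auto simp: compose_def)
    qed
  qed
  have "?M \<in> Obj"
    unfolding Obj_iff
  proof (intro conjI ballI impI)
    show "farr ?M x y (r \<oplus>\<^bsub>R\<^esub> s) = Ab_add (fobj ?M x) (fobj ?M y) (farr ?M x y r) (farr ?M x y s)"
      if *: "x \<in> obj Fb" "y \<in> obj Fb" "r \<in> Hom Fb x y" "s \<in> Hom Fb x y" for x y r s
    proof (rule ext)
      fix w
      have "r \<in> carrier R" "s \<in> carrier R" using Hom_Fb_R * by blast+
      then show "farr ?M x y (r \<oplus>\<^bsub>R\<^esub> s) w = Ab_add (fobj ?M x) (fobj ?M y) (farr ?M x y r) (farr ?M x y s) w"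
        using add[of r s w] V_sub[OF *(1)] unfolding Ab_add_def by auto
    qed
    have inj: "inj_on (restrict (a \<one>\<^bsub>R\<^esub>) (?V x)) (?V x)" if "x \<in> obj Fb" for x
    proof (rule inj_onI)
      fix v w assume "v \<in> ?V x" "w \<in> ?V x" "restrict (a \<one>\<^bsub>R\<^esub>) (?V x) v = restrict (a \<one>\<^bsub>R\<^esub>) (?V x) w"
      then show "v = w" using one[of v] one[of w] V_sub[OF that] by auto
    qed
    show "farr ?M (Some \<alpha>) (Some \<beta>) \<one>\<^bsub>R\<^esub> \<in> mon (fobj ?M (Some \<alpha>)) (fobj ?M (Some \<beta>))"
      if "\<alpha> \<in> \<Lambda>" "\<beta> \<in> \<Lambda>" "(\<alpha>, \<beta>) \<in> leq" for \<alpha> \<beta>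
      using hom[of "Some \<alpha>" "Some \<beta>" "\<one>\<^bsub>R\<^esub>"] Hom_Fb_Some[OF scal_one[OF that]] that inj[of "Some \<alpha>"]
      unfolding mon_def obj_Fb by simp
    show "farr ?M x None \<one>\<^bsub>R\<^esub> \<in> mon (fobj ?M x) (fobj ?M None)" if "x \<in> obj Fb" for x
      using hom[OF that, of None "\<one>\<^bsub>R\<^esub>"] inj[OF that] unfolding mon_def by (simp add: obj_Fb Hom_Fb_None)
  qed (rule fun_M)
  moreover have "total ?M = \<Omega>" unfolding total_def by simp
  moreover have "act ?M r x = a r x" if "r \<in> carrier R" "x \<in> carrier \<Omega>" for r x
    using that unfolding act_def by simp
  moreover have "part ?M \<mu> = V \<mu>" if "\<mu> \<in> \<Lambda>" for \<mu>
  proof -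
    have "V \<mu> \<subseteq> carrier \<Omega>" using sub[OF that] by (rule subgroup.subset)
    then have "restrict (a \<one>\<^bsub>R\<^esub>) (V \<mu>) ` V \<mu> = (\<lambda>x. x) ` V \<mu>"
      using one by (intro image_cong) auto
    then show ?thesis unfolding part_def inc_def by simp
  qed
  ultimately show ?thesis using that by blast
qed


lemma Hom_PG: "Hom PG M N = nat_trans Fb Ab M N"
  and ident_PG: "ident PG M = (\<lambda>a\<in>obj Fb. ident Ab (fobj M a))"
  and cmp_PG: "cmp PG M N P g f = (\<lambda>a\<in>obj Fb. cmp Ab (fobj M a) (fobj N a) (fobj P a) (g a) (f a))"
  unfolding Preglid_def Mod_Fbar_def full_subcategory_def functor_category_def by simp_all

lemma PG_component:
  assumes "f \<in> Hom PG M N" "a \<in> obj Fb"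
  shows "f a \<in> hom (fobj M a) (fobj N a)" "f a \<in> extensional (carrier (fobj M a))"
  using nat_trans_component[OF assms[unfolded Hom_PG]] unfolding Ab_def by simp_all

lemma PG_natural:
  assumes "M \<in> Obj" "N \<in> Obj" "f \<in> Hom PG M N" "a \<in> obj Fb" "b \<in> obj Fb" "r \<in> Hom Fb a b" "x \<in> carrier (fobj M a)"
  shows "f b (farr M a b r x) = farr N a b r (f a x)"
proof -
  have "cmp Ab (fobj M a) (fobj M b) (fobj N b) (f b) (farr M a b r) =
      cmp Ab (fobj M a) (fobj N a) (fobj N b) (farr N a b r) (f a)"
    using assms unfolding Hom_PG nat_trans_def by blast
  then have "compose (carrier (fobj M a)) (f b) (farr M a b r) x = compose (carrier (fobj M a)) (farr N a b r) (f a) x"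
    unfolding Ab_def by simp
  then show ?thesis using assms(7) unfolding compose_def by simp
qed

lemma PG_hom: "f \<in> Hom PG M N \<Longrightarrow> f None \<in> hom (total M) (total N)"
  using PG_component(1)[of f M N None] unfolding total_def obj_Fb by simp

lemma PG_act:
  assumes "M \<in> Obj" "N \<in> Obj" "f \<in> Hom PG M N" "r \<in> carrier R" "x \<in> carrier (total M)"
  shows "f None (act M r x) = act N r (f None x)"
  using PG_natural[OF assms(1-3), of None None r x] assms(4,5) unfolding total_def act_def
  by (simp add: obj_Fb Hom_Fb_None)

lemma PG_inc:
  assumes "M \<in> Obj" "N \<in> Obj" "f \<in> Hom PG M N" "\<mu> \<in> \<Lambda>" "x \<in> carrier (fobj M (Some \<mu>))"
  shows "f None (inc M \<mu> x) = inc N \<mu> (f (Some \<mu>) x)"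
  using PG_natural[OF assms(1-3), of "Some \<mu>" None "\<one>\<^bsub>R\<^esub>" x] assms(4,5) unfolding inc_def
  by (simp add: obj_Fb Hom_Fb_None)

lemma PG_part:
  assumes "M \<in> Obj" "N \<in> Obj" "f \<in> Hom PG M N" "\<mu> \<in> \<Lambda>" "x \<in> part M \<mu>"
  shows "f None x \<in> part N \<mu>"
proof -
  obtain y where y: "x = inc M \<mu> y" "y \<in> carrier (fobj M (Some \<mu>))" using assms(5) unfolding part_def by blast
  have "f (Some \<mu>) y \<in> carrier (fobj N (Some \<mu>))"
    using hom_in_carrier[OF PG_component(1)[OF assms(3), of "Some \<mu>"]] y(2) assms(4) unfolding obj_Fb by blast
  then show ?thesis using PG_inc[OF assms(1-4) y(2)] y(1) unfolding part_def by blast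
qed

text \<open>The component at \<infinity> determines those at \<Lambda>, because the maps
  \<open>inc N \<mu>\<close> are injective and commute with the components.\<close>

lemma PG_ext:
  assumes "M \<in> Obj" "N \<in> Obj" "f \<in> Hom PG M N" "g \<in> Hom PG M N"
    and eq: "\<And>x. x \<in> carrier (total M) \<Longrightarrow> f None x = g None x"
  shows "f = g"
proof
  fix a
  show "f a = g a"
  proof (cases "a \<in> obj Fb")
    case True
    show ?thesis
    proof (rule extensionalityI[where A = "carrier (fobj M a)"])
      show "f a \<in> extensional (carrier (fobj M a))" "g a \<in> extensional (carrier (fobj M a))"
        using PG_component(2) assms(3,4) True by blast+
      fix x assume x: "x \<in> carrier (fobj M a)"
      show "f a x = g a x"
      proof (cases a)
        case None
        then show ?thesis using eq x unfolding total_def by blast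
      next
        case (Some \<mu>)
        then have mu: "\<mu> \<in> \<Lambda>" using True unfolding obj_Fb by auto
        have inM: "inc M \<mu> x \<in> carrier (total M)"
          using hom_in_carrier[OF inc_hom[OF assms(1) mu]] x Some by simp
        have "f (Some \<mu>) x \<in> carrier (fobj N (Some \<mu>))" "g (Some \<mu>) x \<in> carrier (fobj N (Some \<mu>))"
          using hom_in_carrier[OF PG_component(1)] assms(3,4) True x unfolding Some by blast+
        moreover have "inc N \<mu> (f (Some \<mu>) x) = inc N \<mu> (g (Some \<mu>) x)"
          using PG_inc[OF assms(1,2) _ mu] assms(3,4) x eq[OF inM] unfolding Some by metis
        ultimately show ?thesis
          using inc_inj[OF assms(2) mu] unfolding Some by (meson inj_onD)
      qed
    qed
  next
    case False
    then show ?thesis using assms(3,4) unfolding Hom_PG nat_trans_def by (auto simp: PiE_def extensional_def)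
  qed
qed

text \<open>The components at \<Lambda> are forced: they arise by inverting the injections
  \<open>inc N \<mu>\<close> on the parts. Additivity and naturality are checked after applying
  these injections.\<close>

lemma PG_lift:
  assumes M: "M \<in> Obj" and N: "N \<in> Obj" and g: "g \<in> hom (total M) (total N)"
    and lin: "\<And>r x. r \<in> carrier R \<Longrightarrow> x \<in> carrier (total M) \<Longrightarrow> g (act M r x) = act N r (g x)"
    and gp: "\<And>\<mu> x. \<mu> \<in> \<Lambda> \<Longrightarrow> x \<in> part M \<mu> \<Longrightarrow> g x \<in> part N \<mu>"
  obtains f where "f \<in> Hom PG M N" "\<And>x. x \<in> carrier (total M) \<Longrightarrow> f None x = g x"
proof -
  define h where "h a = (case a of None \<Rightarrow> g |
      Some \<mu> \<Rightarrow> (\<lambda>x. inv_into (carrier (fobj N (Some \<mu>))) (inc N \<mu>) (g (inc M \<mu> x))))" for a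
  \<comment> \<open>The identity stands in for the injection at \<infinity>, so that naturality can
    be proved for all pairs of objects at once.\<close>
  define i where "i P a = (case a of None \<Rightarrow> id | Some \<mu> \<Rightarrow> inc P \<mu>)" for P :: "('g, 'r, 'u) module_functor" and a
  have i_farr: "i P b (farr P a b r x) = farr P a None r x"
    if P: "P \<in> Obj" and ab: "a \<in> obj Fb" "b \<in> obj Fb" "r \<in> Hom Fb a b" "x \<in> carrier (fobj P a)" for P a b r x
  proof (cases b)
    case None
    then show ?thesis unfolding i_def by simp
  next
    case (Some \<beta>)
    have "r \<in> carrier R" using Hom_Fb_R ab by blast
    then show ?thesis
      using Obj_cmp[OF P, of a b None r "\<one>\<^bsub>R\<^esub>" x] ab unfolding i_def Some inc_def
      by (simp add: obj_Fb Hom_Fb_None)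
  qed
  have i_act: "farr P a None r x = act P r (i P a x)"
    if P: "P \<in> Obj" and ab: "a \<in> obj Fb" "r \<in> carrier R" "x \<in> carrier (fobj P a)" for P a r x
    using that inc_act[OF P] unfolding i_def act_def obj_Fb by (cases a) auto
  have i_inj: "inj_on (i P a) (carrier (fobj P a))" and i_hom: "i P a \<in> hom (fobj P a) (total P)"
    if P: "P \<in> Obj" and ab: "a \<in> obj Fb" for P a
    using ab inc_inj[OF P] inc_hom[OF P] unfolding i_def total_def obj_Fb by (auto intro: homI)
  have h: "h a x \<in> carrier (fobj N a)" "i N a (h a x) = g (i M a x)"
    if ab: "a \<in> obj Fb" "x \<in> carrier (fobj M a)" for a x
  proof -
    have "h a x \<in> carrier (fobj N a) \<and> i N a (h a x) = g (i M a x)"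
    proof (cases a)
      case None
      then show ?thesis using ab hom_in_carrier[OF g] unfolding i_def h_def total_def by simp
    next
      case (Some \<mu>)
      then have "g (inc M \<mu> x) \<in> part N \<mu>" using gp ab unfolding part_def obj_Fb by blast
      then show ?thesis unfolding Some i_def h_def part_def by (simp add: inv_into_into f_inv_into_f)
    qed
    then show "h a x \<in> carrier (fobj N a)" "i N a (h a x) = g (i M a x)" by blast+
  qed
  have grp: "comm_group (fobj P a)" if "P \<in> Obj" "a \<in> obj Fb" for P a
    using Obj_group that by blast
  have hh: "h a \<in> hom (fobj M a) (fobj N a)" if a: "a \<in> obj Fb" for a
  proof (rule homI)
    fix x y assume xy: "x \<in> carrier (fobj M a)" "y \<in> carrier (fobj M a)"
    interpret A: comm_group "fobj M a" using grp M a by blast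
    interpret B: comm_group "fobj N a" using grp N a by blast
    have "i N a (h a (x \<otimes>\<^bsub>fobj M a\<^esub> y)) = i N a (h a x \<otimes>\<^bsub>fobj N a\<^esub> h a y)"
      using h[OF a] xy hom_mult[OF i_hom[OF M a]] hom_mult[OF i_hom[OF N a]] hom_mult[OF g]
        hom_in_carrier[OF i_hom[OF M a]] A.m_closed by simp
    then show "h a (x \<otimes>\<^bsub>fobj M a\<^esub> y) = h a x \<otimes>\<^bsub>fobj N a\<^esub> h a y"
      using inj_onD[OF i_inj[OF N a]] h[OF a] xy A.m_closed B.m_closed by simp
  qed (use h a in blast)
  have nat: "h b (farr M a b r x) = farr N a b r (h a x)"
    if ab: "a \<in> obj Fb" "b \<in> obj Fb" "r \<in> Hom Fb a b" "x \<in> carrier (fobj M a)" for a b r x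
  proof -
    have r: "r \<in> carrier R" using Hom_Fb_R ab by blast
    have m: "farr M a b r x \<in> carrier (fobj M b)" using hom_in_carrier[OF Obj_hom[OF M]] ab by blast
    have n: "farr N a b r (h a x) \<in> carrier (fobj N b)" using hom_in_carrier[OF Obj_hom[OF N]] h ab by blast
    have ix: "i M a x \<in> carrier (total M)" using hom_in_carrier[OF i_hom[OF M]] ab by blast
    have "i N b (h b (farr M a b r x)) = g (act M r (i M a x))"
      using h(2)[OF ab(2) m] i_farr[OF M ab] i_act[OF M ab(1) r ab(4)] by simp
    also have "\<dots> = act N r (i N a (h a x))" using lin[OF r ix] h(2)[OF ab(1,4)] by simp
    also have "\<dots> = i N b (farr N a b r (h a x))"
      using i_farr[OF N ab(1-3) h(1)[OF ab(1,4)]] i_act[OF N ab(1) r h(1)[OF ab(1,4)]] by simp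
    finally show ?thesis using inj_onD[OF i_inj[OF N ab(2)]] h(1)[OF ab(2) m] n by blast
  qed
  let ?f = "\<lambda>a\<in>obj Fb. \<lambda>x\<in>carrier (fobj M a). h a x"
  have "?f \<in> Hom PG M N"
    unfolding Hom_PG nat_trans_def
  proof (intro CollectI conjI ballI)
    have "restrict (h a) (carrier (fobj M a)) \<in> Hom Ab (fobj M a) (fobj N a)" if "a \<in> obj Fb" for a
    proof -
      interpret A: comm_group "fobj M a" using grp M that by blast
      have "restrict (h a) (carrier (fobj M a)) \<in> hom (fobj M a) (fobj N a)"
        using hh[OF that] by (auto simp: hom_def)
      then show ?thesis unfolding Ab_def by simp
    qed
    then show "?f \<in> (\<Pi>\<^sub>E a\<in>obj Fb. Hom Ab (fobj M a) (fobj N a))" by auto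
    show "cmp Ab (fobj M a) (fobj M b) (fobj N b) (?f b) (farr M a b r) =
        cmp Ab (fobj M a) (fobj N a) (fobj N b) (farr N a b r) (?f a)"
      if ab: "a \<in> obj Fb" "b \<in> obj Fb" "r \<in> Hom Fb a b" for a b r
    proof (rule ext)
      fix x
      have "farr M a b r x \<in> carrier (fobj M b)" if "x \<in> carrier (fobj M a)"
        using hom_in_carrier[OF Obj_hom[OF M]] ab that by blast
      then show "cmp Ab (fobj M a) (fobj M b) (fobj N b) (?f b) (farr M a b r) x =
        cmp Ab (fobj M a) (fobj N a) (fobj N b) (farr N a b r) (?f a) x"
        using nat ab unfolding Ab_def by (simp add: compose_def)
    qed
  qed
  moreover have "?f None x = g x" if "x \<in> carrier (total M)" for x
    using that unfolding h_def total_def obj_Fb by simp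
  ultimately show ?thesis using that by blast
qed

text \<open>On the parts, the component at \<infinity> is conjugate to the component at \<mu> under
  the bijections \<open>inc\<close>, so the condition defining \<Sigma> can be read inside the total
  modules.\<close>

lemma Sigma_iff:
  assumes M: "M \<in> Obj" and N: "N \<in> Obj" and f: "f \<in> Hom PG M N"
  shows "f \<in> Glid_Sigma G leq \<Lambda> R F M N \<longleftrightarrow> (\<forall>\<mu>\<in>\<Lambda>. bij_betw (f None) (part M \<mu>) (part N \<mu>))"
proof -
  have "f (Some \<mu>) \<in> iso (fobj M (Some \<mu>)) (fobj N (Some \<mu>)) \<longleftrightarrow> bij_betw (f None) (part M \<mu>) (part N \<mu>)"
    if mu: "\<mu> \<in> \<Lambda>" for \<mu>
  proof -
    let ?A = "carrier (fobj M (Some \<mu>))" and ?B = "carrier (fobj N (Some \<mu>))"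
    have h: "f (Some \<mu>) \<in> hom (fobj M (Some \<mu>)) (fobj N (Some \<mu>))"
      using PG_component(1)[OF f] mu unfolding obj_Fb by blast
    have img: "f (Some \<mu>) ` ?A \<subseteq> ?B" using hom_in_carrier[OF h] by blast
    have bM: "bij_betw (inc M \<mu>) ?A (part M \<mu>)"
      using inc_inj[OF M mu] unfolding part_def bij_betw_def by blast
    have bN: "bij_betw (inc N \<mu>) ?B (part N \<mu>)"
      using inc_inj[OF N mu] unfolding part_def bij_betw_def by blast
    have "bij_betw (f None) (part M \<mu>) (part N \<mu>) \<longleftrightarrow> bij_betw (f None \<circ> inc M \<mu>) ?A (part N \<mu>)"
      using bij_betw_comp_iff[OF bM] .
    also have "\<dots> \<longleftrightarrow> bij_betw (inc N \<mu> \<circ> f (Some \<mu>)) ?A (part N \<mu>)"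
      by (rule bij_betw_cong) (use PG_inc[OF M N f mu] in simp)
    also have "\<dots> \<longleftrightarrow> bij_betw (f (Some \<mu>)) ?A ?B"
      using bij_betw_comp_iff2[OF bN img] by blast
    finally show ?thesis using h unfolding iso_def by blast
  qed
  then show ?thesis using f unfolding Glid_Sigma_def by blast
qed

lemma ident_PG_None: "x \<in> carrier (total M) \<Longrightarrow> ident PG M None x = x"
  unfolding ident_PG total_def Ab_def obj_Fb by simp

lemma cmp_PG_None: "x \<in> carrier (total M) \<Longrightarrow> cmp PG M N P g f None x = g None (f None x)"
  unfolding cmp_PG total_def Ab_def obj_Fb by (simp add: compose_def)

lemma is_category_PG: "is_category PG"
  unfolding Preglid_def Mod_Fbar_def
proof (intro is_category_full_subcategory is_category_functor_category is_category_Ab)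
  show "{M. additive_functor Fb (\<lambda>a b r s. r \<oplus>\<^bsub>R\<^esub> s) Ab Ab_add M} \<subseteq>
      obj (functor_category Fb Ab)"
    unfolding functor_category_def additive_functor_def by auto
qed blast

context
  fixes M :: "('g, 'r, 'u) module_functor"
  assumes M: "M \<in> Obj"
begin

lemma total_group: "comm_group (total M)"
  and total_small: "small TYPE('u) (carrier (total M))"
  and act_closed: "r \<in> carrier R \<Longrightarrow> x \<in> carrier (total M) \<Longrightarrow> act M r x \<in> carrier (total M)"
  and act_mult: "r \<in> carrier R \<Longrightarrow> x \<in> carrier (total M) \<Longrightarrow> y \<in> carrier (total M) \<Longrightarrow>
    act M r (x \<otimes>\<^bsub>total M\<^esub> y) = act M r x \<otimes>\<^bsub>total M\<^esub> act M r y"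
  and act_add: "r \<in> carrier R \<Longrightarrow> s \<in> carrier R \<Longrightarrow> x \<in> carrier (total M) \<Longrightarrow>
    act M (r \<oplus>\<^bsub>R\<^esub> s) x = act M r x \<otimes>\<^bsub>total M\<^esub> act M s x"
  and act_act: "r \<in> carrier R \<Longrightarrow> s \<in> carrier R \<Longrightarrow> x \<in> carrier (total M) \<Longrightarrow>
    act M (r \<otimes>\<^bsub>R\<^esub> s) x = act M r (act M s x)"
  and act_one: "x \<in> carrier (total M) \<Longrightarrow> act M \<one>\<^bsub>R\<^esub> x = x"
  and part_subgroup: "\<mu> \<in> \<Lambda> \<Longrightarrow> subgroup (part M \<mu>) (total M)"
  and act_part: "\<alpha> \<in> \<Lambda> \<Longrightarrow> \<beta> \<in> \<Lambda> \<Longrightarrow> r \<in> scal \<alpha> \<beta> \<Longrightarrow> x \<in> part M \<alpha> \<Longrightarrow> act M r x \<in> part M \<beta>"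
  using glider_of_Obj[OF M] unfolding is_glider_def by blast+

lemma total_group': "group (total M)"
  using total_group by (rule comm_group.axioms(2))

lemma total_mult: "x \<in> carrier (total M) \<Longrightarrow> y \<in> carrier (total M) \<Longrightarrow> x \<otimes>\<^bsub>total M\<^esub> y \<in> carrier (total M)"
  and total_one: "\<one>\<^bsub>total M\<^esub> \<in> carrier (total M)"
  and total_inv: "x \<in> carrier (total M) \<Longrightarrow> inv\<^bsub>total M\<^esub> x \<in> carrier (total M)"
  and total_l_one: "x \<in> carrier (total M) \<Longrightarrow> \<one>\<^bsub>total M\<^esub> \<otimes>\<^bsub>total M\<^esub> x = x"
  and total_r_one: "x \<in> carrier (total M) \<Longrightarrow> x \<otimes>\<^bsub>total M\<^esub> \<one>\<^bsub>total M\<^esub> = x"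
  and total_assoc: "x \<in> carrier (total M) \<Longrightarrow> y \<in> carrier (total M) \<Longrightarrow> z \<in> carrier (total M) \<Longrightarrow>
    x \<otimes>\<^bsub>total M\<^esub> y \<otimes>\<^bsub>total M\<^esub> z = x \<otimes>\<^bsub>total M\<^esub> (y \<otimes>\<^bsub>total M\<^esub> z)"
  and total_comm: "x \<in> carrier (total M) \<Longrightarrow> y \<in> carrier (total M) \<Longrightarrow> x \<otimes>\<^bsub>total M\<^esub> y = y \<otimes>\<^bsub>total M\<^esub> x"
proof -
  interpret comm_group "total M" by (rule total_group)
  show "x \<otimes>\<^bsub>total M\<^esub> y \<in> carrier (total M)" if "x \<in> carrier (total M)" "y \<in> carrier (total M)" using that by simp
  show "\<one>\<^bsub>total M\<^esub> \<in> carrier (total M)" by simp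
  show "inv\<^bsub>total M\<^esub> x \<in> carrier (total M)" if "x \<in> carrier (total M)" using that by simp
  show "\<one>\<^bsub>total M\<^esub> \<otimes>\<^bsub>total M\<^esub> x = x" if "x \<in> carrier (total M)" using that by simp
  show "x \<otimes>\<^bsub>total M\<^esub> \<one>\<^bsub>total M\<^esub> = x" if "x \<in> carrier (total M)" using that by simp
  show "x \<otimes>\<^bsub>total M\<^esub> y \<otimes>\<^bsub>total M\<^esub> z = x \<otimes>\<^bsub>total M\<^esub> (y \<otimes>\<^bsub>total M\<^esub> z)"
    if "x \<in> carrier (total M)" "y \<in> carrier (total M)" "z \<in> carrier (total M)" using that by (rule m_assoc)
  show "x \<otimes>\<^bsub>total M\<^esub> y = y \<otimes>\<^bsub>total M\<^esub> x" if "x \<in> carrier (total M)" "y \<in> carrier (total M)" using that by (rule m_comm)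
qed

lemma total_idem: "x \<in> carrier (total M) \<Longrightarrow> x \<otimes>\<^bsub>total M\<^esub> x = x \<Longrightarrow> x = \<one>\<^bsub>total M\<^esub>"
  using group.l_cancel_one'[OF total_group', of x x] by metis

lemma part_total: "\<mu> \<in> \<Lambda> \<Longrightarrow> x \<in> part M \<mu> \<Longrightarrow> x \<in> carrier (total M)"
  using subgroup.subset[OF part_subgroup] by blast

lemma part_mult: "\<mu> \<in> \<Lambda> \<Longrightarrow> x \<in> part M \<mu> \<Longrightarrow> y \<in> part M \<mu> \<Longrightarrow> x \<otimes>\<^bsub>total M\<^esub> y \<in> part M \<mu>"
  and part_one: "\<mu> \<in> \<Lambda> \<Longrightarrow> \<one>\<^bsub>total M\<^esub> \<in> part M \<mu>"
  and part_inv: "\<mu> \<in> \<Lambda> \<Longrightarrow> x \<in> part M \<mu> \<Longrightarrow> inv\<^bsub>total M\<^esub> x \<in> part M \<mu>"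
  using subgroup.m_closed[OF part_subgroup] subgroup.one_closed[OF part_subgroup]
    subgroup.m_inv_closed[OF part_subgroup] by blast+

lemma part_small: "\<mu> \<in> \<Lambda> \<Longrightarrow> small TYPE('u) (part M \<mu>)"
  using small_subset[OF total_small] part_total by blast

lemma act_zero: "x \<in> carrier (total M) \<Longrightarrow> act M \<zero>\<^bsub>R\<^esub> x = \<one>\<^bsub>total M\<^esub>"
  using act_add[of "\<zero>\<^bsub>R\<^esub>" "\<zero>\<^bsub>R\<^esub>" x] total_idem act_closed by simp

lemma act_unit: "r \<in> carrier R \<Longrightarrow> act M r \<one>\<^bsub>total M\<^esub> = \<one>\<^bsub>total M\<^esub>"
  using act_mult[of r "\<one>\<^bsub>total M\<^esub>" "\<one>\<^bsub>total M\<^esub>"] total_idem act_closed total_one total_l_one by metis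

lemma act_minus: "r \<in> carrier R \<Longrightarrow> x \<in> carrier (total M) \<Longrightarrow>
    act M r x \<otimes>\<^bsub>total M\<^esub> act M (\<ominus>\<^bsub>R\<^esub> r) x = \<one>\<^bsub>total M\<^esub>"
  using act_add[of r "\<ominus>\<^bsub>R\<^esub> r" x] act_zero by (simp add: R.r_neg)

lemma act_minus_one: "x \<in> carrier (total M) \<Longrightarrow> act M (\<ominus>\<^bsub>R\<^esub> \<one>\<^bsub>R\<^esub>) x = inv\<^bsub>total M\<^esub> x"
  using act_minus[of "\<one>\<^bsub>R\<^esub>" x] act_one act_closed group.inv_equality[OF total_group', of _ x]
    total_comm[OF _ act_closed] by simp

lemma total_mult_inv_eq_one_iff: "x \<in> carrier (total M) \<Longrightarrow> y \<in> carrier (total M) \<Longrightarrow>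
    x \<otimes>\<^bsub>total M\<^esub> inv\<^bsub>total M\<^esub> y = \<one>\<^bsub>total M\<^esub> \<longleftrightarrow> x = y"
proof -
  interpret comm_group "total M" by (rule total_group)
  assume "x \<in> carrier (total M)" "y \<in> carrier (total M)"
  then show ?thesis by (metis inv_closed inv_equality inv_inv r_inv)
qed

end

text \<open>
  Every object needed below is a quotient of a set \<open>A\<close> that carries the operations of a glider
  only up to an equivalence relation \<open>E\<close>; \<open>q\<close> is the quotient map.
\<close>

definition presents ::
  "'a set \<Rightarrow> ('a \<Rightarrow> 'a \<Rightarrow> bool) \<Rightarrow> ('a \<Rightarrow> 'a \<Rightarrow> 'a) \<Rightarrow> ('r \<Rightarrow> 'a \<Rightarrow> 'a) \<Rightarrow> ('g \<Rightarrow> 'a set) \<Rightarrow>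
    ('g, 'r, 'u) module_functor \<Rightarrow> ('a \<Rightarrow> 'u) \<Rightarrow> bool" where
  "presents A E p a V M q \<longleftrightarrow> M \<in> Obj \<and> carrier (total M) = q ` A \<and>
    (\<forall>x\<in>A. \<forall>y\<in>A. q x = q y \<longleftrightarrow> E x y) \<and>
    (\<forall>x\<in>A. \<forall>y\<in>A. p x y \<in> A \<and> q (p x y) = q x \<otimes>\<^bsub>total M\<^esub> q y) \<and>
    (\<forall>r\<in>carrier R. \<forall>x\<in>A. a r x \<in> A \<and> q (a r x) = act M r (q x)) \<and>
    (\<forall>\<mu>\<in>\<Lambda>. V \<mu> \<subseteq> A \<and> part M \<mu> = q ` V \<mu>)"

lemma presentsD:
  assumes "presents A E p a V M q"
  shows "M \<in> Obj" "carrier (total M) = q ` A"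
    "\<And>x y. x \<in> A \<Longrightarrow> y \<in> A \<Longrightarrow> q x = q y \<longleftrightarrow> E x y"
    "\<And>x y. x \<in> A \<Longrightarrow> y \<in> A \<Longrightarrow> p x y \<in> A"
    "\<And>x y. x \<in> A \<Longrightarrow> y \<in> A \<Longrightarrow> q (p x y) = q x \<otimes>\<^bsub>total M\<^esub> q y"
    "\<And>r x. r \<in> carrier R \<Longrightarrow> x \<in> A \<Longrightarrow> a r x \<in> A"
    "\<And>r x. r \<in> carrier R \<Longrightarrow> x \<in> A \<Longrightarrow> q (a r x) = act M r (q x)"
    "\<And>\<mu>. \<mu> \<in> \<Lambda> \<Longrightarrow> V \<mu> \<subseteq> A"
    "\<And>\<mu>. \<mu> \<in> \<Lambda> \<Longrightarrow> part M \<mu> = q ` V \<mu>"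
  using assms by (simp_all add: presents_def)

text \<open>The elements of the quotient are codes in \<open>'u\<close> of chosen representatives,
  so the carrier is an image of \<open>A\<close> and smallness is immediate. Inverses are absent
  from the data: \<open>a_add\<close>, \<open>a_one\<close> and \<open>a_zero\<close> show that the
  scalar minus one produces them.\<close>

lemma setoid_presents:
  fixes A :: "'a set"
  assumes small: "small TYPE('u) A"
    and refl: "\<And>x. x \<in> A \<Longrightarrow> E x x"
    and sym: "\<And>x y. x \<in> A \<Longrightarrow> y \<in> A \<Longrightarrow> E x y \<Longrightarrow> E y x"
    and trans: "\<And>x y w. x \<in> A \<Longrightarrow> y \<in> A \<Longrightarrow> w \<in> A \<Longrightarrow> E x y \<Longrightarrow> E y w \<Longrightarrow> E x w"
    and p_closed: "\<And>x y. x \<in> A \<Longrightarrow> y \<in> A \<Longrightarrow> p x y \<in> A"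
    and p_cong: "\<And>x y x' y'. x \<in> A \<Longrightarrow> y \<in> A \<Longrightarrow> x' \<in> A \<Longrightarrow> y' \<in> A \<Longrightarrow> E x x' \<Longrightarrow> E y y' \<Longrightarrow> E (p x y) (p x' y')"
    and p_assoc: "\<And>x y w. x \<in> A \<Longrightarrow> y \<in> A \<Longrightarrow> w \<in> A \<Longrightarrow> E (p (p x y) w) (p x (p y w))"
    and p_comm: "\<And>x y. x \<in> A \<Longrightarrow> y \<in> A \<Longrightarrow> E (p x y) (p y x)"
    and z: "z \<in> A" and p_z: "\<And>x. x \<in> A \<Longrightarrow> E (p z x) x"
    and a_closed: "\<And>r x. r \<in> carrier R \<Longrightarrow> x \<in> A \<Longrightarrow> a r x \<in> A"
    and a_cong: "\<And>r x y. r \<in> carrier R \<Longrightarrow> x \<in> A \<Longrightarrow> y \<in> A \<Longrightarrow> E x y \<Longrightarrow> E (a r x) (a r y)"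
    and a_p: "\<And>r x y. r \<in> carrier R \<Longrightarrow> x \<in> A \<Longrightarrow> y \<in> A \<Longrightarrow> E (a r (p x y)) (p (a r x) (a r y))"
    and a_add: "\<And>r s x. r \<in> carrier R \<Longrightarrow> s \<in> carrier R \<Longrightarrow> x \<in> A \<Longrightarrow> E (a (r \<oplus>\<^bsub>R\<^esub> s) x) (p (a r x) (a s x))"
    and a_mult: "\<And>r s x. r \<in> carrier R \<Longrightarrow> s \<in> carrier R \<Longrightarrow> x \<in> A \<Longrightarrow> E (a (r \<otimes>\<^bsub>R\<^esub> s) x) (a r (a s x))"
    and a_one: "\<And>x. x \<in> A \<Longrightarrow> E (a \<one>\<^bsub>R\<^esub> x) x"
    and a_zero: "\<And>x. x \<in> A \<Longrightarrow> E (a \<zero>\<^bsub>R\<^esub> x) z"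
    and V_sub: "\<And>\<mu>. \<mu> \<in> \<Lambda> \<Longrightarrow> V \<mu> \<subseteq> A" and V_ne: "\<And>\<mu>. \<mu> \<in> \<Lambda> \<Longrightarrow> V \<mu> \<noteq> {}"
    and V_p: "\<And>\<mu> x y. \<mu> \<in> \<Lambda> \<Longrightarrow> x \<in> V \<mu> \<Longrightarrow> y \<in> V \<mu> \<Longrightarrow> \<exists>w\<in>V \<mu>. E w (p x y)"
    and V_a: "\<And>\<alpha> \<beta> r x. \<alpha> \<in> \<Lambda> \<Longrightarrow> \<beta> \<in> \<Lambda> \<Longrightarrow> r \<in> scal \<alpha> \<beta> \<Longrightarrow> x \<in> V \<alpha> \<Longrightarrow> \<exists>w\<in>V \<beta>. E w (a r x)"
  shows "\<exists>M q. presents A E p a V M q \<and> q z = \<one>\<^bsub>total M\<^esub>"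
proof -
  obtain e :: "'a \<Rightarrow> 'u" where e: "inj_on e A" using small_encode[OF small] .
  define rep where "rep x = (SOME y. y \<in> A \<and> E x y)" for x
  have rep: "rep x \<in> A" "E x (rep x)" if "x \<in> A" for x
    using someI[of "\<lambda>y. y \<in> A \<and> E x y" x] refl that unfolding rep_def by blast+
  have rep_eq: "rep x = rep y \<longleftrightarrow> E x y" if "x \<in> A" "y \<in> A" for x y
  proof
    assume "rep x = rep y" then show "E x y" using rep[of x] rep[of y] that sym trans by metis
  next
    assume "E x y"
    then have "(\<lambda>w. w \<in> A \<and> E x w) = (\<lambda>w. w \<in> A \<and> E y w)" using that sym trans by blast
    then show "rep x = rep y" unfolding rep_def by simp
  qed
  define q where "q x = e (rep x)" for x
  have q_eq: "q x = q y \<longleftrightarrow> E x y" if "x \<in> A" "y \<in> A" for x y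
    using that rep(1) rep_eq inj_on_eq_iff[OF e] unfolding q_def by simp
  define i where "i = inv_into A q"
  have i: "i u \<in> A" "q (i u) = u" if "u \<in> q ` A" for u
    using that unfolding i_def by (simp_all add: inv_into_into f_inv_into_f)
  have iq: "E (i (q x)) x" if "x \<in> A" for x using i[of "q x"] q_eq that by blast
  define \<Omega> where "\<Omega> = \<lparr>carrier = q ` A, monoid.mult = (\<lambda>u v. q (p (i u) (i v))), one = q z\<rparr>"
  have c: "carrier \<Omega> = q ` A" and o: "\<one>\<^bsub>\<Omega>\<^esub> = q z" and m: "u \<otimes>\<^bsub>\<Omega>\<^esub> v = q (p (i u) (i v))" for u v
    unfolding \<Omega>_def by simp_all
  have mq: "q x \<otimes>\<^bsub>\<Omega>\<^esub> q y = q (p x y)" if "x \<in> A" "y \<in> A" for x y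
    unfolding m using q_eq p_closed p_cong iq i that by simp
  define b where "b r u = q (a r (i u))" for r u
  have bq: "b r (q x) = q (a r x)" if "r \<in> carrier R" "x \<in> A" for r x
    unfolding b_def using q_eq a_closed a_cong iq i that by simp
  have grp: "comm_group \<Omega>"
  proof (rule comm_groupI; unfold c o)
    show "u \<otimes>\<^bsub>\<Omega>\<^esub> v \<in> q ` A" if "u \<in> q ` A" "v \<in> q ` A" for u v
      using that mq p_closed by auto
    show "q z \<in> q ` A" using z by blast
    show "u \<otimes>\<^bsub>\<Omega>\<^esub> v \<otimes>\<^bsub>\<Omega>\<^esub> w = u \<otimes>\<^bsub>\<Omega>\<^esub> (v \<otimes>\<^bsub>\<Omega>\<^esub> w)" if "u \<in> q ` A" "v \<in> q ` A" "w \<in> q ` A" for u v w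
      using that by (auto simp: mq p_closed q_eq p_assoc)
    show "u \<otimes>\<^bsub>\<Omega>\<^esub> v = v \<otimes>\<^bsub>\<Omega>\<^esub> u" if "u \<in> q ` A" "v \<in> q ` A" for u v
      using that by (auto simp: mq p_closed q_eq p_comm)
    show "q z \<otimes>\<^bsub>\<Omega>\<^esub> u = u" if "u \<in> q ` A" for u
      using that by (auto simp: mq z p_closed q_eq p_z)
    show "\<exists>v\<in>q ` A. v \<otimes>\<^bsub>\<Omega>\<^esub> u = q z" if "u \<in> q ` A" for u
    proof -
      obtain x where x: "u = q x" "x \<in> A" using \<open>u \<in> q ` A\<close> by blast
      have m1: "\<ominus>\<^bsub>R\<^esub> \<one>\<^bsub>R\<^esub> \<in> carrier R" by simp
      have "\<ominus>\<^bsub>R\<^esub> \<one>\<^bsub>R\<^esub> \<oplus>\<^bsub>R\<^esub> \<one>\<^bsub>R\<^esub> = \<zero>\<^bsub>R\<^esub>" by (simp add: R.l_neg)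
      then have "q (p (a (\<ominus>\<^bsub>R\<^esub> \<one>\<^bsub>R\<^esub>) x) (a \<one>\<^bsub>R\<^esub> x)) = q z"
        using a_add[OF m1 R.one_closed x(2)] a_zero[OF x(2)] x a_closed[OF m1 x(2)] a_closed[OF R.one_closed x(2)]
          a_closed[OF R.zero_closed x(2)] p_closed z q_eq by metis
      moreover have "q (a \<one>\<^bsub>R\<^esub> x) = q x" using a_one x a_closed[OF R.one_closed x(2)] q_eq by blast
      ultimately have "q (a (\<ominus>\<^bsub>R\<^esub> \<one>\<^bsub>R\<^esub>) x) \<otimes>\<^bsub>\<Omega>\<^esub> u = q z"
        using mq a_closed[OF m1 x(2)] a_closed[OF R.one_closed x(2)] x by metis
      then show ?thesis using a_closed[OF m1 x(2)] by blast
    qed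
  qed
  interpret \<Omega>: comm_group \<Omega> by (rule grp)
  have Vq_p: "u \<otimes>\<^bsub>\<Omega>\<^esub> v \<in> q ` V \<mu>" if mu: "\<mu> \<in> \<Lambda>" and uv: "u \<in> q ` V \<mu>" "v \<in> q ` V \<mu>" for \<mu> u v
  proof -
    obtain x y where xy: "u = q x" "v = q y" "x \<in> V \<mu>" "y \<in> V \<mu>" using uv by blast
    obtain w where w: "w \<in> V \<mu>" "E w (p x y)" using V_p[OF mu xy(3,4)] by blast
    have "x \<in> A" "y \<in> A" "w \<in> A" using V_sub[OF mu] xy w by blast+
    then have "u \<otimes>\<^bsub>\<Omega>\<^esub> v = q w" using mq[of x y] q_eq[of w "p x y"] xy w p_closed by simp
    then show ?thesis using w by blast
  qed
  have Vq_a: "b r u \<in> q ` V \<beta>" if ab: "\<alpha> \<in> \<Lambda>" "\<beta> \<in> \<Lambda>" "r \<in> scal \<alpha> \<beta>" and u: "u \<in> q ` V \<alpha>" for \<alpha> \<beta> r u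
  proof -
    obtain x where x: "u = q x" "x \<in> V \<alpha>" using u by blast
    have r: "r \<in> carrier R" using scal_R ab by blast
    obtain w where w: "w \<in> V \<beta>" "E w (a r x)" using V_a[OF ab x(2)] by blast
    have "x \<in> A" "w \<in> A" using V_sub[OF ab(1)] V_sub[OF ab(2)] x w by blast+
    then have "b r u = q w" using bq[OF r, of x] q_eq[of w "a r x"] x w a_closed[OF r] by simp
    then show ?thesis using w by blast
  qed
  have b_zero: "b \<zero>\<^bsub>R\<^esub> u = \<one>\<^bsub>\<Omega>\<^esub>" if "u \<in> q ` A" for u
    using that bq q_eq a_zero z a_closed o by auto
  have b_add: "b (r \<oplus>\<^bsub>R\<^esub> s) u = b r u \<otimes>\<^bsub>\<Omega>\<^esub> b s u" if "r \<in> carrier R" "s \<in> carrier R" "u \<in> q ` A" for r s u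
    using that by (auto simp: bq mq a_closed p_closed q_eq a_add)
  have b_one: "b \<one>\<^bsub>R\<^esub> u = u" if "u \<in> q ` A" for u
    using that by (auto simp: bq a_closed q_eq a_one)
  have "is_glider \<Omega> b (\<lambda>\<mu>. q ` V \<mu>)"
    unfolding is_glider_def c
  proof (intro conjI ballI)
    show "small TYPE('u) (q ` A)" by (rule small_image[OF small])
    show "b r u \<in> q ` A" if "r \<in> carrier R" "u \<in> q ` A" for r u
      using that bq a_closed by auto
    show "b r (u \<otimes>\<^bsub>\<Omega>\<^esub> v) = b r u \<otimes>\<^bsub>\<Omega>\<^esub> b r v" if "r \<in> carrier R" "u \<in> q ` A" "v \<in> q ` A" for r u v
      using that by (auto simp: bq mq a_closed p_closed q_eq a_p)
    show "b (r \<otimes>\<^bsub>R\<^esub> s) u = b r (b s u)" if "r \<in> carrier R" "s \<in> carrier R" "u \<in> q ` A" for r s u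
      using that by (auto simp: bq a_closed q_eq a_mult)
    show "subgroup (q ` V \<mu>) \<Omega>" if mu: "\<mu> \<in> \<Lambda>" for \<mu>
    proof (rule \<Omega>.subgroupI)
      show "q ` V \<mu> \<subseteq> carrier \<Omega>" unfolding c using V_sub[OF mu] by blast
      show "q ` V \<mu> \<noteq> {}" using V_ne[OF mu] by blast
      show "inv\<^bsub>\<Omega>\<^esub> u \<in> q ` V \<mu>" if u: "u \<in> q ` V \<mu>" for u
      proof -
        have uA: "u \<in> q ` A" using u V_sub[OF mu] by blast
        have m1: "\<ominus>\<^bsub>R\<^esub> \<one>\<^bsub>R\<^esub> \<in> carrier R" by simp
        \<comment> \<open>Minus one is a scalar from \<mu> to \<mu>, so \<open>V_a\<close> supplies
          the inverse inside the part.\<close>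
        have bu: "b (\<ominus>\<^bsub>R\<^esub> \<one>\<^bsub>R\<^esub>) u \<in> q ` V \<mu>"
          using Vq_a[OF mu mu scal_minus_one[OF mu mu leq_refl[OF mu]] u] .
        have "b (\<ominus>\<^bsub>R\<^esub> \<one>\<^bsub>R\<^esub>) u \<otimes>\<^bsub>\<Omega>\<^esub> u = \<one>\<^bsub>\<Omega>\<^esub>"
          using b_add[OF m1 R.one_closed uA] b_zero[OF uA] b_one[OF uA] by (simp add: R.l_neg)
        then have "inv\<^bsub>\<Omega>\<^esub> u = b (\<ominus>\<^bsub>R\<^esub> \<one>\<^bsub>R\<^esub>) u"
          using \<Omega>.inv_equality uA bu V_sub[OF mu] c by blast
        then show ?thesis using bu by simp
      qed
      show "u \<otimes>\<^bsub>\<Omega>\<^esub> v \<in> q ` V \<mu>" if "u \<in> q ` V \<mu>" "v \<in> q ` V \<mu>" for u v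
        using Vq_p mu that by blast
    qed
  qed (use grp b_add b_one Vq_a in auto)
  then obtain M where M: "M \<in> Obj" "total M = \<Omega>"
    "\<And>r x. r \<in> carrier R \<Longrightarrow> x \<in> carrier \<Omega> \<Longrightarrow> act M r x = b r x"
    "\<And>\<mu>. \<mu> \<in> \<Lambda> \<Longrightarrow> part M \<mu> = q ` V \<mu>"
    using Obj_of_glider by metis
  have "presents A E p a V M q"
    unfolding presents_def
  proof (intro conjI ballI)
    show "q (a r x) = act M r (q x)" if "r \<in> carrier R" "x \<in> A" for r x
      using M(3)[of r "q x"] bq that c by simp
  qed (use M c q_eq p_closed mq a_closed V_sub in auto)
  then show ?thesis using M(2) o by metis
qed

text \<open>\<open>k\<close> is constant on the classes of \<open>E\<close>, so it descends along
  \<open>q\<close> to the total module; \<open>PG_lift\<close> adds the components at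
  \<Lambda>.\<close>

lemma presents_PG:
  assumes pr: "presents A E p a V M q" and N: "N \<in> Obj"
    and k: "\<And>x. x \<in> A \<Longrightarrow> k x \<in> carrier (total N)"
    and k_cong: "\<And>x y. x \<in> A \<Longrightarrow> y \<in> A \<Longrightarrow> E x y \<Longrightarrow> k x = k y"
    and k_p: "\<And>x y. x \<in> A \<Longrightarrow> y \<in> A \<Longrightarrow> k (p x y) = k x \<otimes>\<^bsub>total N\<^esub> k y"
    and k_a: "\<And>r x. r \<in> carrier R \<Longrightarrow> x \<in> A \<Longrightarrow> k (a r x) = act N r (k x)"
    and k_V: "\<And>\<mu> x. \<mu> \<in> \<Lambda> \<Longrightarrow> x \<in> V \<mu> \<Longrightarrow> k x \<in> part N \<mu>"
  shows "\<exists>f\<in>Hom PG M N. \<forall>x\<in>A. f None (q x) = k x"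
proof -
  note M = presentsD(1)[OF pr] and c = presentsD(2)[OF pr] and q = presentsD(3)[OF pr]
    and qp = presentsD(4,5)[OF pr] and qa = presentsD(6,7)[OF pr] and V = presentsD(9)[OF pr]
  define g where "g u = k (inv_into A q u)" for u
  have g: "g (q x) = k x" if x: "x \<in> A" for x
  proof -
    have "inv_into A q (q x) \<in> A" "q (inv_into A q (q x)) = q x"
      using x by (simp_all add: inv_into_into f_inv_into_f)
    then show ?thesis unfolding g_def using k_cong q x by blast
  qed
  have "g \<in> hom (total M) (total N)"
  proof (rule homI)
    fix u v assume uv: "u \<in> carrier (total M)" "v \<in> carrier (total M)"
    then obtain x y where xy: "u = q x" "v = q y" "x \<in> A" "y \<in> A" unfolding c by blast
    then show "g u \<in> carrier (total N)" using g k by simp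
    show "g (u \<otimes>\<^bsub>total M\<^esub> v) = g u \<otimes>\<^bsub>total N\<^esub> g v"
      using qp[of x y] g[of "p x y"] g[OF xy(3)] g[OF xy(4)] k_p[of x y] xy by metis
  qed
  moreover have "g (act M r u) = act N r (g u)" if r: "r \<in> carrier R" and u: "u \<in> carrier (total M)" for r u
  proof -
    obtain x where x: "u = q x" "x \<in> A" using u unfolding c by blast
    then show ?thesis using qa[of r x] r g[of "a r x"] g[OF x(2)] k_a[OF r x(2)] by metis
  qed
  moreover have "g u \<in> part N \<mu>" if "\<mu> \<in> \<Lambda>" "u \<in> part M \<mu>" for \<mu> u
    using V[OF that(1)] presentsD(8)[OF pr that(1)] that(2) g k_V[OF that(1)] by auto
  ultimately obtain f where "f \<in> Hom PG M N" "\<And>x. x \<in> carrier (total M) \<Longrightarrow> f None x = g x"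
    using PG_lift[OF M N, of g] by blast
  then show ?thesis using g c by (intro bexI[of _ f]) auto
qed


section \<open>Homomorphisms defined on the parts only, and their identification with the
  localization\<close>

section \<open>The category of gliders\<close>

text \<open>Components are indexed by degree because inclusions of parts are respected only along
  \<alpha> \<le> \<beta>, as the case of the scalar one; on an element common to two incomparable
  parts they may differ. Extensionality makes equality of morphisms an equality of
  functions.\<close>

definition gmor :: "('g, 'r, 'u) module_functor \<Rightarrow> ('g, 'r, 'u) module_functor \<Rightarrow> ('g \<Rightarrow> 'u \<Rightarrow> 'u) set" where
  "gmor M N = {f \<in> extensional \<Lambda>. (\<forall>\<mu>\<in>\<Lambda>. f \<mu> \<in> extensional (part M \<mu>)) \<and>
    (\<forall>\<mu>\<in>\<Lambda>. \<forall>x\<in>part M \<mu>. f \<mu> x \<in> part N \<mu>) \<and>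
    (\<forall>\<mu>\<in>\<Lambda>. \<forall>x\<in>part M \<mu>. \<forall>y\<in>part M \<mu>. f \<mu> (x \<otimes>\<^bsub>total M\<^esub> y) = f \<mu> x \<otimes>\<^bsub>total N\<^esub> f \<mu> y) \<and>
    (\<forall>\<alpha>\<in>\<Lambda>. \<forall>\<beta>\<in>\<Lambda>. \<forall>r\<in>scal \<alpha> \<beta>. \<forall>x\<in>part M \<alpha>. f \<beta> (act M r x) = act N r (f \<alpha> x))}"

definition mor :: "('g, 'r, 'u) module_functor \<Rightarrow> ('g \<Rightarrow> 'u \<Rightarrow> 'u) \<Rightarrow> 'g \<Rightarrow> 'u \<Rightarrow> 'u" where
  "mor M h = (\<lambda>\<mu>\<in>\<Lambda>. \<lambda>x\<in>part M \<mu>. h \<mu> x)"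

definition GC :: "(('g, 'r, 'u) module_functor, 'g \<Rightarrow> 'u \<Rightarrow> 'u) category" where
  "GC = \<lparr>obj = Obj, Hom = gmor, ident = (\<lambda>M. mor M (\<lambda>\<mu> x. x)),
    cmp = (\<lambda>M N P g f. mor M (\<lambda>\<mu> x. g \<mu> (f \<mu> x)))\<rparr>"

lemma obj_GC [simp]: "obj GC = Obj"
  and Hom_GC [simp]: "Hom GC = gmor"
  and ident_GC [simp]: "ident GC M = mor M (\<lambda>\<mu> x. x)"
  and cmp_GC [simp]: "cmp GC M N P g f = mor M (\<lambda>\<mu> x. g \<mu> (f \<mu> x))"
  unfolding GC_def by simp_all

lemma mor_apply [simp]: "\<mu> \<in> \<Lambda> \<Longrightarrow> x \<in> part M \<mu> \<Longrightarrow> mor M h \<mu> x = h \<mu> x"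
  unfolding mor_def by simp

lemma gmor_mem: "f \<in> gmor M N \<Longrightarrow> \<mu> \<in> \<Lambda> \<Longrightarrow> x \<in> part M \<mu> \<Longrightarrow> f \<mu> x \<in> part N \<mu>"
  and gmor_mult: "f \<in> gmor M N \<Longrightarrow> \<mu> \<in> \<Lambda> \<Longrightarrow> x \<in> part M \<mu> \<Longrightarrow> y \<in> part M \<mu> \<Longrightarrow>
    f \<mu> (x \<otimes>\<^bsub>total M\<^esub> y) = f \<mu> x \<otimes>\<^bsub>total N\<^esub> f \<mu> y"
  and gmor_act: "f \<in> gmor M N \<Longrightarrow> \<alpha> \<in> \<Lambda> \<Longrightarrow> \<beta> \<in> \<Lambda> \<Longrightarrow> r \<in> scal \<alpha> \<beta> \<Longrightarrow> x \<in> part M \<alpha> \<Longrightarrow>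
    f \<beta> (act M r x) = act N r (f \<alpha> x)"
  unfolding gmor_def by blast+

lemma gmorI:
  assumes M: "M \<in> Obj" and "\<And>\<mu> x. \<mu> \<in> \<Lambda> \<Longrightarrow> x \<in> part M \<mu> \<Longrightarrow> h \<mu> x \<in> part N \<mu>"
    and "\<And>\<mu> x y. \<mu> \<in> \<Lambda> \<Longrightarrow> x \<in> part M \<mu> \<Longrightarrow> y \<in> part M \<mu> \<Longrightarrow> h \<mu> (x \<otimes>\<^bsub>total M\<^esub> y) = h \<mu> x \<otimes>\<^bsub>total N\<^esub> h \<mu> y"
    and "\<And>\<alpha> \<beta> r x. \<alpha> \<in> \<Lambda> \<Longrightarrow> \<beta> \<in> \<Lambda> \<Longrightarrow> r \<in> scal \<alpha> \<beta> \<Longrightarrow> x \<in> part M \<alpha> \<Longrightarrow> h \<beta> (act M r x) = act N r (h \<alpha> x)"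
  shows "mor M h \<in> gmor M N"
  unfolding gmor_def
proof (intro CollectI conjI ballI)
  show "mor M h \<mu> (x \<otimes>\<^bsub>total M\<^esub> y) = mor M h \<mu> x \<otimes>\<^bsub>total N\<^esub> mor M h \<mu> y"
    if "\<mu> \<in> \<Lambda>" "x \<in> part M \<mu>" "y \<in> part M \<mu>" for \<mu> x y
    using that assms(3) part_mult[OF M] by simp
  show "mor M h \<beta> (act M r x) = act N r (mor M h \<alpha> x)"
    if "\<alpha> \<in> \<Lambda>" "\<beta> \<in> \<Lambda>" "r \<in> scal \<alpha> \<beta>" "x \<in> part M \<alpha>" for \<alpha> \<beta> r x
    using that assms(4) act_part[OF M] by simp
qed (use assms(2) in \<open>auto simp: mor_def\<close>)

lemma gmor_ext:
  assumes "f \<in> gmor M N" "g \<in> gmor M N'" "\<And>\<mu> x. \<mu> \<in> \<Lambda> \<Longrightarrow> x \<in> part M \<mu> \<Longrightarrow> f \<mu> x = g \<mu> x"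
  shows "f = g"
proof
  fix \<mu>
  show "f \<mu> = g \<mu>"
  proof (cases "\<mu> \<in> \<Lambda>")
    case True
    then have "f \<mu> \<in> extensional (part M \<mu>)" "g \<mu> \<in> extensional (part M \<mu>)" using assms(1,2) unfolding gmor_def by blast+
    then show ?thesis using assms(3)[OF True] by (rule extensionalityI)
  next
    case False
    then show ?thesis using assms(1,2) unfolding gmor_def by (simp add: extensional_def)
  qed
qed

lemma mor_eqI: "(\<And>\<mu> x. \<mu> \<in> \<Lambda> \<Longrightarrow> x \<in> part M \<mu> \<Longrightarrow> f \<mu> x = g \<mu> x) \<Longrightarrow> mor M f = mor M g"
  unfolding mor_def by (auto simp: restrict_def fun_eq_iff)

lemma mor_self: "f \<in> gmor M N \<Longrightarrow> mor M f = f"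
  unfolding mor_def gmor_def by (auto simp: restrict_def fun_eq_iff extensional_def)

lemma gmor_cmp: "M \<in> Obj \<Longrightarrow> f \<in> gmor M N \<Longrightarrow> g \<in> gmor N P \<Longrightarrow> mor M (\<lambda>\<mu> x. g \<mu> (f \<mu> x)) \<in> gmor M P"
  by (rule gmorI) (auto simp: gmor_mem gmor_mult gmor_act)

lemma gmor_ident: "M \<in> Obj \<Longrightarrow> mor M (\<lambda>\<mu> x. x) \<in> gmor M M"
  by (rule gmorI) auto

lemma is_category_GC: "is_category GC"
  unfolding is_category_def
proof (simp, intro conjI ballI)
  show "mor M (\<lambda>\<mu> x. x) \<in> gmor M M" if "M \<in> Obj" for M using gmor_ident that .
  show "mor M (\<lambda>\<mu> x. g \<mu> (f \<mu> x)) \<in> gmor M P" if "M \<in> Obj" "f \<in> gmor M N" "g \<in> gmor N P" for M N P f g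
    using gmor_cmp that .
  show "mor M (\<lambda>\<mu> x. f \<mu> (mor M (\<lambda>\<mu> x. x) \<mu> x)) = f" if "f \<in> gmor M N" for M N f
    using mor_self[OF that] mor_eqI[of M "\<lambda>\<mu> x. f \<mu> (mor M (\<lambda>\<mu> x. x) \<mu> x)" f] by simp
  show "mor M (\<lambda>\<mu> x. mor N (\<lambda>\<mu> x. x) \<mu> (f \<mu> x)) = f" if "f \<in> gmor M N" for M N f
    using mor_self[OF that] mor_eqI[of M "\<lambda>\<mu> x. mor N (\<lambda>\<mu> x. x) \<mu> (f \<mu> x)" f] gmor_mem[OF that] by simp
  show "mor M (\<lambda>\<mu> x. h \<mu> (mor M (\<lambda>\<mu> x. g \<mu> (f \<mu> x)) \<mu> x)) = mor M (\<lambda>\<mu> x. mor N (\<lambda>\<mu> x. h \<mu> (g \<mu> x)) \<mu> (f \<mu> x))"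
    if "f \<in> gmor M N" for M N f g h
    by (rule mor_eqI) (use gmor_mem[OF that] in simp)
qed

lemma gmor_one:
  assumes "M \<in> Obj" "N \<in> Obj" "f \<in> gmor M N" "\<mu> \<in> \<Lambda>"
  shows "f \<mu> \<one>\<^bsub>total M\<^esub> = \<one>\<^bsub>total N\<^esub>"
proof -
  have "f \<mu> \<one>\<^bsub>total M\<^esub> \<otimes>\<^bsub>total N\<^esub> f \<mu> \<one>\<^bsub>total M\<^esub> = f \<mu> \<one>\<^bsub>total M\<^esub>"
    using gmor_mult[OF assms(3,4) part_one part_one] assms(1,4) total_l_one[OF assms(1) total_one] by metis
  moreover have "f \<mu> \<one>\<^bsub>total M\<^esub> \<in> carrier (total N)"
    using part_total[OF assms(2,4)] gmor_mem[OF assms(3,4)] part_one[OF assms(1,4)] by blast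
  ultimately show ?thesis using total_idem[OF assms(2)] by blast
qed

lemma gmor_inv:
  assumes "M \<in> Obj" "N \<in> Obj" "f \<in> gmor M N" "\<mu> \<in> \<Lambda>" "x \<in> part M \<mu>"
  shows "f \<mu> (inv\<^bsub>total M\<^esub> x) = inv\<^bsub>total N\<^esub> (f \<mu> x)"
proof -
  have "f \<mu> (inv\<^bsub>total M\<^esub> x) = f \<mu> (act M (\<ominus>\<^bsub>R\<^esub> \<one>\<^bsub>R\<^esub>) x)"
    using act_minus_one[OF assms(1)] part_total assms by simp
  also have "\<dots> = act N (\<ominus>\<^bsub>R\<^esub> \<one>\<^bsub>R\<^esub>) (f \<mu> x)"
    using gmor_act[OF assms(3,4,4) scal_minus_one[OF assms(4,4) leq_refl[OF assms(4)]] assms(5)] .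
  also have "\<dots> = inv\<^bsub>total N\<^esub> (f \<mu> x)"
    using act_minus_one[OF assms(2)] part_total[OF assms(2,4)] gmor_mem[OF assms(3-5)] by simp
  finally show ?thesis .
qed

lemma gmor_inverse:
  assumes M: "M \<in> Obj" and N: "N \<in> Obj" and f: "f \<in> gmor M N"
    and bij: "\<And>\<mu>. \<mu> \<in> \<Lambda> \<Longrightarrow> bij_betw (f \<mu>) (part M \<mu>) (part N \<mu>)"
  shows "mor N (\<lambda>\<mu>. inv_into (part M \<mu>) (f \<mu>)) \<in> gmor N M"
proof (rule gmorI[OF N])
  let ?g = "\<lambda>\<mu>. inv_into (part M \<mu>) (f \<mu>)"
  have g: "?g \<mu> y \<in> part M \<mu>" "f \<mu> (?g \<mu> y) = y" if "\<mu> \<in> \<Lambda>" "y \<in> part N \<mu>" for \<mu> y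
    using bij[OF that(1)] that(2) bij_betw_inv_into_right bij_betwE[OF bij_betw_inv_into] by metis+
  have inj: "x = y" if "\<mu> \<in> \<Lambda>" "x \<in> part M \<mu>" "y \<in> part M \<mu>" "f \<mu> x = f \<mu> y" for \<mu> x y
    using bij[OF that(1)] that inj_onD unfolding bij_betw_def by metis
  show "?g \<mu> y \<in> part M \<mu>" if "\<mu> \<in> \<Lambda>" "y \<in> part N \<mu>" for \<mu> y using g that by blast
  show "?g \<mu> (x \<otimes>\<^bsub>total N\<^esub> y) = ?g \<mu> x \<otimes>\<^bsub>total M\<^esub> ?g \<mu> y" if "\<mu> \<in> \<Lambda>" "x \<in> part N \<mu>" "y \<in> part N \<mu>" for \<mu> x y
    using inj[OF that(1)] that g part_mult[OF N] part_mult[OF M] gmor_mult[OF f] by simp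
  show "?g \<beta> (act N r x) = act M r (?g \<alpha> x)"
    if "\<alpha> \<in> \<Lambda>" "\<beta> \<in> \<Lambda>" "r \<in> scal \<alpha> \<beta>" "x \<in> part N \<alpha>" for \<alpha> \<beta> r x
    using inj[OF that(2)] that g act_part[OF N] act_part[OF M] gmor_act[OF f that(1-3)] by simp
qed

text \<open>The inverse functions are again additive and linear, by \<open>gmor_inverse\<close>.
  Together with \<open>Sigma_iff\<close> this shows that \<Sigma> is precisely the class of
  morphisms that become invertible in \<open>GC\<close>.\<close>

lemma is_iso_GC_iff:
  assumes M: "M \<in> Obj" and N: "N \<in> Obj" and f: "f \<in> gmor M N"
  shows "is_iso_in GC M N f \<longleftrightarrow> (\<forall>\<mu>\<in>\<Lambda>. bij_betw (f \<mu>) (part M \<mu>) (part N \<mu>))"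
proof
  assume "is_iso_in GC M N f"
  then obtain g where g: "g \<in> gmor N M" and gf: "mor M (\<lambda>\<mu> x. g \<mu> (f \<mu> x)) = mor M (\<lambda>\<mu> x. x)"
    and fg: "mor N (\<lambda>\<mu> x. f \<mu> (g \<mu> x)) = mor N (\<lambda>\<mu> x. x)"
    unfolding is_iso_in_def by auto
  have "g \<mu> (f \<mu> x) = x" if "\<mu> \<in> \<Lambda>" "x \<in> part M \<mu>" for \<mu> x
    using fun_cong[OF fun_cong[OF gf, of \<mu>], of x] that by simp
  moreover have "f \<mu> (g \<mu> x) = x" if "\<mu> \<in> \<Lambda>" "x \<in> part N \<mu>" for \<mu> x
    using fun_cong[OF fun_cong[OF fg, of \<mu>], of x] that by simp
  ultimately show "\<forall>\<mu>\<in>\<Lambda>. bij_betw (f \<mu>) (part M \<mu>) (part N \<mu>)"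
    using gmor_mem[OF f] gmor_mem[OF g] by (intro ballI bij_betwI[where g = "g _"]) auto
next
  assume bij: "\<forall>\<mu>\<in>\<Lambda>. bij_betw (f \<mu>) (part M \<mu>) (part N \<mu>)"
  let ?g = "mor N (\<lambda>\<mu>. inv_into (part M \<mu>) (f \<mu>))"
  have "?g \<in> gmor N M" using gmor_inverse[OF M N f] bij by blast
  moreover have "mor M (\<lambda>\<mu> x. ?g \<mu> (f \<mu> x)) = mor M (\<lambda>\<mu> x. x)"
    using bij gmor_mem[OF f] by (intro mor_eqI) (simp add: bij_betw_inv_into_left[OF bspec[OF bij]])
  moreover have "mor N (\<lambda>\<mu> x. f \<mu> (?g \<mu> x)) = mor N (\<lambda>\<mu> x. x)"
    by (intro mor_eqI) (simp add: bij_betw_inv_into_right[OF bspec[OF bij]])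
  ultimately show "is_iso_in GC M N f" unfolding is_iso_in_def by auto
qed

text \<open>The total module is the full product of the two total modules; only the parts are cut
  down to \<open>V\<close>. Nothing asks \<open>V\<close> to come from a submodule of the product,
  so graphs of morphisms without a component at \<infinity> are covered, as are kernels, biproducts
  and fibre products.\<close>

lemma relation_object:
  assumes M: "M \<in> Obj" and N: "N \<in> Obj"
    and V: "\<And>\<mu>. \<mu> \<in> \<Lambda> \<Longrightarrow> V \<mu> \<subseteq> part M \<mu> \<times> part N \<mu>"
    and V_one: "\<And>\<mu>. \<mu> \<in> \<Lambda> \<Longrightarrow> (\<one>\<^bsub>total M\<^esub>, \<one>\<^bsub>total N\<^esub>) \<in> V \<mu>"
    and V_mult: "\<And>\<mu> x y x' y'. \<mu> \<in> \<Lambda> \<Longrightarrow> (x, y) \<in> V \<mu> \<Longrightarrow> (x', y') \<in> V \<mu> \<Longrightarrow>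
      (x \<otimes>\<^bsub>total M\<^esub> x', y \<otimes>\<^bsub>total N\<^esub> y') \<in> V \<mu>"
    and V_act: "\<And>\<alpha> \<beta> r x y. \<alpha> \<in> \<Lambda> \<Longrightarrow> \<beta> \<in> \<Lambda> \<Longrightarrow> r \<in> scal \<alpha> \<beta> \<Longrightarrow> (x, y) \<in> V \<alpha> \<Longrightarrow>
      (act M r x, act N r y) \<in> V \<beta>"
  obtains P s f where "P \<in> Obj" "s \<in> Hom PG P M" "f \<in> Hom PG P N"
    "\<And>\<mu>. \<mu> \<in> \<Lambda> \<Longrightarrow> bij_betw (\<lambda>x. (s None x, f None x)) (part P \<mu>) (V \<mu>)"
proof -
  let ?A = "carrier (total M) \<times> carrier (total N)"
  note simps = total_mult[OF M] total_mult[OF N] total_assoc[OF M] total_assoc[OF N] total_one[OF M] total_one[OF N]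
    total_l_one[OF M] total_l_one[OF N] act_closed[OF M] act_closed[OF N] act_mult[OF M] act_mult[OF N]
    act_add[OF M] act_add[OF N] act_act[OF M] act_act[OF N] act_one[OF M] act_one[OF N] act_zero[OF M] act_zero[OF N]
  let ?p = "\<lambda>v w. (fst v \<otimes>\<^bsub>total M\<^esub> fst w, snd v \<otimes>\<^bsub>total N\<^esub> snd w)"
  let ?a = "\<lambda>r v. (act M r (fst v), act N r (snd v))"
  have "\<exists>P q. presents ?A (=) ?p ?a V P q \<and> q (\<one>\<^bsub>total M\<^esub>, \<one>\<^bsub>total N\<^esub>) = \<one>\<^bsub>total P\<^esub>"
  proof (rule setoid_presents)
    show "small TYPE('u) ?A" by (rule small_Sigma[OF universe total_small[OF M] total_small[OF N]])
    show "V \<mu> \<subseteq> ?A" if "\<mu> \<in> \<Lambda>" for \<mu>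
      using V[OF that] part_total[OF M that] part_total[OF N that] by auto
    show "V \<mu> \<noteq> {}" if "\<mu> \<in> \<Lambda>" for \<mu> using V_one[OF that] by blast
    show "\<exists>w\<in>V \<mu>. w = ?p x y" if mu: "\<mu> \<in> \<Lambda>" and xy: "x \<in> V \<mu>" "y \<in> V \<mu>" for \<mu> x y
      using V_mult[OF mu, of "fst x" "snd x" "fst y" "snd y"] xy by simp
    show "\<exists>w\<in>V \<beta>. w = ?a r x" if ab: "\<alpha> \<in> \<Lambda>" "\<beta> \<in> \<Lambda>" "r \<in> scal \<alpha> \<beta>" and x: "x \<in> V \<alpha>" for \<alpha> \<beta> r x
      using V_act[OF ab, of "fst x" "snd x"] x by simp
    show "?p x y = ?p y x" if "x \<in> ?A" "y \<in> ?A" for x y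
      using that total_comm[OF M] total_comm[OF N] by (auto simp: mem_Times_iff)
  qed (simp_all add: simps mem_Times_iff)
  then obtain P q where P: "presents ?A (=) ?p ?a V P q" by blast
  note PO = presentsD(1)[OF P] and part = presentsD(9)[OF P] and V_sub = presentsD(8)[OF P]
  have "\<exists>s\<in>Hom PG P M. \<forall>x\<in>?A. s None (q x) = fst x"
    by (rule presents_PG[OF P M]) (auto dest: V[THEN subsetD])
  then obtain s where s: "s \<in> Hom PG P M" "\<And>x. x \<in> ?A \<Longrightarrow> s None (q x) = fst x" by blast
  have "\<exists>f\<in>Hom PG P N. \<forall>x\<in>?A. f None (q x) = snd x"
    by (rule presents_PG[OF P N]) (auto dest: V[THEN subsetD])
  then obtain f where f: "f \<in> Hom PG P N" "\<And>x. x \<in> ?A \<Longrightarrow> f None (q x) = snd x" by blast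
  have "bij_betw (\<lambda>x. (s None x, f None x)) (part P \<mu>) (V \<mu>)" if mu: "\<mu> \<in> \<Lambda>" for \<mu>
  proof (rule bij_betw_imageI)
    have sq: "s None (q x) = fst x" "f None (q x) = snd x" if "x \<in> V \<mu>" for x
      using s(2)[of x] f(2)[of x] V_sub[OF mu] that by blast+
    show "inj_on (\<lambda>x. (s None x, f None x)) (part P \<mu>)"
      unfolding part[OF mu] by (rule inj_onI) (auto simp: sq prod_eq_iff)
    show "(\<lambda>x. (s None x, f None x)) ` part P \<mu> = V \<mu>"
      unfolding part[OF mu] using sq by (simp add: image_image)
  qed
  then show ?thesis using that PO s(1) f(1) by blast
qed

text \<open>The graph of a morphism of gliders lives in \<open>M(\<infinity>) \<times> N(\<infinity>)\<close>, although the morphism has no component at \<open>\<infinity>\<close>.\<close>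

lemma full_up_to_Sigma:
  assumes M: "M \<in> Obj" and N: "N \<in> Obj" and h: "h \<in> gmor M N"
  shows "\<exists>P\<in>Obj. \<exists>s\<in>Glid_Sigma G leq \<Lambda> R F P M. \<exists>f\<in>Hom PG P N. \<forall>\<mu>\<in>\<Lambda>. \<forall>x\<in>part P \<mu>. h \<mu> (s None x) = f None x"
proof -
  let ?V = "\<lambda>\<mu>. {(x, h \<mu> x) |x. x \<in> part M \<mu>}"
  obtain P s f where P: "P \<in> Obj" "s \<in> Hom PG P M" "f \<in> Hom PG P N"
    and bij: "\<And>\<mu>. \<mu> \<in> \<Lambda> \<Longrightarrow> bij_betw (\<lambda>x. (s None x, f None x)) (part P \<mu>) (?V \<mu>)"
  proof (rule relation_object[OF M N, of ?V])
    show "?V \<mu> \<subseteq> part M \<mu> \<times> part N \<mu>" if "\<mu> \<in> \<Lambda>" for \<mu> using gmor_mem[OF h that] by blast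
    show "(\<one>\<^bsub>total M\<^esub>, \<one>\<^bsub>total N\<^esub>) \<in> ?V \<mu>" if "\<mu> \<in> \<Lambda>" for \<mu>
      using gmor_one[OF M N h that] part_one[OF M that] by auto
    show "(x \<otimes>\<^bsub>total M\<^esub> x', y \<otimes>\<^bsub>total N\<^esub> y') \<in> ?V \<mu>"
      if "\<mu> \<in> \<Lambda>" "(x, y) \<in> ?V \<mu>" "(x', y') \<in> ?V \<mu>" for \<mu> x y x' y'
      using that(2,3) gmor_mult[OF h that(1)] part_mult[OF M that(1)] by auto
    show "(act M r x, act N r y) \<in> ?V \<beta>" if "\<alpha> \<in> \<Lambda>" "\<beta> \<in> \<Lambda>" "r \<in> scal \<alpha> \<beta>" "(x, y) \<in> ?V \<alpha>" for \<alpha> \<beta> r x y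
      using that(4) gmor_act[OF h that(1-3)] act_part[OF M that(1-3)] by auto
  qed blast
  have h_s: "h \<mu> (s None x) = f None x" if "\<mu> \<in> \<Lambda>" "x \<in> part P \<mu>" for \<mu> x
    using bij_betwE[OF bij[OF that(1)]] that(2) by auto
  have "bij_betw (s None) (part P \<mu>) (part M \<mu>)" if mu: "\<mu> \<in> \<Lambda>" for \<mu>
  proof -
    \<comment> \<open>A graph projects bijectively to its source, which is what places
      \<open>s\<close> in \<Sigma>.\<close>
    have "bij_betw fst (?V \<mu>) (part M \<mu>)"
      by (rule bij_betw_imageI) (auto simp: inj_on_def image_iff)
    from bij_betw_trans[OF bij[OF mu] this] show ?thesis by (simp add: comp_def)
  qed
  then have "s \<in> Glid_Sigma G leq \<Lambda> R F P M" using Sigma_iff[OF P(1) M P(2)] by blast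
  then show ?thesis using P h_s by blast
qed

text \<open>The equalizer of \<open>f\<close> and \<open>g\<close> at \<open>\<infinity>\<close> contains all parts of \<open>M\<close>.\<close>

lemma faithful_up_to_Sigma:
  assumes M: "M \<in> Obj" and N: "N \<in> Obj" and f: "f \<in> Hom PG M N" and g: "g \<in> Hom PG M N"
    and eq: "\<And>\<mu> x. \<mu> \<in> \<Lambda> \<Longrightarrow> x \<in> part M \<mu> \<Longrightarrow> f None x = g None x"
  shows "\<exists>P\<in>Obj. \<exists>s\<in>Glid_Sigma G leq \<Lambda> R F P M. cmp PG P M N f s = cmp PG P M N g s"
proof -
  let ?A = "{x \<in> carrier (total M). f None x = g None x}"
  note simps = total_mult[OF M] total_assoc[OF M] total_one[OF M] total_l_one[OF M] act_closed[OF M]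
    act_mult[OF M] act_add[OF M] act_act[OF M] act_one[OF M] act_zero[OF M]
    PG_act[OF M N f] PG_act[OF M N g] hom_mult[OF PG_hom[OF f]] hom_mult[OF PG_hom[OF g]]
  note f1 = hom_one[OF PG_hom[OF f] total_group'[OF M] total_group'[OF N]]
    and g1 = hom_one[OF PG_hom[OF g] total_group'[OF M] total_group'[OF N]]
  let ?p = "\<lambda>x y. x \<otimes>\<^bsub>total M\<^esub> y"
  have "\<exists>P q. presents ?A (=) ?p (act M) (part M) P q \<and> q \<one>\<^bsub>total M\<^esub> = \<one>\<^bsub>total P\<^esub>"
  proof (rule setoid_presents)
    show "small TYPE('u) ?A" by (rule small_subset[OF total_small[OF M]]) blast
    show "part M \<mu> \<subseteq> ?A" if "\<mu> \<in> \<Lambda>" for \<mu> using part_total[OF M that] eq[OF that] by blast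
    show "part M \<mu> \<noteq> {}" if "\<mu> \<in> \<Lambda>" for \<mu> using part_one[OF M that] by blast
    show "\<exists>w\<in>part M \<mu>. w = x \<otimes>\<^bsub>total M\<^esub> y" if "\<mu> \<in> \<Lambda>" "x \<in> part M \<mu>" "y \<in> part M \<mu>" for \<mu> x y
      using part_mult[OF M that] by blast
    show "\<exists>w\<in>part M \<beta>. w = act M r x" if "\<alpha> \<in> \<Lambda>" "\<beta> \<in> \<Lambda>" "r \<in> scal \<alpha> \<beta>" "x \<in> part M \<alpha>" for \<alpha> \<beta> r x
      using act_part[OF M that] by blast
    show "x \<otimes>\<^bsub>total M\<^esub> y = y \<otimes>\<^bsub>total M\<^esub> x" if "x \<in> ?A" "y \<in> ?A" for x y using that total_comm[OF M] by simp
  qed (simp_all add: simps f1 g1)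
  then obtain P q where P: "presents ?A (=) ?p (act M) (part M) P q" by blast
  note PO = presentsD(1)[OF P] and c = presentsD(2)[OF P] and part = presentsD(9)[OF P] and V_sub = presentsD(8)[OF P]
  have "\<exists>s\<in>Hom PG P M. \<forall>x\<in>?A. s None (q x) = x"
    by (rule presents_PG[OF P M]) auto
  then obtain s where s: "s \<in> Hom PG P M" "\<And>x. x \<in> ?A \<Longrightarrow> s None (q x) = x" by blast
  have "bij_betw (s None) (part P \<mu>) (part M \<mu>)" if mu: "\<mu> \<in> \<Lambda>" for \<mu>
  proof (rule bij_betw_imageI)
    have sq: "s None (q x) = x" if "x \<in> part M \<mu>" for x
      using s(2)[of x] V_sub[OF mu] that by blast
    show "inj_on (s None) (part P \<mu>)" unfolding part[OF mu] by (rule inj_onI) (auto simp: sq)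
    show "s None ` part P \<mu> = part M \<mu>" unfolding part[OF mu] using sq by (simp add: image_image)
  qed
  then have "s \<in> Glid_Sigma G leq \<Lambda> R F P M" using Sigma_iff[OF PO M s(1)] by blast
  moreover have "cmp PG P M N f s = cmp PG P M N g s"
  proof (rule PG_ext[OF PO N])
    show "cmp PG P M N f s \<in> Hom PG P N" "cmp PG P M N g s \<in> Hom PG P N"
      using cat_cmp[OF is_category_PG] PO M N s f g by blast+
    show "cmp PG P M N f s None x = cmp PG P M N g s None x" if x: "x \<in> carrier (total P)" for x
    proof -
      obtain y where "x = q y" "y \<in> ?A" using x unfolding c by blast
      then show ?thesis using cmp_PG_None[OF x] s(2)[of y] by simp
    qed
  qed
  ultimately show ?thesis using PO by blast
qed

definition underlying :: "('g, 'r, 'u) module_functor \<Rightarrow> ('g, 'r, 'u) module_functor \<Rightarrow>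
    ('g option \<Rightarrow> 'u \<Rightarrow> 'u) \<Rightarrow> 'g \<Rightarrow> 'u \<Rightarrow> 'u" where
  "underlying M N f = mor M (\<lambda>\<mu>. f None)"

text \<open>With \<open>localization_isomorphism\<close> this identifies \<open>Glid\<close> with
  \<open>GC\<close>. The functor keeps the component at \<infinity>, restricted to the
  parts.\<close>

sublocale localizing_functor PG GC underlying "Glid_Sigma G leq \<Lambda> R F"
proof
  show mem: "underlying M N f \<in> Hom GC M N" if "M \<in> Obj" "N \<in> Obj" "f \<in> Hom PG M N" for M N f
    unfolding underlying_def using that
    by (auto intro!: gmorI simp: PG_part PG_act scal_R part_total hom_mult[OF PG_hom[OF that(3)]])
  show "underlying M M (ident PG M) = ident GC M" if "M \<in> Obj" for M
    unfolding underlying_def by (auto intro!: mor_eqI ident_PG_None part_total[OF that])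
  show "underlying M P (cmp PG M N P g f) = cmp GC M N P (underlying N P g) (underlying M N f)"
    if "M \<in> Obj" "N \<in> Obj" "P \<in> Obj" "f \<in> Hom PG M N" "g \<in> Hom PG N P" for M N P f g
    unfolding underlying_def using that
    by (auto intro!: mor_eqI simp: cmp_PG_None part_total PG_part)
  show "f \<in> Glid_Sigma G leq \<Lambda> R F M N \<longleftrightarrow> f \<in> Hom PG M N \<and> is_iso_in GC M N (underlying M N f)"
    if "M \<in> Obj" "N \<in> Obj" for M N f
  proof (cases "f \<in> Hom PG M N")
    case True
    have "bij_betw (underlying M N f \<mu>) (part M \<mu>) (part N \<mu>) \<longleftrightarrow> bij_betw (f None) (part M \<mu>) (part N \<mu>)"
      if "\<mu> \<in> \<Lambda>" for \<mu>
      by (rule bij_betw_cong) (use that in \<open>simp add: underlying_def\<close>)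
    then show ?thesis
      using Sigma_iff[OF that True] is_iso_GC_iff[OF that] mem[OF that True] True by simp
  next
    case False
    then show ?thesis unfolding Glid_Sigma_def by blast
  qed
  show "\<exists>P\<in>Obj. \<exists>s\<in>Glid_Sigma G leq \<Lambda> R F P M. \<exists>f\<in>Hom PG P N. cmp GC P M N h (underlying P M s) = underlying P N f"
    if MN: "M \<in> Obj" "N \<in> Obj" "h \<in> Hom GC M N" for M N h
  proof -
    obtain P s f where P: "P \<in> Obj" "s \<in> Glid_Sigma G leq \<Lambda> R F P M" "f \<in> Hom PG P N"
      "\<forall>\<mu>\<in>\<Lambda>. \<forall>x\<in>part P \<mu>. h \<mu> (s None x) = f None x"
      using full_up_to_Sigma[OF MN(1,2)] MN(3) unfolding Hom_GC by blast
    then have "cmp GC P M N h (underlying P M s) = underlying P N f"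
      unfolding underlying_def by (auto intro!: mor_eqI)
    then show ?thesis using P by blast
  qed
  show "\<exists>P\<in>Obj. \<exists>s\<in>Glid_Sigma G leq \<Lambda> R F P M. cmp PG P M N f s = cmp PG P M N g s"
    if MN: "M \<in> Obj" "N \<in> Obj" "f \<in> Hom PG M N" "g \<in> Hom PG M N" "underlying M N f = underlying M N g" for M N f g
  proof (rule faithful_up_to_Sigma[OF MN(1-4)])
    show "f None x = g None x" if "\<mu> \<in> \<Lambda>" "x \<in> part M \<mu>" for \<mu> x
      using fun_cong[OF fun_cong[OF MN(5), of \<mu>], of x] that unfolding underlying_def by simp
  qed
qed (use is_category_PG is_category_GC in auto)

section \<open>Exactness in each degree, as for abelian groups\<close>

section \<open>Kernels, cokernels and conflations of gliders\<close>

lemma underlying_gmor: "M \<in> Obj \<Longrightarrow> N \<in> Obj \<Longrightarrow> f \<in> Hom PG M N \<Longrightarrow> underlying M N f \<in> gmor M N"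
  using map_mem by simp

lemma gmor_eqD: "mor M f = mor M g \<Longrightarrow> \<mu> \<in> \<Lambda> \<Longrightarrow> x \<in> part M \<mu> \<Longrightarrow> f \<mu> x = g \<mu> x"
  using mor_apply by metis

lemma relation_gmor:
  assumes M: "M \<in> Obj" and N: "N \<in> Obj"
    and V: "\<And>\<mu>. \<mu> \<in> \<Lambda> \<Longrightarrow> V \<mu> \<subseteq> part M \<mu> \<times> part N \<mu>"
    and V_one: "\<And>\<mu>. \<mu> \<in> \<Lambda> \<Longrightarrow> (\<one>\<^bsub>total M\<^esub>, \<one>\<^bsub>total N\<^esub>) \<in> V \<mu>"
    and V_mult: "\<And>\<mu> x y x' y'. \<mu> \<in> \<Lambda> \<Longrightarrow> (x, y) \<in> V \<mu> \<Longrightarrow> (x', y') \<in> V \<mu> \<Longrightarrow>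
      (x \<otimes>\<^bsub>total M\<^esub> x', y \<otimes>\<^bsub>total N\<^esub> y') \<in> V \<mu>"
    and V_act: "\<And>\<alpha> \<beta> r x y. \<alpha> \<in> \<Lambda> \<Longrightarrow> \<beta> \<in> \<Lambda> \<Longrightarrow> r \<in> scal \<alpha> \<beta> \<Longrightarrow> (x, y) \<in> V \<alpha> \<Longrightarrow>
      (act M r x, act N r y) \<in> V \<beta>"
  obtains P s f where "P \<in> Obj" "s \<in> gmor P M" "f \<in> gmor P N"
    "\<And>\<mu>. \<mu> \<in> \<Lambda> \<Longrightarrow> bij_betw (\<lambda>x. (s \<mu> x, f \<mu> x)) (part P \<mu>) (V \<mu>)"
proof -
  obtain P s f where P: "P \<in> Obj" "s \<in> Hom PG P M" "f \<in> Hom PG P N"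
    and bij: "\<And>\<mu>. \<mu> \<in> \<Lambda> \<Longrightarrow> bij_betw (\<lambda>x. (s None x, f None x)) (part P \<mu>) (V \<mu>)"
  proof (rule relation_object[OF M N, of V])
    show "V \<mu> \<subseteq> part M \<mu> \<times> part N \<mu>" "(\<one>\<^bsub>total M\<^esub>, \<one>\<^bsub>total N\<^esub>) \<in> V \<mu>" if "\<mu> \<in> \<Lambda>" for \<mu>
      by (rule V[OF that], rule V_one[OF that])
    show "(x \<otimes>\<^bsub>total M\<^esub> x', y \<otimes>\<^bsub>total N\<^esub> y') \<in> V \<mu>"
      if "\<mu> \<in> \<Lambda>" "(x, y) \<in> V \<mu>" "(x', y') \<in> V \<mu>" for \<mu> x y x' y'
      by (rule V_mult[OF that])
    show "(act M r x, act N r y) \<in> V \<beta>" if "\<alpha> \<in> \<Lambda>" "\<beta> \<in> \<Lambda>" "r \<in> scal \<alpha> \<beta>" "(x, y) \<in> V \<alpha>" for \<alpha> \<beta> r x y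
      by (rule V_act[OF that])
  qed blast
  have "bij_betw (\<lambda>x. (underlying P M s \<mu> x, underlying P N f \<mu> x)) (part P \<mu>) (V \<mu>)" if "\<mu> \<in> \<Lambda>" for \<mu>
    using bij[OF that] by (rule bij_betw_cong[THEN iffD1, rotated]) (simp add: underlying_def that)
  then show ?thesis
    using that[of P "underlying P M s" "underlying P N f"] P M N underlying_gmor by blast
qed

text \<open>A subobject is treated as a relation whose second coordinate is trivial, so
  \<open>relation_gmor\<close> applies.\<close>

lemma subobject_gmor:
  assumes M: "M \<in> Obj"
    and V: "\<And>\<mu>. \<mu> \<in> \<Lambda> \<Longrightarrow> V \<mu> \<subseteq> part M \<mu>"
    and V_one: "\<And>\<mu>. \<mu> \<in> \<Lambda> \<Longrightarrow> \<one>\<^bsub>total M\<^esub> \<in> V \<mu>"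
    and V_mult: "\<And>\<mu> x y. \<mu> \<in> \<Lambda> \<Longrightarrow> x \<in> V \<mu> \<Longrightarrow> y \<in> V \<mu> \<Longrightarrow> x \<otimes>\<^bsub>total M\<^esub> y \<in> V \<mu>"
    and V_act: "\<And>\<alpha> \<beta> r x. \<alpha> \<in> \<Lambda> \<Longrightarrow> \<beta> \<in> \<Lambda> \<Longrightarrow> r \<in> scal \<alpha> \<beta> \<Longrightarrow> x \<in> V \<alpha> \<Longrightarrow> act M r x \<in> V \<beta>"
  obtains P k where "P \<in> Obj" "k \<in> gmor P M" "\<And>\<mu>. \<mu> \<in> \<Lambda> \<Longrightarrow> bij_betw (k \<mu>) (part P \<mu>) (V \<mu>)"
proof -
  let ?W = "\<lambda>\<mu>. V \<mu> \<times> {\<one>\<^bsub>total M\<^esub>}"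
  obtain P s f where P: "P \<in> Obj" "s \<in> gmor P M" "f \<in> gmor P M"
    and bij: "\<And>\<mu>. \<mu> \<in> \<Lambda> \<Longrightarrow> bij_betw (\<lambda>x. (s \<mu> x, f \<mu> x)) (part P \<mu>) (?W \<mu>)"
  proof (rule relation_gmor[OF M M, of ?W])
    show "?W \<mu> \<subseteq> part M \<mu> \<times> part M \<mu>" if "\<mu> \<in> \<Lambda>" for \<mu> using V[OF that] part_one[OF M that] by blast
    show "(act M r x, act M r y) \<in> ?W \<beta>" if "\<alpha> \<in> \<Lambda>" "\<beta> \<in> \<Lambda>" "r \<in> scal \<alpha> \<beta>" "(x, y) \<in> ?W \<alpha>" for \<alpha> \<beta> r x y
      using V_act[OF that(1-3)] that(4) act_unit[OF M scal_R[OF that(1-3)]] by auto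
  qed (use V_one V_mult total_l_one[OF M total_one[OF M]] in auto)
  have "bij_betw (s \<mu>) (part P \<mu>) (V \<mu>)" if mu: "\<mu> \<in> \<Lambda>" for \<mu>
  proof -
    have "bij_betw fst (?W \<mu>) (V \<mu>)" by (rule bij_betw_imageI) (auto simp: inj_on_def)
    from bij_betw_trans[OF bij[OF mu] this] show ?thesis by (simp add: comp_def)
  qed
  then show ?thesis using that P by blast
qed

lemma zero_object_exists: "\<exists>Z\<in>Obj. \<forall>\<mu>\<in>\<Lambda>. part Z \<mu> = {\<one>\<^bsub>total Z\<^esub>}"
proof -
  have "\<exists>Z q. presents {()} (=) (\<lambda>x y. ()) (\<lambda>r x. ()) (\<lambda>\<mu>. {()}) Z q \<and> q () = \<one>\<^bsub>total Z\<^esub>"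
    by (rule setoid_presents) (auto simp: small_finite[OF universe])
  then obtain Z q where Z: "presents {()} (=) (\<lambda>x y. ()) (\<lambda>r x. ()) (\<lambda>\<mu>. {()}) Z q" "q () = \<one>\<^bsub>total Z\<^esub>"
    by blast
  show ?thesis
    using presentsD(1,9)[OF Z(1)] Z(2) by auto
qed

definition mzero :: "('g, 'r, 'u) module_functor \<Rightarrow> ('g, 'r, 'u) module_functor \<Rightarrow> 'g \<Rightarrow> 'u \<Rightarrow> 'u" where
  "mzero M N = mor M (\<lambda>\<mu> x. \<one>\<^bsub>total N\<^esub>)"

lemma mzero_gmor: "M \<in> Obj \<Longrightarrow> N \<in> Obj \<Longrightarrow> mzero M N \<in> gmor M N"
  unfolding mzero_def by (rule gmorI) (auto simp: part_one total_l_one total_one act_unit scal_R)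

lemma mzero_apply: "\<mu> \<in> \<Lambda> \<Longrightarrow> x \<in> part M \<mu> \<Longrightarrow> mzero M N \<mu> x = \<one>\<^bsub>total N\<^esub>"
  unfolding mzero_def by simp

lemma zero_object_GC:
  assumes Z: "Z \<in> Obj" "\<And>\<mu>. \<mu> \<in> \<Lambda> \<Longrightarrow> part Z \<mu> = {\<one>\<^bsub>total Z\<^esub>}"
  shows "zero_object GC Z"
  unfolding zero_object_def
proof (simp add: Z(1), intro ballI conjI)
  fix M assume M: "M \<in> Obj"
  show "\<exists>!f. f \<in> gmor M Z"
  proof (rule ex1I[of "\<lambda>f. f \<in> gmor M Z", OF mzero_gmor[OF M Z(1)]])
    show "f = mzero M Z" if "f \<in> gmor M Z" for f
      by (rule gmor_ext[OF that mzero_gmor[OF M Z(1)]]) (use gmor_mem[OF that] Z(2) in \<open>auto simp: mzero_apply\<close>)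
  qed
  show "\<exists>!f. f \<in> gmor Z M"
  proof (rule ex1I[of "\<lambda>f. f \<in> gmor Z M", OF mzero_gmor[OF Z(1) M]])
    show "f = mzero Z M" if "f \<in> gmor Z M" for f
      by (rule gmor_ext[OF that mzero_gmor[OF Z(1) M]])
        (use gmor_one[OF Z(1) M that] Z(2) in \<open>auto simp: mzero_apply\<close>)
  qed
qed

text \<open>The trivial endomorphism and the identity of a zero object coincide, so each element
  equals the unit. The total module itself is not constrained.\<close>

lemma zero_object_GC_part:
  assumes "zero_object GC Z" "\<mu> \<in> \<Lambda>"
  shows "part Z \<mu> = {\<one>\<^bsub>total Z\<^esub>}"
proof -
  have Z: "Z \<in> Obj" and "\<exists>!f. f \<in> gmor Z Z" using assms unfolding zero_object_def by auto
  then have "mzero Z Z = mor Z (\<lambda>\<mu> x. x)" using mzero_gmor[OF Z Z] gmor_ident[OF Z] by blast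
  then have "x = \<one>\<^bsub>total Z\<^esub>" if "x \<in> part Z \<mu>" for x
    using gmor_eqD[of Z "\<lambda>\<mu> x. \<one>\<^bsub>total Z\<^esub>" "\<lambda>\<mu> x. x"] assms(2) that unfolding mzero_def by metis
  then show ?thesis using part_one[OF Z assms(2)] by blast
qed

text \<open>A categorical zero morphism passes through trivial parts, and conversely an object with
  trivial parts exists to factor through. This turns the conditions on kernels and cokernels into
  equations between elements.\<close>

lemma zero_morphism_GC:
  assumes M: "M \<in> Obj" and N: "N \<in> Obj" and f: "f \<in> gmor M N"
  shows "zero_morphism GC M N f \<longleftrightarrow> (\<forall>\<mu>\<in>\<Lambda>. \<forall>x\<in>part M \<mu>. f \<mu> x = \<one>\<^bsub>total N\<^esub>)"
proof
  assume "zero_morphism GC M N f"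
  then obtain Z g h where Z: "zero_object GC Z" and g: "g \<in> gmor M Z" and h: "h \<in> gmor Z N"
    and fgh: "f = mor M (\<lambda>\<mu> x. h \<mu> (g \<mu> x))"
    unfolding zero_morphism_def by auto
  have ZO: "Z \<in> Obj" using Z unfolding zero_object_def by simp
  show "\<forall>\<mu>\<in>\<Lambda>. \<forall>x\<in>part M \<mu>. f \<mu> x = \<one>\<^bsub>total N\<^esub>"
  proof (intro ballI)
    fix \<mu> x assume *: "\<mu> \<in> \<Lambda>" "x \<in> part M \<mu>"
    have "g \<mu> x = \<one>\<^bsub>total Z\<^esub>" using gmor_mem[OF g *] zero_object_GC_part[OF Z *(1)] by blast
    then show "f \<mu> x = \<one>\<^bsub>total N\<^esub>" unfolding fgh using * gmor_one[OF ZO N h *(1)] by simp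
  qed
next
  assume *: "\<forall>\<mu>\<in>\<Lambda>. \<forall>x\<in>part M \<mu>. f \<mu> x = \<one>\<^bsub>total N\<^esub>"
  obtain Z where Z: "Z \<in> Obj" "\<And>\<mu>. \<mu> \<in> \<Lambda> \<Longrightarrow> part Z \<mu> = {\<one>\<^bsub>total Z\<^esub>}" using zero_object_exists by blast
  have "f = mor M (\<lambda>\<mu> x. mzero Z N \<mu> (mzero M Z \<mu> x))"
    by (rule gmor_ext[OF f gmor_cmp[OF M mzero_gmor[OF M Z(1)] mzero_gmor[OF Z(1) N]]])
      (use * Z part_one in \<open>auto simp: mzero_apply\<close>)
  then show "zero_morphism GC M N f"
    unfolding zero_morphism_def using zero_object_GC[OF Z] mzero_gmor[OF M Z(1)] mzero_gmor[OF Z(1) N]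
    by (intro exI[of _ Z] conjI bexI[of _ "mzero M Z"] bexI[of _ "mzero Z N"]) simp_all
qed

definition madd :: "('g, 'r, 'u) module_functor \<Rightarrow> ('g, 'r, 'u) module_functor \<Rightarrow>
    ('g \<Rightarrow> 'u \<Rightarrow> 'u) \<Rightarrow> ('g \<Rightarrow> 'u \<Rightarrow> 'u) \<Rightarrow> 'g \<Rightarrow> 'u \<Rightarrow> 'u" where
  "madd M N f g = mor M (\<lambda>\<mu> x. f \<mu> x \<otimes>\<^bsub>total N\<^esub> g \<mu> x)"

lemma total_swap:
  assumes "N \<in> Obj" "a \<in> carrier (total N)" "b \<in> carrier (total N)" "c \<in> carrier (total N)" "d \<in> carrier (total N)"
  shows "(a \<otimes>\<^bsub>total N\<^esub> b) \<otimes>\<^bsub>total N\<^esub> (c \<otimes>\<^bsub>total N\<^esub> d) = (a \<otimes>\<^bsub>total N\<^esub> c) \<otimes>\<^bsub>total N\<^esub> (b \<otimes>\<^bsub>total N\<^esub> d)"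
proof -
  interpret comm_group "total N" by (rule total_group[OF assms(1)])
  show ?thesis using assms(2-5) by (simp add: m_ac)
qed

lemma madd_gmor:
  assumes M: "M \<in> Obj" and N: "N \<in> Obj" and f: "f \<in> gmor M N" and g: "g \<in> gmor M N"
  shows "madd M N f g \<in> gmor M N"
  unfolding madd_def
proof (rule gmorI[OF M])
  note mem = gmor_mem[OF f] gmor_mem[OF g]
  show "f \<mu> x \<otimes>\<^bsub>total N\<^esub> g \<mu> x \<in> part N \<mu>" if "\<mu> \<in> \<Lambda>" "x \<in> part M \<mu>" for \<mu> x
    using that mem part_mult[OF N] by blast
  show "f \<mu> (x \<otimes>\<^bsub>total M\<^esub> y) \<otimes>\<^bsub>total N\<^esub> g \<mu> (x \<otimes>\<^bsub>total M\<^esub> y) =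
      (f \<mu> x \<otimes>\<^bsub>total N\<^esub> g \<mu> x) \<otimes>\<^bsub>total N\<^esub> (f \<mu> y \<otimes>\<^bsub>total N\<^esub> g \<mu> y)"
    if "\<mu> \<in> \<Lambda>" "x \<in> part M \<mu>" "y \<in> part M \<mu>" for \<mu> x y
    using that gmor_mult[OF f that] gmor_mult[OF g that] mem part_total[OF N] by (simp add: total_swap[OF N])
  show "f \<beta> (act M r x) \<otimes>\<^bsub>total N\<^esub> g \<beta> (act M r x) = act N r (f \<alpha> x \<otimes>\<^bsub>total N\<^esub> g \<alpha> x)"
    if "\<alpha> \<in> \<Lambda>" "\<beta> \<in> \<Lambda>" "r \<in> scal \<alpha> \<beta>" "x \<in> part M \<alpha>" for \<alpha> \<beta> r x
    using gmor_act[OF f that] gmor_act[OF g that] mem[OF that(1,4)] part_total[OF N that(1)] scal_R[OF that(1-3)]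
    by (simp add: act_mult[OF N])
qed

lemma preadditive_GC: "preadditive GC madd"
  unfolding preadditive_def
proof (intro conjI ballI)
  show "is_category GC" by (rule is_category_GC)
  show "\<exists>z. comm_group \<lparr>carrier = Hom GC M N, monoid.mult = madd M N, one = z\<rparr>"
    if "M \<in> obj GC" "N \<in> obj GC" for M N
  proof -
    have M: "M \<in> Obj" and N: "N \<in> Obj" using that by simp_all
    have mem: "f \<mu> x \<in> carrier (total N)" if "f \<in> gmor M N" "\<mu> \<in> \<Lambda>" "x \<in> part M \<mu>" for f \<mu> x
      using part_total[OF N that(2)] gmor_mem[OF that] by blast
    have "comm_group \<lparr>carrier = gmor M N, monoid.mult = madd M N, one = mzero M N\<rparr>"
    proof (rule comm_groupI; simp)
      show "madd M N f g \<in> gmor M N" if "f \<in> gmor M N" "g \<in> gmor M N" for f g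
        using madd_gmor[OF M N that] .
      show "mzero M N \<in> gmor M N" using mzero_gmor[OF M N] .
      show "madd M N (madd M N f g) h = madd M N f (madd M N g h)"
        if "f \<in> gmor M N" "g \<in> gmor M N" "h \<in> gmor M N" for f g h
        unfolding madd_def using mem that by (intro mor_eqI) (simp add: total_assoc[OF N])
      show "madd M N f g = madd M N g f" if "f \<in> gmor M N" "g \<in> gmor M N" for f g
        unfolding madd_def using mem that total_comm[OF N] by (intro mor_eqI) blast
      show "madd M N (mzero M N) f = f" if f: "f \<in> gmor M N" for f
        by (rule gmor_ext[OF madd_gmor[OF M N mzero_gmor[OF M N] f] f])
          (simp add: madd_def mzero_apply mem[OF f] total_l_one[OF N])
      show "\<exists>g\<in>gmor M N. madd M N g f = mzero M N" if f: "f \<in> gmor M N" for f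
      proof (rule bexI)
        let ?g = "mor M (\<lambda>\<mu> x. f \<mu> (inv\<^bsub>total M\<^esub> x))"
        interpret MG: comm_group "total M" by (rule total_group[OF M])
        show g: "?g \<in> gmor M N"
        proof (rule gmorI[OF M])
          show "f \<mu> (inv\<^bsub>total M\<^esub> x) \<in> part N \<mu>" if "\<mu> \<in> \<Lambda>" "x \<in> part M \<mu>" for \<mu> x
            using gmor_mem[OF f that(1) part_inv[OF M that]] .
          show "f \<mu> (inv\<^bsub>total M\<^esub> (x \<otimes>\<^bsub>total M\<^esub> y)) = f \<mu> (inv\<^bsub>total M\<^esub> x) \<otimes>\<^bsub>total N\<^esub> f \<mu> (inv\<^bsub>total M\<^esub> y)"
            if "\<mu> \<in> \<Lambda>" "x \<in> part M \<mu>" "y \<in> part M \<mu>" for \<mu> x y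
            using that gmor_mult[OF f that(1)] part_inv[OF M that(1)] part_total[OF M that(1)]
            by (simp add: MG.inv_mult)
          show "f \<beta> (inv\<^bsub>total M\<^esub> (act M r x)) = act N r (f \<alpha> (inv\<^bsub>total M\<^esub> x))"
            if "\<alpha> \<in> \<Lambda>" "\<beta> \<in> \<Lambda>" "r \<in> scal \<alpha> \<beta>" "x \<in> part M \<alpha>" for \<alpha> \<beta> r x
          proof -
            have xM: "x \<in> carrier (total M)" using part_total[OF M that(1,4)] .
            have r: "r \<in> carrier R" using scal_R[OF that(1-3)] .
            have "act M r (inv\<^bsub>total M\<^esub> x) \<otimes>\<^bsub>total M\<^esub> act M r x = \<one>\<^bsub>total M\<^esub>"
              using act_mult[OF M r, of "inv\<^bsub>total M\<^esub> x" x] xM act_unit[OF M r] by simp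
            then have "inv\<^bsub>total M\<^esub> (act M r x) = act M r (inv\<^bsub>total M\<^esub> x)"
              using MG.inv_equality act_closed[OF M r] xM by simp
            then show ?thesis using gmor_act[OF f that(1-3) part_inv[OF M that(1,4)]] by simp
          qed
        qed
        show "madd M N ?g f = mzero M N"
        proof (rule gmor_ext[OF madd_gmor[OF M N g f] mzero_gmor[OF M N]])
          fix \<mu> x assume *: "\<mu> \<in> \<Lambda>" "x \<in> part M \<mu>"
          have "f \<mu> (inv\<^bsub>total M\<^esub> x) \<otimes>\<^bsub>total N\<^esub> f \<mu> x = f \<mu> (inv\<^bsub>total M\<^esub> x \<otimes>\<^bsub>total M\<^esub> x)"
            using gmor_mult[OF f *(1) part_inv[OF M *] *(2)] by simp
          also have "\<dots> = \<one>\<^bsub>total N\<^esub>"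
            using part_total[OF M *] gmor_one[OF M N f *(1)] by simp
          finally show "madd M N ?g f \<mu> x = mzero M N \<mu> x"
            using * by (simp add: madd_def mzero_apply)
        qed
      qed
    qed
    then show ?thesis by auto
  qed
  fix M N P f f' g g'
  assume "M \<in> obj GC" "N \<in> obj GC" "P \<in> obj GC" and f': "f \<in> Hom GC M N" "f' \<in> Hom GC M N"
    and g': "g \<in> Hom GC N P" "g' \<in> Hom GC N P"
  then have M: "M \<in> Obj" and N: "N \<in> Obj" and P: "P \<in> Obj" and f: "f \<in> gmor M N" "f' \<in> gmor M N"
    and g: "g \<in> gmor N P" "g' \<in> gmor N P" by simp_all
  show "cmp GC M N P g (madd M N f f') = madd M P (cmp GC M N P g f) (cmp GC M N P g f')"
    unfolding madd_def using gmor_mem[OF f(1)] gmor_mem[OF f(2)] gmor_mult[OF g(1)] by (auto intro!: mor_eqI)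
  show "cmp GC M N P (madd N P g g') f = madd M P (cmp GC M N P g f) (cmp GC M N P g' f)"
    unfolding madd_def using gmor_mem[OF f(1)] by (auto intro!: mor_eqI)
qed

lemma biproduct_GC:
  assumes M: "M \<in> Obj" and N: "N \<in> Obj"
  shows "\<exists>P. biproduct GC madd M N P"
proof -
  let ?V = "\<lambda>\<mu>. part M \<mu> \<times> part N \<mu>"
  obtain P s t where P: "P \<in> Obj" and s: "s \<in> gmor P M" and t: "t \<in> gmor P N"
    and bij: "\<And>\<mu>. \<mu> \<in> \<Lambda> \<Longrightarrow> bij_betw (\<lambda>x. (s \<mu> x, t \<mu> x)) (part P \<mu>) (?V \<mu>)"
    by (rule relation_gmor[OF M N, of ?V]) (auto simp: part_one M N part_mult act_part)
  \<comment> \<open>The relation supplies only the two projections. The injections are built from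
    the inverse \<open>j\<close> of their pairing, and equations in \<open>P\<close> are tested by
    applying both projections.\<close>
  define j where "j \<mu> = inv_into (part P \<mu>) (\<lambda>x. (s \<mu> x, t \<mu> x))" for \<mu>
  have j: "j \<mu> (x, y) \<in> part P \<mu>" "s \<mu> (j \<mu> (x, y)) = x" "t \<mu> (j \<mu> (x, y)) = y"
    if "\<mu> \<in> \<Lambda>" "x \<in> part M \<mu>" "y \<in> part N \<mu>" for \<mu> x y
  proof -
    have "(x, y) \<in> ?V \<mu>" using that by blast
    then have "(x, y) \<in> (\<lambda>x. (s \<mu> x, t \<mu> x)) ` part P \<mu>" using bij_betw_imp_surj_on[OF bij[OF that(1)]] by simp
    from inv_into_into[OF this] f_inv_into_f[OF this]
    show "j \<mu> (x, y) \<in> part P \<mu>" "s \<mu> (j \<mu> (x, y)) = x" "t \<mu> (j \<mu> (x, y)) = y" unfolding j_def by simp_all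
  qed
  have eqP: "x = y" if "\<mu> \<in> \<Lambda>" "x \<in> part P \<mu>" "y \<in> part P \<mu>" "s \<mu> x = s \<mu> y" "t \<mu> x = t \<mu> y" for \<mu> x y
    by (rule inj_onD[OF bij_betw_imp_inj_on[OF bij[OF that(1)]] _ that(2,3)]) (simp add: that(4,5))
  let ?i = "mor M (\<lambda>\<mu> x. j \<mu> (x, \<one>\<^bsub>total N\<^esub>))" and ?k = "mor N (\<lambda>\<mu> y. j \<mu> (\<one>\<^bsub>total M\<^esub>, y))"
  note ones = part_one[OF M] part_one[OF N] part_mult[OF M] part_mult[OF N] part_mult[OF P]
    act_part[OF M] act_part[OF N] act_part[OF P]
  have i: "?i \<in> gmor M P"
  proof (rule gmorI[OF M])
    show "j \<mu> (x \<otimes>\<^bsub>total M\<^esub> y, \<one>\<^bsub>total N\<^esub>) = j \<mu> (x, \<one>\<^bsub>total N\<^esub>) \<otimes>\<^bsub>total P\<^esub> j \<mu> (y, \<one>\<^bsub>total N\<^esub>)"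
      if "\<mu> \<in> \<Lambda>" "x \<in> part M \<mu>" "y \<in> part M \<mu>" for \<mu> x y
      by (rule eqP[OF that(1)])
        (use that in \<open>simp_all add: j ones gmor_mult[OF s] gmor_mult[OF t] total_l_one[OF N] total_one[OF N]\<close>)
    show "j \<beta> (act M r x, \<one>\<^bsub>total N\<^esub>) = act P r (j \<alpha> (x, \<one>\<^bsub>total N\<^esub>))"
      if "\<alpha> \<in> \<Lambda>" "\<beta> \<in> \<Lambda>" "r \<in> scal \<alpha> \<beta>" "x \<in> part M \<alpha>" for \<alpha> \<beta> r x
      by (rule eqP[OF that(2)])
        (use that scal_R[OF that(1-3)] in \<open>simp_all add: j ones gmor_act[OF s] gmor_act[OF t] act_unit[OF N]\<close>)
  qed (simp add: j ones)
  have k: "?k \<in> gmor N P"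
  proof (rule gmorI[OF N])
    show "j \<mu> (\<one>\<^bsub>total M\<^esub>, x \<otimes>\<^bsub>total N\<^esub> y) = j \<mu> (\<one>\<^bsub>total M\<^esub>, x) \<otimes>\<^bsub>total P\<^esub> j \<mu> (\<one>\<^bsub>total M\<^esub>, y)"
      if "\<mu> \<in> \<Lambda>" "x \<in> part N \<mu>" "y \<in> part N \<mu>" for \<mu> x y
      by (rule eqP[OF that(1)])
        (use that in \<open>simp_all add: j ones gmor_mult[OF s] gmor_mult[OF t] total_l_one[OF M] total_one[OF M]\<close>)
    show "j \<beta> (\<one>\<^bsub>total M\<^esub>, act N r x) = act P r (j \<alpha> (\<one>\<^bsub>total M\<^esub>, x))"
      if "\<alpha> \<in> \<Lambda>" "\<beta> \<in> \<Lambda>" "r \<in> scal \<alpha> \<beta>" "x \<in> part N \<alpha>" for \<alpha> \<beta> r x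
      by (rule eqP[OF that(2)])
        (use that scal_R[OF that(1-3)] in \<open>simp_all add: j ones gmor_act[OF s] gmor_act[OF t] act_unit[OF M]\<close>)
  qed (simp add: j ones)
  have "mor M (\<lambda>\<mu> x. s \<mu> (?i \<mu> x)) = mor M (\<lambda>\<mu> x. x)" by (rule mor_eqI) (simp add: j ones)
  moreover have "mor N (\<lambda>\<mu> x. t \<mu> (?k \<mu> x)) = mor N (\<lambda>\<mu> x. x)" by (rule mor_eqI) (simp add: j ones)
  moreover have "madd P P (mor P (\<lambda>\<mu> x. ?i \<mu> (s \<mu> x))) (mor P (\<lambda>\<mu> x. ?k \<mu> (t \<mu> x))) = mor P (\<lambda>\<mu> x. x)"
    unfolding madd_def
  proof (rule mor_eqI)
    fix \<mu> x assume *: "\<mu> \<in> \<Lambda>" "x \<in> part P \<mu>"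
    show "mor P (\<lambda>\<mu> x. ?i \<mu> (s \<mu> x)) \<mu> x \<otimes>\<^bsub>total P\<^esub> mor P (\<lambda>\<mu> x. ?k \<mu> (t \<mu> x)) \<mu> x = x"
      by (rule eqP[OF *(1)])
        (use * part_total[OF M *(1)] part_total[OF N *(1)] in \<open>simp_all add: j ones gmor_mult[OF s] gmor_mult[OF t] gmor_mem[OF s] gmor_mem[OF t]
          total_l_one[OF M] total_r_one[OF M] total_l_one[OF N] total_r_one[OF N]\<close>)
  qed
  ultimately have "biproduct GC madd M N P"
    unfolding biproduct_def using P i k s t by auto
  then show ?thesis by blast
qed

lemma additive_GC: "additive_category GC"
  unfolding additive_category_def
  using preadditive_GC biproduct_GC zero_object_GC zero_object_exists by (metis obj_GC)

text \<open>Injectivity of \<open>k\<close> makes the set-theoretic lift unique in each degree, and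
  this uniqueness forces it to be additive and linear. Serves both kernels and images.\<close>

lemma gmor_factor:
  assumes k: "k \<in> gmor N M" and N: "N \<in> Obj" and M: "M \<in> Obj" and X: "X \<in> Obj"
    and inj: "\<And>\<mu>. \<mu> \<in> \<Lambda> \<Longrightarrow> inj_on (k \<mu>) (part N \<mu>)"
    and h: "h \<in> gmor X M" and img: "\<And>\<mu> x. \<mu> \<in> \<Lambda> \<Longrightarrow> x \<in> part X \<mu> \<Longrightarrow> h \<mu> x \<in> k \<mu> ` part N \<mu>"
  shows "\<exists>!u. u \<in> gmor X N \<and> mor X (\<lambda>\<mu> x. k \<mu> (u \<mu> x)) = h"
proof (rule ex1I)
  define u where "u \<mu> x = inv_into (part N \<mu>) (k \<mu>) (h \<mu> x)" for \<mu> x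
  have u: "u \<mu> x \<in> part N \<mu>" "k \<mu> (u \<mu> x) = h \<mu> x" if "\<mu> \<in> \<Lambda>" "x \<in> part X \<mu>" for \<mu> x
    using inv_into_into[OF img[OF that]] f_inv_into_f[OF img[OF that]] unfolding u_def by simp_all
  have eqN: "x = y" if "\<mu> \<in> \<Lambda>" "x \<in> part N \<mu>" "y \<in> part N \<mu>" "k \<mu> x = k \<mu> y" for \<mu> x y
    using inj_onD[OF inj[OF that(1)]] that by blast
  have ug: "mor X u \<in> gmor X N"
  proof (rule gmorI[OF X u(1)])
    show "u \<mu> (x \<otimes>\<^bsub>total X\<^esub> y) = u \<mu> x \<otimes>\<^bsub>total N\<^esub> u \<mu> y" if "\<mu> \<in> \<Lambda>" "x \<in> part X \<mu>" "y \<in> part X \<mu>" for \<mu> x y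
      by (rule eqN[OF that(1)]) (use that in \<open>simp_all add: u part_mult[OF X] part_mult[OF N] gmor_mult[OF k] gmor_mult[OF h]\<close>)
    show "u \<beta> (act X r x) = act N r (u \<alpha> x)" if "\<alpha> \<in> \<Lambda>" "\<beta> \<in> \<Lambda>" "r \<in> scal \<alpha> \<beta>" "x \<in> part X \<alpha>" for \<alpha> \<beta> r x
      by (rule eqN[OF that(2)]) (use that in \<open>simp_all add: u act_part[OF X] act_part[OF N] gmor_act[OF k] gmor_act[OF h]\<close>)
  qed
  have "mor X (\<lambda>\<mu> x. k \<mu> (mor X u \<mu> x)) = mor X h" by (rule mor_eqI) (simp add: u)
  then show "mor X u \<in> gmor X N \<and> mor X (\<lambda>\<mu> x. k \<mu> (mor X u \<mu> x)) = h"
    using ug mor_self[OF h] by simp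
  show "v = mor X u" if v: "v \<in> gmor X N \<and> mor X (\<lambda>\<mu> x. k \<mu> (v \<mu> x)) = h" for v
  proof (rule gmor_ext[OF conjunct1[OF v] ug])
    fix \<mu> x assume *: "\<mu> \<in> \<Lambda>" "x \<in> part X \<mu>"
    have "k \<mu> (v \<mu> x) = h \<mu> x" using v mor_apply[OF *, of "\<lambda>\<mu> x. k \<mu> (v \<mu> x)"] by simp
    then show "v \<mu> x = mor X u \<mu> x" using eqN[OF *(1)] gmor_mem[OF conjunct1[OF v] *] u[OF *] * by simp
  qed
qed

lemma kernelI:
  assumes O: "K \<in> Obj" "M \<in> Obj" "N \<in> Obj" and k: "k \<in> gmor K M" and f: "f \<in> gmor M N"
    and inj: "\<And>\<mu>. \<mu> \<in> \<Lambda> \<Longrightarrow> inj_on (k \<mu>) (part K \<mu>)"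
    and img: "\<And>\<mu>. \<mu> \<in> \<Lambda> \<Longrightarrow> k \<mu> ` part K \<mu> = {x \<in> part M \<mu>. f \<mu> x = \<one>\<^bsub>total N\<^esub>}"
  shows "is_kernel GC K M N k f"
  unfolding is_kernel_def
proof (intro conjI ballI impI)
  have fk: "mor K (\<lambda>\<mu> x. f \<mu> (k \<mu> x)) \<in> gmor K N" using gmor_cmp[OF O(1) k f] .
  show "zero_morphism GC K N (cmp GC K M N f k)"
    unfolding cmp_GC zero_morphism_GC[OF O(1,3) fk] using img by auto
  fix X h assume X: "X \<in> obj GC" and h: "h \<in> Hom GC X M" and z: "zero_morphism GC X N (cmp GC X M N f h)"
  have X': "X \<in> Obj" and h': "h \<in> gmor X M" using X h by simp_all
  have "\<exists>!u. u \<in> gmor X K \<and> mor X (\<lambda>\<mu> x. k \<mu> (u \<mu> x)) = h"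
  proof (rule gmor_factor[OF k O(1,2) X' inj h'])
    have "mor X (\<lambda>\<mu> x. f \<mu> (h \<mu> x)) \<in> gmor X N" using gmor_cmp[OF X' h' f] .
    from z[unfolded cmp_GC zero_morphism_GC[OF X' O(3) this]]
    show "h \<mu> x \<in> k \<mu> ` part K \<mu>" if "\<mu> \<in> \<Lambda>" "x \<in> part X \<mu>" for \<mu> x
      unfolding img[OF that(1)] using that gmor_mem[OF h' that] by simp
  qed
  then show "\<exists>!u. u \<in> Hom GC X K \<and> cmp GC X K M k u = h" by simp
qed (use O k f in simp_all)

lemma kernel_exists:
  assumes M: "M \<in> Obj" and N: "N \<in> Obj" and f: "f \<in> gmor M N"
  shows "\<exists>K\<in>Obj. \<exists>k\<in>gmor K M.
    (\<forall>\<mu>\<in>\<Lambda>. bij_betw (k \<mu>) (part K \<mu>) {x \<in> part M \<mu>. f \<mu> x = \<one>\<^bsub>total N\<^esub>}) \<and> is_kernel GC K M N k f"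
proof -
  let ?V = "\<lambda>\<mu>. {x \<in> part M \<mu>. f \<mu> x = \<one>\<^bsub>total N\<^esub>}"
  obtain K k where K: "K \<in> Obj" "k \<in> gmor K M" "\<And>\<mu>. \<mu> \<in> \<Lambda> \<Longrightarrow> bij_betw (k \<mu>) (part K \<mu>) (?V \<mu>)"
  proof (rule subobject_gmor[OF M, of ?V])
    show "act M r x \<in> ?V \<beta>" if "\<alpha> \<in> \<Lambda>" "\<beta> \<in> \<Lambda>" "r \<in> scal \<alpha> \<beta>" "x \<in> ?V \<alpha>" for \<alpha> \<beta> r x
      using that gmor_act[OF f that(1-3)] act_part[OF M that(1-3)] act_unit[OF N scal_R[OF that(1-3)]] by simp
  qed (use gmor_one[OF M N f] gmor_mult[OF f] part_one[OF M] part_mult[OF M] total_l_one[OF N] total_one[OF N] in auto)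
  moreover have "is_kernel GC K M N k f"
    by (rule kernelI[OF K(1) M N K(2) f]) (use K(3) in \<open>auto simp: bij_betw_def\<close>)
  ultimately show ?thesis by blast
qed

text \<open>An arbitrary kernel is compared with the explicit one of \<open>kernel_exists\<close>.
  The comparison maps \<open>u\<close> and \<open>v\<close> give the two inclusions of images, and
  \<open>u\<close> after \<open>v\<close> being the identity carries injectivity over.\<close>

lemma kernelD:
  assumes ker: "is_kernel GC K M N k f" and mu: "\<mu> \<in> \<Lambda>"
  shows "inj_on (k \<mu>) (part K \<mu>)" "k \<mu> ` part K \<mu> = {x \<in> part M \<mu>. f \<mu> x = \<one>\<^bsub>total N\<^esub>}"
proof -
  have K: "K \<in> Obj" and M: "M \<in> Obj" and N: "N \<in> Obj" and k: "k \<in> gmor K M" and f: "f \<in> gmor M N"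
    and z: "zero_morphism GC K N (cmp GC K M N f k)"
    and univ: "\<And>X h. X \<in> Obj \<Longrightarrow> h \<in> gmor X M \<Longrightarrow> zero_morphism GC X N (cmp GC X M N f h) \<Longrightarrow>
      \<exists>!u. u \<in> gmor X K \<and> mor X (\<lambda>\<mu> x. k \<mu> (u \<mu> x)) = h"
    using ker unfolding is_kernel_def by simp_all
  obtain K' k' where K': "K' \<in> Obj" "k' \<in> gmor K' M"
    "\<And>\<mu>. \<mu> \<in> \<Lambda> \<Longrightarrow> bij_betw (k' \<mu>) (part K' \<mu>) {x \<in> part M \<mu>. f \<mu> x = \<one>\<^bsub>total N\<^esub>}"
    "is_kernel GC K' M N k' f"
    using kernel_exists[OF M N f] by blast
  have univ': "\<And>X h. X \<in> Obj \<Longrightarrow> h \<in> gmor X M \<Longrightarrow> zero_morphism GC X N (cmp GC X M N f h) \<Longrightarrow>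
      \<exists>!u. u \<in> gmor X K' \<and> mor X (\<lambda>\<mu> x. k' \<mu> (u \<mu> x)) = h" and z': "zero_morphism GC K' N (cmp GC K' M N f k')"
    using K'(4) unfolding is_kernel_def by simp_all
  obtain u where u: "u \<in> gmor K' K" "mor K' (\<lambda>\<mu> x. k \<mu> (u \<mu> x)) = k'" using univ[OF K'(1,2) z'] by blast
  obtain v where v: "v \<in> gmor K K'" "mor K (\<lambda>\<mu> x. k' \<mu> (v \<mu> x)) = k" using univ'[OF K k z] by blast
  have u': "k \<mu> (u \<mu> x) = k' \<mu> x" if "\<mu> \<in> \<Lambda>" "x \<in> part K' \<mu>" for \<mu> x
    using mor_apply[OF that, of "\<lambda>\<mu> x. k \<mu> (u \<mu> x)"] u(2) by simp
  have v': "k' \<mu> (v \<mu> x) = k \<mu> x" if "\<mu> \<in> \<Lambda>" "x \<in> part K \<mu>" for \<mu> x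
    using mor_apply[OF that, of "\<lambda>\<mu> x. k' \<mu> (v \<mu> x)"] v(2) by simp
  have e1: "mor K (\<lambda>\<mu> x. k \<mu> (mor K (\<lambda>\<mu> x. u \<mu> (v \<mu> x)) \<mu> x)) = mor K k"
    by (rule mor_eqI) (simp add: u' v' gmor_mem[OF v(1)])
  have e2: "mor K (\<lambda>\<mu> x. k \<mu> (mor K (\<lambda>\<mu> x. x) \<mu> x)) = mor K k" by (rule mor_eqI) simp
  have uv: "mor K (\<lambda>\<mu> x. u \<mu> (v \<mu> x)) = mor K (\<lambda>\<mu> x. x)"
  proof -
    obtain w0 where w0: "\<And>w. w \<in> gmor K K \<Longrightarrow> mor K (\<lambda>\<mu> x. k \<mu> (w \<mu> x)) = k \<Longrightarrow> w = w0"
      using univ[OF K k z] by (elim ex1E) blast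
    have uniq: "w = w'" if "w \<in> gmor K K" "mor K (\<lambda>\<mu> x. k \<mu> (w \<mu> x)) = k"
      "w' \<in> gmor K K" "mor K (\<lambda>\<mu> x. k \<mu> (w' \<mu> x)) = k" for w w'
      using w0[of w] w0[of w'] that by simp
    show ?thesis by (rule uniq) (use e1 e2 gmor_cmp[OF K v(1) u(1)] gmor_ident[OF K] mor_self[OF k] in simp_all)
  qed
  have uv': "u \<mu> (v \<mu> x) = x" if "x \<in> part K \<mu>" for x
    using gmor_eqD[OF uv mu that] .
  show "inj_on (k \<mu>) (part K \<mu>)"
  proof (rule inj_onI)
    fix x y assume xy: "x \<in> part K \<mu>" "y \<in> part K \<mu>" "k \<mu> x = k \<mu> y"
    then have "k' \<mu> (v \<mu> x) = k' \<mu> (v \<mu> y)" using v' mu by simp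
    then have "v \<mu> x = v \<mu> y"
      using inj_onD[OF bij_betw_imp_inj_on[OF K'(3)[OF mu]]] gmor_mem[OF v(1) mu] xy by blast
    then show "x = y" using uv' xy by metis
  qed
  have "k \<mu> ` part K \<mu> = k' \<mu> ` part K' \<mu>"
  proof (intro subset_antisym subsetI)
    fix y assume "y \<in> k \<mu> ` part K \<mu>"
    then show "y \<in> k' \<mu> ` part K' \<mu>" using v' mu gmor_mem[OF v(1) mu] by force
  next
    fix y assume "y \<in> k' \<mu> ` part K' \<mu>"
    then show "y \<in> k \<mu> ` part K \<mu>" using u' mu gmor_mem[OF u(1) mu] by force
  qed
  then show "k \<mu> ` part K \<mu> = {x \<in> part M \<mu>. f \<mu> x = \<one>\<^bsub>total N\<^esub>}"
    using bij_betw_imp_surj_on[OF K'(3)[OF mu]] by simp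
qed

text \<open>The homomorphism theorem: elements with equal images under \<open>c\<close> differ by an
  element of its kernel, where \<open>h\<close> is trivial, so any degreewise section
  \<open>i\<close> of \<open>c\<close> defines the factorization.\<close>

lemma gmor_cofactor:
  assumes c: "c \<in> gmor M Q" and M: "M \<in> Obj" and Q: "Q \<in> Obj" and X: "X \<in> Obj"
    and surj: "\<And>\<mu>. \<mu> \<in> \<Lambda> \<Longrightarrow> c \<mu> ` part M \<mu> = part Q \<mu>"
    and h: "h \<in> gmor M X" and ker: "\<And>\<mu> x. \<mu> \<in> \<Lambda> \<Longrightarrow> x \<in> part M \<mu> \<Longrightarrow> c \<mu> x = \<one>\<^bsub>total Q\<^esub> \<Longrightarrow> h \<mu> x = \<one>\<^bsub>total X\<^esub>"
  shows "\<exists>!u. u \<in> gmor Q X \<and> mor M (\<lambda>\<mu> x. u \<mu> (c \<mu> x)) = h"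
proof (rule ex1I)
  define i where "i \<mu> = inv_into (part M \<mu>) (c \<mu>)" for \<mu>
  have i: "i \<mu> y \<in> part M \<mu>" "c \<mu> (i \<mu> y) = y" if "\<mu> \<in> \<Lambda>" "y \<in> part Q \<mu>" for \<mu> y
  proof -
    have "y \<in> c \<mu> ` part M \<mu>" using surj that by blast
    from inv_into_into[OF this] f_inv_into_f[OF this] show "i \<mu> y \<in> part M \<mu>" "c \<mu> (i \<mu> y) = y"
      unfolding i_def by simp_all
  qed
  have eq: "h \<mu> x = h \<mu> y" if *: "\<mu> \<in> \<Lambda>" "x \<in> part M \<mu>" "y \<in> part M \<mu>" "c \<mu> x = c \<mu> y" for \<mu> x y
  proof -
    have p: "x \<otimes>\<^bsub>total M\<^esub> inv\<^bsub>total M\<^esub> y \<in> part M \<mu>"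
      using part_mult[OF M *(1,2) part_inv[OF M *(1,3)]] .
    have "c \<mu> (x \<otimes>\<^bsub>total M\<^esub> inv\<^bsub>total M\<^esub> y) = c \<mu> x \<otimes>\<^bsub>total Q\<^esub> inv\<^bsub>total Q\<^esub> (c \<mu> y)"
      using gmor_mult[OF c *(1,2) part_inv[OF M *(1,3)]] gmor_inv[OF M Q c *(1,3)] by simp
    then have "c \<mu> (x \<otimes>\<^bsub>total M\<^esub> inv\<^bsub>total M\<^esub> y) = \<one>\<^bsub>total Q\<^esub>"
      using total_mult_inv_eq_one_iff[OF Q] part_total[OF Q *(1) gmor_mem[OF c *(1,3)]] *(4) by simp
    then have "h \<mu> (x \<otimes>\<^bsub>total M\<^esub> inv\<^bsub>total M\<^esub> y) = \<one>\<^bsub>total X\<^esub>" using ker *(1) p by blast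
    then have "h \<mu> x \<otimes>\<^bsub>total X\<^esub> inv\<^bsub>total X\<^esub> (h \<mu> y) = \<one>\<^bsub>total X\<^esub>"
      using gmor_mult[OF h *(1,2) part_inv[OF M *(1,3)]] gmor_inv[OF M X h *(1,3)] by simp
    then show ?thesis
      using total_mult_inv_eq_one_iff[OF X] part_total[OF X *(1)] gmor_mem[OF h *(1)] *(2,3) by blast
  qed
  let ?u = "mor Q (\<lambda>\<mu> y. h \<mu> (i \<mu> y))"
  have u: "?u \<in> gmor Q X"
  proof (rule gmorI[OF Q])
    show "h \<mu> (i \<mu> y) \<in> part X \<mu>" if "\<mu> \<in> \<Lambda>" "y \<in> part Q \<mu>" for \<mu> y
      using gmor_mem[OF h that(1)] i that by blast
    show "h \<mu> (i \<mu> (x \<otimes>\<^bsub>total Q\<^esub> y)) = h \<mu> (i \<mu> x) \<otimes>\<^bsub>total X\<^esub> h \<mu> (i \<mu> y)"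
      if "\<mu> \<in> \<Lambda>" "x \<in> part Q \<mu>" "y \<in> part Q \<mu>" for \<mu> x y
    proof -
      have "h \<mu> (i \<mu> (x \<otimes>\<^bsub>total Q\<^esub> y)) = h \<mu> (i \<mu> x \<otimes>\<^bsub>total M\<^esub> i \<mu> y)"
        by (rule eq[OF that(1)]) (use that in \<open>simp_all add: i part_mult[OF M] part_mult[OF Q] gmor_mult[OF c]\<close>)
      then show ?thesis using gmor_mult[OF h] that i by simp
    qed
    show "h \<beta> (i \<beta> (act Q r x)) = act X r (h \<alpha> (i \<alpha> x))"
      if "\<alpha> \<in> \<Lambda>" "\<beta> \<in> \<Lambda>" "r \<in> scal \<alpha> \<beta>" "x \<in> part Q \<alpha>" for \<alpha> \<beta> r x
    proof -
      have "h \<beta> (i \<beta> (act Q r x)) = h \<beta> (act M r (i \<alpha> x))"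
        by (rule eq[OF that(2)]) (use that in \<open>simp_all add: i act_part[OF M] act_part[OF Q] gmor_act[OF c]\<close>)
      then show ?thesis using gmor_act[OF h] that i by simp
    qed
  qed
  have "mor M (\<lambda>\<mu> x. ?u \<mu> (c \<mu> x)) = mor M h"
  proof (rule mor_eqI)
    fix \<mu> x assume *: "\<mu> \<in> \<Lambda>" "x \<in> part M \<mu>"
    then show "?u \<mu> (c \<mu> x) = h \<mu> x" using eq[OF *(1), of "i \<mu> (c \<mu> x)" x] i gmor_mem[OF c *] by simp
  qed
  then show "?u \<in> gmor Q X \<and> mor M (\<lambda>\<mu> x. ?u \<mu> (c \<mu> x)) = h" using u mor_self[OF h] by simp
  show "v = ?u" if v: "v \<in> gmor Q X \<and> mor M (\<lambda>\<mu> x. v \<mu> (c \<mu> x)) = h" for v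
  proof (rule gmor_ext[OF conjunct1[OF v] u])
    fix \<mu> y assume *: "\<mu> \<in> \<Lambda>" "y \<in> part Q \<mu>"
    have "v \<mu> (c \<mu> (i \<mu> y)) = h \<mu> (i \<mu> y)"
      using v mor_apply[OF *(1) i(1)[OF *], of "\<lambda>\<mu> x. v \<mu> (c \<mu> x)"] by simp
    then show "v \<mu> y = ?u \<mu> y" using * i by simp
  qed
qed

lemma cokernelI:
  assumes O: "K \<in> Obj" "M \<in> Obj" "Q \<in> Obj" and k: "k \<in> gmor K M" and c: "c \<in> gmor M Q"
    and surj: "\<And>\<mu>. \<mu> \<in> \<Lambda> \<Longrightarrow> c \<mu> ` part M \<mu> = part Q \<mu>"
    and img: "\<And>\<mu>. \<mu> \<in> \<Lambda> \<Longrightarrow> k \<mu> ` part K \<mu> = {x \<in> part M \<mu>. c \<mu> x = \<one>\<^bsub>total Q\<^esub>}"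
  shows "is_cokernel GC K M Q k c"
  unfolding is_cokernel_def
proof (intro conjI ballI impI)
  have ck: "mor K (\<lambda>\<mu> x. c \<mu> (k \<mu> x)) \<in> gmor K Q" using gmor_cmp[OF O(1) k c] .
  show "zero_morphism GC K Q (cmp GC K M Q c k)"
    unfolding cmp_GC zero_morphism_GC[OF O(1,3) ck] using img by auto
  fix X h assume X: "X \<in> obj GC" and h: "h \<in> Hom GC M X" and z: "zero_morphism GC K X (cmp GC K M X h k)"
  have X': "X \<in> Obj" and h': "h \<in> gmor M X" using X h by simp_all
  have "\<exists>!u. u \<in> gmor Q X \<and> mor M (\<lambda>\<mu> x. u \<mu> (c \<mu> x)) = h"
  proof (rule gmor_cofactor[OF c O(2,3) X' surj h'])
    have "mor K (\<lambda>\<mu> x. h \<mu> (k \<mu> x)) \<in> gmor K X" using gmor_cmp[OF O(1) k h'] .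
    from z[unfolded cmp_GC zero_morphism_GC[OF O(1) X' this]]
    have hk: "h \<mu> (k \<mu> x) = \<one>\<^bsub>total X\<^esub>" if "\<mu> \<in> \<Lambda>" "x \<in> part K \<mu>" for \<mu> x using that by simp
    show "h \<mu> x = \<one>\<^bsub>total X\<^esub>" if "\<mu> \<in> \<Lambda>" "x \<in> part M \<mu>" "c \<mu> x = \<one>\<^bsub>total Q\<^esub>" for \<mu> x
    proof -
      have "x \<in> k \<mu> ` part K \<mu>" using img that by blast
      then show ?thesis using hk[OF that(1)] by blast
    qed
  qed
  then show "\<exists>!u. u \<in> Hom GC Q X \<and> cmp GC M Q X u c = h" by simp
qed (use O k c in simp_all)

text \<open>The image of \<open>c\<close> is a subobject \<open>I\<close> through which
  \<open>c\<close> factors as \<open>c'\<close>. Since \<open>c'\<close> annihilates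
  \<open>k\<close>, the universal property gives \<open>u\<close> from \<open>Q\<close> to
  \<open>I\<close>, and uniqueness makes \<open>m\<close> after \<open>u\<close> the identity of
  \<open>Q\<close>. Hence \<open>I\<close> is everything.\<close>

lemma cokernel_surj:
  assumes cok: "is_cokernel GC K M Q k c" and mu: "\<mu> \<in> \<Lambda>"
  shows "c \<mu> ` part M \<mu> = part Q \<mu>"
proof -
  have K: "K \<in> Obj" and M: "M \<in> Obj" and Q: "Q \<in> Obj" and k: "k \<in> gmor K M" and c: "c \<in> gmor M Q"
    and z: "zero_morphism GC K Q (cmp GC K M Q c k)"
    and univ: "\<And>X h. X \<in> Obj \<Longrightarrow> h \<in> gmor M X \<Longrightarrow> zero_morphism GC K X (cmp GC K M X h k) \<Longrightarrow>
      \<exists>!u. u \<in> gmor Q X \<and> mor M (\<lambda>\<mu> x. u \<mu> (c \<mu> x)) = h"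
    using cok unfolding is_cokernel_def by simp_all
  let ?V = "\<lambda>\<mu>. c \<mu> ` part M \<mu>"
  obtain I m where I: "I \<in> Obj" "m \<in> gmor I Q" "\<And>\<mu>. \<mu> \<in> \<Lambda> \<Longrightarrow> bij_betw (m \<mu>) (part I \<mu>) (?V \<mu>)"
  proof (rule subobject_gmor[OF Q, of ?V])
    show "?V \<mu> \<subseteq> part Q \<mu>" if "\<mu> \<in> \<Lambda>" for \<mu> using gmor_mem[OF c that] by blast
    show "\<one>\<^bsub>total Q\<^esub> \<in> ?V \<mu>" if "\<mu> \<in> \<Lambda>" for \<mu> using gmor_one[OF M Q c that] part_one[OF M that] by (metis imageI)
    show "x \<otimes>\<^bsub>total Q\<^esub> y \<in> ?V \<mu>" if "\<mu> \<in> \<Lambda>" "x \<in> ?V \<mu>" "y \<in> ?V \<mu>" for \<mu> x y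
      using that(2,3) gmor_mult[OF c that(1)] part_mult[OF M that(1)] by (auto simp flip: gmor_mult[OF c that(1)])
    show "act Q r x \<in> ?V \<beta>" if "\<alpha> \<in> \<Lambda>" "\<beta> \<in> \<Lambda>" "r \<in> scal \<alpha> \<beta>" "x \<in> ?V \<alpha>" for \<alpha> \<beta> r x
      using that(4) act_part[OF M that(1-3)] by (auto simp flip: gmor_act[OF c that(1-3)])
  qed blast
  have inj: "inj_on (m \<mu>) (part I \<mu>)" and img: "m \<mu> ` part I \<mu> = ?V \<mu>" if "\<mu> \<in> \<Lambda>" for \<mu>
    using I(3)[OF that] unfolding bij_betw_def by blast+
  obtain c' where c': "c' \<in> gmor M I" "mor M (\<lambda>\<mu> x. m \<mu> (c' \<mu> x)) = c"
    using gmor_factor[OF I(2,1) Q M inj c] img by blast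
  have mc: "m \<mu> (c' \<mu> x) = c \<mu> x" if "\<mu> \<in> \<Lambda>" "x \<in> part M \<mu>" for \<mu> x
    using mor_apply[OF that, of "\<lambda>\<mu> x. m \<mu> (c' \<mu> x)"] c'(2) by simp
  have ck: "c \<mu> (k \<mu> x) = \<one>\<^bsub>total Q\<^esub>" if "\<mu> \<in> \<Lambda>" "x \<in> part K \<mu>" for \<mu> x
    using z[unfolded cmp_GC zero_morphism_GC[OF K Q gmor_cmp[OF K k c]]] that by simp
  have "c' \<mu> (k \<mu> x) = \<one>\<^bsub>total I\<^esub>" if *: "\<mu> \<in> \<Lambda>" "x \<in> part K \<mu>" for \<mu> x
  proof (rule inj_onD[OF inj[OF *(1)]])
    show "m \<mu> (c' \<mu> (k \<mu> x)) = m \<mu> \<one>\<^bsub>total I\<^esub>"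
      using mc[OF *(1) gmor_mem[OF k *]] ck[OF *] gmor_one[OF I(1) Q I(2) *(1)] by simp
  qed (use gmor_mem[OF c'(1) *(1) gmor_mem[OF k *]] part_one[OF I(1) *(1)] in auto)
  then have "zero_morphism GC K I (cmp GC K M I c' k)"
    unfolding cmp_GC zero_morphism_GC[OF K I(1) gmor_cmp[OF K k c'(1)]] by simp
  then obtain u where u: "u \<in> gmor Q I" "mor M (\<lambda>\<mu> x. u \<mu> (c \<mu> x)) = c'" using univ[OF I(1) c'(1)] by blast
  have uc: "u \<mu> (c \<mu> x) = c' \<mu> x" if "\<mu> \<in> \<Lambda>" "x \<in> part M \<mu>" for \<mu> x
    using mor_apply[OF that, of "\<lambda>\<mu> x. u \<mu> (c \<mu> x)"] u(2) by simp
  have e1: "mor M (\<lambda>\<mu> x. mor Q (\<lambda>\<mu> x. m \<mu> (u \<mu> x)) \<mu> (c \<mu> x)) = mor M c"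
    by (rule mor_eqI) (simp add: uc mc gmor_mem[OF c])
  have e2: "mor M (\<lambda>\<mu> x. mor Q (\<lambda>\<mu> x. x) \<mu> (c \<mu> x)) = mor M c"
    by (rule mor_eqI) (simp add: gmor_mem[OF c])
  have mu_id: "mor Q (\<lambda>\<mu> x. m \<mu> (u \<mu> x)) = mor Q (\<lambda>\<mu> x. x)"
  proof -
    obtain w0 where w0: "\<And>w. w \<in> gmor Q Q \<Longrightarrow> mor M (\<lambda>\<mu> x. w \<mu> (c \<mu> x)) = c \<Longrightarrow> w = w0"
      using univ[OF Q c z] by (elim ex1E) blast
    have uniq: "w = w'" if "w \<in> gmor Q Q" "mor M (\<lambda>\<mu> x. w \<mu> (c \<mu> x)) = c"
      "w' \<in> gmor Q Q" "mor M (\<lambda>\<mu> x. w' \<mu> (c \<mu> x)) = c" for w w'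
      using w0[of w] w0[of w'] that by simp
    show ?thesis by (rule uniq) (use e1 e2 gmor_cmp[OF Q u(1) I(2)] gmor_ident[OF Q] mor_self[OF c] in simp_all)
  qed
  have "y \<in> c \<mu> ` part M \<mu>" if y: "y \<in> part Q \<mu>" for y
  proof -
    have "m \<mu> (u \<mu> y) = y" using gmor_eqD[OF mu_id mu y] .
    then have "y \<in> m \<mu> ` part I \<mu>" using gmor_mem[OF u(1) mu y] by (metis imageI)
    then show ?thesis using img[OF mu] by simp
  qed
  then show ?thesis using gmor_mem[OF c mu] by blast
qed

text \<open>Conversely to \<open>cokernel_surj\<close>, a degreewise surjection is the cokernel of
  its own kernel. In this form stability under base change is visible.\<close>

lemma cokernel_map_GC:
  assumes M: "M \<in> Obj" and Q: "Q \<in> Obj" and c: "c \<in> gmor M Q"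
  shows "cokernel_map GC M Q c \<longleftrightarrow> (\<forall>\<mu>\<in>\<Lambda>. c \<mu> ` part M \<mu> = part Q \<mu>)"
proof
  assume "cokernel_map GC M Q c"
  then show "\<forall>\<mu>\<in>\<Lambda>. c \<mu> ` part M \<mu> = part Q \<mu>" unfolding cokernel_map_def using cokernel_surj by blast
next
  assume surj: "\<forall>\<mu>\<in>\<Lambda>. c \<mu> ` part M \<mu> = part Q \<mu>"
  obtain K k where K: "K \<in> Obj" "k \<in> gmor K M"
    "\<And>\<mu>. \<mu> \<in> \<Lambda> \<Longrightarrow> bij_betw (k \<mu>) (part K \<mu>) {x \<in> part M \<mu>. c \<mu> x = \<one>\<^bsub>total Q\<^esub>}"
    using kernel_exists[OF M Q c] by blast
  have "is_cokernel GC K M Q k c"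
    by (rule cokernelI[OF K(1) M Q K(2) c]) (use surj K(3) in \<open>auto simp: bij_betw_def\<close>)
  then show "cokernel_map GC M Q c" unfolding cokernel_map_def by blast
qed

text \<open>Ties conflations to short exact sequences of abelian groups in each degree, the form in
  which exactness of filtered colimits is checked.\<close>

lemma conflation_GC:
  assumes O: "K \<in> Obj" "M \<in> Obj" "Q \<in> Obj" and k: "k \<in> gmor K M" and c: "c \<in> gmor M Q"
  shows "conflation GC K M Q k c \<longleftrightarrow> (\<forall>\<mu>\<in>\<Lambda>. inj_on (k \<mu>) (part K \<mu>) \<and>
    k \<mu> ` part K \<mu> = {x \<in> part M \<mu>. c \<mu> x = \<one>\<^bsub>total Q\<^esub>} \<and> c \<mu> ` part M \<mu> = part Q \<mu>)"
proof
  assume "conflation GC K M Q k c"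
  then have "is_kernel GC K M Q k c" "is_cokernel GC K M Q k c" unfolding conflation_def by blast+
  then show "\<forall>\<mu>\<in>\<Lambda>. inj_on (k \<mu>) (part K \<mu>) \<and>
    k \<mu> ` part K \<mu> = {x \<in> part M \<mu>. c \<mu> x = \<one>\<^bsub>total Q\<^esub>} \<and> c \<mu> ` part M \<mu> = part Q \<mu>"
    by (auto simp: kernelD cokernel_surj)
next
  assume *: "\<forall>\<mu>\<in>\<Lambda>. inj_on (k \<mu>) (part K \<mu>) \<and>
    k \<mu> ` part K \<mu> = {x \<in> part M \<mu>. c \<mu> x = \<one>\<^bsub>total Q\<^esub>} \<and> c \<mu> ` part M \<mu> = part Q \<mu>"
  show "conflation GC K M Q k c"
    unfolding conflation_def using * by (intro conjI kernelI[OF O k c] cokernelI[OF O k c]) blast+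
qed

text \<open>The given pullback is not computed. The fibre product \<open>X\<close> of the parts maps
  to it by the universal property, and its projection \<open>t\<close> to \<open>B\<close> is
  already surjective because \<open>f\<close> is; since \<open>t\<close> factors through
  \<open>r\<close>, so is \<open>r\<close>.\<close>

lemma pullback_cokernel:
  assumes pb: "is_pullback GC P A B C q r f g" and cok: "cokernel_map GC A C f"
  shows "cokernel_map GC P B r"
proof -
  have O: "P \<in> Obj" "A \<in> Obj" "B \<in> Obj" "C \<in> Obj" and q: "q \<in> gmor P A" and r: "r \<in> gmor P B"
    and f: "f \<in> gmor A C" and g: "g \<in> gmor B C"
    and univ: "\<And>X s t. X \<in> Obj \<Longrightarrow> s \<in> gmor X A \<Longrightarrow> t \<in> gmor X B \<Longrightarrow>
      mor X (\<lambda>\<mu> x. f \<mu> (s \<mu> x)) = mor X (\<lambda>\<mu> x. g \<mu> (t \<mu> x)) \<Longrightarrow>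
      \<exists>!u. u \<in> gmor X P \<and> mor X (\<lambda>\<mu> x. q \<mu> (u \<mu> x)) = s \<and> mor X (\<lambda>\<mu> x. r \<mu> (u \<mu> x)) = t"
    using pb unfolding is_pullback_def by simp_all
  let ?V = "\<lambda>\<mu>. {(x, y). x \<in> part A \<mu> \<and> y \<in> part B \<mu> \<and> f \<mu> x = g \<mu> y}"
  obtain X s t where X: "X \<in> Obj" "s \<in> gmor X A" "t \<in> gmor X B"
    and bij: "\<And>\<mu>. \<mu> \<in> \<Lambda> \<Longrightarrow> bij_betw (\<lambda>x. (s \<mu> x, t \<mu> x)) (part X \<mu>) (?V \<mu>)"
  proof (rule relation_gmor[OF O(2,3), of ?V])
    show "(act A r x, act B r y) \<in> ?V \<beta>" if "\<alpha> \<in> \<Lambda>" "\<beta> \<in> \<Lambda>" "r \<in> scal \<alpha> \<beta>" "(x, y) \<in> ?V \<alpha>" for \<alpha> \<beta> r x y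
      using that gmor_act[OF f that(1-3)] gmor_act[OF g that(1-3)] act_part[OF O(2) that(1-3)]
        act_part[OF O(3) that(1-3)] by simp
  qed (use gmor_one[OF O(2,4) f] gmor_one[OF O(3,4) g] gmor_mult[OF f] gmor_mult[OF g]
      part_one[OF O(2)] part_one[OF O(3)] part_mult[OF O(2)] part_mult[OF O(3)] in auto)
  have "mor X (\<lambda>\<mu> x. f \<mu> (s \<mu> x)) = mor X (\<lambda>\<mu> x. g \<mu> (t \<mu> x))"
    using bij_betwE[OF bij] by (intro mor_eqI) auto
  then obtain u where u: "u \<in> gmor X P" "mor X (\<lambda>\<mu> x. r \<mu> (u \<mu> x)) = t" using univ[OF X] by blast
  have ru: "r \<mu> (u \<mu> x) = t \<mu> x" if "\<mu> \<in> \<Lambda>" "x \<in> part X \<mu>" for \<mu> x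
    using mor_apply[OF that, of "\<lambda>\<mu> x. r \<mu> (u \<mu> x)"] u(2) by simp
  have "r \<mu> ` part P \<mu> = part B \<mu>" if mu: "\<mu> \<in> \<Lambda>" for \<mu>
  proof (intro subset_antisym subsetI)
    fix y assume y: "y \<in> part B \<mu>"
    have "f \<mu> ` part A \<mu> = part C \<mu>" using cok cokernel_map_GC[OF O(2,4) f] mu by blast
    then obtain x where "x \<in> part A \<mu>" "f \<mu> x = g \<mu> y" using gmor_mem[OF g mu y] by (metis imageE)
    then have "(x, y) \<in> (\<lambda>x. (s \<mu> x, t \<mu> x)) ` part X \<mu>" using bij_betw_imp_surj_on[OF bij[OF mu]] y by simp
    then obtain w where "w \<in> part X \<mu>" "t \<mu> w = y" by auto
    then show "y \<in> r \<mu> ` part P \<mu>" using ru[OF mu] gmor_mem[OF u(1) mu] by (metis imageI)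
  qed (use gmor_mem[OF r mu] in blast)
  then show ?thesis using cokernel_map_GC[OF O(1,3) r] by blast
qed

section \<open>Generators and relations; existence of cokernels\<close>

section \<open>Formal linear combinations and presented gliders\<close>

primrec ev :: "('g, 'r, 'u) module_functor \<Rightarrow> ('s \<Rightarrow> 'u) \<Rightarrow> ('r \<times> 's) list \<Rightarrow> 'u" where
  "ev N e [] = \<one>\<^bsub>total N\<^esub>"
| "ev N e (p # l) = act N (fst p) (e (snd p)) \<otimes>\<^bsub>total N\<^esub> ev N e l"

definition scale :: "'r \<Rightarrow> ('r \<times> 's) list \<Rightarrow> ('r \<times> 's) list" where
  "scale c l = map (\<lambda>p. (c \<otimes>\<^bsub>R\<^esub> fst p, snd p)) l"

text \<open>Formal sums are plain lists, with no normalization of order or of repeated generators,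
  because they are compared only through their values.\<close>

definition combs :: "'s set \<Rightarrow> ('r \<times> 's) list set" where
  "combs S = lists (carrier R \<times> S)"

lemma combs_simps [simp]: "[] \<in> combs S"
  "p # l \<in> combs S \<longleftrightarrow> fst p \<in> carrier R \<and> snd p \<in> S \<and> l \<in> combs S"
  "l @ m \<in> combs S \<longleftrightarrow> l \<in> combs S \<and> m \<in> combs S"
  unfolding combs_def by (auto simp: mem_Times_iff)

text \<open>The homogeneous combinations of degree \<mu>: every summand, not just the sum, is bound
  to lie in the part of degree \<mu>.\<close>

definition hcombs :: "'s set \<Rightarrow> ('s \<Rightarrow> 'g) \<Rightarrow> 'g \<Rightarrow> ('r \<times> 's) list set" where
  "hcombs S d \<mu> = {l. \<forall>p\<in>set l. snd p \<in> S \<and> fst p \<in> scal (d (snd p)) \<mu>}"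

lemma scale_combs: "c \<in> carrier R \<Longrightarrow> l \<in> combs S \<Longrightarrow> scale c l \<in> combs S"
  unfolding scale_def by (induction l) auto

lemma scale_append: "scale c (l @ m) = scale c l @ scale c m"
  unfolding scale_def by simp

lemma hcombs_combs: "\<mu> \<in> \<Lambda> \<Longrightarrow> d ` S \<subseteq> \<Lambda> \<Longrightarrow> hcombs S d \<mu> \<subseteq> combs S"
proof
  fix l assume mu: "\<mu> \<in> \<Lambda>" "d ` S \<subseteq> \<Lambda>" and "l \<in> hcombs S d \<mu>"
  then show "l \<in> combs S"
  proof (induction l)
    case (Cons p l)
    then have p: "snd p \<in> S" "fst p \<in> scal (d (snd p)) \<mu>" and l: "l \<in> hcombs S d \<mu>" unfolding hcombs_def by auto
    have "d (snd p) \<in> \<Lambda>" using mu(2) p(1) by blast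
    then show ?case using Cons.IH[OF mu l] scal_R[OF _ mu(1) p(2)] p(1) by simp
  qed simp
qed

lemma hcombs_scale:
  assumes "\<alpha> \<in> \<Lambda>" "\<beta> \<in> \<Lambda>" "d ` S \<subseteq> \<Lambda>" "c \<in> scal \<alpha> \<beta>" "l \<in> hcombs S d \<alpha>"
  shows "scale c l \<in> hcombs S d \<beta>"
  using assms scal_mult unfolding hcombs_def scale_def by (auto simp: image_subset_iff)

context
  fixes N :: "('g, 'r, 'u) module_functor" and S :: "'s set" and e :: "'s \<Rightarrow> 'u"
  assumes N: "N \<in> Obj" and e: "\<And>s. s \<in> S \<Longrightarrow> e s \<in> carrier (total N)"
begin

lemma ev_closed: "l \<in> combs S \<Longrightarrow> ev N e l \<in> carrier (total N)"
  by (induction l) (auto simp: e intro!: total_mult[OF N] total_one[OF N] act_closed[OF N])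

lemma ev_append: "l \<in> combs S \<Longrightarrow> m \<in> combs S \<Longrightarrow> ev N e (l @ m) = ev N e l \<otimes>\<^bsub>total N\<^esub> ev N e m"
  by (induction l) (auto simp: e ev_closed total_l_one[OF N] total_assoc[OF N] act_closed[OF N])

lemma ev_scale: "c \<in> carrier R \<Longrightarrow> l \<in> combs S \<Longrightarrow> ev N e (scale c l) = act N c (ev N e l)"
  unfolding scale_def
  by (induction l) (auto simp: e ev_closed act_unit[OF N] act_mult[OF N] act_act[OF N] act_closed[OF N])

end

lemma ev_part:
  assumes N: "N \<in> Obj" and d: "d ` S \<subseteq> \<Lambda>" and e: "\<And>s. s \<in> S \<Longrightarrow> e s \<in> part N (d s)" and mu: "\<mu> \<in> \<Lambda>"
    and l: "l \<in> hcombs S d \<mu>"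
  shows "ev N e l \<in> part N \<mu>"
  using l
proof (induction l)
  case Nil
  then show ?case using part_one[OF N mu] by simp
next
  case (Cons p l)
  then have p: "snd p \<in> S" "fst p \<in> scal (d (snd p)) \<mu>" and l: "l \<in> hcombs S d \<mu>" unfolding hcombs_def by auto
  have "d (snd p) \<in> \<Lambda>" using d p(1) by blast
  then show ?case using part_mult[OF N mu act_part[OF N _ mu p(2) e[OF p(1)]]] Cons.IH[OF l] by simp
qed

text \<open>A morphism of gliders cannot be applied to arbitrary elements of the total module. In a
  homogeneous combination each summand already lies in the part of degree \<mu>, so the morphism can
  be applied term by term.\<close>

lemma ev_gmor:
  assumes M: "M \<in> Obj" and N: "N \<in> Obj" and g: "g \<in> gmor M N" and d: "d ` S \<subseteq> \<Lambda>"
    and e: "\<And>s. s \<in> S \<Longrightarrow> e s \<in> part M (d s)" and e': "\<And>s. s \<in> S \<Longrightarrow> e' s = g (d s) (e s)"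
    and mu: "\<mu> \<in> \<Lambda>" and l: "l \<in> hcombs S d \<mu>"
  shows "g \<mu> (ev M e l) = ev N e' l"
  using l
proof (induction l)
  case Nil
  then show ?case using gmor_one[OF M N g mu] by simp
next
  case (Cons p l)
  then have p: "snd p \<in> S" "fst p \<in> scal (d (snd p)) \<mu>" and l: "l \<in> hcombs S d \<mu>" unfolding hcombs_def by auto
  have dp: "d (snd p) \<in> \<Lambda>" using d p(1) by blast
  show ?case
    using gmor_mult[OF g mu act_part[OF M dp mu p(2) e[OF p(1)]] ev_part[OF M d e mu l]]
      gmor_act[OF g dp mu p(2) e[OF p(1)]] Cons.IH[OF l] e'[OF p(1)] by simp
qed

text \<open>The condition concerns elements of the parts only and asks for homogeneous combinations,
  since these are what a morphism of gliders can be evaluated on.\<close>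

definition generates :: "('g, 'r, 'u) module_functor \<Rightarrow> 's set \<Rightarrow> ('s \<Rightarrow> 'g) \<Rightarrow> ('s \<Rightarrow> 'u) \<Rightarrow> bool" where
  "generates M S d \<gamma> \<longleftrightarrow> d ` S \<subseteq> \<Lambda> \<and> (\<forall>s\<in>S. \<gamma> s \<in> part M (d s)) \<and>
    (\<forall>\<mu>\<in>\<Lambda>. \<forall>x\<in>part M \<mu>. \<exists>l\<in>hcombs S d \<mu>. x = ev M \<gamma> l)"

lemma generates_gmor_eq:
  assumes M: "M \<in> Obj" and N: "N \<in> Obj" and gen: "generates M S d \<gamma>"
    and g: "g \<in> gmor M N" and h: "h \<in> gmor M N" and eq: "\<And>s. s \<in> S \<Longrightarrow> g (d s) (\<gamma> s) = h (d s) (\<gamma> s)"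
  shows "g = h"
proof (rule gmor_ext[OF g h])
  fix \<mu> x assume mu: "\<mu> \<in> \<Lambda>" and x: "x \<in> part M \<mu>"
  have d: "d ` S \<subseteq> \<Lambda>" and \<gamma>: "\<And>s. s \<in> S \<Longrightarrow> \<gamma> s \<in> part M (d s)" using gen unfolding generates_def by blast+
  obtain l where l: "l \<in> hcombs S d \<mu>" "x = ev M \<gamma> l" using gen mu x unfolding generates_def by blast
  have "g \<mu> x = ev N (\<lambda>s. g (d s) (\<gamma> s)) l"
    unfolding l(2) by (rule ev_gmor[OF M N g d \<gamma> _ mu l(1)]) auto
  moreover have "h \<mu> x = ev N (\<lambda>s. g (d s) (\<gamma> s)) l"
    unfolding l(2) by (rule ev_gmor[OF M N h d \<gamma> _ mu l(1)]) (auto simp: eq)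
  ultimately show "g \<mu> x = h \<mu> x" by simp
qed

text \<open>
  The universal glider on generators \<open>s \<in> S\<close> of degree \<open>d s\<close> for a class \<open>\<E>\<close> of
  assignments of elements of gliders to the generators: two combinations are identified if
  all members of the class give them the same value.
\<close>

lemma presented_object:
  fixes S :: "'s set"
  assumes S: "small TYPE('u) S" and d: "d ` S \<subseteq> \<Lambda>"
    and \<E>: "\<And>N e. (N, e) \<in> \<E> \<Longrightarrow> N \<in> Obj \<and> (\<forall>s\<in>S. e s \<in> part N (d s))"
  shows "\<exists>M\<in>Obj. \<exists>\<gamma>. generates M S d \<gamma> \<and>
    (\<forall>l\<in>combs S. \<forall>l'\<in>combs S. (\<forall>N e. (N, e) \<in> \<E> \<longrightarrow> ev N e l = ev N e l') \<longrightarrow> ev M \<gamma> l = ev M \<gamma> l') \<and>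
    (\<forall>N e. (N, e) \<in> \<E> \<longrightarrow> (\<exists>g\<in>gmor M N. \<forall>s\<in>S. g (d s) (\<gamma> s) = e s))"
proof -
  let ?A = "combs S" and ?E = "\<lambda>l l'. \<forall>N\<in>Obj. \<forall>e. (N, e) \<in> \<E> \<longrightarrow> ev N e l = ev N e l'"
  have N: "N \<in> Obj" if "(N, e) \<in> \<E>" for N e using \<E> that by blast
  have e: "e s \<in> part N (d s)" if "(N, e) \<in> \<E>" "s \<in> S" for N e s using \<E> that by blast
  have e': "e s \<in> carrier (total N)" if "(N, e) \<in> \<E>" "s \<in> S" for N e s
    using part_total[OF N[OF that(1)] _ e[OF that]] d that(2) by blast
  have cl: "ev N e l \<in> carrier (total N)" if "(N, e) \<in> \<E>" "l \<in> combs S" for N e l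
    by (rule ev_closed[OF N e', OF that(1) that(1) _ that(2)])
  have ap: "ev N e (l @ m) = ev N e l \<otimes>\<^bsub>total N\<^esub> ev N e m" if "(N, e) \<in> \<E>" "l \<in> combs S" "m \<in> combs S" for N e l m
    by (rule ev_append[OF N e', OF that(1) that(1) _ that(2,3)])
  have sc: "ev N e (scale c l) = act N c (ev N e l)" if "(N, e) \<in> \<E>" "c \<in> carrier R" "l \<in> combs S" for N e c l
    by (rule ev_scale[OF N e', OF that(1) that(1) _ that(2,3)])
  \<comment> \<open>For lists the module laws hold only up to \<open>?E\<close>: each of them
    becomes a true equation after evaluation in every \<open>N\<close>.\<close>
  have "\<exists>M q. presents ?A ?E (@) scale (hcombs S d) M q \<and> q [] = \<one>\<^bsub>total M\<^esub>"
  proof (rule setoid_presents)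
    show "small TYPE('u) ?A" by (rule small_lists[OF universe small_Sigma[OF universe small_R S], folded combs_def])
    show "hcombs S d \<mu> \<noteq> {}" if "\<mu> \<in> \<Lambda>" for \<mu> unfolding hcombs_def by (auto intro: exI[of _ "[]"])
    show "\<exists>w\<in>hcombs S d \<mu>. ?E w (x @ y)" if "\<mu> \<in> \<Lambda>" "x \<in> hcombs S d \<mu>" "y \<in> hcombs S d \<mu>" for \<mu> x y
      using that by (intro bexI[of _ "x @ y"]) (auto simp: hcombs_def)
    show "\<exists>w\<in>hcombs S d \<beta>. ?E w (scale r x)"
      if "\<alpha> \<in> \<Lambda>" "\<beta> \<in> \<Lambda>" "r \<in> scal \<alpha> \<beta>" "x \<in> hcombs S d \<alpha>" for \<alpha> \<beta> r x
      using hcombs_scale[OF that(1,2) d that(3,4)] by (intro bexI[of _ "scale r x"]) auto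
    show "hcombs S d \<mu> \<subseteq> combs S" if "\<mu> \<in> \<Lambda>" for \<mu> using hcombs_combs[OF that d] .
    show "?E (x @ y) (y @ x)" if "x \<in> ?A" "y \<in> ?A" for x y
    proof (intro ballI allI impI)
      fix N e assume Ne: "N \<in> Obj" "(N, e) \<in> \<E>"
      show "ev N e (x @ y) = ev N e (y @ x)"
        using that Ne total_comm[OF Ne(1) cl[OF Ne(2)] cl[OF Ne(2)]] by (simp add: ap)
    qed
  qed (simp_all add: ap sc cl scale_combs act_mult act_add act_act act_one act_zero total_l_one total_assoc)
  then obtain M q where P: "presents ?A ?E (@) scale (hcombs S d) M q" and q_Nil: "q [] = \<one>\<^bsub>total M\<^esub>" by blast
  note M = presentsD(1)[OF P]
  define \<gamma> where "\<gamma> s = q [(\<one>\<^bsub>R\<^esub>, s)]" for s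
  have q_ev: "q l = ev M \<gamma> l" if "l \<in> combs S" for l
    using that
  proof (induction l)
    case Nil
    then show ?case using q_Nil by simp
  next
    case (Cons p l)
    then have p: "fst p \<in> carrier R" "snd p \<in> S" and l: "l \<in> combs S" by auto
    have "p # l = scale (fst p) [(\<one>\<^bsub>R\<^esub>, snd p)] @ l" using p unfolding scale_def by simp
    then have "q (p # l) = q (scale (fst p) [(\<one>\<^bsub>R\<^esub>, snd p)]) \<otimes>\<^bsub>total M\<^esub> q l"
      using presentsD(5)[OF P _ l, of "scale (fst p) [(\<one>\<^bsub>R\<^esub>, snd p)]"] p by (simp add: scale_def)
    also have "q (scale (fst p) [(\<one>\<^bsub>R\<^esub>, snd p)]) = act M (fst p) (\<gamma> (snd p))"
      unfolding \<gamma>_def using presentsD(7)[OF P p(1)] p by simp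
    finally show ?case using Cons.IH l by simp
  qed
  have "generates M S d \<gamma>"
    unfolding generates_def
  proof (intro conjI ballI)
    show "d ` S \<subseteq> \<Lambda>" by (rule d)
    show "\<gamma> s \<in> part M (d s)" if "s \<in> S" for s
    proof -
      have ds: "d s \<in> \<Lambda>" using d that by blast
      then have "[(\<one>\<^bsub>R\<^esub>, s)] \<in> hcombs S d (d s)" using that scal_one[OF ds ds leq_refl[OF ds]] unfolding hcombs_def by simp
      then show ?thesis unfolding \<gamma>_def presentsD(9)[OF P ds] by (rule imageI)
    qed
    show "\<exists>l\<in>hcombs S d \<mu>. x = ev M \<gamma> l" if mu: "\<mu> \<in> \<Lambda>" and x: "x \<in> part M \<mu>" for \<mu> x
      using x q_ev hcombs_combs[OF mu d] unfolding presentsD(9)[OF P mu] by blast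
  qed
  moreover have "ev M \<gamma> l = ev M \<gamma> l'" if "l \<in> combs S" "l' \<in> combs S" "\<forall>N e. (N, e) \<in> \<E> \<longrightarrow> ev N e l = ev N e l'" for l l'
    using presentsD(3)[OF P that(1,2)] that(3) q_ev[OF that(1)] q_ev[OF that(2)] by simp
  moreover have "\<exists>g\<in>gmor M N. \<forall>s\<in>S. g (d s) (\<gamma> s) = e s" if Ne: "(N, e) \<in> \<E>" for N e
  proof -
    have "\<exists>f\<in>Hom PG M N. \<forall>x\<in>?A. f None (q x) = ev N e x"
    proof (rule presents_PG[OF P N[OF Ne]])
      show "ev N e x \<in> part N \<mu>" if "\<mu> \<in> \<Lambda>" "x \<in> hcombs S d \<mu>" for \<mu> x
        using ev_part[OF N[OF Ne] d e[OF Ne] that] .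
    qed (use Ne N[OF Ne] in \<open>auto simp: ap sc cl\<close>)
    then obtain f where f: "f \<in> Hom PG M N" "\<And>x. x \<in> ?A \<Longrightarrow> f None (q x) = ev N e x" by blast
    have "underlying M N f (d s) (\<gamma> s) = e s" if s: "s \<in> S" for s
    proof -
      have "d s \<in> \<Lambda>" "\<gamma> s \<in> part M (d s)"
        using d s \<open>generates M S d \<gamma>\<close> unfolding generates_def by blast+
      then have "underlying M N f (d s) (\<gamma> s) = f None (q [(\<one>\<^bsub>R\<^esub>, s)])"
        unfolding underlying_def \<gamma>_def by simp
      also have "\<dots> = e s"
        using f(2)[of "[(\<one>\<^bsub>R\<^esub>, s)]"] s e'[OF Ne s] by (simp add: act_one[OF N[OF Ne]] total_r_one[OF N[OF Ne]])
      finally show ?thesis .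
    qed
    then show ?thesis using underlying_gmor[OF M N[OF Ne] f(1)] by blast
  qed
  ultimately show ?thesis using M by (intro bexI[of _ M] exI[of _ \<gamma>]) blast+
qed

text \<open>The degreewise quotient of \<open>B\<close> by the image of \<open>f\<close> need not
  embed in a module. The cokernel is instead the universal object generated by all elements of the
  parts of \<open>B\<close>, where the tests are the morphisms out of \<open>B\<close> that
  annihilate the image of \<open>f\<close>.\<close>

lemma cokernel_exists:
  assumes A: "A \<in> Obj" and B: "B \<in> Obj" and f: "f \<in> gmor A B"
  shows "\<exists>Q c. is_cokernel GC A B Q f c"
proof -
  let ?S = "Sigma \<Lambda> (part B)"
  define \<E> where "\<E> = {(N, \<lambda>s. h (fst s) (snd s)) |N h. N \<in> Obj \<and> h \<in> gmor B N \<and>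
    (\<forall>\<mu>\<in>\<Lambda>. \<forall>x\<in>part A \<mu>. h \<mu> (f \<mu> x) = \<one>\<^bsub>total N\<^esub>)}"
  have d: "fst ` ?S \<subseteq> \<Lambda>" by auto
  have "small TYPE('u) ?S" using small_Sigma[OF universe small_Lambda part_small[OF B]] .
  then have "\<exists>M\<in>Obj. \<exists>\<gamma>. generates M ?S fst \<gamma> \<and>
    (\<forall>l\<in>combs ?S. \<forall>l'\<in>combs ?S. (\<forall>N e. (N, e) \<in> \<E> \<longrightarrow> ev N e l = ev N e l') \<longrightarrow> ev M \<gamma> l = ev M \<gamma> l') \<and>
    (\<forall>N e. (N, e) \<in> \<E> \<longrightarrow> (\<exists>g\<in>gmor M N. \<forall>s\<in>?S. g (fst s) (\<gamma> s) = e s))"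
    by (rule presented_object[OF _ d]) (auto simp: gmor_mem \<E>_def)
  then obtain Q \<gamma> where Q: "Q \<in> Obj" and gen: "generates Q ?S fst \<gamma>"
    and rel0: "\<forall>l\<in>combs ?S. \<forall>l'\<in>combs ?S. (\<forall>N e. (N, e) \<in> \<E> \<longrightarrow> ev N e l = ev N e l') \<longrightarrow> ev Q \<gamma> l = ev Q \<gamma> l'"
    and univ0: "\<forall>N e. (N, e) \<in> \<E> \<longrightarrow> (\<exists>g\<in>gmor Q N. \<forall>s\<in>?S. g (fst s) (\<gamma> s) = e s)"
    by blast
  have rel: "ev Q \<gamma> l = ev Q \<gamma> l'" if "l \<in> combs ?S" "l' \<in> combs ?S"
      "\<And>N h. N \<in> Obj \<Longrightarrow> h \<in> gmor B N \<Longrightarrow>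
        ev N (\<lambda>s. h (fst s) (snd s)) l = ev N (\<lambda>s. h (fst s) (snd s)) l'" for l l'
    by (rule rel0[rule_format, OF that(1,2)]) (use that(3) in \<open>auto simp: \<E>_def\<close>)
  \<comment> \<open>\<open>rel\<close> covers equations valid under every morphism out of
    \<open>B\<close>, which make \<open>?c\<close> a morphism. \<open>rel1\<close> also uses that
    the test morphisms annihilate the image of \<open>f\<close>, which makes \<open>?c\<close> do
    the same.\<close>
  have rel1: "ev Q \<gamma> l = ev Q \<gamma> l'" if "l \<in> combs ?S" "l' \<in> combs ?S"
      "\<And>N h. N \<in> Obj \<Longrightarrow> h \<in> gmor B N \<Longrightarrow> (\<forall>\<mu>\<in>\<Lambda>. \<forall>x\<in>part A \<mu>. h \<mu> (f \<mu> x) = \<one>\<^bsub>total N\<^esub>) \<Longrightarrow>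
        ev N (\<lambda>s. h (fst s) (snd s)) l = ev N (\<lambda>s. h (fst s) (snd s)) l'" for l l'
    by (rule rel0[rule_format, OF that(1,2)]) (use that(3) in \<open>auto simp: \<E>_def\<close>)
  have univ: "\<exists>g\<in>gmor Q N. \<forall>s\<in>?S. g (fst s) (\<gamma> s) = h (fst s) (snd s)"
    if "N \<in> Obj" "h \<in> gmor B N" "\<forall>\<mu>\<in>\<Lambda>. \<forall>x\<in>part A \<mu>. h \<mu> (f \<mu> x) = \<one>\<^bsub>total N\<^esub>" for N h
  proof -
    have "(N, \<lambda>s. h (fst s) (snd s)) \<in> \<E>" unfolding \<E>_def using that by blast
    from univ0[rule_format, OF this] show ?thesis by simp
  qed
  have \<gamma>: "\<gamma> (\<mu>, x) \<in> part Q \<mu>" if "\<mu> \<in> \<Lambda>" "x \<in> part B \<mu>" for \<mu> x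
    using gen that unfolding generates_def by fastforce
  have \<gamma>': "\<gamma> (\<mu>, x) \<in> carrier (total Q)" if "\<mu> \<in> \<Lambda>" "x \<in> part B \<mu>" for \<mu> x
    using part_total[OF Q that(1) \<gamma>[OF that]] .
  let ?c = "mor B (\<lambda>\<mu> x. \<gamma> (\<mu>, x))"
  have c: "?c \<in> gmor B Q"
  proof (rule gmorI[OF B \<gamma>])
    show "\<gamma> (\<mu>, x \<otimes>\<^bsub>total B\<^esub> y) = \<gamma> (\<mu>, x) \<otimes>\<^bsub>total Q\<^esub> \<gamma> (\<mu>, y)"
      if *: "\<mu> \<in> \<Lambda>" "x \<in> part B \<mu>" "y \<in> part B \<mu>" for \<mu> x y
    proof -
      have xy: "x \<otimes>\<^bsub>total B\<^esub> y \<in> part B \<mu>" using part_mult[OF B *] .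
      have "ev Q \<gamma> [(\<one>\<^bsub>R\<^esub>, (\<mu>, x \<otimes>\<^bsub>total B\<^esub> y))] = ev Q \<gamma> [(\<one>\<^bsub>R\<^esub>, (\<mu>, x)), (\<one>\<^bsub>R\<^esub>, (\<mu>, y))]"
      proof (rule rel)
        fix N h assume N: "N \<in> Obj" and h: "h \<in> gmor B N"
        have "h \<mu> x \<in> carrier (total N)" "h \<mu> y \<in> carrier (total N)"
          using part_total[OF N *(1)] gmor_mem[OF h *(1)] * by blast+
        then show "ev N (\<lambda>s. h (fst s) (snd s)) [(\<one>\<^bsub>R\<^esub>, (\<mu>, x \<otimes>\<^bsub>total B\<^esub> y))] =
            ev N (\<lambda>s. h (fst s) (snd s)) [(\<one>\<^bsub>R\<^esub>, (\<mu>, x)), (\<one>\<^bsub>R\<^esub>, (\<mu>, y))]"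
          using gmor_mult[OF h *] by (simp add: act_one[OF N] total_mult[OF N] total_r_one[OF N])
      qed (use * xy in auto)
      then show ?thesis
        using \<gamma>' * xy by (simp add: act_one[OF Q] total_r_one[OF Q])
    qed
    show "\<gamma> (\<beta>, act B r x) = act Q r (\<gamma> (\<alpha>, x))"
      if *: "\<alpha> \<in> \<Lambda>" "\<beta> \<in> \<Lambda>" "r \<in> scal \<alpha> \<beta>" "x \<in> part B \<alpha>" for \<alpha> \<beta> r x
    proof -
      have rx: "act B r x \<in> part B \<beta>" using act_part[OF B *] .
      have r: "r \<in> carrier R" using scal_R[OF *(1-3)] .
      have "ev Q \<gamma> [(\<one>\<^bsub>R\<^esub>, (\<beta>, act B r x))] = ev Q \<gamma> [(r, (\<alpha>, x))]"
      proof (rule rel)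
        fix N h assume N: "N \<in> Obj" and h: "h \<in> gmor B N"
        have "h \<alpha> x \<in> carrier (total N)"
          using part_total[OF N *(1)] gmor_mem[OF h *(1)] * by blast
        then show "ev N (\<lambda>s. h (fst s) (snd s)) [(\<one>\<^bsub>R\<^esub>, (\<beta>, act B r x))] = ev N (\<lambda>s. h (fst s) (snd s)) [(r, (\<alpha>, x))]"
          using gmor_act[OF h *] r by (simp add: act_one[OF N] act_closed[OF N])
      qed (use * rx r in auto)
      then show ?thesis
        using \<gamma>' * rx r by (simp add: act_one[OF Q] act_closed[OF Q] total_r_one[OF Q])
    qed
  qed
  have cf: "\<gamma> (\<mu>, f \<mu> x) = \<one>\<^bsub>total Q\<^esub>" if *: "\<mu> \<in> \<Lambda>" "x \<in> part A \<mu>" for \<mu> x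
  proof -
    have fx: "f \<mu> x \<in> part B \<mu>" using gmor_mem[OF f *] .
    have "ev Q \<gamma> [(\<one>\<^bsub>R\<^esub>, (\<mu>, f \<mu> x))] = ev Q \<gamma> []"
      by (rule rel1) (use * fx in \<open>auto simp: act_one total_one total_r_one\<close>)
    then show ?thesis using \<gamma>' * fx by (simp add: act_one[OF Q] total_r_one[OF Q])
  qed
  have cf': "mor A (\<lambda>\<mu> x. ?c \<mu> (f \<mu> x)) \<in> gmor A Q" using gmor_cmp[OF A f c] .
  have "is_cokernel GC A B Q f ?c"
    unfolding is_cokernel_def
  proof (intro conjI ballI impI)
    show "zero_morphism GC A Q (cmp GC A B Q ?c f)"
      unfolding cmp_GC zero_morphism_GC[OF A Q cf'] using cf gmor_mem[OF f] by simp
    fix X h assume X: "X \<in> obj GC" and h: "h \<in> Hom GC B X" and z: "zero_morphism GC A X (cmp GC A B X h f)"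
    have X': "X \<in> Obj" and h': "h \<in> gmor B X" using X h by simp_all
    have "h \<mu> (f \<mu> x) = \<one>\<^bsub>total X\<^esub>" if "\<mu> \<in> \<Lambda>" "x \<in> part A \<mu>" for \<mu> x
      using z[unfolded cmp_GC zero_morphism_GC[OF A X' gmor_cmp[OF A f h']]] that by simp
    then obtain g where g: "g \<in> gmor Q X" "\<And>s. s \<in> ?S \<Longrightarrow> g (fst s) (\<gamma> s) = h (fst s) (snd s)"
      using univ[OF X' h'] by blast
    have gc: "mor B (\<lambda>\<mu> x. g \<mu> (?c \<mu> x)) = h"
    proof -
      have "mor B (\<lambda>\<mu> x. g \<mu> (?c \<mu> x)) = mor B h" by (rule mor_eqI) (use g(2) in force)
      then show ?thesis using mor_self[OF h'] by simp
    qed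
    \<comment> \<open>The generators of \<open>Q\<close> are the images under \<open>?c\<close> of
      elements of \<open>B\<close>, so a factorization of \<open>h\<close> is prescribed on
      them.\<close>
    have "g' = g" if g': "g' \<in> gmor Q X" "mor B (\<lambda>\<mu> x. g' \<mu> (?c \<mu> x)) = h" for g'
    proof (rule generates_gmor_eq[OF Q X' gen g'(1) g(1)])
      fix s assume s: "s \<in> ?S"
      have "mor B (\<lambda>\<mu> x. g' \<mu> (?c \<mu> x)) = mor B (\<lambda>\<mu> x. g \<mu> (?c \<mu> x))" using g'(2) gc by simp
      from gmor_eqD[OF this, of "fst s" "snd s"] s show "g' (fst s) (\<gamma> s) = g (fst s) (\<gamma> s)" by auto
    qed
    then have "\<exists>!u. u \<in> gmor Q X \<and> mor B (\<lambda>\<mu> x. u \<mu> (?c \<mu> x)) = h" using g(1) gc by blast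
    then show "\<exists>!u. u \<in> Hom GC Q X \<and> cmp GC B Q X u ?c = h" by simp
  qed (use A B Q f c in simp_all)
  then show ?thesis by blast
qed

lemma deflation_quasi_abelian_GC: "deflation_quasi_abelian GC"
  unfolding deflation_quasi_abelian_def
proof (intro conjI ballI allI impI)
  show "additive_category GC" by (rule additive_GC)
  show "\<exists>K k. is_kernel GC K M N k f" if "M \<in> obj GC" "N \<in> obj GC" "f \<in> Hom GC M N" for M N f
    using kernel_exists[of M N f] that by auto
  show "\<exists>Q c. is_cokernel GC M N Q f c" if "M \<in> obj GC" "N \<in> obj GC" "f \<in> Hom GC M N" for M N f
    using cokernel_exists[of M N f] that by simp
  show "cokernel_map GC P B r" if "is_pullback GC P A B C q r f g \<and> cokernel_map GC A C f" for P A B C q r f g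
    using pullback_cokernel that by blast
qed

end

section \<open>Filtered colimits, computed degree by degree\<close>

section \<open>Filtered colimits of gliders\<close>

text \<open>Apply \<open>filtered_span\<close> at \<open>i\<close>, then make the two resulting
  morphisms out of \<open>j\<close> equal; the first equation survives. It is used to show that a
  sum does not depend on the chosen upper bound.\<close>

lemma filtered_cospan:
  assumes "filtered J" "i \<in> obj J" "j \<in> obj J" "k \<in> obj J" "k' \<in> obj J"
    "u \<in> Hom J i k" "u' \<in> Hom J i k'" "v \<in> Hom J j k" "v' \<in> Hom J j k'"
  obtains m w w' where "m \<in> obj J" "w \<in> Hom J k m" "w' \<in> Hom J k' m"
    "cmp J i k m w u = cmp J i k' m w' u'" "cmp J j k m w v = cmp J j k' m w' v'"
proof -
  have cat: "is_category J" using assms unfolding filtered_def by blast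
  obtain n a a' where n: "n \<in> obj J" "a \<in> Hom J k n" "a' \<in> Hom J k' n"
    "cmp J i k n a u = cmp J i k' n a' u'"
    using filtered_span[OF assms(1,2,4,5,6,7)] .
  have "cmp J j k n a v \<in> Hom J j n" "cmp J j k' n a' v' \<in> Hom J j n"
    using cat_cmp[OF cat] n assms by blast+
  then obtain m b where m: "m \<in> obj J" "b \<in> Hom J n m"
    "cmp J j n m b (cmp J j k n a v) = cmp J j n m b (cmp J j k' n a' v')"
    using assms(1,3) n(1) unfolding filtered_def by blast
  show ?thesis
  proof
    show "m \<in> obj J" by fact
    show "cmp J k n m b a \<in> Hom J k m" "cmp J k' n m b a' \<in> Hom J k' m"
      using cat_cmp[OF cat] n m assms by blast+
    show "cmp J i k m (cmp J k n m b a) u = cmp J i k' m (cmp J k' n m b a') u'"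
      using cat_assoc[OF cat assms(2,4) n(1) m(1) assms(6) n(2) m(2)]
        cat_assoc[OF cat assms(2,5) n(1) m(1) assms(7) n(3) m(2)] n(4) by simp
    show "cmp J j k m (cmp J k n m b a) v = cmp J j k' m (cmp J k' n m b a') v'"
      using cat_assoc[OF cat assms(3,4) n(1) m(1) assms(8) n(2) m(2)]
        cat_assoc[OF cat assms(3,5) n(1) m(1) assms(9) n(3) m(2)] m(3) by simp
  qed
qed

context gliders begin

text \<open>The cocone \<open>\<iota>\<close> is in each degree a direct limit of sets.\<close>

definition pointwise_colimit ::
  "('i, 'k) category \<Rightarrow> ('i, 'k, ('g, 'r, 'u) module_functor, 'g \<Rightarrow> 'u \<Rightarrow> 'u) functor_data \<Rightarrow>
    ('g, 'r, 'u) module_functor \<Rightarrow> ('i \<Rightarrow> 'g \<Rightarrow> 'u \<Rightarrow> 'u) \<Rightarrow> bool" where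
  "pointwise_colimit J D L \<iota> \<longleftrightarrow>
    (\<forall>\<mu>\<in>\<Lambda>. \<forall>y\<in>part L \<mu>. \<exists>i\<in>obj J. \<exists>x\<in>part (fobj D i) \<mu>. \<iota> i \<mu> x = y) \<and>
    (\<forall>i\<in>obj J. \<forall>\<mu>\<in>\<Lambda>. \<forall>x\<in>part (fobj D i) \<mu>. \<forall>y\<in>part (fobj D i) \<mu>. \<iota> i \<mu> x = \<iota> i \<mu> y \<longrightarrow>
      (\<exists>k\<in>obj J. \<exists>u\<in>Hom J i k. farr D i k u \<mu> x = farr D i k u \<mu> y))"

context
  fixes J :: "('i, 'k) category"
    and D :: "('i, 'k, ('g, 'r, 'u) module_functor, 'g \<Rightarrow> 'u \<Rightarrow> 'u) functor_data"
  assumes J: "filtered J" and D: "is_functor J GC D"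
begin

lemma J_cat: "is_category J"
  using J unfolding filtered_def by blast

lemma J_bound: "i \<in> obj J \<Longrightarrow> j \<in> obj J \<Longrightarrow> \<exists>k\<in>obj J. \<exists>u\<in>Hom J i k. \<exists>v\<in>Hom J j k. True"
  using J unfolding filtered_def by blast

lemma D_Obj: "i \<in> obj J \<Longrightarrow> fobj D i \<in> Obj"
  using functor_obj[OF D] by simp

lemma D_gmor: "i \<in> obj J \<Longrightarrow> j \<in> obj J \<Longrightarrow> u \<in> Hom J i j \<Longrightarrow> farr D i j u \<in> gmor (fobj D i) (fobj D j)"
  using functor_arr[OF D] by simp

lemma D_mem: "i \<in> obj J \<Longrightarrow> j \<in> obj J \<Longrightarrow> u \<in> Hom J i j \<Longrightarrow> \<mu> \<in> \<Lambda> \<Longrightarrow> x \<in> part (fobj D i) \<mu> \<Longrightarrow>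
    farr D i j u \<mu> x \<in> part (fobj D j) \<mu>"
  using gmor_mem[OF D_gmor] .

lemma D_cmp: "i \<in> obj J \<Longrightarrow> j \<in> obj J \<Longrightarrow> k \<in> obj J \<Longrightarrow> u \<in> Hom J i j \<Longrightarrow> v \<in> Hom J j k \<Longrightarrow>
    \<mu> \<in> \<Lambda> \<Longrightarrow> x \<in> part (fobj D i) \<mu> \<Longrightarrow>
    farr D i k (cmp J i j k v u) \<mu> x = farr D j k v \<mu> (farr D i j u \<mu> x)"
  using functor_cmp[OF D] by simp

lemma D_ident: "i \<in> obj J \<Longrightarrow> \<mu> \<in> \<Lambda> \<Longrightarrow> x \<in> part (fobj D i) \<mu> \<Longrightarrow> farr D i i (ident J i) \<mu> x = x"
  using functor_ident[OF D] by simp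

lemma cocone_gmor: "is_cocone J GC D L \<kappa> \<Longrightarrow> i \<in> obj J \<Longrightarrow> \<kappa> i \<in> gmor (fobj D i) L"
  using cocone_leg[of J GC D L \<kappa> i] by simp

lemma cocone_apply: "is_cocone J GC D L \<kappa> \<Longrightarrow> i \<in> obj J \<Longrightarrow> j \<in> obj J \<Longrightarrow> u \<in> Hom J i j \<Longrightarrow> \<mu> \<in> \<Lambda> \<Longrightarrow>
    x \<in> part (fobj D i) \<mu> \<Longrightarrow> \<kappa> j \<mu> (farr D i j u \<mu> x) = \<kappa> i \<mu> x"
  using cocone_cmp[of J GC D L \<kappa> i j u] mor_apply[of \<mu> x "fobj D i" "\<lambda>\<mu> x. \<kappa> j \<mu> (farr D i j u \<mu> x)"] by simp

context
  fixes L \<iota>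
  assumes L: "is_cocone J GC D L \<iota>" and pw: "pointwise_colimit J D L \<iota>"
begin

lemma pointwise_surj: "\<mu> \<in> \<Lambda> \<Longrightarrow> y \<in> part L \<mu> \<Longrightarrow> \<exists>i\<in>obj J. \<exists>x\<in>part (fobj D i) \<mu>. \<iota> i \<mu> x = y"
  using pw unfolding pointwise_colimit_def by blast

lemma pointwise_eq: "i \<in> obj J \<Longrightarrow> \<mu> \<in> \<Lambda> \<Longrightarrow> x \<in> part (fobj D i) \<mu> \<Longrightarrow> y \<in> part (fobj D i) \<mu> \<Longrightarrow>
    \<iota> i \<mu> x = \<iota> i \<mu> y \<Longrightarrow> \<exists>k\<in>obj J. \<exists>u\<in>Hom J i k. farr D i k u \<mu> x = farr D i k u \<mu> y"
  using pw unfolding pointwise_colimit_def by blast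

lemma pointwise_two:
  assumes "\<mu> \<in> \<Lambda>" "\<nu> \<in> \<Lambda>" "y \<in> part L \<mu>" "z \<in> part L \<nu>"
  shows "\<exists>k\<in>obj J. \<exists>x\<in>part (fobj D k) \<mu>. \<exists>w\<in>part (fobj D k) \<nu>. \<iota> k \<mu> x = y \<and> \<iota> k \<nu> w = z"
proof -
  obtain i x where i: "i \<in> obj J" "x \<in> part (fobj D i) \<mu>" "\<iota> i \<mu> x = y" using pointwise_surj assms by blast
  obtain j w where j: "j \<in> obj J" "w \<in> part (fobj D j) \<nu>" "\<iota> j \<nu> w = z" using pointwise_surj assms by blast
  obtain k u v where k: "k \<in> obj J" "u \<in> Hom J i k" "v \<in> Hom J j k" using J_bound i j by blast
  show ?thesis
    using k D_mem[OF i(1) k(1,2) assms(1) i(2)] D_mem[OF j(1) k(1,3) assms(2) j(2)]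
      cocone_apply[OF L i(1) k(1,2) assms(1) i(2)] cocone_apply[OF L j(1) k(1,3) assms(2) j(2)] i(3) j(3) by metis
qed

text \<open>Elements with equal images in \<open>L\<close> become equal at some later stage, where a
  cocone can no longer distinguish them. So \<open>\<kappa>\<close> descends to
  \<open>L\<close>.\<close>

lemma pointwise_factor:
  assumes \<kappa>: "is_cocone J GC D X \<kappa>" and i: "i \<in> obj J" and j: "j \<in> obj J" and mu: "\<mu> \<in> \<Lambda>"
    and x: "x \<in> part (fobj D i) \<mu>" and y: "y \<in> part (fobj D j) \<mu>" and eq: "\<iota> i \<mu> x = \<iota> j \<mu> y"
  shows "\<kappa> i \<mu> x = \<kappa> j \<mu> y"
proof -
  obtain k u v where k: "k \<in> obj J" "u \<in> Hom J i k" "v \<in> Hom J j k" using J_bound i j by blast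
  let ?x = "farr D i k u \<mu> x" and ?y = "farr D j k v \<mu> y"
  have xy: "?x \<in> part (fobj D k) \<mu>" "?y \<in> part (fobj D k) \<mu>"
    using D_mem[OF i k(1,2) mu x] D_mem[OF j k(1,3) mu y] .
  have "\<iota> k \<mu> ?x = \<iota> k \<mu> ?y"
    using cocone_apply[OF L i k(1,2) mu x] cocone_apply[OF L j k(1,3) mu y] eq by simp
  then obtain m w where m: "m \<in> obj J" "w \<in> Hom J k m" "farr D k m w \<mu> ?x = farr D k m w \<mu> ?y"
    using pointwise_eq[OF k(1) mu xy] by blast
  have "\<kappa> k \<mu> ?x = \<kappa> k \<mu> ?y"
    using cocone_apply[OF \<kappa> k(1) m(1,2) mu xy(1)] cocone_apply[OF \<kappa> k(1) m(1,2) mu xy(2)] m(3) by simp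
  then show ?thesis
    using cocone_apply[OF \<kappa> i k(1,2) mu x] cocone_apply[OF \<kappa> j k(1,3) mu y] by simp
qed

text \<open>The comparison map is read off from lifts to stages. Its additivity is checked on lifts
  to a common stage, where the legs of \<open>\<kappa>\<close> are morphisms, and surjectivity of
  the legs of \<open>\<iota>\<close> gives uniqueness.\<close>

lemma pointwise_is_colimit: "is_colimit J GC D L \<iota>"
  unfolding is_colimit_def
proof (intro conjI allI impI)
  show "is_functor J GC D" "is_cocone J GC D L \<iota>" by (rule D, rule L)
  fix X \<kappa> assume \<kappa>: "is_cocone J GC D X \<kappa>"
  have LO: "L \<in> Obj" and XO: "X \<in> Obj" using cocone_obj[OF L] cocone_obj[OF \<kappa>] by simp_all
  define h where "h \<mu> y = (SOME z. \<exists>i\<in>obj J. \<exists>x\<in>part (fobj D i) \<mu>. \<iota> i \<mu> x = y \<and> z = \<kappa> i \<mu> x)" for \<mu> y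
  have h: "h \<mu> (\<iota> i \<mu> x) = \<kappa> i \<mu> x" if i: "i \<in> obj J" and mu: "\<mu> \<in> \<Lambda>" and x: "x \<in> part (fobj D i) \<mu>" for i \<mu> x
  proof -
    have "\<exists>z. \<exists>j\<in>obj J. \<exists>w\<in>part (fobj D j) \<mu>. \<iota> j \<mu> w = \<iota> i \<mu> x \<and> z = \<kappa> j \<mu> w" using i x by blast
    from someI_ex[OF this] obtain j w where j: "j \<in> obj J" "w \<in> part (fobj D j) \<mu>" "\<iota> j \<mu> w = \<iota> i \<mu> x"
      "h \<mu> (\<iota> i \<mu> x) = \<kappa> j \<mu> w" unfolding h_def by blast
    then show ?thesis using pointwise_factor[OF \<kappa> j(1) i mu j(2) x j(3)] by simp
  qed
  have hg: "mor L h \<in> gmor L X"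
  proof (rule gmorI[OF LO])
    show "h \<mu> y \<in> part X \<mu>" if mu: "\<mu> \<in> \<Lambda>" and y: "y \<in> part L \<mu>" for \<mu> y
    proof -
      obtain i x where i: "i \<in> obj J" "x \<in> part (fobj D i) \<mu>" "\<iota> i \<mu> x = y" using pointwise_surj[OF mu y] by blast
      then show ?thesis using h[OF i(1) mu i(2)] gmor_mem[OF cocone_gmor[OF \<kappa> i(1)] mu i(2)] by simp
    qed
    show "h \<mu> (y \<otimes>\<^bsub>total L\<^esub> z) = h \<mu> y \<otimes>\<^bsub>total X\<^esub> h \<mu> z" if mu: "\<mu> \<in> \<Lambda>" and yz: "y \<in> part L \<mu>" "z \<in> part L \<mu>" for \<mu> y z
    proof -
      obtain k x w where k: "k \<in> obj J" "x \<in> part (fobj D k) \<mu>" "w \<in> part (fobj D k) \<mu>" "\<iota> k \<mu> x = y" "\<iota> k \<mu> w = z"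
        using pointwise_two[OF mu mu yz] by blast
      have "y \<otimes>\<^bsub>total L\<^esub> z = \<iota> k \<mu> (x \<otimes>\<^bsub>total (fobj D k)\<^esub> w)"
        using gmor_mult[OF cocone_gmor[OF L k(1)] mu k(2,3)] k(4,5) by simp
      then show ?thesis
        using h[OF k(1) mu part_mult[OF D_Obj[OF k(1)] mu k(2,3)]] h[OF k(1) mu k(2)] h[OF k(1) mu k(3)]
          gmor_mult[OF cocone_gmor[OF \<kappa> k(1)] mu k(2,3)] k(4,5) by simp
    qed
    show "h \<beta> (act L r y) = act X r (h \<alpha> y)" if ab: "\<alpha> \<in> \<Lambda>" "\<beta> \<in> \<Lambda>" "r \<in> scal \<alpha> \<beta>" and y: "y \<in> part L \<alpha>" for \<alpha> \<beta> r y
    proof -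
      obtain i x where i: "i \<in> obj J" "x \<in> part (fobj D i) \<alpha>" "\<iota> i \<alpha> x = y" using pointwise_surj[OF ab(1) y] by blast
      have "act L r y = \<iota> i \<beta> (act (fobj D i) r x)"
        using gmor_act[OF cocone_gmor[OF L i(1)] ab i(2)] i(3) by simp
      then show ?thesis
        using h[OF i(1) ab(2) act_part[OF D_Obj[OF i(1)] ab i(2)]] h[OF i(1) ab(1) i(2)]
          gmor_act[OF cocone_gmor[OF \<kappa> i(1)] ab i(2)] i(3) by simp
    qed
  qed
  have hi: "mor (fobj D i) (\<lambda>\<mu> x. mor L h \<mu> (\<iota> i \<mu> x)) = \<kappa> i" if i: "i \<in> obj J" for i
  proof -
    have "mor (fobj D i) (\<lambda>\<mu> x. mor L h \<mu> (\<iota> i \<mu> x)) = mor (fobj D i) (\<kappa> i)"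
      by (rule mor_eqI) (simp add: h[OF i] gmor_mem[OF cocone_gmor[OF L i]])
    then show ?thesis using mor_self[OF cocone_gmor[OF \<kappa> i]] by simp
  qed
  have "g = mor L h" if g: "g \<in> gmor L X" and gi: "\<And>i. i \<in> obj J \<Longrightarrow> mor (fobj D i) (\<lambda>\<mu> x. g \<mu> (\<iota> i \<mu> x)) = \<kappa> i" for g
  proof (rule gmor_ext[OF g hg])
    fix \<mu> y assume mu: "\<mu> \<in> \<Lambda>" and y: "y \<in> part L \<mu>"
    obtain i x where i: "i \<in> obj J" "x \<in> part (fobj D i) \<mu>" "\<iota> i \<mu> x = y" using pointwise_surj[OF mu y] by blast
    have "g \<mu> (\<iota> i \<mu> x) = \<kappa> i \<mu> x"
      using gi[OF i(1)] mor_apply[OF mu i(2), of "\<lambda>\<mu> x. g \<mu> (\<iota> i \<mu> x)"] by simp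
    then show "g \<mu> y = mor L h \<mu> y" using h[OF i(1) mu i(2)] i(3) mu y by simp
  qed
  then have "\<exists>!h. h \<in> gmor L X \<and> (\<forall>i\<in>obj J. mor (fobj D i) (\<lambda>\<mu> x. h \<mu> (\<iota> i \<mu> x)) = \<kappa> i)"
  proof (intro ex1I)
    show "mor L h \<in> gmor L X \<and> (\<forall>i\<in>obj J. mor (fobj D i) (\<lambda>\<mu> x. mor L h \<mu> (\<iota> i \<mu> x)) = \<kappa> i)"
      using hg hi by blast
  qed blast
  then show "\<exists>!h. h \<in> Hom GC L X \<and> (\<forall>i\<in>obj J. cmp GC (fobj D i) L X h (\<iota> i) = \<kappa> i)" by simp
qed

text \<open>Any colimit \<open>l\<close> compares with the pointwise one, and \<open>g\<close> after
  \<open>h\<close> being the identity of \<open>l\<close> suffices to carry both clauses over. So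
  one pointwise colimit of a diagram makes all its colimits pointwise.\<close>

lemma pointwise_colimit_transfer:
  assumes l: "is_colimit J GC D l \<zeta>"
  shows "pointwise_colimit J D l \<zeta>"
proof -
  have c: "is_cocone J GC D l \<zeta>" using l unfolding is_colimit_def by blast
  have lO: "l \<in> Obj" using cocone_obj[OF c] by simp
  have u1: "\<And>X \<kappa>. is_cocone J GC D X \<kappa> \<Longrightarrow>
      \<exists>!h. h \<in> gmor l X \<and> (\<forall>i\<in>obj J. mor (fobj D i) (\<lambda>\<mu> x. h \<mu> (\<zeta> i \<mu> x)) = \<kappa> i)"
    using l unfolding is_colimit_def by simp
  have u2: "\<And>X \<kappa>. is_cocone J GC D X \<kappa> \<Longrightarrow>
      \<exists>!h. h \<in> gmor L X \<and> (\<forall>i\<in>obj J. mor (fobj D i) (\<lambda>\<mu> x. h \<mu> (\<iota> i \<mu> x)) = \<kappa> i)"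
    using pointwise_is_colimit unfolding is_colimit_def by simp
  obtain h where h: "h \<in> gmor l L" "\<And>i. i \<in> obj J \<Longrightarrow> mor (fobj D i) (\<lambda>\<mu> x. h \<mu> (\<zeta> i \<mu> x)) = \<iota> i"
    using u1[OF L] by blast
  obtain g where g: "g \<in> gmor L l" "\<And>i. i \<in> obj J \<Longrightarrow> mor (fobj D i) (\<lambda>\<mu> x. g \<mu> (\<iota> i \<mu> x)) = \<zeta> i"
    using u2[OF c] by blast
  have h': "h \<mu> (\<zeta> i \<mu> x) = \<iota> i \<mu> x" if "i \<in> obj J" "\<mu> \<in> \<Lambda>" "x \<in> part (fobj D i) \<mu>" for i \<mu> x
    using h(2)[OF that(1)] mor_apply[OF that(2,3), of "\<lambda>\<mu> x. h \<mu> (\<zeta> i \<mu> x)"] by simp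
  have g': "g \<mu> (\<iota> i \<mu> x) = \<zeta> i \<mu> x" if "i \<in> obj J" "\<mu> \<in> \<Lambda>" "x \<in> part (fobj D i) \<mu>" for i \<mu> x
    using g(2)[OF that(1)] mor_apply[OF that(2,3), of "\<lambda>\<mu> x. g \<mu> (\<iota> i \<mu> x)"] by simp
  obtain w0 where w0: "\<And>w. w \<in> gmor l l \<Longrightarrow> (\<forall>i\<in>obj J. mor (fobj D i) (\<lambda>\<mu> x. w \<mu> (\<zeta> i \<mu> x)) = \<zeta> i) \<Longrightarrow> w = w0"
    using u1[OF c] by (elim ex1E) blast
  have "mor l (\<lambda>\<mu> x. g \<mu> (h \<mu> x)) = w0"
  proof (rule w0[OF gmor_cmp[OF lO h(1) g(1)]], intro ballI)
    fix i assume i: "i \<in> obj J"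
    have "mor (fobj D i) (\<lambda>\<mu> x. mor l (\<lambda>\<mu> x. g \<mu> (h \<mu> x)) \<mu> (\<zeta> i \<mu> x)) = mor (fobj D i) (\<zeta> i)"
      by (rule mor_eqI) (simp add: gmor_mem[OF cocone_gmor[OF c i]] h'[OF i] g'[OF i])
    then show "mor (fobj D i) (\<lambda>\<mu> x. mor l (\<lambda>\<mu> x. g \<mu> (h \<mu> x)) \<mu> (\<zeta> i \<mu> x)) = \<zeta> i"
      using mor_self[OF cocone_gmor[OF c i]] by simp
  qed
  moreover have "mor l (\<lambda>\<mu> x. x) = w0"
  proof (rule w0[OF gmor_ident[OF lO]], intro ballI)
    fix i assume i: "i \<in> obj J"
    have "mor (fobj D i) (\<lambda>\<mu> x. mor l (\<lambda>\<mu> x. x) \<mu> (\<zeta> i \<mu> x)) = mor (fobj D i) (\<zeta> i)"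
      by (rule mor_eqI) (simp add: gmor_mem[OF cocone_gmor[OF c i]])
    then show "mor (fobj D i) (\<lambda>\<mu> x. mor l (\<lambda>\<mu> x. x) \<mu> (\<zeta> i \<mu> x)) = \<zeta> i"
      using mor_self[OF cocone_gmor[OF c i]] by simp
  qed
  ultimately have gh: "mor l (\<lambda>\<mu> x. g \<mu> (h \<mu> x)) = mor l (\<lambda>\<mu> x. x)" by simp
  show ?thesis
    unfolding pointwise_colimit_def
  proof (intro conjI ballI impI)
    fix \<mu> y assume mu: "\<mu> \<in> \<Lambda>" and y: "y \<in> part l \<mu>"
    obtain i x where i: "i \<in> obj J" "x \<in> part (fobj D i) \<mu>" "\<iota> i \<mu> x = h \<mu> y"
      using pointwise_surj[OF mu gmor_mem[OF h(1) mu y]] by blast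
    have "\<zeta> i \<mu> x = y" using g'[OF i(1) mu i(2)] gmor_eqD[OF gh mu y] i(3) by simp
    then show "\<exists>i\<in>obj J. \<exists>x\<in>part (fobj D i) \<mu>. \<zeta> i \<mu> x = y" using i by blast
  next
    fix i \<mu> x y assume *: "i \<in> obj J" "\<mu> \<in> \<Lambda>" "x \<in> part (fobj D i) \<mu>" "y \<in> part (fobj D i) \<mu>" "\<zeta> i \<mu> x = \<zeta> i \<mu> y"
    then have "\<iota> i \<mu> x = \<iota> i \<mu> y" using h' by metis
    then show "\<exists>k\<in>obj J. \<exists>u\<in>Hom J i k. farr D i k u \<mu> x = farr D i k u \<mu> y" using pointwise_eq * by blast
  qed
qed

end

text \<open>
  Existence of a pointwise colimit. Its total module consists of pairs of an index \<open>i\<close> and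
  a combination of elements of the parts of \<open>D i\<close>. Two such pairs are identified if, pushed forward
  to a common index \<open>k\<close>, they have the same value under every morphism from \<open>D k\<close> to a glider.
  The colimit of the modules \<open>(D i)(\<infinity>)\<close> itself does not make sense, as the morphisms have
  no component at \<open>\<infinity>\<close>.
\<close>

abbreviation elems :: "'i \<Rightarrow> ('g \<times> 'u) set" where
  "elems i \<equiv> Sigma \<Lambda> (part (fobj D i))"

definition push :: "'i \<Rightarrow> 'i \<Rightarrow> 'k \<Rightarrow> ('r \<times> 'g \<times> 'u) list \<Rightarrow> ('r \<times> 'g \<times> 'u) list" where
  "push i j u l = map (\<lambda>p. (fst p, fst (snd p), farr D i j u (fst (snd p)) (snd (snd p)))) l"

abbreviation evm :: "('g, 'r, 'u) module_functor \<Rightarrow> ('g \<Rightarrow> 'u \<Rightarrow> 'u) \<Rightarrow> ('r \<times> 'g \<times> 'u) list \<Rightarrow> 'u" where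
  "evm N h \<equiv> ev N (\<lambda>s. h (fst s) (snd s))"

definition stage_eq :: "'i \<Rightarrow> ('r \<times> 'g \<times> 'u) list \<Rightarrow> ('r \<times> 'g \<times> 'u) list \<Rightarrow> bool" where
  "stage_eq i l m \<longleftrightarrow> (\<forall>N\<in>Obj. \<forall>h\<in>gmor (fobj D i) N. evm N h l = evm N h m)"

definition colim_set :: "('i \<times> ('r \<times> 'g \<times> 'u) list) set" where
  "colim_set = (SIGMA i:obj J. combs (elems i))"

definition colim_eq :: "'i \<times> ('r \<times> 'g \<times> 'u) list \<Rightarrow> 'i \<times> ('r \<times> 'g \<times> 'u) list \<Rightarrow> bool" where
  "colim_eq a b \<longleftrightarrow> (\<exists>k\<in>obj J. \<exists>u\<in>Hom J (fst a) k. \<exists>v\<in>Hom J (fst b) k.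
    stage_eq k (push (fst a) k u (snd a)) (push (fst b) k v (snd b)))"

lemma push_combs:
  "i \<in> obj J \<Longrightarrow> j \<in> obj J \<Longrightarrow> u \<in> Hom J i j \<Longrightarrow> l \<in> combs (elems i) \<Longrightarrow> push i j u l \<in> combs (elems j)"
  unfolding push_def by (induction l) (auto simp: D_mem)

lemma push_append: "push i j u (l @ m) = push i j u l @ push i j u m"
  unfolding push_def by simp

lemma push_scale: "push i j u (scale c l) = scale c (push i j u l)"
  unfolding push_def scale_def by simp

lemma push_cmp:
  "i \<in> obj J \<Longrightarrow> j \<in> obj J \<Longrightarrow> k \<in> obj J \<Longrightarrow> u \<in> Hom J i j \<Longrightarrow> v \<in> Hom J j k \<Longrightarrow> l \<in> combs (elems i) \<Longrightarrow>
    push i k (cmp J i j k v u) l = push j k v (push i j u l)"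
  unfolding push_def by (induction l) (auto simp: D_cmp)

lemma push_ident: "i \<in> obj J \<Longrightarrow> l \<in> combs (elems i) \<Longrightarrow> push i i (ident J i) l = l"
  unfolding push_def by (induction l) (auto simp: D_ident)

lemma evm_push:
  assumes "i \<in> obj J" "j \<in> obj J" "u \<in> Hom J i j" "l \<in> combs (elems i)"
  shows "evm N h (push i j u l) = evm N (mor (fobj D i) (\<lambda>\<mu> x. h \<mu> (farr D i j u \<mu> x))) l"
  using assms(4) unfolding push_def by (induction l) auto

text \<open>A test morphism out of \<open>fobj D j\<close> becomes one out of
  \<open>fobj D i\<close> by composition with the transition map, so equality under all tests is
  inherited by later stages.\<close>

lemma stage_eq_push:
  assumes "i \<in> obj J" "j \<in> obj J" "u \<in> Hom J i j" "l \<in> combs (elems i)" "m \<in> combs (elems i)" "stage_eq i l m"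
  shows "stage_eq j (push i j u l) (push i j u m)"
  unfolding stage_eq_def
proof (intro ballI)
  fix N h assume N: "N \<in> Obj" and h: "h \<in> gmor (fobj D j) N"
  have "mor (fobj D i) (\<lambda>\<mu> x. h \<mu> (farr D i j u \<mu> x)) \<in> gmor (fobj D i) N"
    using gmor_cmp[OF D_Obj[OF assms(1)] D_gmor[OF assms(1-3)] h] .
  then show "evm N h (push i j u l) = evm N h (push i j u m)"
    using evm_push[OF assms(1-4)] evm_push[OF assms(1-3,5)] assms(6) N unfolding stage_eq_def by simp
qed

lemma stage_eq_refl: "stage_eq i l l"
  and stage_eq_sym: "stage_eq i l m \<Longrightarrow> stage_eq i m l"
  and stage_eq_trans: "stage_eq i l m \<Longrightarrow> stage_eq i m n \<Longrightarrow> stage_eq i l n"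
  unfolding stage_eq_def by simp_all

lemma gmor_total: "N \<in> Obj \<Longrightarrow> h \<in> gmor M N \<Longrightarrow> \<mu> \<in> \<Lambda> \<Longrightarrow> x \<in> part M \<mu> \<Longrightarrow> h \<mu> x \<in> carrier (total N)"
  using part_total gmor_mem by blast

lemma evm_closed: "i \<in> obj J \<Longrightarrow> N \<in> Obj \<Longrightarrow> h \<in> gmor (fobj D i) N \<Longrightarrow> l \<in> combs (elems i) \<Longrightarrow>
    evm N h l \<in> carrier (total N)"
  by (rule ev_closed[where S = "elems i"]) (auto intro: gmor_total)

lemma evm_append: "i \<in> obj J \<Longrightarrow> N \<in> Obj \<Longrightarrow> h \<in> gmor (fobj D i) N \<Longrightarrow> l \<in> combs (elems i) \<Longrightarrow>
    m \<in> combs (elems i) \<Longrightarrow> evm N h (l @ m) = evm N h l \<otimes>\<^bsub>total N\<^esub> evm N h m"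
  by (rule ev_append[where S = "elems i"]) (auto intro: gmor_total)

lemma evm_scale: "i \<in> obj J \<Longrightarrow> N \<in> Obj \<Longrightarrow> h \<in> gmor (fobj D i) N \<Longrightarrow> c \<in> carrier R \<Longrightarrow> l \<in> combs (elems i) \<Longrightarrow>
    evm N h (scale c l) = act N c (evm N h l)"
  by (rule ev_scale[where S = "elems i"]) (auto intro: gmor_total)

lemma stage_eq_append:
  assumes "i \<in> obj J" "l \<in> combs (elems i)" "l' \<in> combs (elems i)" "m \<in> combs (elems i)" "m' \<in> combs (elems i)"
    "stage_eq i l l'" "stage_eq i m m'"
  shows "stage_eq i (l @ m) (l' @ m')"
  using assms unfolding stage_eq_def by (simp add: evm_append[OF assms(1)])

lemma stage_eq_scale:
  assumes "i \<in> obj J" "l \<in> combs (elems i)" "l' \<in> combs (elems i)" "c \<in> carrier R" "stage_eq i l l'"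
  shows "stage_eq i (scale c l) (scale c l')"
  using assms unfolding stage_eq_def by (simp add: evm_scale[OF assms(1)])

lemma colim_eq_refl: "a \<in> colim_set \<Longrightarrow> colim_eq a a"
  unfolding colim_set_def colim_eq_def using cat_ident[OF J_cat] stage_eq_refl by fastforce

lemma colim_eq_sym: "colim_eq a b \<Longrightarrow> colim_eq b a"
  unfolding colim_eq_def using stage_eq_sym by blast

lemma colim_eq_trans:
  assumes "(i, l) \<in> colim_set" "(j, m) \<in> colim_set" "(p, n) \<in> colim_set"
    and "colim_eq (i, l) (j, m)" "colim_eq (j, m) (p, n)"
  shows "colim_eq (i, l) (p, n)"
proof -
  have o: "i \<in> obj J" "j \<in> obj J" "p \<in> obj J" and c: "l \<in> combs (elems i)" "m \<in> combs (elems j)" "n \<in> combs (elems p)"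
    using assms(1-3) unfolding colim_set_def by auto
  obtain k u v where k: "k \<in> obj J" "u \<in> Hom J i k" "v \<in> Hom J j k" "stage_eq k (push i k u l) (push j k v m)"
    using assms(4) unfolding colim_eq_def by auto
  obtain k' u' v' where k': "k' \<in> obj J" "u' \<in> Hom J j k'" "v' \<in> Hom J p k'" "stage_eq k' (push j k' u' m) (push p k' v' n)"
    using assms(5) unfolding colim_eq_def by auto
  obtain t w w' where t: "t \<in> obj J" "w \<in> Hom J k t" "w' \<in> Hom J k' t" "cmp J j k t w v = cmp J j k' t w' u'"
    using filtered_span[OF J o(2) k(1) k'(1) k(3) k'(2)] .
  note pc = push_combs[OF o(1) k(1,2) c(1)] push_combs[OF o(2) k(1,3) c(2)]
    push_combs[OF o(2) k'(1,2) c(2)] push_combs[OF o(3) k'(1,3) c(3)]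
  have e1: "stage_eq t (push i t (cmp J i k t w u) l) (push j t (cmp J j k t w v) m)"
    using stage_eq_push[OF k(1) t(1,2) pc(1,2) k(4)] push_cmp[OF o(1) k(1) t(1) k(2) t(2) c(1)]
      push_cmp[OF o(2) k(1) t(1) k(3) t(2) c(2)] by simp
  have e2: "stage_eq t (push j t (cmp J j k' t w' u') m) (push p t (cmp J p k' t w' v') n)"
    using stage_eq_push[OF k'(1) t(1,3) pc(3,4) k'(4)] push_cmp[OF o(2) k'(1) t(1) k'(2) t(3) c(2)]
      push_cmp[OF o(3) k'(1) t(1) k'(3) t(3) c(3)] by simp
  have "stage_eq t (push i t (cmp J i k t w u) l) (push p t (cmp J p k' t w' v') n)"
    by (rule stage_eq_trans[OF e1[unfolded t(4)] e2])
  moreover have "cmp J i k t w u \<in> Hom J i t" "cmp J p k' t w' v' \<in> Hom J p t"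
    using cat_cmp[OF J_cat] o k k' t by blast+
  ultimately show ?thesis unfolding colim_eq_def using t(1) by auto
qed

text \<open>Stating the relation as an equality of classes makes reflexivity, symmetry and
  transitivity trivial and turns congruence arguments into rewriting.\<close>

definition cls :: "'i \<times> ('r \<times> 'g \<times> 'u) list \<Rightarrow> ('i \<times> ('r \<times> 'g \<times> 'u) list) set" where
  "cls a = {b \<in> colim_set. colim_eq a b}"

lemma cls_eq_iff:
  assumes a: "a \<in> colim_set" and b: "b \<in> colim_set"
  shows "cls a = cls b \<longleftrightarrow> colim_eq a b"
proof
  assume "cls a = cls b"
  then show "colim_eq a b" using colim_eq_refl[OF b] b unfolding cls_def by blast
next
  assume ab: "colim_eq a b"
  have tr: "colim_eq x z" if "x \<in> colim_set" "y \<in> colim_set" "z \<in> colim_set" "colim_eq x y" "colim_eq y z" for x y z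
    using colim_eq_trans[of "fst x" "snd x" "fst y" "snd y" "fst z" "snd z"] that by simp
  show "cls a = cls b"
    unfolding cls_def using tr[OF a b _ ab] tr[OF b a _ colim_eq_sym[OF ab]] by blast
qed

lemma colim_set_iff: "(i, l) \<in> colim_set \<longleftrightarrow> i \<in> obj J \<and> l \<in> combs (elems i)"
  unfolding colim_set_def by simp

lemma cls_push:
  assumes "i \<in> obj J" "k \<in> obj J" "u \<in> Hom J i k" "l \<in> combs (elems i)"
  shows "cls (k, push i k u l) = cls (i, l)"
proof -
  have p: "push i k u l \<in> combs (elems k)" using push_combs[OF assms] .
  have "colim_eq (k, push i k u l) (i, l)"
    unfolding colim_eq_def
    using assms(3) push_ident[OF assms(2) p] stage_eq_refl
    by (intro bexI[OF _ assms(2)] bexI[of _ "ident J k"] bexI[of _ u]) (simp_all add: cat_ident[OF J_cat assms(2)])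
  then show ?thesis using cls_eq_iff[of "(k, push i k u l)" "(i, l)"] assms p by (simp add: colim_set_iff)
qed

lemma cls_stage:
  assumes "k \<in> obj J" "l \<in> combs (elems k)" "m \<in> combs (elems k)" "stage_eq k l m"
  shows "cls (k, l) = cls (k, m)"
proof -
  have "colim_eq (k, l) (k, m)"
    unfolding colim_eq_def
    using assms(4) push_ident[OF assms(1,2)] push_ident[OF assms(1,3)]
    by (intro bexI[OF _ assms(1)] bexI[of _ "ident J k"]) (simp_all add: cat_ident[OF J_cat assms(1)])
  then show ?thesis using cls_eq_iff assms by (simp add: colim_set_iff)
qed

text \<open>Concatenation at an arbitrarily chosen upper bound of the two indices; only the class of
  the result is independent of the choice.\<close>

definition colim_add :: "'i \<times> ('r \<times> 'g \<times> 'u) list \<Rightarrow> 'i \<times> ('r \<times> 'g \<times> 'u) list \<Rightarrow> 'i \<times> ('r \<times> 'g \<times> 'u) list" where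
  "colim_add a b = (let (k, u, v) = (SOME (k, u, v). k \<in> obj J \<and> u \<in> Hom J (fst a) k \<and> v \<in> Hom J (fst b) k)
    in (k, push (fst a) k u (snd a) @ push (fst b) k v (snd b)))"

text \<open>Two upper bounds are compared at a common later index, where
  \<open>filtered_cospan\<close> makes both pairs of transition maps agree, so the pushed lists
  coincide.\<close>

lemma colim_add:
  assumes "i \<in> obj J" "j \<in> obj J" "l \<in> combs (elems i)" "m \<in> combs (elems j)"
  shows "colim_add (i, l) (j, m) \<in> colim_set"
    and "\<And>k u v. k \<in> obj J \<Longrightarrow> u \<in> Hom J i k \<Longrightarrow> v \<in> Hom J j k \<Longrightarrow>
      cls (colim_add (i, l) (j, m)) = cls (k, push i k u l @ push j k v m)"
proof -
  let ?P = "\<lambda>(k, u, v). k \<in> obj J \<and> u \<in> Hom J i k \<and> v \<in> Hom J j k"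
  have "\<exists>p. ?P p" using J_bound[OF assms(1,2)] by auto
  then have P: "?P (SOME p. ?P p)" by (rule someI_ex)
  obtain k0 u0 v0 where S: "(SOME p. ?P p) = (k0, u0, v0)" by (cases "SOME p. ?P p") auto
  have k0: "k0 \<in> obj J" "u0 \<in> Hom J i k0" "v0 \<in> Hom J j k0" using P unfolding S by auto
  have add: "colim_add (i, l) (j, m) = (k0, push i k0 u0 l @ push j k0 v0 m)"
    unfolding colim_add_def using S by simp
  have c0: "push i k0 u0 l @ push j k0 v0 m \<in> combs (elems k0)"
    using push_combs assms k0 by simp
  then show "colim_add (i, l) (j, m) \<in> colim_set" unfolding add colim_set_iff using k0 by simp
  fix k u v assume k: "k \<in> obj J" "u \<in> Hom J i k" "v \<in> Hom J j k"
  have c: "push i k u l @ push j k v m \<in> combs (elems k)"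
    using push_combs assms k by simp
  obtain n w w' where n: "n \<in> obj J" "w \<in> Hom J k n" "w' \<in> Hom J k0 n"
    "cmp J i k n w u = cmp J i k0 n w' u0" "cmp J j k n w v = cmp J j k0 n w' v0"
    using filtered_cospan[OF J assms(1,2) k(1) k0(1) k(2) k0(2) k(3) k0(3)] .
  have "push k n w (push i k u l @ push j k v m) = push k0 n w' (push i k0 u0 l @ push j k0 v0 m)"
    unfolding push_append
    using push_cmp[OF assms(1) k(1) n(1) k(2) n(2) assms(3)] push_cmp[OF assms(2) k(1) n(1) k(3) n(2) assms(4)]
      push_cmp[OF assms(1) k0(1) n(1) k0(2) n(3) assms(3)] push_cmp[OF assms(2) k0(1) n(1) k0(3) n(3) assms(4)] n(4,5) by simp
  then show "cls (colim_add (i, l) (j, m)) = cls (k, push i k u l @ push j k v m)"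
    unfolding add using cls_push[OF k(1) n(1,2) c] cls_push[OF k0(1) n(1,3) c0] by simp
qed

lemma colim_add_stage:
  assumes "k \<in> obj J" "l \<in> combs (elems k)" "m \<in> combs (elems k)"
  shows "cls (colim_add (k, l) (k, m)) = cls (k, l @ m)"
  using colim_add(2)[OF assms(1,1,2,3) assms(1) cat_ident[OF J_cat assms(1)] cat_ident[OF J_cat assms(1)]]
    push_ident[OF assms(1,2)] push_ident[OF assms(1,3)] by simp

lemma colim_add_closed: "a \<in> colim_set \<Longrightarrow> b \<in> colim_set \<Longrightarrow> colim_add a b \<in> colim_set"
  using colim_add(1)[of "fst a" "fst b" "snd a" "snd b"] unfolding colim_set_def by auto

text \<open>All four lists are moved to one index at which equivalent ones are already equal under
  all tests; there addition is concatenation, which \<open>stage_eq_append\<close> respects.\<close>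

lemma colim_add_cong:
  assumes a: "a \<in> colim_set" "a' \<in> colim_set" "cls a = cls a'" and b: "b \<in> colim_set" "b' \<in> colim_set" "cls b = cls b'"
  shows "cls (colim_add a b) = cls (colim_add a' b')"
proof -
  obtain i l i' l' j m j' m' where e: "a = (i, l)" "a' = (i', l')" "b = (j, m)" "b' = (j', m')" by fastforce
  have o: "i \<in> obj J" "i' \<in> obj J" "j \<in> obj J" "j' \<in> obj J" and c: "l \<in> combs (elems i)" "l' \<in> combs (elems i')"
    "m \<in> combs (elems j)" "m' \<in> combs (elems j')"
    using a(1,2) b(1,2) unfolding e colim_set_iff by blast+
  have "colim_eq (i, l) (i', l')" "colim_eq (j, m) (j', m')" using a b cls_eq_iff unfolding e by blast+
  then obtain k u u' n v v' where k: "k \<in> obj J" "u \<in> Hom J i k" "u' \<in> Hom J i' k" "stage_eq k (push i k u l) (push i' k u' l')"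
    and n: "n \<in> obj J" "v \<in> Hom J j n" "v' \<in> Hom J j' n" "stage_eq n (push j n v m) (push j' n v' m')"
    unfolding colim_eq_def by auto
  obtain t x y where t: "t \<in> obj J" "x \<in> Hom J k t" "y \<in> Hom J n t" using J_bound[OF k(1) n(1)] by blast
  let ?l = "push i t (cmp J i k t x u) l" and ?l' = "push i' t (cmp J i' k t x u') l'"
  let ?m = "push j t (cmp J j n t y v) m" and ?m' = "push j' t (cmp J j' n t y v') m'"
  have h: "cmp J i k t x u \<in> Hom J i t" "cmp J i' k t x u' \<in> Hom J i' t"
    "cmp J j n t y v \<in> Hom J j t" "cmp J j' n t y v' \<in> Hom J j' t"
    using cat_cmp[OF J_cat] o k(1-3) n(1-3) t by blast+
  have lc: "?l \<in> combs (elems t)" "?l' \<in> combs (elems t)" "?m \<in> combs (elems t)" "?m' \<in> combs (elems t)"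
    using push_combs o t(1) h c by blast+
  have "stage_eq t ?l ?l'"
    using stage_eq_push[OF k(1) t(1,2) push_combs[OF o(1) k(1,2) c(1)] push_combs[OF o(2) k(1,3) c(2)] k(4)]
      push_cmp[OF o(1) k(1) t(1) k(2) t(2) c(1)] push_cmp[OF o(2) k(1) t(1) k(3) t(2) c(2)] by simp
  moreover have "stage_eq t ?m ?m'"
    using stage_eq_push[OF n(1) t(1,3) push_combs[OF o(3) n(1,2) c(3)] push_combs[OF o(4) n(1,3) c(4)] n(4)]
      push_cmp[OF o(3) n(1) t(1) n(2) t(3) c(3)] push_cmp[OF o(4) n(1) t(1) n(3) t(3) c(4)] by simp
  ultimately have "cls (t, ?l @ ?m) = cls (t, ?l' @ ?m')"
    using stage_eq_append[OF t(1) lc] cls_stage[OF t(1)] lc by simp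
  then show ?thesis
    unfolding e using colim_add(2)[OF o(1,3) c(1,3) t(1) h(1,3)] colim_add(2)[OF o(2,4) c(2,4) t(1) h(2,4)] by simp
qed

text \<open>Reduces the module laws to one common index, where they hold up to
  \<open>stage_eq\<close>. Arguments are repeated when fewer than three elements have to be
  lifted.\<close>

lemma colim_lift3:
  assumes "a \<in> colim_set" "b \<in> colim_set" "c \<in> colim_set"
  obtains k l m n where "k \<in> obj J" "l \<in> combs (elems k)" "m \<in> combs (elems k)" "n \<in> combs (elems k)"
    "cls a = cls (k, l)" "cls b = cls (k, m)" "cls c = cls (k, n)"
proof -
  obtain i l j m p n where e: "a = (i, l)" "b = (j, m)" "c = (p, n)" by fastforce
  have o: "i \<in> obj J" "j \<in> obj J" "p \<in> obj J" and c: "l \<in> combs (elems i)" "m \<in> combs (elems j)" "n \<in> combs (elems p)"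
    using assms unfolding e colim_set_iff by blast+
  obtain q u v where q: "q \<in> obj J" "u \<in> Hom J i q" "v \<in> Hom J j q" using J_bound[OF o(1,2)] by blast
  obtain k x w where k: "k \<in> obj J" "x \<in> Hom J q k" "w \<in> Hom J p k" using J_bound[OF q(1) o(3)] by blast
  have h: "cmp J i q k x u \<in> Hom J i k" "cmp J j q k x v \<in> Hom J j k" using cat_cmp[OF J_cat] o q k by blast+
  show ?thesis
    using that[OF k(1) push_combs[OF o(1) k(1) h(1) c(1)] push_combs[OF o(2) k(1) h(2) c(2)] push_combs[OF o(3) k(1,3) c(3)]]
      cls_push[OF o(1) k(1) h(1) c(1)] cls_push[OF o(2) k(1) h(2) c(2)] cls_push[OF o(3) k(1,3) c(3)]
    unfolding e by simp
qed

lemma cls_act_cong: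
  assumes a: "a \<in> colim_set" "b \<in> colim_set" "cls a = cls b" and r: "r \<in> carrier R"
  shows "cls (fst a, scale r (snd a)) = cls (fst b, scale r (snd b))"
proof -
  obtain i l j m where e: "a = (i, l)" "b = (j, m)" by fastforce
  have o: "i \<in> obj J" "j \<in> obj J" and c: "l \<in> combs (elems i)" "m \<in> combs (elems j)"
    using a(1,2) unfolding e colim_set_iff by blast+
  have "colim_eq (i, l) (j, m)" using a cls_eq_iff unfolding e by blast
  then obtain k u v where k: "k \<in> obj J" "u \<in> Hom J i k" "v \<in> Hom J j k" "stage_eq k (push i k u l) (push j k v m)"
    unfolding colim_eq_def by auto
  have pc: "push i k u l \<in> combs (elems k)" "push j k v m \<in> combs (elems k)"
    using push_combs[OF o(1) k(1,2) c(1)] push_combs[OF o(2) k(1,3) c(2)] .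
  have "cls (k, push i k u (scale r l)) = cls (k, push j k v (scale r m))"
    unfolding push_scale using cls_stage[OF k(1) scale_combs[OF r pc(1)] scale_combs[OF r pc(2)]]
      stage_eq_scale[OF k(1) pc r k(4)] by blast
  then show ?thesis
    unfolding e using cls_push[OF o(1) k(1,2) scale_combs[OF r c(1)]] cls_push[OF o(2) k(1,3) scale_combs[OF r c(2)]] by simp
qed

text \<open>The part of degree \<mu> consists of the classes of single elements with coefficient
  one. Their sums and admissible scalar multiples are again of this form, because every test
  morphism respects the operations of the parts. Testing with an identity morphism shows that no
  more elements are identified than the direct limit of sets requires.\<close>

lemma pointwise_colimit_exists:
  assumes small_J: "small TYPE('u) (obj J)"
  shows "\<exists>L \<iota>. is_cocone J GC D L \<iota> \<and> pointwise_colimit J D L \<iota>"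
proof -
  obtain i0 where i0: "i0 \<in> obj J" using J unfolding filtered_def by blast
  let ?E = "\<lambda>a b. cls a = cls b"
  let ?a = "\<lambda>r a. (fst a, scale r (snd a))"
  let ?V = "\<lambda>\<mu>. {(i, [(\<one>\<^bsub>R\<^esub>, \<mu>, x)]) |i x. i \<in> obj J \<and> x \<in> part (fobj D i) \<mu>}"
  have a_closed: "?a r a \<in> colim_set" if "r \<in> carrier R" "a \<in> colim_set" for r a
    using that scale_combs unfolding colim_set_def by auto
  have add_stage: "cls (colim_add a b) = cls (k, l @ m)"
    if "a \<in> colim_set" "b \<in> colim_set" "k \<in> obj J" "l \<in> combs (elems k)" "m \<in> combs (elems k)"
      "cls a = cls (k, l)" "cls b = cls (k, m)" for a b k l m
    using colim_add_cong[of a "(k, l)" b "(k, m)"] that colim_add_stage[of k l m] by (simp add: colim_set_iff)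
  have act_stage: "cls (?a r a) = cls (k, scale r l)"
    if "a \<in> colim_set" "r \<in> carrier R" "k \<in> obj J" "l \<in> combs (elems k)" "cls a = cls (k, l)" for a r k l
    using cls_act_cong[of a "(k, l)" r] that by (simp add: colim_set_iff)
  have single: "[(\<one>\<^bsub>R\<^esub>, \<mu>, x)] \<in> combs (elems i)" if "\<mu> \<in> \<Lambda>" "x \<in> part (fobj D i) \<mu>" for \<mu> x i
    using that by simp
  have push_single: "push i k u [(\<one>\<^bsub>R\<^esub>, \<mu>, x)] = [(\<one>\<^bsub>R\<^esub>, \<mu>, farr D i k u \<mu> x)]" for i k u \<mu> x
    unfolding push_def by simp
  have hm: "h \<mu> x \<in> carrier (total N)" if "N \<in> Obj" "h \<in> gmor (fobj D i) N" "\<mu> \<in> \<Lambda>" "x \<in> part (fobj D i) \<mu>" for N h i \<mu> x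
    using part_total[OF that(1,3) gmor_mem[OF that(2-4)]] .
  have single_add: "cls (k, [(\<one>\<^bsub>R\<^esub>, \<mu>, x)] @ [(\<one>\<^bsub>R\<^esub>, \<mu>, y)]) = cls (k, [(\<one>\<^bsub>R\<^esub>, \<mu>, x \<otimes>\<^bsub>total (fobj D k)\<^esub> y)])"
    if *: "k \<in> obj J" "\<mu> \<in> \<Lambda>" "x \<in> part (fobj D k) \<mu>" "y \<in> part (fobj D k) \<mu>" for k \<mu> x y
  proof (rule cls_stage[OF *(1)])
    show "stage_eq k ([(\<one>\<^bsub>R\<^esub>, \<mu>, x)] @ [(\<one>\<^bsub>R\<^esub>, \<mu>, y)]) [(\<one>\<^bsub>R\<^esub>, \<mu>, x \<otimes>\<^bsub>total (fobj D k)\<^esub> y)]"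
      unfolding stage_eq_def
    proof (intro ballI)
      fix N h assume N: "N \<in> Obj" and h: "h \<in> gmor (fobj D k) N"
      show "evm N h ([(\<one>\<^bsub>R\<^esub>, \<mu>, x)] @ [(\<one>\<^bsub>R\<^esub>, \<mu>, y)]) = evm N h [(\<one>\<^bsub>R\<^esub>, \<mu>, x \<otimes>\<^bsub>total (fobj D k)\<^esub> y)]"
        using hm[OF N h *(2,3)] hm[OF N h *(2,4)] gmor_mult[OF h *(2-4)]
        by (simp add: act_one[OF N] total_r_one[OF N] total_mult[OF N])
    qed
  qed (use * part_mult[OF D_Obj] in simp_all)
  have single_act: "cls (k, scale r [(\<one>\<^bsub>R\<^esub>, \<alpha>, x)]) = cls (k, [(\<one>\<^bsub>R\<^esub>, \<beta>, act (fobj D k) r x)])"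
    if k: "k \<in> obj J" and *: "\<alpha> \<in> \<Lambda>" "\<beta> \<in> \<Lambda>" "r \<in> scal \<alpha> \<beta>" "x \<in> part (fobj D k) \<alpha>" for k \<alpha> \<beta> r x
  proof (rule cls_stage[OF k])
    have r: "r \<in> carrier R" using scal_R[OF *(1-3)] .
    show "stage_eq k (scale r [(\<one>\<^bsub>R\<^esub>, \<alpha>, x)]) [(\<one>\<^bsub>R\<^esub>, \<beta>, act (fobj D k) r x)]"
      unfolding stage_eq_def
    proof (intro ballI)
      fix N h assume N: "N \<in> Obj" and h: "h \<in> gmor (fobj D k) N"
      show "evm N h (scale r [(\<one>\<^bsub>R\<^esub>, \<alpha>, x)]) = evm N h [(\<one>\<^bsub>R\<^esub>, \<beta>, act (fobj D k) r x)]"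
        using hm[OF N h *(1,4)] gmor_act[OF h *] r unfolding scale_def
        by (simp add: act_one[OF N] total_r_one[OF N] act_closed[OF N])
    qed
    show "scale r [(\<one>\<^bsub>R\<^esub>, \<alpha>, x)] \<in> combs (elems k)" using scale_combs[OF r single[OF *(1,4)]] .
    show "[(\<one>\<^bsub>R\<^esub>, \<beta>, act (fobj D k) r x)] \<in> combs (elems k)"
      using single[OF *(2) act_part[OF D_Obj[OF k] *]] .
  qed
  \<comment> \<open>The empty combinations at all indices form one class, so the neutral element may
    be taken at the arbitrary index \<open>i0\<close>.\<close>
  have nil: "cls (k, []) = cls (i0, [])" if kJ: "k \<in> obj J" for k
  proof -
    obtain n u v where n: "n \<in> obj J" "u \<in> Hom J k n" "v \<in> Hom J i0 n" using J_bound[OF kJ i0] by blast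
    then show ?thesis
      using cls_push[OF kJ n(1,2), of "[]"] cls_push[OF i0 n(1,3), of "[]"] by (simp add: push_def)
  qed
  have "\<exists>L q. presents colim_set ?E colim_add ?a ?V L q \<and> q (i0, []) = \<one>\<^bsub>total L\<^esub>"
  proof (rule setoid_presents)
    show "small TYPE('u) colim_set"
      unfolding colim_set_def
    proof (rule small_Sigma[OF universe small_J])
      fix i assume i: "i \<in> obj J"
      have "small TYPE('u) (carrier R \<times> elems i)"
        by (rule small_Sigma[OF universe small_R small_Sigma[OF universe small_Lambda part_small[OF D_Obj[OF i]]]])
      then show "small TYPE('u) (combs (elems i))" unfolding combs_def by (rule small_lists[OF universe])
    qed
    show "cls (colim_add (colim_add a b) c) = cls (colim_add a (colim_add b c))"
      if abc: "a \<in> colim_set" "b \<in> colim_set" "c \<in> colim_set" for a b c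
    proof -
      obtain k l m n where k: "k \<in> obj J" "l \<in> combs (elems k)" "m \<in> combs (elems k)" "n \<in> combs (elems k)"
        "cls a = cls (k, l)" "cls b = cls (k, m)" "cls c = cls (k, n)" using colim_lift3[OF abc] .
      have ab: "cls (colim_add a b) = cls (k, l @ m)" by (rule add_stage[OF abc(1,2) k(1,2,3,5,6)])
      have bc: "cls (colim_add b c) = cls (k, m @ n)" by (rule add_stage[OF abc(2,3) k(1,3,4,6,7)])
      have "cls (colim_add (colim_add a b) c) = cls (k, (l @ m) @ n)"
        by (rule add_stage[OF colim_add_closed[OF abc(1,2)] abc(3) k(1) _ k(4) ab k(7)]) (simp add: k)
      moreover have "cls (colim_add a (colim_add b c)) = cls (k, l @ (m @ n))"
        by (rule add_stage[OF abc(1) colim_add_closed[OF abc(2,3)] k(1,2) _ k(5) bc]) (simp add: k)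
      ultimately show ?thesis by simp
    qed
    show "cls (colim_add a b) = cls (colim_add b a)" if ab: "a \<in> colim_set" "b \<in> colim_set" for a b
    proof -
      obtain k l m where k: "k \<in> obj J" "l \<in> combs (elems k)" "m \<in> combs (elems k)"
        "cls a = cls (k, l)" "cls b = cls (k, m)" using colim_lift3[OF ab ab(2)] .
      have "stage_eq k (l @ m) (m @ l)"
        unfolding stage_eq_def using k total_comm[OF _ evm_closed[OF k(1)] evm_closed[OF k(1)]]
        by (simp add: evm_append[OF k(1)])
      then have "cls (k, l @ m) = cls (k, m @ l)" using cls_stage k by simp
      then show ?thesis using add_stage ab k by simp
    qed
    show "(i0, []) \<in> colim_set" using i0 by (simp add: colim_set_iff)
    show "cls (colim_add (i0, []) a) = cls a" if a: "a \<in> colim_set" for a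
    proof -
      obtain k l where k: "k \<in> obj J" "l \<in> combs (elems k)" "cls a = cls (k, l)" using colim_lift3[OF a a a] .
      show ?thesis using add_stage[of "(i0, [])" a k "[]" l] nil[OF k(1)] k a i0 by (simp add: colim_set_iff)
    qed
    show "cls (?a r (colim_add a b)) = cls (colim_add (?a r a) (?a r b))"
      if r: "r \<in> carrier R" and ab: "a \<in> colim_set" "b \<in> colim_set" for r a b
    proof -
      obtain k l m where k: "k \<in> obj J" "l \<in> combs (elems k)" "m \<in> combs (elems k)"
        "cls a = cls (k, l)" "cls b = cls (k, m)" using colim_lift3[OF ab ab(2)] .
      have "cls (?a r (colim_add a b)) = cls (k, scale r (l @ m))"
        by (rule act_stage) (use r ab k add_stage colim_add_closed in simp_all)
      moreover have "cls (colim_add (?a r a) (?a r b)) = cls (k, scale r l @ scale r m)"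
        by (rule add_stage[OF a_closed[OF r ab(1)] a_closed[OF r ab(2)] k(1) scale_combs[OF r k(2)] scale_combs[OF r k(3)]
          act_stage[OF ab(1) r k(1,2,4)] act_stage[OF ab(2) r k(1,3,5)]])
      ultimately show ?thesis by (simp add: scale_append)
    qed
    show "cls (?a (r \<oplus>\<^bsub>R\<^esub> s) a) = cls (colim_add (?a r a) (?a s a))"
      if rs: "r \<in> carrier R" "s \<in> carrier R" and a: "a \<in> colim_set" for r s a
    proof -
      obtain k l where k: "k \<in> obj J" "l \<in> combs (elems k)" "cls a = cls (k, l)" using colim_lift3[OF a a a] .
      have "cls (colim_add (?a r a) (?a s a)) = cls (k, scale r l @ scale s l)"
        by (rule add_stage[OF a_closed[OF rs(1) a] a_closed[OF rs(2) a] k(1) scale_combs[OF rs(1) k(2)] scale_combs[OF rs(2) k(2)]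
          act_stage[OF a rs(1) k] act_stage[OF a rs(2) k]])
      moreover have "stage_eq k (scale (r \<oplus>\<^bsub>R\<^esub> s) l) (scale r l @ scale s l)"
        unfolding stage_eq_def using k rs act_add[OF _ _ _ evm_closed[OF k(1)]]
        by (simp add: evm_append[OF k(1)] evm_scale[OF k(1)] scale_combs)
      ultimately show ?thesis
        using act_stage[OF a R.a_closed[OF rs] k] cls_stage[OF k(1), of "scale (r \<oplus>\<^bsub>R\<^esub> s) l" "scale r l @ scale s l"]
          k(2) rs by (simp add: scale_combs)
    qed
    show "cls (?a (r \<otimes>\<^bsub>R\<^esub> s) a) = cls (?a r (?a s a))"
      if rs: "r \<in> carrier R" "s \<in> carrier R" and a: "a \<in> colim_set" for r s a
    proof -
      have k: "fst a \<in> obj J" "snd a \<in> combs (elems (fst a))" using a unfolding colim_set_def by auto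
      have "stage_eq (fst a) (scale (r \<otimes>\<^bsub>R\<^esub> s) (snd a)) (scale r (scale s (snd a)))"
        unfolding stage_eq_def using k rs act_act[OF _ _ _ evm_closed[OF k(1)]]
        by (simp add: evm_scale[OF k(1)] scale_combs)
      then show ?thesis
        using cls_stage[OF k(1), of "scale (r \<otimes>\<^bsub>R\<^esub> s) (snd a)" "scale r (scale s (snd a))"] k rs
        by (simp add: scale_combs)
    qed
    show "cls (?a \<one>\<^bsub>R\<^esub> a) = cls a" if a: "a \<in> colim_set" for a
    proof -
      have k: "fst a \<in> obj J" "snd a \<in> combs (elems (fst a))" using a unfolding colim_set_def by auto
      have "stage_eq (fst a) (scale \<one>\<^bsub>R\<^esub> (snd a)) (snd a)"
        unfolding stage_eq_def using k act_one[OF _ evm_closed[OF k(1)]] by (simp add: evm_scale[OF k(1)])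
      then show ?thesis using cls_stage[OF k(1), of "scale \<one>\<^bsub>R\<^esub> (snd a)" "snd a"] k by (simp add: scale_combs)
    qed
    show "cls (?a \<zero>\<^bsub>R\<^esub> a) = cls (i0, [])" if a: "a \<in> colim_set" for a
    proof -
      have k: "fst a \<in> obj J" "snd a \<in> combs (elems (fst a))" using a unfolding colim_set_def by auto
      have "stage_eq (fst a) (scale \<zero>\<^bsub>R\<^esub> (snd a)) []"
        unfolding stage_eq_def using k act_zero[OF _ evm_closed[OF k(1)]] by (simp add: evm_scale[OF k(1)])
      then show ?thesis using cls_stage[OF k(1), of "scale \<zero>\<^bsub>R\<^esub> (snd a)" "[]"] k nil[OF k(1)] by (simp add: scale_combs)
    qed
    show "?V \<mu> \<subseteq> colim_set" if "\<mu> \<in> \<Lambda>" for \<mu> using that by (auto simp: colim_set_iff)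
    show "?V \<mu> \<noteq> {}" if "\<mu> \<in> \<Lambda>" for \<mu> using part_one[OF D_Obj[OF i0] that] i0 by blast
    show "\<exists>c\<in>?V \<mu>. cls c = cls (colim_add a b)" if mu: "\<mu> \<in> \<Lambda>" and ab: "a \<in> ?V \<mu>" "b \<in> ?V \<mu>" for \<mu> a b
    proof -
      obtain i x j y where e: "a = (i, [(\<one>\<^bsub>R\<^esub>, \<mu>, x)])" "i \<in> obj J" "x \<in> part (fobj D i) \<mu>"
        "b = (j, [(\<one>\<^bsub>R\<^esub>, \<mu>, y)])" "j \<in> obj J" "y \<in> part (fobj D j) \<mu>" using ab by blast
      obtain k u v where k: "k \<in> obj J" "u \<in> Hom J i k" "v \<in> Hom J j k" using J_bound[OF e(2,5)] by blast
      have xy: "farr D i k u \<mu> x \<in> part (fobj D k) \<mu>" "farr D j k v \<mu> y \<in> part (fobj D k) \<mu>"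
        using D_mem[OF e(2) k(1,2) mu e(3)] D_mem[OF e(5) k(1,3) mu e(6)] .
      have "cls (colim_add a b) = cls (k, [(\<one>\<^bsub>R\<^esub>, \<mu>, farr D i k u \<mu> x)] @ [(\<one>\<^bsub>R\<^esub>, \<mu>, farr D j k v \<mu> y)])"
        unfolding e(1,4) using colim_add(2)[OF e(2,5) single[OF mu e(3)] single[OF mu e(6)] k] unfolding push_single .
      then have "cls (k, [(\<one>\<^bsub>R\<^esub>, \<mu>, farr D i k u \<mu> x \<otimes>\<^bsub>total (fobj D k)\<^esub> farr D j k v \<mu> y)]) = cls (colim_add a b)"
        using single_add[OF k(1) mu xy] by simp
      then show ?thesis using k(1) part_mult[OF D_Obj[OF k(1)] mu xy] by blast
    qed
    show "\<exists>c\<in>?V \<beta>. cls c = cls (?a r a)" if ab: "\<alpha> \<in> \<Lambda>" "\<beta> \<in> \<Lambda>" "r \<in> scal \<alpha> \<beta>" and a: "a \<in> ?V \<alpha>" for \<alpha> \<beta> r a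
    proof -
      obtain i x where e: "a = (i, [(\<one>\<^bsub>R\<^esub>, \<alpha>, x)])" "i \<in> obj J" "x \<in> part (fobj D i) \<alpha>" using a by blast
      have "cls (i, [(\<one>\<^bsub>R\<^esub>, \<beta>, act (fobj D i) r x)]) = cls (?a r a)"
        using single_act[OF e(2) ab e(3)] unfolding e(1) by simp
      then show ?thesis using e(2) act_part[OF D_Obj[OF e(2)] ab e(3)] by blast
    qed
    show "colim_add a b \<in> colim_set" if "a \<in> colim_set" "b \<in> colim_set" for a b
      by (rule colim_add_closed[OF that])
    show "cls (colim_add a b) = cls (colim_add a' b')"
      if "a \<in> colim_set" "b \<in> colim_set" "a' \<in> colim_set" "b' \<in> colim_set" "cls a = cls a'" "cls b = cls b'" for a b a' b'
      by (rule colim_add_cong[OF that(1,3,5,2,4,6)])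
    show "?a r a \<in> colim_set" if "r \<in> carrier R" "a \<in> colim_set" for r a by (rule a_closed[OF that])
    show "cls (?a r a) = cls (?a r b)" if "r \<in> carrier R" "a \<in> colim_set" "b \<in> colim_set" "cls a = cls b" for r a b
      by (rule cls_act_cong[OF that(2,3,4,1)])
  qed simp_all
  then obtain L q where P: "presents colim_set ?E colim_add ?a ?V L q" by blast
  note L = presentsD(1)[OF P]
  have q_eq: "q a = q b" if "a \<in> colim_set" "b \<in> colim_set" "cls a = cls b" for a b
    using presentsD(3)[OF P that(1,2)] that(3) by simp
  have sc: "(i, [(\<one>\<^bsub>R\<^esub>, \<mu>, x)]) \<in> colim_set" if "i \<in> obj J" "\<mu> \<in> \<Lambda>" "x \<in> part (fobj D i) \<mu>" for i \<mu> x
    using that by (simp add: colim_set_iff)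
  let ?\<iota> = "\<lambda>i. mor (fobj D i) (\<lambda>\<mu> x. q (i, [(\<one>\<^bsub>R\<^esub>, \<mu>, x)]))"
  have \<iota>: "?\<iota> i \<in> gmor (fobj D i) L" if i: "i \<in> obj J" for i
  proof (rule gmorI[OF D_Obj[OF i]])
    show "q (i, [(\<one>\<^bsub>R\<^esub>, \<mu>, x)]) \<in> part L \<mu>" if "\<mu> \<in> \<Lambda>" "x \<in> part (fobj D i) \<mu>" for \<mu> x
      unfolding presentsD(9)[OF P that(1)] using that i by blast
    show "q (i, [(\<one>\<^bsub>R\<^esub>, \<mu>, x \<otimes>\<^bsub>total (fobj D i)\<^esub> y)]) = q (i, [(\<one>\<^bsub>R\<^esub>, \<mu>, x)]) \<otimes>\<^bsub>total L\<^esub> q (i, [(\<one>\<^bsub>R\<^esub>, \<mu>, y)])"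
      if *: "\<mu> \<in> \<Lambda>" "x \<in> part (fobj D i) \<mu>" "y \<in> part (fobj D i) \<mu>" for \<mu> x y
    proof -
      have "cls (i, [(\<one>\<^bsub>R\<^esub>, \<mu>, x \<otimes>\<^bsub>total (fobj D i)\<^esub> y)]) = cls (colim_add (i, [(\<one>\<^bsub>R\<^esub>, \<mu>, x)]) (i, [(\<one>\<^bsub>R\<^esub>, \<mu>, y)]))"
        using single_add[OF i *] colim_add_stage[OF i single[OF *(1,2)] single[OF *(1,3)]] by simp
      then have "q (i, [(\<one>\<^bsub>R\<^esub>, \<mu>, x \<otimes>\<^bsub>total (fobj D i)\<^esub> y)]) = q (colim_add (i, [(\<one>\<^bsub>R\<^esub>, \<mu>, x)]) (i, [(\<one>\<^bsub>R\<^esub>, \<mu>, y)]))"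
        by (rule q_eq[rotated 2])
          (use sc[OF i *(1)] * part_mult[OF D_Obj[OF i] *] colim_add_closed in auto)
      then show ?thesis using presentsD(5)[OF P sc[OF i *(1,2)] sc[OF i *(1,3)]] by simp
    qed
    show "q (i, [(\<one>\<^bsub>R\<^esub>, \<beta>, act (fobj D i) r x)]) = act L r (q (i, [(\<one>\<^bsub>R\<^esub>, \<alpha>, x)]))"
      if *: "\<alpha> \<in> \<Lambda>" "\<beta> \<in> \<Lambda>" "r \<in> scal \<alpha> \<beta>" "x \<in> part (fobj D i) \<alpha>" for \<alpha> \<beta> r x
    proof -
      have r: "r \<in> carrier R" using scal_R[OF *(1-3)] .
      have "q (i, [(\<one>\<^bsub>R\<^esub>, \<beta>, act (fobj D i) r x)]) = q (?a r (i, [(\<one>\<^bsub>R\<^esub>, \<alpha>, x)]))"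
      proof (rule q_eq)
        show "cls (i, [(\<one>\<^bsub>R\<^esub>, \<beta>, act (fobj D i) r x)]) = cls (?a r (i, [(\<one>\<^bsub>R\<^esub>, \<alpha>, x)]))"
          using single_act[OF i *] by simp
        show "(i, [(\<one>\<^bsub>R\<^esub>, \<beta>, act (fobj D i) r x)]) \<in> colim_set" using sc[OF i *(2) act_part[OF D_Obj[OF i] *]] .
        show "?a r (i, [(\<one>\<^bsub>R\<^esub>, \<alpha>, x)]) \<in> colim_set" by (rule a_closed[OF r sc[OF i *(1,4)]])
      qed
      then show ?thesis using presentsD(7)[OF P r sc[OF i *(1,4)]] by simp
    qed
  qed
  have "is_cocone J GC D L ?\<iota>"
    unfolding is_cocone_def
  proof (intro conjI ballI)
    show "L \<in> obj GC" using L by simp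
    show "?\<iota> i \<in> Hom GC (fobj D i) L" if "i \<in> obj J" for i using \<iota>[OF that] by simp
    show "cmp GC (fobj D i) (fobj D j) L (?\<iota> j) (farr D i j u) = ?\<iota> i"
      if *: "i \<in> obj J" "j \<in> obj J" "u \<in> Hom J i j" for i j u
      unfolding cmp_GC
    proof (rule mor_eqI)
      fix \<mu> x assume mx: "\<mu> \<in> \<Lambda>" "x \<in> part (fobj D i) \<mu>"
      have "q (j, [(\<one>\<^bsub>R\<^esub>, \<mu>, farr D i j u \<mu> x)]) = q (i, [(\<one>\<^bsub>R\<^esub>, \<mu>, x)])"
        by (rule q_eq[OF sc[OF *(2) mx(1) D_mem[OF * mx]] sc[OF *(1) mx]])
          (use cls_push[OF * single[OF mx]] in \<open>simp add: push_single\<close>)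
      then show "?\<iota> j \<mu> (farr D i j u \<mu> x) = q (i, [(\<one>\<^bsub>R\<^esub>, \<mu>, x)])" using mx D_mem[OF * mx] by simp
    qed
  qed
  moreover have "pointwise_colimit J D L ?\<iota>"
    unfolding pointwise_colimit_def
  proof (intro conjI ballI impI)
    fix \<mu> y assume mu: "\<mu> \<in> \<Lambda>" and "y \<in> part L \<mu>"
    then have "y \<in> q ` ?V \<mu>" using presentsD(9)[OF P mu] by simp
    then obtain i x where "i \<in> obj J" "x \<in> part (fobj D i) \<mu>" "y = q (i, [(\<one>\<^bsub>R\<^esub>, \<mu>, x)])" by auto
    then show "\<exists>i\<in>obj J. \<exists>x\<in>part (fobj D i) \<mu>. ?\<iota> i \<mu> x = y" using mu by auto
  next
    fix i \<mu> x y assume i: "i \<in> obj J" and mu: "\<mu> \<in> \<Lambda>" and xy: "x \<in> part (fobj D i) \<mu>" "y \<in> part (fobj D i) \<mu>"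
      and "?\<iota> i \<mu> x = ?\<iota> i \<mu> y"
    then have "cls (i, [(\<one>\<^bsub>R\<^esub>, \<mu>, x)]) = cls (i, [(\<one>\<^bsub>R\<^esub>, \<mu>, y)])"
      using presentsD(3)[OF P sc[OF i mu xy(1)] sc[OF i mu xy(2)]] by simp
    then have "colim_eq (i, [(\<one>\<^bsub>R\<^esub>, \<mu>, x)]) (i, [(\<one>\<^bsub>R\<^esub>, \<mu>, y)])"
      using cls_eq_iff[OF sc[OF i mu xy(1)] sc[OF i mu xy(2)]] by simp
    then obtain k u v where k: "k \<in> obj J" "u \<in> Hom J i k" "v \<in> Hom J i k"
      "stage_eq k [(\<one>\<^bsub>R\<^esub>, \<mu>, farr D i k u \<mu> x)] [(\<one>\<^bsub>R\<^esub>, \<mu>, farr D i k v \<mu> y)]"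
      unfolding colim_eq_def by (auto simp: push_single)
    have xyk: "farr D i k u \<mu> x \<in> part (fobj D k) \<mu>" "farr D i k v \<mu> y \<in> part (fobj D k) \<mu>"
      using D_mem[OF i k(1,2) mu xy(1)] D_mem[OF i k(1,3) mu xy(2)] .
    note Dk = D_Obj[OF k(1)]
    \<comment> \<open>The identity of \<open>fobj D k\<close> is among the test morphisms, and its
      value on a single element is that element itself.\<close>
    have "evm (fobj D k) (mor (fobj D k) (\<lambda>\<mu> x. x)) [(\<one>\<^bsub>R\<^esub>, \<mu>, farr D i k u \<mu> x)] =
        evm (fobj D k) (mor (fobj D k) (\<lambda>\<mu> x. x)) [(\<one>\<^bsub>R\<^esub>, \<mu>, farr D i k v \<mu> y)]"
      using k(4) gmor_ident[OF Dk] Dk unfolding stage_eq_def by blast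
    then have eq: "farr D i k u \<mu> x = farr D i k v \<mu> y"
      using xyk part_total[OF Dk mu xyk(1)] part_total[OF Dk mu xyk(2)] mu
      by (simp add: act_one[OF Dk] total_r_one[OF Dk])
    \<comment> \<open>\<open>u\<close> and \<open>v\<close> are parallel but may differ. A later
      \<open>w\<close> makes them equal, so that a single morphism identifies \<open>x\<close> and
      \<open>y\<close>.\<close>
    obtain m w where m: "m \<in> obj J" "w \<in> Hom J k m" "cmp J i k m w u = cmp J i k m w v"
      using J i k unfolding filtered_def by blast
    have "farr D i m (cmp J i k m w u) \<mu> x = farr D i m (cmp J i k m w u) \<mu> y"
      using D_cmp[OF i k(1) m(1) k(2) m(2) mu xy(1)] D_cmp[OF i k(1) m(1) k(3) m(2) mu xy(2)] m(3) eq by simp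
    moreover have "cmp J i k m w u \<in> Hom J i m" using cat_cmp[OF J_cat i k(1) m(1) k(2) m(2)] .
    ultimately show "\<exists>k\<in>obj J. \<exists>u\<in>Hom J i k. farr D i k u \<mu> x = farr D i k u \<mu> y" using m(1) by blast
  qed
  ultimately show ?thesis by blast
qed

end

lemma colimit_pointwise:
  assumes "filtered J" "small TYPE('u) (obj J)" "is_colimit J GC D l \<iota>"
  shows "pointwise_colimit J D l \<iota>"
  using assms pointwise_colimit_exists[OF assms(1) colimit_functor[OF assms(3)] assms(2)]
    pointwise_colimit_transfer[OF assms(1) colimit_functor[OF assms(3)]] by blast

lemma has_filtered_colimits_GC: "has_filtered_colimits TYPE('u) GC"
  unfolding has_filtered_colimits_def small_filtered_def
  using pointwise_colimit_exists pointwise_is_colimit by blast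

text \<open>By \<open>conflation_GC\<close> and the pointwise description of colimits this is the
  exactness of filtered colimits of abelian groups in each degree: an equation in a colimit already
  holds at a later stage, where the given sequence is exact.\<close>

lemma exact_filtered_colimits_GC: "exact_filtered_colimits TYPE('u) GC"
  unfolding exact_filtered_colimits_def
proof (intro allI impI)
  fix J :: "('u, 'u) category" and A B E f g a \<alpha> b \<beta> e \<epsilon> f' g'
  assume *: "small_filtered J \<and>
      is_colimit J GC A a \<alpha> \<and> is_colimit J GC B b \<beta> \<and> is_colimit J GC E e \<epsilon> \<and>
      f \<in> nat_trans J GC A B \<and> g \<in> nat_trans J GC B E \<and>
      (\<forall>j\<in>obj J. conflation GC (fobj A j) (fobj B j) (fobj E j) (f j) (g j)) \<and>
      f' \<in> Hom GC a b \<and> g' \<in> Hom GC b e \<and>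
      (\<forall>j\<in>obj J.
        cmp GC (fobj A j) a b f' (\<alpha> j) = cmp GC (fobj A j) (fobj B j) b (\<beta> j) (f j) \<and>
        cmp GC (fobj B j) b e g' (\<beta> j) = cmp GC (fobj B j) (fobj E j) e (\<epsilon> j) (g j))"
  have J: "filtered J" and sJ: "small TYPE('u) (obj J)" using * unfolding small_filtered_def by blast+
  have colim: "is_colimit J GC A a \<alpha>" "is_colimit J GC B b \<beta>" "is_colimit J GC E e \<epsilon>" using * by blast+
  note F = colim[THEN colimit_functor]
  note co = colim[THEN colimit_cocone]
  note pw = colim[THEN colimit_pointwise[OF J sJ]]
  have O: "a \<in> Obj" "b \<in> Obj" "e \<in> Obj" using co[THEN cocone_obj] by simp_all
  have f': "f' \<in> gmor a b" and g': "g' \<in> gmor b e" using * by simp_all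
  have fo: "fobj A j \<in> Obj" "fobj B j \<in> Obj" "fobj E j \<in> Obj" if "j \<in> obj J" for j
    using functor_obj[OF F(1) that] functor_obj[OF F(2) that] functor_obj[OF F(3) that] by simp_all
  have ft: "f \<in> nat_trans J GC A B" and gt: "g \<in> nat_trans J GC B E" using * by blast+
  have fg: "f j \<in> gmor (fobj A j) (fobj B j)" "g j \<in> gmor (fobj B j) (fobj E j)" if "j \<in> obj J" for j
    using nat_trans_component[OF ft that] nat_trans_component[OF gt that] by simp_all
  have nat_apply: "\<theta> j \<mu> (farr S i j u \<mu> x) = farr T i j u \<mu> (\<theta> i \<mu> x)"
    if "\<theta> \<in> nat_trans J GC S T" "i \<in> obj J" "j \<in> obj J" "u \<in> Hom J i j" "\<mu> \<in> \<Lambda>" "x \<in> part (fobj S i) \<mu>" for \<theta> S T i j u \<mu> x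
  proof -
    have "mor (fobj S i) (\<lambda>\<mu> x. \<theta> j \<mu> (farr S i j u \<mu> x)) = mor (fobj S i) (\<lambda>\<mu> x. farr T i j u \<mu> (\<theta> i \<mu> x))"
      using that(1-4) unfolding nat_trans_def by simp
    from gmor_eqD[OF this that(5,6)] show ?thesis .
  qed
  have exact: "inj_on (f j \<mu>) (part (fobj A j) \<mu>)"
    "f j \<mu> ` part (fobj A j) \<mu> = {x \<in> part (fobj B j) \<mu>. g j \<mu> x = \<one>\<^bsub>total (fobj E j)\<^esub>}"
    "g j \<mu> ` part (fobj B j) \<mu> = part (fobj E j) \<mu>" if "j \<in> obj J" "\<mu> \<in> \<Lambda>" for j \<mu>
    using * conflation_GC[OF fo[OF that(1)] fg[OF that(1)]] that by blast+
  have f'\<alpha>: "f' \<mu> (\<alpha> j \<mu> x) = \<beta> j \<mu> (f j \<mu> x)" if "j \<in> obj J" "\<mu> \<in> \<Lambda>" "x \<in> part (fobj A j) \<mu>" for j \<mu> x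
    using gmor_eqD[OF _ that(2,3), of "\<lambda>\<mu> x. f' \<mu> (\<alpha> j \<mu> x)" "\<lambda>\<mu> x. \<beta> j \<mu> (f j \<mu> x)"] * that(1) by simp
  have g'\<beta>: "g' \<mu> (\<beta> j \<mu> x) = \<epsilon> j \<mu> (g j \<mu> x)" if "j \<in> obj J" "\<mu> \<in> \<Lambda>" "x \<in> part (fobj B j) \<mu>" for j \<mu> x
    using gmor_eqD[OF _ that(2,3), of "\<lambda>\<mu> x. g' \<mu> (\<beta> j \<mu> x)" "\<lambda>\<mu> x. \<epsilon> j \<mu> (g j \<mu> x)"] * that(1) by simp
  show "conflation GC a b e f' g'"
    unfolding conflation_GC[OF O f' g']
  proof (intro ballI conjI)
    fix \<mu> assume mu: "\<mu> \<in> \<Lambda>"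
    show "inj_on (f' \<mu>) (part a \<mu>)"
    proof (rule inj_onI)
      fix y z assume yz: "y \<in> part a \<mu>" "z \<in> part a \<mu>" "f' \<mu> y = f' \<mu> z"
      obtain k x w where k: "k \<in> obj J" "x \<in> part (fobj A k) \<mu>" "w \<in> part (fobj A k) \<mu>" "\<alpha> k \<mu> x = y" "\<alpha> k \<mu> w = z"
        using pointwise_two[OF J F(1) co(1) pw(1) mu mu yz(1,2)] by blast
      have fx: "f k \<mu> x \<in> part (fobj B k) \<mu>" "f k \<mu> w \<in> part (fobj B k) \<mu>" using gmor_mem[OF fg(1)[OF k(1)] mu] k by blast+
      have "\<beta> k \<mu> (f k \<mu> x) = \<beta> k \<mu> (f k \<mu> w)" using f'\<alpha>[OF k(1) mu k(2)] f'\<alpha>[OF k(1) mu k(3)] k(4,5) yz(3) by simp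
      then obtain m u where m: "m \<in> obj J" "u \<in> Hom J k m" "farr B k m u \<mu> (f k \<mu> x) = farr B k m u \<mu> (f k \<mu> w)"
        using pointwise_eq[OF J F(2) co(2) pw(2) k(1) mu fx] by blast
      have "f m \<mu> (farr A k m u \<mu> x) = f m \<mu> (farr A k m u \<mu> w)"
        using nat_apply[OF ft k(1) m(1,2) mu k(2)] nat_apply[OF ft k(1) m(1,2) mu k(3)] m(3) by simp
      then have "farr A k m u \<mu> x = farr A k m u \<mu> w"
        using inj_onD[OF exact(1)[OF m(1) mu]] D_mem[OF J F(1) k(1) m(1,2) mu] k(2,3) by blast
      then show "y = z"
        using cocone_apply[OF J F(1) co(1) k(1) m(1,2) mu k(2)] cocone_apply[OF J F(1) co(1) k(1) m(1,2) mu k(3)] k(4,5) by simp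
    qed
    show "f' \<mu> ` part a \<mu> = {x \<in> part b \<mu>. g' \<mu> x = \<one>\<^bsub>total e\<^esub>}"
    proof (intro subset_antisym subsetI)
      fix z assume "z \<in> f' \<mu> ` part a \<mu>"
      then obtain y where y: "y \<in> part a \<mu>" "z = f' \<mu> y" by blast
      obtain k x where k: "k \<in> obj J" "x \<in> part (fobj A k) \<mu>" "\<alpha> k \<mu> x = y"
        using pointwise_surj[OF J F(1) co(1) pw(1) mu y(1)] by blast
      have fx: "f k \<mu> x \<in> part (fobj B k) \<mu>" "g k \<mu> (f k \<mu> x) = \<one>\<^bsub>total (fobj E k)\<^esub>" using exact(2)[OF k(1) mu] k(2) by blast+
      have "g' \<mu> z = \<epsilon> k \<mu> (g k \<mu> (f k \<mu> x))"
        using f'\<alpha>[OF k(1) mu k(2)] g'\<beta>[OF k(1) mu fx(1)] k(3) y(2) by simp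
      also have "\<dots> = \<one>\<^bsub>total e\<^esub>"
        unfolding fx(2) using gmor_one[OF fo(3)[OF k(1)] O(3) cocone_gmor[OF J F(3) co(3) k(1)] mu] .
      finally show "z \<in> {x \<in> part b \<mu>. g' \<mu> x = \<one>\<^bsub>total e\<^esub>}" using y gmor_mem[OF f' mu] by simp
    next
      fix z assume "z \<in> {x \<in> part b \<mu>. g' \<mu> x = \<one>\<^bsub>total e\<^esub>}"
      then have z: "z \<in> part b \<mu>" "g' \<mu> z = \<one>\<^bsub>total e\<^esub>" by blast+
      obtain k w where k: "k \<in> obj J" "w \<in> part (fobj B k) \<mu>" "\<beta> k \<mu> w = z"
        using pointwise_surj[OF J F(2) co(2) pw(2) mu z(1)] by blast
      have gw: "g k \<mu> w \<in> part (fobj E k) \<mu>" using gmor_mem[OF fg(2)[OF k(1)] mu k(2)] .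
      \<comment> \<open>The image of \<open>w\<close> under \<open>g\<close> vanishes only in the
        colimit. Moving to the stage \<open>m\<close> makes it vanish there, and exactness at
        \<open>m\<close> provides a preimage.\<close>
      have "\<epsilon> k \<mu> (g k \<mu> w) = \<epsilon> k \<mu> \<one>\<^bsub>total (fobj E k)\<^esub>"
        using g'\<beta>[OF k(1) mu k(2)] k(3) z(2) gmor_one[OF fo(3)[OF k(1)] O(3) cocone_gmor[OF J F(3) co(3) k(1)] mu] by simp
      then obtain m u where m: "m \<in> obj J" "u \<in> Hom J k m" "farr E k m u \<mu> (g k \<mu> w) = farr E k m u \<mu> \<one>\<^bsub>total (fobj E k)\<^esub>"
        using pointwise_eq[OF J F(3) co(3) pw(3) k(1) mu gw part_one[OF fo(3)[OF k(1)] mu]] by blast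
      let ?w = "farr B k m u \<mu> w"
      have w: "?w \<in> part (fobj B m) \<mu>" using D_mem[OF J F(2) k(1) m(1,2) mu k(2)] .
      have "g m \<mu> ?w = \<one>\<^bsub>total (fobj E m)\<^esub>"
        using nat_apply[OF gt k(1) m(1,2) mu k(2)] m(3)
          gmor_one[OF fo(3)[OF k(1)] fo(3)[OF m(1)] D_gmor[OF J F(3) k(1) m(1,2)] mu] by simp
      then have "?w \<in> f m \<mu> ` part (fobj A m) \<mu>" unfolding exact(2)[OF m(1) mu] using w by simp
      then obtain x where x: "?w = f m \<mu> x" "x \<in> part (fobj A m) \<mu>" by (rule imageE)
      have "z = f' \<mu> (\<alpha> m \<mu> x)"
        using f'\<alpha>[OF m(1) mu x(2)] x(1) cocone_apply[OF J F(2) co(2) k(1) m(1,2) mu k(2)] k(3) by simp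
      then show "z \<in> f' \<mu> ` part a \<mu>" using gmor_mem[OF cocone_gmor[OF J F(1) co(1) m(1)] mu x(2)] by blast
    qed
    show "g' \<mu> ` part b \<mu> = part e \<mu>"
    proof (intro subset_antisym subsetI)
      fix y assume y: "y \<in> part e \<mu>"
      obtain k x where k: "k \<in> obj J" "x \<in> part (fobj E k) \<mu>" "\<epsilon> k \<mu> x = y"
        using pointwise_surj[OF J F(3) co(3) pw(3) mu y] by blast
      have "x \<in> g k \<mu> ` part (fobj B k) \<mu>" unfolding exact(3)[OF k(1) mu] by (rule k(2))
      then obtain w where w: "x = g k \<mu> w" "w \<in> part (fobj B k) \<mu>" by (rule imageE)
      have "y = g' \<mu> (\<beta> k \<mu> w)" using g'\<beta>[OF k(1) mu w(2)] w(1) k(3) by simp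
      then show "y \<in> g' \<mu> ` part b \<mu>" using gmor_mem[OF cocone_gmor[OF J F(2) co(2) k(1)] mu w(2)] by blast
    qed (use gmor_mem[OF g' mu] in blast)
  qed
qed

end

section \<open>Finite presentation and local presentability\<close>

section \<open>Finitely presentable gliders\<close>

text \<open>Persistence of the properties lets the stages found for the members of \<open>T\<close>
  be merged one after the other by \<open>filtered_span\<close>. The morphisms start at a fixed
  index because the properties concern elements given there.\<close>

lemma filtered_eventually_finite:
  assumes J: "filtered J" and i: "i \<in> obj J" and T: "finite T"
    and ex: "\<And>t. t \<in> T \<Longrightarrow> \<exists>k\<in>obj J. \<exists>u\<in>Hom J i k. Q t k u"
    and stable: "\<And>t k m u w. t \<in> T \<Longrightarrow> k \<in> obj J \<Longrightarrow> m \<in> obj J \<Longrightarrow> u \<in> Hom J i k \<Longrightarrow> w \<in> Hom J k m \<Longrightarrow>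
      Q t k u \<Longrightarrow> Q t m (cmp J i k m w u)"
  shows "\<exists>k\<in>obj J. \<exists>u\<in>Hom J i k. \<forall>t\<in>T. Q t k u"
  using T ex stable
proof (induction T)
  case empty
  have "is_category J" using J unfolding filtered_def by blast
  with i show ?case by (intro bexI[OF _ i] bexI[of _ "ident J i"]) (simp_all add: cat_ident)
next
  case (insert t T)
  have cat: "is_category J" using J unfolding filtered_def by blast
  have "\<exists>k\<in>obj J. \<exists>u\<in>Hom J i k. \<forall>t\<in>T. Q t k u"
    by (rule insert.IH) (use insert.prems in blast)+
  then obtain k u where k: "k \<in> obj J" "u \<in> Hom J i k" "\<forall>t\<in>T. Q t k u" by blast
  obtain k' u' where k': "k' \<in> obj J" "u' \<in> Hom J i k'" "Q t k' u'" using insert.prems(1) by blast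
  obtain m w w' where m: "m \<in> obj J" "w \<in> Hom J k m" "w' \<in> Hom J k' m" "cmp J i k m w u = cmp J i k' m w' u'"
    using filtered_span[OF J i k(1) k'(1) k(2) k'(2)] .
  have "Q t' m (cmp J i k m w u)" if "t' \<in> insert t T" for t'
  proof (cases "t' = t")
    case True
    then show ?thesis
      using insert.prems(2)[of t k' m u' w'] k' m by simp
  next
    case False
    then show ?thesis
      using insert.prems(2)[of t' k m u w] k m that by simp
  qed
  moreover have "cmp J i k m w u \<in> Hom J i m" using cat_cmp[OF cat i k(1) m(1) k(2) m(2)] .
  ultimately show ?case using m(1) by blast
qed

context gliders begin

text \<open>The images of the finitely many generators lift to one stage, the finitely many
  relations hold at a later one, and two morphisms that agree in the colimit agree on all generators
  at some stage.\<close>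

lemma finitely_presentable_presented:
  assumes P: "P \<in> Obj" and S: "finite S" and gen: "generates P S d \<gamma>" and T: "finite T"
    and T_rel: "\<And>\<mu> l. (\<mu>, l) \<in> T \<Longrightarrow> \<mu> \<in> \<Lambda> \<and> l \<in> hcombs S d \<mu> \<and> ev P \<gamma> l = \<one>\<^bsub>total P\<^esub>"
    and univ: "\<And>N e. N \<in> Obj \<Longrightarrow> (\<And>s. s \<in> S \<Longrightarrow> e s \<in> part N (d s)) \<Longrightarrow>
      (\<And>\<mu> l. (\<mu>, l) \<in> T \<Longrightarrow> ev N e l = \<one>\<^bsub>total N\<^esub>) \<Longrightarrow> \<exists>g\<in>gmor P N. \<forall>s\<in>S. g (d s) (\<gamma> s) = e s"
  shows "finitely_presentable TYPE('u) GC P"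
  unfolding finitely_presentable_def
proof (intro conjI allI impI)
  show "P \<in> obj GC" using P by simp
  fix J :: "('u, 'u) category" and D l \<iota>
  assume *: "small_filtered J \<and> is_colimit J GC D l \<iota>"
  then have J: "filtered J" and sJ: "small TYPE('u) (obj J)" and col: "is_colimit J GC D l \<iota>"
    unfolding small_filtered_def by blast+
  note D = colimit_functor[OF col] and co = colimit_cocone[OF col] and pw = colimit_pointwise[OF J sJ col]
  have l: "l \<in> Obj" using cocone_obj[OF co] by simp
  have d: "d s \<in> \<Lambda>" and \<gamma>: "\<gamma> s \<in> part P (d s)" if "s \<in> S" for s
    using gen that unfolding generates_def by blast+
  have dS: "d ` S \<subseteq> \<Lambda>" using d by blast
  note DO = D_Obj[OF J D] and Dg = D_gmor[OF J D] and Dm = D_mem[OF J D] and Dc = D_cmp[OF J D]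
    and cg = cocone_gmor[OF J D co] and ca = cocone_apply[OF J D co]
  have surj: "\<exists>i\<in>obj J. \<exists>g\<in>gmor P (fobj D i). mor P (\<lambda>\<mu> x. \<iota> i \<mu> (g \<mu> x)) = f" if f: "f \<in> gmor P l" for f
  proof -
    \<comment> \<open>The generators are lifted one at a time; each new lift moves the earlier ones
      along to a common upper bound.\<close>
    have "\<exists>i\<in>obj J. \<exists>e. \<forall>s\<in>S'. e s \<in> part (fobj D i) (d s) \<and> \<iota> i (d s) (e s) = f (d s) (\<gamma> s)"
      if "finite S'" "S' \<subseteq> S" for S'
      using that
    proof (induction S')
      case empty
      then show ?case using J unfolding filtered_def by blast
    next
      case (insert s S')
      then obtain i e where i: "i \<in> obj J" "\<And>s. s \<in> S' \<Longrightarrow> e s \<in> part (fobj D i) (d s) \<and> \<iota> i (d s) (e s) = f (d s) (\<gamma> s)"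
        by blast
      have s: "s \<in> S" using insert.prems by blast
      obtain j x where j: "j \<in> obj J" "x \<in> part (fobj D j) (d s)" "\<iota> j (d s) x = f (d s) (\<gamma> s)"
        using pointwise_surj[OF J D co pw d[OF s] gmor_mem[OF f d[OF s] \<gamma>[OF s]]] by blast
      obtain k u v where k: "k \<in> obj J" "u \<in> Hom J i k" "v \<in> Hom J j k" using J_bound[OF J D i(1) j(1)] by blast
      let ?e = "\<lambda>s'. if s' = s then farr D j k v (d s) x else farr D i k u (d s') (e s')"
      have "?e s' \<in> part (fobj D k) (d s') \<and> \<iota> k (d s') (?e s') = f (d s') (\<gamma> s')" if s': "s' \<in> insert s S'" for s'
      proof (cases "s' = s")
        case True
        then show ?thesis using Dm[OF j(1) k(1,3) d[OF s] j(2)] ca[OF j(1) k(1,3) d[OF s] j(2)] j(3) by simp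
      next
        case False
        then have s'': "s' \<in> S'" "s' \<in> S" using s' insert.prems by auto
        note is' = i(2)[OF s''(1)]
        show ?thesis
          using False Dm[OF i(1) k(1,2) d[OF s''(2)] conjunct1[OF is']] ca[OF i(1) k(1,2) d[OF s''(2)] conjunct1[OF is']] is' by simp
      qed
      then show ?case using k(1) by (intro bexI[of _ k] exI[of _ ?e]) auto
    qed
    from this[OF S order_refl] obtain i e where i: "i \<in> obj J" and e: "\<And>s. s \<in> S \<Longrightarrow> e s \<in> part (fobj D i) (d s)"
      and \<iota>e: "\<And>s. s \<in> S \<Longrightarrow> \<iota> i (d s) (e s) = f (d s) (\<gamma> s)" by blast
    have ev_u: "farr D i k u \<mu> (ev (fobj D i) e r) = ev (fobj D k) (\<lambda>s. farr D i k u (d s) (e s)) r"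
      if "k \<in> obj J" "u \<in> Hom J i k" "\<mu> \<in> \<Lambda>" "r \<in> hcombs S d \<mu>" for k u \<mu> r
      by (rule ev_gmor[OF DO[OF i] DO[OF that(1)] Dg[OF i that(1,2)] dS e _ that(3,4)]) auto
    \<comment> \<open>The lifted values are known to satisfy the relations only in \<open>l\<close>.
      Each relation therefore holds at some stage, and finitely many hold at one.\<close>
    have "\<exists>k\<in>obj J. \<exists>u\<in>Hom J i k. \<forall>t\<in>T. ev (fobj D k) (\<lambda>s. farr D i k u (d s) (e s)) (snd t) = \<one>\<^bsub>total (fobj D k)\<^esub>"
    proof (rule filtered_eventually_finite[OF J i T])
      fix t assume t: "t \<in> T"
      obtain \<mu> r where tr: "t = (\<mu>, r)" by fastforce
      have mu: "\<mu> \<in> \<Lambda>" and r: "r \<in> hcombs S d \<mu>" and r1: "ev P \<gamma> r = \<one>\<^bsub>total P\<^esub>" using T_rel[of \<mu> r] t tr by blast+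
      let ?z = "ev (fobj D i) e r"
      have z: "?z \<in> part (fobj D i) \<mu>" using ev_part[OF DO[OF i] dS e mu r] .
      have "\<iota> i \<mu> ?z = ev l (\<lambda>s. \<iota> i (d s) (e s)) r"
        by (rule ev_gmor[OF DO[OF i] l cg[OF i] dS e _ mu r]) auto
      moreover have "f \<mu> (ev P \<gamma> r) = ev l (\<lambda>s. \<iota> i (d s) (e s)) r"
        by (rule ev_gmor[OF P l f dS \<gamma> _ mu r]) (auto simp: \<iota>e)
      ultimately have "\<iota> i \<mu> ?z = \<iota> i \<mu> \<one>\<^bsub>total (fobj D i)\<^esub>"
        using r1 gmor_one[OF P l f mu] gmor_one[OF DO[OF i] l cg[OF i] mu] by simp
      then obtain k u where k: "k \<in> obj J" "u \<in> Hom J i k" "farr D i k u \<mu> ?z = farr D i k u \<mu> \<one>\<^bsub>total (fobj D i)\<^esub>"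
        using pointwise_eq[OF J D co pw i mu z part_one[OF DO[OF i] mu]] by blast
      then have "ev (fobj D k) (\<lambda>s. farr D i k u (d s) (e s)) (snd t) = \<one>\<^bsub>total (fobj D k)\<^esub>"
        using ev_u[OF k(1,2) mu r] gmor_one[OF DO[OF i] DO[OF k(1)] Dg[OF i k(1,2)] mu] tr by simp
      then show "\<exists>k\<in>obj J. \<exists>u\<in>Hom J i k. ev (fobj D k) (\<lambda>s. farr D i k u (d s) (e s)) (snd t) = \<one>\<^bsub>total (fobj D k)\<^esub>"
        using k by blast
    next
      fix t k m u w assume t: "t \<in> T" and k: "k \<in> obj J" "m \<in> obj J" "u \<in> Hom J i k" "w \<in> Hom J k m"
        and eq: "ev (fobj D k) (\<lambda>s. farr D i k u (d s) (e s)) (snd t) = \<one>\<^bsub>total (fobj D k)\<^esub>"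
      obtain \<mu> r where tr: "t = (\<mu>, r)" by fastforce
      have mu: "\<mu> \<in> \<Lambda>" and r: "r \<in> hcombs S d \<mu>" using T_rel[of \<mu> r] t tr by blast+
      have "farr D k m w \<mu> (ev (fobj D k) (\<lambda>s. farr D i k u (d s) (e s)) r) =
          ev (fobj D m) (\<lambda>s. farr D i m (cmp J i k m w u) (d s) (e s)) r"
      proof (rule ev_gmor[OF DO[OF k(1)] DO[OF k(2)] Dg[OF k(1,2,4)] dS _ _ mu r])
        show "farr D i k u (d s) (e s) \<in> part (fobj D k) (d s)" if "s \<in> S" for s
          using Dm[OF i k(1,3) d[OF that] e[OF that]] .
        show "farr D i m (cmp J i k m w u) (d s) (e s) = farr D k m w (d s) (farr D i k u (d s) (e s))" if "s \<in> S" for s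
          using Dc[OF i k(1,2,3,4) d[OF that] e[OF that]] .
      qed
      then show "ev (fobj D m) (\<lambda>s. farr D i m (cmp J i k m w u) (d s) (e s)) (snd t) = \<one>\<^bsub>total (fobj D m)\<^esub>"
        using eq gmor_one[OF DO[OF k(1)] DO[OF k(2)] Dg[OF k(1,2,4)] mu] tr by simp
    qed
    then obtain k u where k: "k \<in> obj J" "u \<in> Hom J i k"
      and T1: "\<And>t. t \<in> T \<Longrightarrow> ev (fobj D k) (\<lambda>s. farr D i k u (d s) (e s)) (snd t) = \<one>\<^bsub>total (fobj D k)\<^esub>" by blast
    have "\<exists>g\<in>gmor P (fobj D k). \<forall>s\<in>S. g (d s) (\<gamma> s) = farr D i k u (d s) (e s)"
    proof (rule univ[OF DO[OF k(1)]])
      show "farr D i k u (d s) (e s) \<in> part (fobj D k) (d s)" if "s \<in> S" for s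
        using Dm[OF i k d[OF that] e[OF that]] .
      show "ev (fobj D k) (\<lambda>s. farr D i k u (d s) (e s)) r = \<one>\<^bsub>total (fobj D k)\<^esub>" if "(\<mu>, r) \<in> T" for \<mu> r
        using T1[OF that] by simp
    qed
    then obtain g where g: "g \<in> gmor P (fobj D k)" "\<And>s. s \<in> S \<Longrightarrow> g (d s) (\<gamma> s) = farr D i k u (d s) (e s)" by blast
    have "mor P (\<lambda>\<mu> x. \<iota> k \<mu> (g \<mu> x)) = f"
    proof (rule generates_gmor_eq[OF P l gen gmor_cmp[OF P g(1) cg[OF k(1)]] f])
      fix s assume s: "s \<in> S"
      show "mor P (\<lambda>\<mu> x. \<iota> k \<mu> (g \<mu> x)) (d s) (\<gamma> s) = f (d s) (\<gamma> s)"
        using s d[OF s] \<gamma>[OF s] g(2)[OF s] ca[OF i k d[OF s] e[OF s]] \<iota>e[OF s] by simp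
    qed
    then show ?thesis using k(1) g(1) by blast
  qed
  have inj: "\<exists>k\<in>obj J. \<exists>u\<in>Hom J i k. \<exists>v\<in>Hom J j k.
      mor P (\<lambda>\<mu> x. farr D i k u \<mu> (f \<mu> x)) = mor P (\<lambda>\<mu> x. farr D j k v \<mu> (g \<mu> x))"
    if ij: "i \<in> obj J" "j \<in> obj J" and f: "f \<in> gmor P (fobj D i)" and g: "g \<in> gmor P (fobj D j)"
      and eq: "mor P (\<lambda>\<mu> x. \<iota> i \<mu> (f \<mu> x)) = mor P (\<lambda>\<mu> x. \<iota> j \<mu> (g \<mu> x))" for i j f g
  proof -
    \<comment> \<open>Both morphisms are first moved to one index, so that their values on each
      generator can be compared there.\<close>
    obtain n a b where n: "n \<in> obj J" "a \<in> Hom J i n" "b \<in> Hom J j n" using J_bound[OF J D ij] by blast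
    have fm: "f (d s) (\<gamma> s) \<in> part (fobj D i) (d s)" and gm: "g (d s) (\<gamma> s) \<in> part (fobj D j) (d s)" if "s \<in> S" for s
      using gmor_mem[OF f d[OF that] \<gamma>[OF that]] gmor_mem[OF g d[OF that] \<gamma>[OF that]] .
    let ?x = "\<lambda>s. farr D i n a (d s) (f (d s) (\<gamma> s))" and ?y = "\<lambda>s. farr D j n b (d s) (g (d s) (\<gamma> s))"
    have xm: "?x s \<in> part (fobj D n) (d s)" and ym: "?y s \<in> part (fobj D n) (d s)" if "s \<in> S" for s
      using Dm[OF ij(1) n(1,2) d[OF that] fm[OF that]] Dm[OF ij(2) n(1,3) d[OF that] gm[OF that]] .
    have "\<exists>k\<in>obj J. \<exists>w\<in>Hom J n k. \<forall>s\<in>S. farr D n k w (d s) (?x s) = farr D n k w (d s) (?y s)"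
    proof (rule filtered_eventually_finite[OF J n(1) S])
      fix s assume s: "s \<in> S"
      have "\<iota> n (d s) (?x s) = \<iota> n (d s) (?y s)"
        using ca[OF ij(1) n(1,2) d[OF s] fm[OF s]] ca[OF ij(2) n(1,3) d[OF s] gm[OF s]] gmor_eqD[OF eq d[OF s] \<gamma>[OF s]] by simp
      then show "\<exists>k\<in>obj J. \<exists>w\<in>Hom J n k. farr D n k w (d s) (?x s) = farr D n k w (d s) (?y s)"
        using pointwise_eq[OF J D co pw n(1) d[OF s] xm[OF s] ym[OF s]] by blast
    next
      fix s k m u w assume s: "s \<in> S" and k: "k \<in> obj J" "m \<in> obj J" "u \<in> Hom J n k" "w \<in> Hom J k m"
        and "farr D n k u (d s) (?x s) = farr D n k u (d s) (?y s)"
      then show "farr D n m (cmp J n k m w u) (d s) (?x s) = farr D n m (cmp J n k m w u) (d s) (?y s)"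
        using Dc[OF n(1) k d[OF s] xm[OF s]] Dc[OF n(1) k d[OF s] ym[OF s]] by simp
    qed
    then obtain k w where k: "k \<in> obj J" "w \<in> Hom J n k"
      and kw: "\<And>s. s \<in> S \<Longrightarrow> farr D n k w (d s) (?x s) = farr D n k w (d s) (?y s)" by blast
    let ?u = "cmp J i n k w a" and ?v = "cmp J j n k w b"
    have uv: "?u \<in> Hom J i k" "?v \<in> Hom J j k"
      using cat_cmp[OF J_cat[OF J D] ij(1) n(1) k(1) n(2) k(2)] cat_cmp[OF J_cat[OF J D] ij(2) n(1) k(1) n(3) k(2)] .
    have "mor P (\<lambda>\<mu> x. farr D i k ?u \<mu> (f \<mu> x)) = mor P (\<lambda>\<mu> x. farr D j k ?v \<mu> (g \<mu> x))"
    proof (rule generates_gmor_eq[OF P DO[OF k(1)] gen gmor_cmp[OF P f Dg[OF ij(1) k(1) uv(1)]] gmor_cmp[OF P g Dg[OF ij(2) k(1) uv(2)]]])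
      fix s assume s: "s \<in> S"
      show "mor P (\<lambda>\<mu> x. farr D i k ?u \<mu> (f \<mu> x)) (d s) (\<gamma> s) = mor P (\<lambda>\<mu> x. farr D j k ?v \<mu> (g \<mu> x)) (d s) (\<gamma> s)"
        using d[OF s] \<gamma>[OF s] kw[OF s] Dc[OF ij(1) n(1) k(1) n(2) k(2) d[OF s] fm[OF s]]
          Dc[OF ij(2) n(1) k(1) n(3) k(2) d[OF s] gm[OF s]] by simp
    qed
    then show ?thesis using k(1) uv by blast
  qed
  show "bij_betw (canonical_map GC D P l \<iota>) (hom_union J GC D P // hom_rel J GC D P) (Hom GC P l)"
    unfolding bij_betw_canonical_map_iff[OF J is_category_GC col \<open>P \<in> obj GC\<close>]
    unfolding Hom_GC cmp_GC using surj inj by blast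
qed

text \<open>
  A glider is the filtered colimit of the gliders presented by finitely many of its elements
  and finitely many relations. A relation that involves other elements is ignored, so that the two
  finite sets can be chosen independently.
\<close>

context
  fixes X :: "('g, 'r, 'u) module_functor"
  assumes X: "X \<in> Obj"
begin

definition els :: "('g \<times> 'u) set" where
  "els = Sigma \<Lambda> (part X)"

text \<open>\<open>snd\<close> is the tautological valuation: the generator
  \<open>(\<mu>, x)\<close> stands for the element \<open>x\<close> of \<open>X\<close>.\<close>

definition rels :: "('g \<times> ('r \<times> 'g \<times> 'u) list) set" where
  "rels = {(\<mu>, l). \<mu> \<in> \<Lambda> \<and> l \<in> hcombs els fst \<mu> \<and> ev X snd l = \<one>\<^bsub>total X\<^esub>}"

definition stages :: "(('g \<times> 'u) set \<times> ('g \<times> ('r \<times> 'g \<times> 'u) list) set) set" where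
  "stages = Fpow els \<times> Fpow rels"

definition assignments :: "('g \<times> 'u) set \<times> ('g \<times> ('r \<times> 'g \<times> 'u) list) set \<Rightarrow>
    (('g, 'r, 'u) module_functor \<times> ('g \<times> 'u \<Rightarrow> 'u)) set" where
  "assignments t = {(N, e). N \<in> Obj \<and> (\<forall>s\<in>fst t. e s \<in> part N (fst s)) \<and>
    (\<forall>(\<mu>, l)\<in>snd t. l \<in> hcombs (fst t) fst \<mu> \<longrightarrow> ev N e l = \<one>\<^bsub>total N\<^esub>)}"

definition presents_stage :: "('g \<times> 'u) set \<times> ('g \<times> ('r \<times> 'g \<times> 'u) list) set \<Rightarrow>
    ('g, 'r, 'u) module_functor \<Rightarrow> ('g \<times> 'u \<Rightarrow> 'u) \<Rightarrow> bool" where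
  "presents_stage t P \<gamma> \<longleftrightarrow> P \<in> Obj \<and> generates P (fst t) fst \<gamma> \<and>
    (\<forall>l\<in>combs (fst t). \<forall>l'\<in>combs (fst t).
      (\<forall>N e. (N, e) \<in> assignments t \<longrightarrow> ev N e l = ev N e l') \<longrightarrow> ev P \<gamma> l = ev P \<gamma> l') \<and>
    (\<forall>N e. (N, e) \<in> assignments t \<longrightarrow> (\<exists>g\<in>gmor P N. \<forall>s\<in>fst t. g (fst s) (\<gamma> s) = e s))"

lemma stagesD:
  assumes "t \<in> stages"
  shows "finite (fst t)" "finite (snd t)" "fst t \<subseteq> els" "snd t \<subseteq> rels" "fst ` fst t \<subseteq> \<Lambda>"
  using assms unfolding stages_def Fpow_def els_def by auto

lemma presents_stage_exists:
  assumes "t \<in> stages"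
  shows "\<exists>P \<gamma>. presents_stage t P \<gamma>"
proof -
  have "\<exists>M\<in>Obj. \<exists>\<gamma>. generates M (fst t) fst \<gamma> \<and>
    (\<forall>l\<in>combs (fst t). \<forall>l'\<in>combs (fst t).
      (\<forall>N e. (N, e) \<in> assignments t \<longrightarrow> ev N e l = ev N e l') \<longrightarrow> ev M \<gamma> l = ev M \<gamma> l') \<and>
    (\<forall>N e. (N, e) \<in> assignments t \<longrightarrow> (\<exists>g\<in>gmor M N. \<forall>s\<in>fst t. g (fst s) (\<gamma> s) = e s))"
    by (rule presented_object[OF small_finite[OF universe stagesD(1)[OF assms]] stagesD(5)[OF assms]])
      (simp add: assignments_def)
  then show ?thesis unfolding presents_stage_def by blast
qed

definition stage_data where
  "stage_data t = (SOME (P, \<gamma>). presents_stage t P \<gamma>)"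

definition stage :: "('g \<times> 'u) set \<times> ('g \<times> ('r \<times> 'g \<times> 'u) list) set \<Rightarrow> ('g, 'r, 'u) module_functor" where
  "stage t = fst (stage_data t)"

definition gens :: "('g \<times> 'u) set \<times> ('g \<times> ('r \<times> 'g \<times> 'u) list) set \<Rightarrow> 'g \<times> 'u \<Rightarrow> 'u" where
  "gens t = snd (stage_data t)"

lemma stage_presents: "t \<in> stages \<Longrightarrow> presents_stage t (stage t) (gens t)"
  unfolding stage_def gens_def stage_data_def
  using someI_ex[of "\<lambda>(P, \<gamma>). presents_stage t P \<gamma>"] presents_stage_exists[of t] by (simp add: case_prod_unfold)

lemma stage_Obj: "t \<in> stages \<Longrightarrow> stage t \<in> Obj"
  and stage_generates: "t \<in> stages \<Longrightarrow> generates (stage t) (fst t) fst (gens t)"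
  and stage_rel: "t \<in> stages \<Longrightarrow> l \<in> combs (fst t) \<Longrightarrow> l' \<in> combs (fst t) \<Longrightarrow>
    (\<And>N e. (N, e) \<in> assignments t \<Longrightarrow> ev N e l = ev N e l') \<Longrightarrow> ev (stage t) (gens t) l = ev (stage t) (gens t) l'"
  and stage_univ: "t \<in> stages \<Longrightarrow> (N, e) \<in> assignments t \<Longrightarrow>
    \<exists>g\<in>gmor (stage t) N. \<forall>s\<in>fst t. g (fst s) (gens t s) = e s"
  using stage_presents[of t] unfolding presents_stage_def by blast+

lemma gens_part: "t \<in> stages \<Longrightarrow> s \<in> fst t \<Longrightarrow> gens t s \<in> part (stage t) (fst s)"
  using stage_generates unfolding generates_def by blast

lemma stage_relation:
  assumes "t \<in> stages" "(\<mu>, l) \<in> snd t" "l \<in> hcombs (fst t) fst \<mu>"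
  shows "ev (stage t) (gens t) l = \<one>\<^bsub>total (stage t)\<^esub>"
proof -
  have "\<mu> \<in> \<Lambda>" using stagesD(4)[OF assms(1)] assms(2) unfolding rels_def by blast
  then have "l \<in> combs (fst t)" using hcombs_combs[OF _ stagesD(5)[OF assms(1)]] assms(3) by blast
  then have "ev (stage t) (gens t) l = ev (stage t) (gens t) []"
    by (rule stage_rel[OF assms(1)]) (use assms in \<open>auto simp: assignments_def\<close>)
  then show ?thesis by simp
qed

lemma finitely_presentable_stage:
  assumes t: "t \<in> stages"
  shows "finitely_presentable TYPE('u) GC (stage t)"
proof (rule finitely_presentable_presented[OF stage_Obj[OF t] stagesD(1)[OF t] stage_generates[OF t]])
  let ?T = "{p \<in> snd t. snd p \<in> hcombs (fst t) fst (fst p)}"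
  show "finite ?T" using stagesD(2)[OF t] by simp
  show "\<mu> \<in> \<Lambda> \<and> l \<in> hcombs (fst t) fst \<mu> \<and> ev (stage t) (gens t) l = \<one>\<^bsub>total (stage t)\<^esub>" if "(\<mu>, l) \<in> ?T" for \<mu> l
    using that stage_relation[OF t, of \<mu> l] stagesD(4)[OF t] unfolding rels_def by auto
  show "\<exists>g\<in>gmor (stage t) N. \<forall>s\<in>fst t. g (fst s) (gens t s) = e s"
    if "N \<in> Obj" "\<And>s. s \<in> fst t \<Longrightarrow> e s \<in> part N (fst s)" "\<And>\<mu> l. (\<mu>, l) \<in> ?T \<Longrightarrow> ev N e l = \<one>\<^bsub>total N\<^esub>" for N e
    by (rule stage_univ[OF t]) (use that in \<open>auto simp: assignments_def\<close>)
qed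

definition stage_le where
  "stage_le t t' \<longleftrightarrow> fst t \<subseteq> fst t' \<and> snd t \<subseteq> snd t'"

lemma hcombs_mono: "S \<subseteq> S' \<Longrightarrow> hcombs S d \<mu> \<subseteq> hcombs S' d \<mu>"
  unfolding hcombs_def by blast

lemma stage_map_exists:
  assumes t: "t \<in> stages" "t' \<in> stages" and le: "stage_le t t'"
  shows "\<exists>g\<in>gmor (stage t) (stage t'). \<forall>s\<in>fst t. g (fst s) (gens t s) = gens t' s"
proof (rule stage_univ[OF t(1)])
  have "ev (stage t') (gens t') l = \<one>\<^bsub>total (stage t')\<^esub>"
    if "(\<mu>, l) \<in> snd t" "l \<in> hcombs (fst t) fst \<mu>" for \<mu> l
    using stage_relation[OF t(2), of \<mu> l] hcombs_mono[of "fst t" "fst t'" fst \<mu>] that le unfolding stage_le_def by blast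
  then show "(stage t', gens t') \<in> assignments t"
    unfolding assignments_def using stage_Obj[OF t(2)] gens_part[OF t(2)] le unfolding stage_le_def by auto
qed

text \<open>Any morphism with these values on generators will do. The generators determine it, and
  this gives functoriality in \<open>t\<close>.\<close>

definition stage_map where
  "stage_map t t' = (SOME g. g \<in> gmor (stage t) (stage t') \<and> (\<forall>s\<in>fst t. g (fst s) (gens t s) = gens t' s))"

lemma stage_map:
  assumes "t \<in> stages" "t' \<in> stages" "stage_le t t'"
  shows "stage_map t t' \<in> gmor (stage t) (stage t')"
    "\<And>s. s \<in> fst t \<Longrightarrow> stage_map t t' (fst s) (gens t s) = gens t' s"
proof -
  have "\<exists>g. g \<in> gmor (stage t) (stage t') \<and> (\<forall>s\<in>fst t. g (fst s) (gens t s) = gens t' s)"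
    using stage_map_exists[OF assms] by blast
  from someI_ex[OF this] show "stage_map t t' \<in> gmor (stage t) (stage t')"
    "\<And>s. s \<in> fst t \<Longrightarrow> stage_map t t' (fst s) (gens t s) = gens t' s"
    unfolding stage_map_def by blast+
qed

definition stage_leg where
  "stage_leg t = (SOME g. g \<in> gmor (stage t) X \<and> (\<forall>s\<in>fst t. g (fst s) (gens t s) = snd s))"

lemma stage_leg:
  assumes t: "t \<in> stages"
  shows "stage_leg t \<in> gmor (stage t) X" "\<And>s. s \<in> fst t \<Longrightarrow> stage_leg t (fst s) (gens t s) = snd s"
proof -
  have "(X, snd) \<in> assignments t"
    using X stagesD(3,4)[OF t] unfolding assignments_def els_def rels_def by auto
  then have "\<exists>g. g \<in> gmor (stage t) X \<and> (\<forall>s\<in>fst t. g (fst s) (gens t s) = snd s)"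
    using stage_univ[OF t] by blast
  from someI_ex[OF this] show "stage_leg t \<in> gmor (stage t) X" "\<And>s. s \<in> fst t \<Longrightarrow> stage_leg t (fst s) (gens t s) = snd s"
    unfolding stage_leg_def by blast+
qed

text \<open>Relations are lists over small sets and hence form a small set; restricting to finite
  subsets keeps the index set small.\<close>

lemma small_stages: "small TYPE('u) stages"
proof -
  have E: "small TYPE('u) els" unfolding els_def by (rule small_Sigma[OF universe small_Lambda part_small[OF X]])
  have "small TYPE('u) (\<Lambda> \<times> combs els)"
    unfolding combs_def by (rule small_Sigma[OF universe small_Lambda small_lists[OF universe small_Sigma[OF universe small_R E]]])
  moreover have "rels \<subseteq> \<Lambda> \<times> combs els"
    using hcombs_combs[of _ fst els] unfolding rels_def els_def by fastforce
  ultimately have "small TYPE('u) rels" by (rule small_subset)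
  then show ?thesis unfolding stages_def by (intro small_Sigma[OF universe] small_Fpow[OF universe] E)
qed

text \<open>Pairs of finite sets are directed under inclusion by unions, and smallness lets them be
  encoded in \<open>'u\<close>. An element of \<open>X\<close> is reached from the stage with that
  element as its only generator. Two elements of a stage with the same image in \<open>X\<close> are
  identified by adding one relation.\<close>

lemma filtered_colimit_of_presentable:
  "\<exists>(J :: ('u, 'u) category) D \<iota>. small_filtered J \<and>
    (\<forall>i\<in>obj J. finitely_presentable TYPE('u) GC (fobj D i)) \<and> is_colimit J GC D X \<iota>"
proof -
  obtain enc :: "_ \<Rightarrow> 'u" where enc: "inj_on enc stages" using small_encode[OF small_stages] .
  define dec where "dec = inv_into stages enc"
  have dec_enc: "dec (enc t) = t" if "t \<in> stages" for t using that enc unfolding dec_def by simp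
  have dec: "dec i \<in> stages" if "i \<in> enc ` stages" for i using that dec_enc by auto
  \<comment> \<open>Any element of \<open>'u\<close> can serve as the only morphism between
    comparable indices.\<close>
  define c :: 'u where "c = undefined"
  define J :: "('u, 'u) category" where
    "J = \<lparr>obj = enc ` stages, Hom = (\<lambda>i j. if stage_le (dec i) (dec j) then {c} else {}),
      ident = (\<lambda>i. c), cmp = (\<lambda>i j k v u. c)\<rparr>"
  define D :: "('u, 'u, ('g, 'r, 'u) module_functor, 'g \<Rightarrow> 'u \<Rightarrow> 'u) functor_data" where
    "D = \<lparr>fobj = (\<lambda>i. stage (dec i)), farr = (\<lambda>i j u. stage_map (dec i) (dec j))\<rparr>"
  have objJ: "obj J = enc ` stages" and HomJ: "\<And>i j. Hom J i j = (if stage_le (dec i) (dec j) then {c} else {})"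
    and identJ: "\<And>i. ident J i = c" and cmpJ: "\<And>i j k v u. cmp J i j k v u = c"
    unfolding J_def by simp_all
  have fobjD: "\<And>i. fobj D i = stage (dec i)" and farrD: "\<And>i j u. farr D i j u = stage_map (dec i) (dec j)"
    unfolding D_def by simp_all
  have le_refl: "stage_le t t" and le_trans: "stage_le t t' \<Longrightarrow> stage_le t' t'' \<Longrightarrow> stage_le t t''" for t t' t''
    unfolding stage_le_def by auto
  have catJ: "is_category J"
    unfolding is_category_def HomJ identJ cmpJ
    by (intro conjI ballI) (auto simp: le_refl split: if_splits dest: le_trans)
  have ex_bound: "\<exists>t''\<in>stages. stage_le t t'' \<and> stage_le t' t''" if "t \<in> stages" "t' \<in> stages" for t t'
    using that unfolding stages_def stage_le_def Fpow_def
    by (intro bexI[of _ "(fst t \<union> fst t', snd t \<union> snd t')"]) auto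
  have "filtered J"
    unfolding filtered_def
  proof (intro conjI ballI)
    have "({}, {}) \<in> stages" unfolding stages_def Fpow_def by simp
    then show "obj J \<noteq> {}" unfolding objJ by blast
    show "\<exists>k\<in>obj J. Hom J i k \<noteq> {} \<and> Hom J j k \<noteq> {}" if "i \<in> obj J" "j \<in> obj J" for i j
    proof -
      obtain t where t: "t \<in> stages" "stage_le (dec i) t" "stage_le (dec j) t"
        using ex_bound[of "dec i" "dec j"] dec \<open>i \<in> obj J\<close> \<open>j \<in> obj J\<close> unfolding objJ by blast
      then show ?thesis unfolding objJ HomJ using dec_enc[OF t(1)] by (intro bexI[of _ "enc t"]) auto
    qed
    show "\<exists>k\<in>obj J. \<exists>w\<in>Hom J j k. cmp J i j k w u = cmp J i j k w v" if "j \<in> obj J" for i j u v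
      unfolding cmpJ HomJ by (intro bexI[OF _ that] bexI[of _ c]) (simp_all add: le_refl)
  qed (rule catJ)
  then have J: "filtered J" and sJ: "small_filtered J"
    unfolding small_filtered_def objJ HomJ using small_image[OF small_stages] small_finite[OF universe] by auto
  have D_uniq: "f = g" if "t \<in> stages" "N \<in> Obj" "f \<in> gmor (stage t) N" "g \<in> gmor (stage t) N"
    "\<And>s. s \<in> fst t \<Longrightarrow> f (fst s) (gens t s) = g (fst s) (gens t s)" for t N f g
    by (rule generates_gmor_eq[OF stage_Obj[OF that(1)] that(2) stage_generates[OF that(1)] that(3-5)])
  have fst_L: "fst s \<in> \<Lambda>" if "t \<in> stages" "s \<in> fst t" for t s using stagesD(5)[OF that(1)] that(2) by blast
  have map_apply: "mor (stage t) h (fst s) (gens t s) = h (fst s) (gens t s)" if "t \<in> stages" "s \<in> fst t" for t s h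
    using fst_L[OF that] gens_part[OF that] by simp
  have D: "is_functor J GC D"
    unfolding is_functor_def fobjD farrD identJ cmpJ
  proof (intro conjI ballI)
    show "stage (dec i) \<in> obj GC" if "i \<in> obj J" for i using stage_Obj dec that unfolding objJ by simp
    show "stage_map (dec i) (dec j) \<in> Hom GC (stage (dec i)) (stage (dec j))"
      if "i \<in> obj J" "j \<in> obj J" "u \<in> Hom J i j" for i j u
      using that dec stage_map(1) unfolding objJ HomJ by (simp split: if_splits)
    show "stage_map (dec i) (dec i) = ident GC (stage (dec i))" if "i \<in> obj J" for i
    proof -
      have i: "dec i \<in> stages" using dec that unfolding objJ by blast
      show ?thesis
        unfolding ident_GC
        by (rule D_uniq[OF i stage_Obj[OF i] stage_map(1)[OF i i le_refl] gmor_ident[OF stage_Obj[OF i]]])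
          (simp add: stage_map(2)[OF i i le_refl] map_apply[OF i])
    qed
    show "stage_map (dec i) (dec k) = cmp GC (stage (dec i)) (stage (dec j)) (stage (dec k))
        (stage_map (dec j) (dec k)) (stage_map (dec i) (dec j))"
      if ijk: "i \<in> obj J" "j \<in> obj J" "k \<in> obj J" and u: "u \<in> Hom J i j" and v: "v \<in> Hom J j k" for i j k u v
    proof -
      have t: "dec i \<in> stages" "dec j \<in> stages" "dec k \<in> stages" using dec ijk unfolding objJ by blast+
      have le: "stage_le (dec i) (dec j)" "stage_le (dec j) (dec k)" using u v unfolding HomJ by (auto split: if_splits)
      show ?thesis
        unfolding cmp_GC
      proof (rule D_uniq[OF t(1) stage_Obj[OF t(3)] stage_map(1)[OF t(1,3) le_trans[OF le]]
            gmor_cmp[OF stage_Obj[OF t(1)] stage_map(1)[OF t(1,2) le(1)] stage_map(1)[OF t(2,3) le(2)]]])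
        fix s assume s: "s \<in> fst (dec i)"
        then have "s \<in> fst (dec j)" using le(1) unfolding stage_le_def by blast
        then show "stage_map (dec i) (dec k) (fst s) (gens (dec i) s) =
            mor (stage (dec i)) (\<lambda>\<mu> x. stage_map (dec j) (dec k) \<mu> (stage_map (dec i) (dec j) \<mu> x)) (fst s) (gens (dec i) s)"
          using stage_map(2)[OF t(1,3) le_trans[OF le] s] stage_map(2)[OF t(1,2) le(1) s] stage_map(2)[OF t(2,3) le(2)]
            map_apply[OF t(1) s] by simp
      qed
    qed
  qed
  let ?\<iota> = "\<lambda>i. stage_leg (dec i)"
  have leg_map: "stage_leg t' \<mu> (stage_map t t' \<mu> x) = stage_leg t \<mu> x"
    if t: "t \<in> stages" "t' \<in> stages" "stage_le t t'" and x: "\<mu> \<in> \<Lambda>" "x \<in> part (stage t) \<mu>" for t t' \<mu> x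
  proof -
    have "mor (stage t) (\<lambda>\<mu> x. stage_leg t' \<mu> (stage_map t t' \<mu> x)) = stage_leg t"
    proof (rule D_uniq[OF t(1) X gmor_cmp[OF stage_Obj[OF t(1)] stage_map(1)[OF t] stage_leg(1)[OF t(2)]] stage_leg(1)[OF t(1)]])
      fix s assume s: "s \<in> fst t"
      then have s': "s \<in> fst t'" using t(3) unfolding stage_le_def by blast
      show "mor (stage t) (\<lambda>\<mu> x. stage_leg t' \<mu> (stage_map t t' \<mu> x)) (fst s) (gens t s) = stage_leg t (fst s) (gens t s)"
        using map_apply[OF t(1) s] stage_map(2)[OF t s] stage_leg(2)[OF t(1) s] stage_leg(2)[OF t(2) s'] by simp
    qed
    then show ?thesis using mor_apply[OF x, of "\<lambda>\<mu> x. stage_leg t' \<mu> (stage_map t t' \<mu> x)"] by simp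
  qed
  have co: "is_cocone J GC D X ?\<iota>"
    unfolding is_cocone_def fobjD farrD
  proof (intro conjI ballI)
    show "X \<in> obj GC" using X by simp
    show "stage_leg (dec i) \<in> Hom GC (stage (dec i)) X" if "i \<in> obj J" for i
      using stage_leg(1) dec that unfolding objJ by simp
    show "cmp GC (stage (dec i)) (stage (dec j)) X (stage_leg (dec j)) (stage_map (dec i) (dec j)) = stage_leg (dec i)"
      if ij: "i \<in> obj J" "j \<in> obj J" "u \<in> Hom J i j" for i j u
    proof -
      have t: "dec i \<in> stages" "dec j \<in> stages" "stage_le (dec i) (dec j)"
        using dec ij unfolding objJ HomJ by (auto split: if_splits)
      have "mor (stage (dec i)) (\<lambda>\<mu> x. stage_leg (dec j) \<mu> (stage_map (dec i) (dec j) \<mu> x)) = mor (stage (dec i)) (stage_leg (dec i))"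
        by (rule mor_eqI) (rule leg_map[OF t])
      then show ?thesis unfolding cmp_GC using mor_self[OF stage_leg(1)[OF t(1)]] by simp
    qed
  qed
  have "pointwise_colimit J D X ?\<iota>"
    unfolding pointwise_colimit_def fobjD farrD
  proof (intro conjI ballI impI)
    fix \<mu> x assume mu: "\<mu> \<in> \<Lambda>" and x: "x \<in> part X \<mu>"
    let ?t = "({(\<mu>, x)}, {})"
    have t: "?t \<in> stages" using mu x unfolding stages_def Fpow_def els_def by simp
    have "gens ?t (\<mu>, x) \<in> part (stage ?t) \<mu>" "stage_leg ?t \<mu> (gens ?t (\<mu>, x)) = x"
      using gens_part[OF t, of "(\<mu>, x)"] stage_leg(2)[OF t, of "(\<mu>, x)"] by simp_all
    then show "\<exists>i\<in>obj J. \<exists>y\<in>part (stage (dec i)) \<mu>. stage_leg (dec i) \<mu> y = x"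
      unfolding objJ using t dec_enc[OF t] by (intro bexI[of _ "enc ?t"] bexI[of _ "gens ?t (\<mu>, x)"]) auto
  next
    fix i \<mu> x y assume i: "i \<in> obj J" and mu: "\<mu> \<in> \<Lambda>" and xy: "x \<in> part (stage (dec i)) \<mu>" "y \<in> part (stage (dec i)) \<mu>"
      and eq: "stage_leg (dec i) \<mu> x = stage_leg (dec i) \<mu> y"
    let ?t = "dec i"
    have t: "?t \<in> stages" using dec i unfolding objJ by blast
    note dS = stagesD(5)[OF t]
    have gen: "\<forall>x\<in>part (stage ?t) \<mu>. \<exists>l\<in>hcombs (fst ?t) fst \<mu>. x = ev (stage ?t) (gens ?t) l"
      using stage_generates[OF t] mu unfolding generates_def by simp
    obtain l where l: "l \<in> hcombs (fst ?t) fst \<mu>" "x = ev (stage ?t) (gens ?t) l" using gen xy(1) by blast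
    obtain m where m: "m \<in> hcombs (fst ?t) fst \<mu>" "y = ev (stage ?t) (gens ?t) m" using gen xy(2) by blast
    \<comment> \<open>The formal difference of the two combinations. It vanishes in
      \<open>X\<close>, so it qualifies as a relation, and by \<open>ev_r\<close> its vanishing at a
      later stage identifies the two values.\<close>
    let ?r = "l @ scale (\<ominus>\<^bsub>R\<^esub> \<one>\<^bsub>R\<^esub>) m"
    have r: "?r \<in> hcombs (fst ?t) fst \<mu>"
      using l(1) hcombs_scale[OF mu mu dS scal_minus_one[OF mu mu leq_refl[OF mu]] m(1)] unfolding hcombs_def by auto
    have lm: "l \<in> combs (fst ?t)" "m \<in> combs (fst ?t)" using hcombs_combs[OF mu dS] l(1) m(1) by blast+
    have m1: "\<ominus>\<^bsub>R\<^esub> \<one>\<^bsub>R\<^esub> \<in> carrier R" by simp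
    have ev_r: "ev N e ?r = \<one>\<^bsub>total N\<^esub> \<longleftrightarrow> ev N e l = ev N e m"
      if N: "N \<in> Obj" and e: "\<And>s. s \<in> fst ?t \<Longrightarrow> e s \<in> part N (fst s)" for N e
    proof -
      have e': "e s \<in> carrier (total N)" if "s \<in> fst ?t" for s
        using part_total[OF N fst_L[OF t that] e[OF that]] .
      have c: "ev N e l \<in> carrier (total N)" "ev N e m \<in> carrier (total N)"
        by (rule ev_closed[OF N e' lm(1)], assumption, rule ev_closed[OF N e' lm(2)])
      have "ev N e ?r = ev N e l \<otimes>\<^bsub>total N\<^esub> inv\<^bsub>total N\<^esub> (ev N e m)"
        using ev_append[where S = "fst ?t" and e = e, OF N e' lm(1) scale_combs[OF m1 lm(2)]] ev_scale[where S = "fst ?t" and e = e, OF N e' m1 lm(2)]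
          act_minus_one[OF N c(2)] by simp
      then show ?thesis using total_mult_inv_eq_one_iff[OF N c] by simp
    qed
    have leg_ev: "stage_leg ?t \<mu> (ev (stage ?t) (gens ?t) k) = ev X snd k" if "k \<in> hcombs (fst ?t) fst \<mu>" for k
      by (rule ev_gmor[OF stage_Obj[OF t] X stage_leg(1)[OF t] dS gens_part[OF t] _ mu that]) (simp_all add: stage_leg(2)[OF t])
    have snd_part: "snd s \<in> part X (fst s)" if "s \<in> fst ?t" for s
      using stagesD(3)[OF t] that unfolding els_def by auto
    have "ev X snd l = ev X snd m" using leg_ev[OF l(1)] leg_ev[OF m(1)] l(2) m(2) eq by simp
    then have "ev X snd ?r = \<one>\<^bsub>total X\<^esub>" using ev_r[OF X snd_part] by simp
    then have "(\<mu>, ?r) \<in> rels" using mu r hcombs_mono[OF stagesD(3)[OF t]] unfolding rels_def by blast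
    \<comment> \<open>Keeping the same generators ensures that the new relation is homogeneous in
      them and so is actually imposed.\<close>
    then have t': "(fst ?t, insert (\<mu>, ?r) (snd ?t)) \<in> stages" (is "?t' \<in> stages")
      using t unfolding stages_def Fpow_def by auto
    have le: "stage_le ?t ?t'" unfolding stage_le_def by auto
    have "ev (stage ?t') (gens ?t') ?r = \<one>\<^bsub>total (stage ?t')\<^esub>"
      by (rule stage_relation[OF t', of \<mu>]) (use r in simp_all)
    then have lm': "ev (stage ?t') (gens ?t') l = ev (stage ?t') (gens ?t') m"
      using ev_r[OF stage_Obj[OF t']] gens_part[OF t'] by simp
    have map_ev: "stage_map ?t ?t' \<mu> (ev (stage ?t) (gens ?t) k) = ev (stage ?t') (gens ?t') k" if "k \<in> hcombs (fst ?t) fst \<mu>" for k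
      by (rule ev_gmor[OF stage_Obj[OF t] stage_Obj[OF t'] stage_map(1)[OF t t' le] dS gens_part[OF t] _ mu that])
        (simp_all add: stage_map(2)[OF t t' le])
    have "stage_map ?t ?t' \<mu> x = stage_map ?t ?t' \<mu> y"
      using map_ev[OF l(1)] map_ev[OF m(1)] l(2) m(2) lm' by simp
    then show "\<exists>k\<in>obj J. \<exists>u\<in>Hom J i k. stage_map (dec i) (dec k) \<mu> x = stage_map (dec i) (dec k) \<mu> y"
      unfolding objJ HomJ using t' le dec_enc[OF t'] by (intro bexI[of _ "enc ?t'"] bexI[of _ c]) auto
  qed
  then have "is_colimit J GC D X ?\<iota>" by (rule pointwise_is_colimit[OF J D co])
  moreover have "\<forall>i\<in>obj J. finitely_presentable TYPE('u) GC (fobj D i)"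
    using finitely_presentable_stage dec unfolding objJ fobjD by blast
  ultimately show ?thesis using sJ by blast
qed

end

lemma grothendieck_GC: "grothendieck_deflation_quasi_abelian TYPE('u) GC"
  unfolding grothendieck_deflation_quasi_abelian_def locally_presentable_def
  using deflation_quasi_abelian_GC has_filtered_colimits_GC exact_filtered_colimits_GC
    filtered_colimit_of_presentable by simp

end

theorem theorem5p16:
  fixes G :: "'g monoid" and leq :: "'g rel" and \<Lambda> :: "'g set"
    and R :: "'r ring" and F :: "'g \<Rightarrow> 'r set"
  assumes "universe TYPE('u)"
    and "ordered_group G leq"
    and "\<Lambda> \<subseteq> carrier G"
    and "filtered_ring G leq R F"
    and "small TYPE('u) \<Lambda>"
    and "small TYPE('u) (carrier R)"
  shows "grothendieck_deflation_quasi_abelian TYPE('u) (Glid TYPE('u) G leq \<Lambda> R F)"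
proof -
  interpret filtered_ring G leq R F by fact
  interpret gliders G leq R F \<Lambda> "TYPE('u)" by unfold_locales fact+
  show ?thesis
    unfolding Glid_def
    \<comment> \<open>\<open>localization_isomorphism\<close> leads from the localization to
      \<open>GC\<close>, whereas the property is known for \<open>GC\<close>; hence the transfer
      runs along the inverse.\<close>
    using category_isomorphism.grothendieck_deflation_quasi_abelian_map
      [OF category_isomorphism.inverse[OF localization_isomorphism] grothendieck_GC] .
qed

end
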